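(* The assignments $$(A^{(0)},M^{(0)},A^{(\infty)},M^{(\infty)})\mapsto A,\qquad (F,S^{(0)},S^{(\infty)})\mapsto F$$ and $$(A^{(0)},M^{(0)},A^{(\infty)},M^{(\infty)})\mapsto(A^{(0)},M,A^{(\infty)}),\qquad (F,S^{(0)},S^{(\infty)})\mapsto(S^{(0)},S^{(\infty)}),$$ where $A=(\sigma_qM^{(0)})A^{(0)}(M^{(0)})^{-1}=(\sigma_qM^{(\infty)})A^{(\infty)}(M^{(\infty)})^{-1}$ and $M=(M^{(\infty)})^{-1}M^{(0)}$, define $\mathbb C$-linear $\otimes$-equivalences from $\mathcal S$ to $\mathcal E_f$ and from $\mathcal S$ to $\mathcal C$, respectively.
   Context: Fix $q\in\mathbb C$, $|q|>1$; $(\sigma_qF)(z)=F(qz)$. $\mathbf S$ is the Riemann sphere, $\mathbb C_\infty=\mathbf S\setminus\{0\}$, and $\mathcal M(U)$ is the field of meromorphic functions on $U$. In all categories below tensor products are Kronecker products (componentwise on tuples), and $n\in\mathbb N$. Category $\mathcal E_f$: a matrix $A\in GL_n(\mathbb C(z))$ is strictly fuchsian at $0$ (resp. at $\infty$) if $A(0)\in GL_n(\mathbb C)$ (resp. $A(\infty)\in GL_n(\mathbb C)$). It is fuchsian at $0$ (resp. $\infty$) if there is $F\in GL_n(\mathcal M(\mathbb C))$ (resp. $F\in GL_n(\mathcal M(\mathbb C_\infty))$) such that $(\sigma_qF)^{-1}AF$ is rational and strictly fuchsian at $0$ (resp. $\infty$). Objects of $\mathcal E_f$ are the $A\in GL_n(\mathbb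 C(z))$ that are fuchsian at both $0$ and $\infty$; morphisms from $A$ (rank $n$) to $B$ (rank $p$) are the $F\in M_{p,n}(\mathbb C(z))$ with $(\sigma_qF)A=BF$. For constant matrices $A\in GL_n(\mathbb C)$, $B\in GL_p(\mathbb C)$, a morphism $A\to B$ "at $0$" (resp. "at $\infty$") is $S\in M_{p,n}(\mathcal M(\mathbb C))$ (resp. $M_{p,n}(\mathcal M(\mathbb C_\infty))$) with $(\sigma_qS)A=BS$. Category $\mathcal C$: objects are triples $(A^{(0)},M,A^{(\infty)})$ with $A^{(0)},A^{(\infty)}\in GL_n(\mathbb C)$, $M\in GL_n(\mathcal M(\mathbb C^* ))$ and $(\sigma_qM)A^{(0)}=A^{(\infty)}M$. Morphisms $(A^{(0)},M,A^{(\infty)})\to(B^{(0)},N,B^{(\infty)})$ are pairs $(S^{(0)},S^{(\infty)})$ with $S^{(0)}:A^{(0)}\to B^{(0)}$ a morphism at $0$, $S^{(\infty)}:A^{(\infty)}\to B^{(\infty)}$ a morphism at $\infty$, and $S^{(\infty)}M=NS^{(0)}$. Category $\mathcal S$: objects are quadruples $(A^{(0)},M^{(0)},A^{(\infty)},M^{(\infty)})\in GL_n(\mathbb C)\times GL_n(\mathcal M(\mathbb C))\times GL_n(\mathbb C)\times GL_n(\mathcal M(\mathbb C_\infty))$ that are connected, i.e. $(\sigma_qM^{(\infty)})A^{(\infty)}(M^{(\infty)})^{-1}=(\sigma_qM^{(0)})A^{(0)}(M^{(0)})^{-1}$; the common value $A$ is then a rational matrix. Morphisms from $(A^{(0)},M^{(0)},A^{(\infty)},M^{(\infty)})$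 to $(B^{(0)},N^{(0)},B^{(\infty)},N^{(\infty)})$ are triples $(F,S^{(0)},S^{(\infty)})$ with $S^{(0)}:A^{(0)}\to B^{(0)}$ a morphism at $0$, $S^{(\infty)}:A^{(\infty)}\to B^{(\infty)}$ a morphism at $\infty$, $FM^{(0)}=N^{(0)}S^{(0)}$ and $FM^{(\infty)}=N^{(\infty)}S^{(\infty)}$ (then $F$ is rational and is a morphism $A\to B$ in $\mathcal E_f$). *)

theory Defs
  imports
    "HOL-Complex_Analysis.Complex_Analysis"
    "Jordan_Normal_Form.Matrix"
begin

section \<open>The field of meromorphic functions on the punctured plane\<close>

text \<open>
  All function fields involved embed, by restriction, into the field of meromorphic functions on
  the punctured plane; the restriction maps are injective by the identity theorem.  This field is
  a type below, and the smaller fields are the images of the embeddings.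
  A meromorphic function is a class of HOL functions modulo equality off a closed discrete subset
  of the punctured plane.
\<close>

definition mero_eq :: "(complex \<Rightarrow> complex) \<Rightarrow> (complex \<Rightarrow> complex) \<Rightarrow> bool" where
  "mero_eq f g \<longleftrightarrow> f meromorphic_on -{0} \<and> g meromorphic_on -{0} \<and>
     (\<forall>\<^sub>\<approx>z\<in>-{0}. f z = g z)"

quotient_type mero = "complex \<Rightarrow> complex" / partial: mero_eq
  morphisms rep_mero abs_mero
proof (rule part_equivpI)
  show "\<exists>f. mero_eq f f"
    by (rule exI[of _ "\<lambda>_. 0"]) (auto simp: mero_eq_def)
  show "symp mero_eq"
    by (auto simp: symp_def mero_eq_def eq_commute)
  show "transp mero_eq"
    unfolding transp_def mero_eq_def by (auto elim: eventually_elim2)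
qed

instantiation mero :: field
begin

lift_definition zero_mero :: mero is "\<lambda>_. 0"
  by (auto simp: mero_eq_def)

lift_definition one_mero :: mero is "\<lambda>_. 1"
  by (auto simp: mero_eq_def)

lift_definition plus_mero :: "mero \<Rightarrow> mero \<Rightarrow> mero" is "\<lambda>f g z. f z + g z"
  by (auto simp: mero_eq_def intro!: meromorphic_intros elim: eventually_elim2)

lift_definition minus_mero :: "mero \<Rightarrow> mero \<Rightarrow> mero" is "\<lambda>f g z. f z - g z"
  by (auto simp: mero_eq_def intro!: meromorphic_intros elim: eventually_elim2)

lift_definition uminus_mero :: "mero \<Rightarrow> mero" is "\<lambda>f z. - f z"
  by (auto simp: mero_eq_def intro!: meromorphic_intros elim: eventually_mono)

lift_definition times_mero :: "mero \<Rightarrow> mero \<Rightarrow> mero" is "\<lambda>f g z. f z * g z"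
  by (auto simp: mero_eq_def intro!: meromorphic_intros elim: eventually_elim2)

lift_definition inverse_mero :: "mero \<Rightarrow> mero" is "\<lambda>f z. inverse (f z)"
  by (auto simp: mero_eq_def intro!: meromorphic_intros elim: eventually_mono)

lift_definition divide_mero :: "mero \<Rightarrow> mero \<Rightarrow> mero" is "\<lambda>f g z. f z / g z"
  by (auto simp: mero_eq_def intro!: meromorphic_intros elim: eventually_elim2)

instance
proof
  fix a b c :: mero
  show "a * b * c = a * (b * c)"
    by transfer (auto simp: mero_eq_def mult.assoc intro!: meromorphic_intros)
  show "a * b = b * a"
    by transfer (auto simp: mero_eq_def mult.commute intro!: meromorphic_intros)
  show "1 * a = a"
    by transfer (auto simp: mero_eq_def)
  show "a + b + c = a + (b + c)"
    by transfer (auto simp: mero_eq_def add.assoc intro!: meromorphic_intros)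
  show "a + b = b + a"
    by transfer (auto simp: mero_eq_def add.commute intro!: meromorphic_intros)
  show "0 + a = a"
    by transfer (auto simp: mero_eq_def)
  show "- a + a = 0"
    by transfer (auto simp: mero_eq_def intro!: meromorphic_intros)
  show "a - b = a + - b"
    by transfer (auto simp: mero_eq_def intro!: meromorphic_intros)
  show "(a + b) * c = a * c + b * c"
    by transfer (auto simp: mero_eq_def distrib_right intro!: meromorphic_intros)
  show "(0 :: mero) \<noteq> 1"
  proof transfer
    have "cosparse (-{0 :: complex}) \<noteq> bot"
      unfolding cosparse_eq_bot_iff' by (metis ComplI empty_iff singletonD zero_neq_one)
    then show "\<not> mero_eq (\<lambda>_. 0) (\<lambda>_. 1)"
      by (simp add: mero_eq_def)
  qed
  show "inverse (0 :: mero) = 0"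
    by transfer (auto simp: mero_eq_def)
  show "a div b = a * inverse b"
    by transfer (auto simp: mero_eq_def field_simps intro!: meromorphic_intros)
  show "inverse a * a = 1" if "a \<noteq> 0"
    using that
  proof transfer
    fix f assume f: "mero_eq f f" and nz: "\<not> mero_eq f (\<lambda>_. 0)"
    have m: "f meromorphic_on -{0}"
      using f by (simp add: mero_eq_def)
    have "connected (-{0 :: complex})"
      by (rule connected_punctured_universe) simp
    then have "(\<forall>\<^sub>\<approx>z\<in>-{0}. f z = 0) \<or> (\<forall>\<^sub>\<approx>z\<in>-{0}. f z \<noteq> 0)"
      by (intro meromorphic_imp_constant_or_avoid m) auto
    with nz m have "\<forall>\<^sub>\<approx>z\<in>-{0}. f z \<noteq> 0"
      by (auto simp: mero_eq_def)
    then have "\<forall>\<^sub>\<approx>z\<in>-{0}. inverse (f z) * f z = 1"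
      by eventually_elim simp
    with m show "mero_eq (\<lambda>z. inverse (f z) * f z) (\<lambda>_. 1)"
      by (auto simp: mero_eq_def intro!: meromorphic_intros)
  qed
qed

end

lemma abs_mero_eq_iff:
  assumes "f meromorphic_on -{0}" "g meromorphic_on -{0}"
  shows "abs_mero f = abs_mero g \<longleftrightarrow> (\<forall>\<^sub>\<approx>z\<in>-{0}. f z = g z)"
  using assms Quotient_rel[OF Quotient_mero, of f g] by (auto simp: mero_eq_def)

definition const_mero :: "complex \<Rightarrow> mero" where
  "const_mero c = abs_mero (\<lambda>_. c)"

text \<open>Meromorphic functions on the plane.\<close>

definition mero_plane :: "mero set" where
  "mero_plane = {abs_mero f | f. f meromorphic_on UNIV}"

text \<open>Meromorphic functions on the sphere minus the origin, via the chart \<open>w = 1 / z\<close> at infinity.\<close>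

definition mero_inf :: "mero set" where
  "mero_inf = {abs_mero f | f. f meromorphic_on -{0} \<and> (\<lambda>w. f (1 / w)) meromorphic_on {0}}"

definition rat_mero :: "mero set" where
  "rat_mero = {abs_mero (\<lambda>z. poly p z / poly d z) | p d. d \<noteq> 0}"

definition value_at_0 :: "mero \<Rightarrow> complex \<Rightarrow> bool" where
  "value_at_0 a c \<longleftrightarrow> (\<exists>f. f meromorphic_on UNIV \<and> a = abs_mero f \<and> f \<midarrow>0\<rightarrow> c)"

definition value_at_inf :: "mero \<Rightarrow> complex \<Rightarrow> bool" where
  "value_at_inf a c \<longleftrightarrow> (\<exists>f. f meromorphic_on -{0} \<and> (\<lambda>w. f (1 / w)) meromorphic_on {0} \<and>
     a = abs_mero f \<and> (f \<longlongrightarrow> c) at_infinity)"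

text \<open>The operator \<open>\<sigma>\<^sub>q\<close>; for \<open>q \<noteq> 0\<close> it does not depend on the chosen representative.\<close>

definition qshift :: "complex \<Rightarrow> mero \<Rightarrow> mero" where
  "qshift q a = abs_mero (\<lambda>z. rep_mero a (q * z))"

lemma qshift_abs_mero:
  assumes "q \<noteq> 0" and f: "f meromorphic_on -{0}"
  shows "qshift q (abs_mero f) = abs_mero (\<lambda>z. f (q * z))"
proof -
  define g where "g = rep_mero (abs_mero f)"
  have "mero_eq f f"
    using f by (simp add: mero_eq_def)
  then have "mero_eq g f"
    unfolding g_def using Quotient_rel_rep[OF Quotient_mero] Quotient_abs_rep[OF Quotient_mero]
      Quotient_rep_reflp[OF Quotient_mero] Quotient_rel[OF Quotient_mero] by metis
  then have g: "g meromorphic_on -{0}" and ev: "\<forall>\<^sub>\<approx>z\<in>-{0}. g z = f z"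
    by (auto simp: mero_eq_def)
  have mero: "(\<lambda>z. h (q * z)) meromorphic_on -{0}" if "h meromorphic_on -{0}" for h
    by (rule meromorphic_on_compose[OF that]) (use assms in \<open>auto intro!: analytic_intros\<close>)
  have "eventually (\<lambda>z. g (q * z) = f (q * z)) (at x)" if "x \<noteq> 0" for x
  proof -
    have "eventually (\<lambda>z. g z = f z) (at (q * x))"
      using that assms by (intro eventually_cosparse_imp_eventually_at[OF ev]) auto
    moreover have "filterlim (\<lambda>z. q * z) (at (q * x)) (at x)"
      using assms by (intro filterlim_atI tendsto_intros) (auto simp: eventually_at_filter)
    ultimately show ?thesis
      by (rule eventually_compose_filterlim)
  qed
  then have "\<forall>\<^sub>\<approx>z\<in>-{0}. g (q * z) = f (q * z)"
    by (subst eventually_cosparse_open_eq) auto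
  then show ?thesis
    using mero[OF f] mero[OF g] by (simp add: qshift_def abs_mero_eq_iff flip: g_def)
qed


section \<open>Matrices\<close>

text \<open>\<open>Mat r c K\<close> and \<open>GL n K\<close> are the matrices and the invertible matrices over a subring \<open>K\<close>.\<close>

definition Mat :: "nat \<Rightarrow> nat \<Rightarrow> 'a set \<Rightarrow> 'a mat set" where
  "Mat r c K = {A \<in> carrier_mat r c. elements_mat A \<subseteq> K}"

definition GL :: "nat \<Rightarrow> 'a :: comm_ring_1 set \<Rightarrow> 'a mat set" where
  "GL n K = {A \<in> Mat n n K. \<exists>B \<in> Mat n n K. A * B = 1\<^sub>m n \<and> B * A = 1\<^sub>m n}"

definition inv_mat :: "'a :: comm_ring_1 mat \<Rightarrow> 'a mat" where
  "inv_mat A = (THE B. B \<in> carrier_mat (dim_row A) (dim_row A) \<and>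
     A * B = 1\<^sub>m (dim_row A) \<and> B * A = 1\<^sub>m (dim_row A))"

abbreviation const_mat :: "complex mat \<Rightarrow> mero mat" where
  "const_mat \<equiv> map_mat const_mero"

abbreviation qshift_mat :: "complex \<Rightarrow> mero mat \<Rightarrow> mero mat" where
  "qshift_mat q \<equiv> map_mat (qshift q)"

definition kron :: "'a :: comm_ring_1 mat \<Rightarrow> 'a mat \<Rightarrow> 'a mat" where
  "kron A B = mat (dim_row A * dim_row B) (dim_col A * dim_col B)
     (\<lambda>(i, j). A $$ (i div dim_row B, j div dim_col B) * B $$ (i mod dim_row B, j mod dim_col B))"

text \<open>
  The matrix of the flip \<open>K\<^sup>n \<otimes> K\<^sup>p \<rightarrow> K\<^sup>p \<otimes> K\<^sup>n\<close> in the bases underlying \<open>kron\<close>: the vector with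
  index \<open>i * p + j\<close> goes to the vector with index \<open>j * n + i\<close>.
\<close>

definition flip_mat :: "nat \<Rightarrow> nat \<Rightarrow> 'a :: comm_ring_1 mat" where
  "flip_mat n p = mat (p * n) (n * p)
     (\<lambda>(r, c). if r div n = c mod p \<and> r mod n = c div p then 1 else 0)"


section \<open>Linear tensor categories\<close>

text \<open>
  Hom-sets need not be disjoint, so the action of a functor on morphisms takes source and target
  as arguments.  \<open>cComp C g f\<close> is the composite of \<open>f\<close> followed by \<open>g\<close>.
\<close>

record ('o, 'm) tensor_cat =
  cOb :: "'o set"
  cHom :: "'o \<Rightarrow> 'o \<Rightarrow> 'm set"
  cId :: "'o \<Rightarrow> 'm"
  cComp :: "'m \<Rightarrow> 'm \<Rightarrow> 'm"
  cZero :: "'o \<Rightarrow> 'o \<Rightarrow> 'm"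
  cAdd :: "'m \<Rightarrow> 'm \<Rightarrow> 'm"
  cScale :: "complex \<Rightarrow> 'm \<Rightarrow> 'm"
  tOb :: "'o \<Rightarrow> 'o \<Rightarrow> 'o"
  tMor :: "'m \<Rightarrow> 'm \<Rightarrow> 'm"
  tUnit :: "'o"
  tAssoc :: "'o \<Rightarrow> 'o \<Rightarrow> 'o \<Rightarrow> 'm"
  tLunit :: "'o \<Rightarrow> 'm"
  tRunit :: "'o \<Rightarrow> 'm"
  tBraid :: "'o \<Rightarrow> 'o \<Rightarrow> 'm"

locale category =
  fixes C :: "('o, 'm) tensor_cat"
  assumes id_hom: "X \<in> cOb C \<Longrightarrow> cId C X \<in> cHom C X X"
    and comp_hom: "\<lbrakk>X \<in> cOb C; Y \<in> cOb C; Z \<in> cOb C; f \<in> cHom C X Y; g \<in> cHom C Y Z\<rbrakk>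
      \<Longrightarrow> cComp C g f \<in> cHom C X Z"
    and id_left: "\<lbrakk>X \<in> cOb C; Y \<in> cOb C; f \<in> cHom C X Y\<rbrakk> \<Longrightarrow> cComp C (cId C Y) f = f"
    and id_right: "\<lbrakk>X \<in> cOb C; Y \<in> cOb C; f \<in> cHom C X Y\<rbrakk> \<Longrightarrow> cComp C f (cId C X) = f"
    and comp_assoc: "\<lbrakk>W \<in> cOb C; X \<in> cOb C; Y \<in> cOb C; Z \<in> cOb C;
        f \<in> cHom C W X; g \<in> cHom C X Y; h \<in> cHom C Y Z\<rbrakk>
      \<Longrightarrow> cComp C (cComp C h g) f = cComp C h (cComp C g f)"

locale linear_category = category C for C :: "('o, 'm) tensor_cat" +
  assumes zero_hom: "\<lbrakk>X \<in> cOb C; Y \<in> cOb C\<rbrakk> \<Longrightarrow> cZero C X Y \<in> cHom C X Y"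
    and add_hom: "\<lbrakk>X \<in> cOb C; Y \<in> cOb C; f \<in> cHom C X Y; g \<in> cHom C X Y\<rbrakk>
      \<Longrightarrow> cAdd C f g \<in> cHom C X Y"
    and scale_hom: "\<lbrakk>X \<in> cOb C; Y \<in> cOb C; f \<in> cHom C X Y\<rbrakk> \<Longrightarrow> cScale C s f \<in> cHom C X Y"
    and add_assoc: "\<lbrakk>X \<in> cOb C; Y \<in> cOb C; f \<in> cHom C X Y; g \<in> cHom C X Y; h \<in> cHom C X Y\<rbrakk>
      \<Longrightarrow> cAdd C (cAdd C f g) h = cAdd C f (cAdd C g h)"
    and add_comm: "\<lbrakk>X \<in> cOb C; Y \<in> cOb C; f \<in> cHom C X Y; g \<in> cHom C X Y\<rbrakk>
      \<Longrightarrow> cAdd C f g = cAdd C g f"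
    and add_zero: "\<lbrakk>X \<in> cOb C; Y \<in> cOb C; f \<in> cHom C X Y\<rbrakk> \<Longrightarrow> cAdd C (cZero C X Y) f = f"
    and add_inverse: "\<lbrakk>X \<in> cOb C; Y \<in> cOb C; f \<in> cHom C X Y\<rbrakk>
      \<Longrightarrow> \<exists>g \<in> cHom C X Y. cAdd C g f = cZero C X Y"
    and scale_one: "\<lbrakk>X \<in> cOb C; Y \<in> cOb C; f \<in> cHom C X Y\<rbrakk> \<Longrightarrow> cScale C 1 f = f"
    and scale_scale: "\<lbrakk>X \<in> cOb C; Y \<in> cOb C; f \<in> cHom C X Y\<rbrakk>
      \<Longrightarrow> cScale C s (cScale C t f) = cScale C (s * t) f"
    and scale_add: "\<lbrakk>X \<in> cOb C; Y \<in> cOb C; f \<in> cHom C X Y; g \<in> cHom C X Y\<rbrakk>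
      \<Longrightarrow> cScale C s (cAdd C f g) = cAdd C (cScale C s f) (cScale C s g)"
    and add_scale: "\<lbrakk>X \<in> cOb C; Y \<in> cOb C; f \<in> cHom C X Y\<rbrakk>
      \<Longrightarrow> cScale C (s + t) f = cAdd C (cScale C s f) (cScale C t f)"
    and comp_add_right: "\<lbrakk>X \<in> cOb C; Y \<in> cOb C; Z \<in> cOb C;
        f \<in> cHom C X Y; f' \<in> cHom C X Y; g \<in> cHom C Y Z\<rbrakk>
      \<Longrightarrow> cComp C g (cAdd C f f') = cAdd C (cComp C g f) (cComp C g f')"
    and comp_add_left: "\<lbrakk>X \<in> cOb C; Y \<in> cOb C; Z \<in> cOb C;
        f \<in> cHom C X Y; g \<in> cHom C Y Z; g' \<in> cHom C Y Z\<rbrakk>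
      \<Longrightarrow> cComp C (cAdd C g g') f = cAdd C (cComp C g f) (cComp C g' f)"
    and comp_scale_right: "\<lbrakk>X \<in> cOb C; Y \<in> cOb C; Z \<in> cOb C; f \<in> cHom C X Y; g \<in> cHom C Y Z\<rbrakk>
      \<Longrightarrow> cComp C g (cScale C s f) = cScale C s (cComp C g f)"
    and comp_scale_left: "\<lbrakk>X \<in> cOb C; Y \<in> cOb C; Z \<in> cOb C; f \<in> cHom C X Y; g \<in> cHom C Y Z\<rbrakk>
      \<Longrightarrow> cComp C (cScale C s g) f = cScale C s (cComp C g f)"

definition is_iso :: "('o, 'm) tensor_cat \<Rightarrow> 'o \<Rightarrow> 'o \<Rightarrow> 'm \<Rightarrow> bool" where
  "is_iso C X Y f \<longleftrightarrow> f \<in> cHom C X Y \<and>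
     (\<exists>g \<in> cHom C Y X. cComp C g f = cId C X \<and> cComp C f g = cId C Y)"

text \<open>Symmetric monoidal linear categories (ACU tensor categories) with bilinear tensor product.\<close>

locale linear_tensor_category = linear_category C for C :: "('o, 'm) tensor_cat" +
  assumes tensor_ob: "\<lbrakk>X \<in> cOb C; Y \<in> cOb C\<rbrakk> \<Longrightarrow> tOb C X Y \<in> cOb C"
    and tensor_hom: "\<lbrakk>X \<in> cOb C; X' \<in> cOb C; Y \<in> cOb C; Y' \<in> cOb C;
        f \<in> cHom C X X'; g \<in> cHom C Y Y'\<rbrakk>
      \<Longrightarrow> tMor C f g \<in> cHom C (tOb C X Y) (tOb C X' Y')"
    and tensor_id: "\<lbrakk>X \<in> cOb C; Y \<in> cOb C\<rbrakk>
      \<Longrightarrow> tMor C (cId C X) (cId C Y) = cId C (tOb C X Y)"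
    and tensor_comp: "\<lbrakk>X \<in> cOb C; X' \<in> cOb C; X'' \<in> cOb C; Y \<in> cOb C; Y' \<in> cOb C; Y'' \<in> cOb C;
        f \<in> cHom C X X'; f' \<in> cHom C X' X''; g \<in> cHom C Y Y'; g' \<in> cHom C Y' Y''\<rbrakk>
      \<Longrightarrow> tMor C (cComp C f' f) (cComp C g' g) = cComp C (tMor C f' g') (tMor C f g)"
    and tensor_add_left: "\<lbrakk>X \<in> cOb C; X' \<in> cOb C; Y \<in> cOb C; Y' \<in> cOb C;
        f \<in> cHom C X X'; f' \<in> cHom C X X'; g \<in> cHom C Y Y'\<rbrakk>
      \<Longrightarrow> tMor C (cAdd C f f') g = cAdd C (tMor C f g) (tMor C f' g)"
    and tensor_add_right: "\<lbrakk>X \<in> cOb C; X' \<in> cOb C; Y \<in> cOb C; Y' \<in> cOb C;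
        f \<in> cHom C X X'; g \<in> cHom C Y Y'; g' \<in> cHom C Y Y'\<rbrakk>
      \<Longrightarrow> tMor C f (cAdd C g g') = cAdd C (tMor C f g) (tMor C f g')"
    and tensor_scale_left: "\<lbrakk>X \<in> cOb C; X' \<in> cOb C; Y \<in> cOb C; Y' \<in> cOb C;
        f \<in> cHom C X X'; g \<in> cHom C Y Y'\<rbrakk>
      \<Longrightarrow> tMor C (cScale C s f) g = cScale C s (tMor C f g)"
    and tensor_scale_right: "\<lbrakk>X \<in> cOb C; X' \<in> cOb C; Y \<in> cOb C; Y' \<in> cOb C;
        f \<in> cHom C X X'; g \<in> cHom C Y Y'\<rbrakk>
      \<Longrightarrow> tMor C f (cScale C s g) = cScale C s (tMor C f g)"
    and unit_ob: "tUnit C \<in> cOb C"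
    and assoc_iso: "\<lbrakk>X \<in> cOb C; Y \<in> cOb C; Z \<in> cOb C\<rbrakk>
      \<Longrightarrow> is_iso C (tOb C (tOb C X Y) Z) (tOb C X (tOb C Y Z)) (tAssoc C X Y Z)"
    and assoc_natural: "\<lbrakk>X \<in> cOb C; X' \<in> cOb C; Y \<in> cOb C; Y' \<in> cOb C; Z \<in> cOb C; Z' \<in> cOb C;
        f \<in> cHom C X X'; g \<in> cHom C Y Y'; h \<in> cHom C Z Z'\<rbrakk>
      \<Longrightarrow> cComp C (tAssoc C X' Y' Z') (tMor C (tMor C f g) h) =
          cComp C (tMor C f (tMor C g h)) (tAssoc C X Y Z)"
    and lunit_iso: "X \<in> cOb C \<Longrightarrow> is_iso C (tOb C (tUnit C) X) X (tLunit C X)"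
    and lunit_natural: "\<lbrakk>X \<in> cOb C; Y \<in> cOb C; f \<in> cHom C X Y\<rbrakk>
      \<Longrightarrow> cComp C (tLunit C Y) (tMor C (cId C (tUnit C)) f) = cComp C f (tLunit C X)"
    and runit_iso: "X \<in> cOb C \<Longrightarrow> is_iso C (tOb C X (tUnit C)) X (tRunit C X)"
    and runit_natural: "\<lbrakk>X \<in> cOb C; Y \<in> cOb C; f \<in> cHom C X Y\<rbrakk>
      \<Longrightarrow> cComp C (tRunit C Y) (tMor C f (cId C (tUnit C))) = cComp C f (tRunit C X)"
    and braid_iso: "\<lbrakk>X \<in> cOb C; Y \<in> cOb C\<rbrakk>
      \<Longrightarrow> is_iso C (tOb C X Y) (tOb C Y X) (tBraid C X Y)"
    and braid_natural: "\<lbrakk>X \<in> cOb C; X' \<in> cOb C; Y \<in> cOb C; Y' \<in> cOb C;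
        f \<in> cHom C X X'; g \<in> cHom C Y Y'\<rbrakk>
      \<Longrightarrow> cComp C (tBraid C X' Y') (tMor C f g) = cComp C (tMor C g f) (tBraid C X Y)"
    and pentagon: "\<lbrakk>W \<in> cOb C; X \<in> cOb C; Y \<in> cOb C; Z \<in> cOb C\<rbrakk>
      \<Longrightarrow> cComp C (tAssoc C W X (tOb C Y Z)) (tAssoc C (tOb C W X) Y Z) =
          cComp C (tMor C (cId C W) (tAssoc C X Y Z))
            (cComp C (tAssoc C W (tOb C X Y) Z) (tMor C (tAssoc C W X Y) (cId C Z)))"
    and triangle: "\<lbrakk>X \<in> cOb C; Y \<in> cOb C\<rbrakk>
      \<Longrightarrow> cComp C (tMor C (cId C X) (tLunit C Y)) (tAssoc C X (tUnit C) Y) =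
          tMor C (tRunit C X) (cId C Y)"
    and hexagon: "\<lbrakk>X \<in> cOb C; Y \<in> cOb C; Z \<in> cOb C\<rbrakk>
      \<Longrightarrow> cComp C (tAssoc C Y Z X) (cComp C (tBraid C X (tOb C Y Z)) (tAssoc C X Y Z)) =
          cComp C (tMor C (cId C Y) (tBraid C X Z))
            (cComp C (tAssoc C Y X Z) (tMor C (tBraid C X Y) (cId C Z)))"
    and braid_symmetric: "\<lbrakk>X \<in> cOb C; Y \<in> cOb C\<rbrakk>
      \<Longrightarrow> cComp C (tBraid C Y X) (tBraid C X Y) = cId C (tOb C X Y)"

locale cat_functor =
  fixes C :: "('o, 'm) tensor_cat" and D :: "('p, 'n) tensor_cat"
    and F :: "'o \<Rightarrow> 'p" and Fm :: "'o \<Rightarrow> 'o \<Rightarrow> 'm \<Rightarrow> 'n"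
  assumes functor_ob: "X \<in> cOb C \<Longrightarrow> F X \<in> cOb D"
    and functor_hom: "\<lbrakk>X \<in> cOb C; Y \<in> cOb C; f \<in> cHom C X Y\<rbrakk>
      \<Longrightarrow> Fm X Y f \<in> cHom D (F X) (F Y)"
    and functor_id: "X \<in> cOb C \<Longrightarrow> Fm X X (cId C X) = cId D (F X)"
    and functor_comp: "\<lbrakk>X \<in> cOb C; Y \<in> cOb C; Z \<in> cOb C; f \<in> cHom C X Y; g \<in> cHom C Y Z\<rbrakk>
      \<Longrightarrow> Fm X Z (cComp C g f) = cComp D (Fm Y Z g) (Fm X Y f)"

locale linear_functor = cat_functor C D F Fm
  for C :: "('o, 'm) tensor_cat" and D :: "('p, 'n) tensor_cat"
    and F :: "'o \<Rightarrow> 'p" and Fm :: "'o \<Rightarrow> 'o \<Rightarrow> 'm \<Rightarrow> 'n" +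
  assumes functor_add: "\<lbrakk>X \<in> cOb C; Y \<in> cOb C; f \<in> cHom C X Y; g \<in> cHom C X Y\<rbrakk>
      \<Longrightarrow> Fm X Y (cAdd C f g) = cAdd D (Fm X Y f) (Fm X Y g)"
    and functor_scale: "\<lbrakk>X \<in> cOb C; Y \<in> cOb C; f \<in> cHom C X Y\<rbrakk>
      \<Longrightarrow> Fm X Y (cScale C s f) = cScale D s (Fm X Y f)"

definition natural_iso ::
  "('o, 'm) tensor_cat \<Rightarrow> ('p, 'n) tensor_cat \<Rightarrow> ('o \<Rightarrow> 'p) \<Rightarrow> ('o \<Rightarrow> 'o \<Rightarrow> 'm \<Rightarrow> 'n) \<Rightarrow>
   ('o \<Rightarrow> 'p) \<Rightarrow> ('o \<Rightarrow> 'o \<Rightarrow> 'm \<Rightarrow> 'n) \<Rightarrow> ('o \<Rightarrow> 'n) \<Rightarrow> bool" where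
  "natural_iso C D F Fm G Gm \<eta> \<longleftrightarrow>
     (\<forall>X \<in> cOb C. is_iso D (F X) (G X) (\<eta> X)) \<and>
     (\<forall>X \<in> cOb C. \<forall>Y \<in> cOb C. \<forall>f \<in> cHom C X Y.
        cComp D (\<eta> Y) (Fm X Y f) = cComp D (Gm X Y f) (\<eta> X))"

definition category_equivalence ::
  "('o, 'm) tensor_cat \<Rightarrow> ('p, 'n) tensor_cat \<Rightarrow> ('o \<Rightarrow> 'p) \<Rightarrow> ('o \<Rightarrow> 'o \<Rightarrow> 'm \<Rightarrow> 'n) \<Rightarrow> bool" where
  "category_equivalence C D F Fm \<longleftrightarrow> cat_functor C D F Fm \<and>
     (\<exists>G Gm \<eta> \<epsilon>. cat_functor D C G Gm \<and>
        natural_iso C C (\<lambda>X. X) (\<lambda>X Y f. f)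
          (\<lambda>X. G (F X)) (\<lambda>X Y f. Gm (F X) (F Y) (Fm X Y f)) \<eta> \<and>
        natural_iso D D (\<lambda>X. F (G X)) (\<lambda>X Y f. Fm (G X) (G Y) (Gm X Y f))
          (\<lambda>X. X) (\<lambda>X Y f. f) \<epsilon>)"

text \<open>
  Symmetric (strong) monoidal functors, with structure isomorphisms
  \<open>\<mu> X Y : F X \<otimes> F Y \<rightarrow> F (X \<otimes> Y)\<close> and \<open>\<upsilon> : 1 \<rightarrow> F 1\<close>.
\<close>

locale tensor_functor = cat_functor C D F Fm
  for C :: "('o, 'm) tensor_cat" and D :: "('p, 'n) tensor_cat"
    and F :: "'o \<Rightarrow> 'p" and Fm :: "'o \<Rightarrow> 'o \<Rightarrow> 'm \<Rightarrow> 'n" +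
  fixes \<mu> :: "'o \<Rightarrow> 'o \<Rightarrow> 'n" and \<upsilon> :: "'n"
  assumes mult_iso: "\<lbrakk>X \<in> cOb C; Y \<in> cOb C\<rbrakk>
      \<Longrightarrow> is_iso D (tOb D (F X) (F Y)) (F (tOb C X Y)) (\<mu> X Y)"
    and mult_natural: "\<lbrakk>X \<in> cOb C; X' \<in> cOb C; Y \<in> cOb C; Y' \<in> cOb C;
        f \<in> cHom C X X'; g \<in> cHom C Y Y'\<rbrakk>
      \<Longrightarrow> cComp D (\<mu> X' Y') (tMor D (Fm X X' f) (Fm Y Y' g)) =
          cComp D (Fm (tOb C X Y) (tOb C X' Y') (tMor C f g)) (\<mu> X Y)"
    and unit_iso: "is_iso D (tUnit D) (F (tUnit C)) \<upsilon>"
    and mult_assoc: "\<lbrakk>X \<in> cOb C; Y \<in> cOb C; Z \<in> cOb C\<rbrakk>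
      \<Longrightarrow> cComp D (Fm (tOb C (tOb C X Y) Z) (tOb C X (tOb C Y Z)) (tAssoc C X Y Z))
            (cComp D (\<mu> (tOb C X Y) Z) (tMor D (\<mu> X Y) (cId D (F Z)))) =
          cComp D (\<mu> X (tOb C Y Z))
            (cComp D (tMor D (cId D (F X)) (\<mu> Y Z)) (tAssoc D (F X) (F Y) (F Z)))"
    and mult_lunit: "X \<in> cOb C
      \<Longrightarrow> cComp D (Fm (tOb C (tUnit C) X) X (tLunit C X))
            (cComp D (\<mu> (tUnit C) X) (tMor D \<upsilon> (cId D (F X)))) = tLunit D (F X)"
    and mult_runit: "X \<in> cOb C
      \<Longrightarrow> cComp D (Fm (tOb C X (tUnit C)) X (tRunit C X))
            (cComp D (\<mu> X (tUnit C)) (tMor D (cId D (F X)) \<upsilon>)) = tRunit D (F X)"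
    and mult_braid: "\<lbrakk>X \<in> cOb C; Y \<in> cOb C\<rbrakk>
      \<Longrightarrow> cComp D (Fm (tOb C X Y) (tOb C Y X) (tBraid C X Y)) (\<mu> X Y) =
          cComp D (\<mu> Y X) (tBraid D (F X) (F Y))"

definition linear_tensor_equivalence ::
  "('o, 'm) tensor_cat \<Rightarrow> ('p, 'n) tensor_cat \<Rightarrow> ('o \<Rightarrow> 'p) \<Rightarrow> ('o \<Rightarrow> 'o \<Rightarrow> 'm \<Rightarrow> 'n) \<Rightarrow>
   ('o \<Rightarrow> 'o \<Rightarrow> 'n) \<Rightarrow> 'n \<Rightarrow> bool" where
  "linear_tensor_equivalence C D F Fm \<mu> \<upsilon> \<longleftrightarrow>
     linear_tensor_category C \<and> linear_tensor_category D \<and>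
     linear_functor C D F Fm \<and> tensor_functor C D F Fm \<mu> \<upsilon> \<and> category_equivalence C D F Fm"


section \<open>The category of fuchsian equations\<close>

definition strictly_fuchsian_0 :: "nat \<Rightarrow> mero mat \<Rightarrow> bool" where
  "strictly_fuchsian_0 n A \<longleftrightarrow> A \<in> GL n rat_mero \<and>
     (\<exists>A0 \<in> GL n UNIV. \<forall>i < n. \<forall>j < n. value_at_0 (A $$ (i, j)) (A0 $$ (i, j)))"

definition strictly_fuchsian_inf :: "nat \<Rightarrow> mero mat \<Rightarrow> bool" where
  "strictly_fuchsian_inf n A \<longleftrightarrow> A \<in> GL n rat_mero \<and>
     (\<exists>A0 \<in> GL n UNIV. \<forall>i < n. \<forall>j < n. value_at_inf (A $$ (i, j)) (A0 $$ (i, j)))"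

definition fuchsian_0 :: "complex \<Rightarrow> nat \<Rightarrow> mero mat \<Rightarrow> bool" where
  "fuchsian_0 q n A \<longleftrightarrow> A \<in> GL n rat_mero \<and>
     (\<exists>F \<in> GL n mero_plane. strictly_fuchsian_0 n (inv_mat (qshift_mat q F) * A * F))"

definition fuchsian_inf :: "complex \<Rightarrow> nat \<Rightarrow> mero mat \<Rightarrow> bool" where
  "fuchsian_inf q n A \<longleftrightarrow> A \<in> GL n rat_mero \<and>
     (\<exists>F \<in> GL n mero_inf. strictly_fuchsian_inf n (inv_mat (qshift_mat q F) * A * F))"

text \<open>
  The rank of an object is the number of rows.  The Kronecker product is strictly associative and
  unital, so the associativity and unit constraints are identity matrices.
\<close>

definition cat_E :: "complex \<Rightarrow> (mero mat, mero mat) tensor_cat" where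
  "cat_E q = \<lparr>
     cOb = {A. \<exists>n. fuchsian_0 q n A \<and> fuchsian_inf q n A},
     cHom = (\<lambda>A B. {F \<in> Mat (dim_row B) (dim_row A) rat_mero. qshift_mat q F * A = B * F}),
     cId = (\<lambda>A. 1\<^sub>m (dim_row A)),
     cComp = (\<lambda>G F. G * F),
     cZero = (\<lambda>A B. 0\<^sub>m (dim_row B) (dim_row A)),
     cAdd = (\<lambda>F G. F + G),
     cScale = (\<lambda>s F. const_mero s \<cdot>\<^sub>m F),
     tOb = kron,
     tMor = kron,
     tUnit = 1\<^sub>m 1,
     tAssoc = (\<lambda>A B C. 1\<^sub>m (dim_row A * dim_row B * dim_row C)),
     tLunit = (\<lambda>A. 1\<^sub>m (dim_row A)),
     tRunit = (\<lambda>A. 1\<^sub>m (dim_row A)),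
     tBraid = (\<lambda>A B. flip_mat (dim_row A) (dim_row B)) \<rparr>"


section \<open>The categories of connection data and of solutions\<close>

definition hom_0 :: "complex \<Rightarrow> complex mat \<Rightarrow> complex mat \<Rightarrow> mero mat set" where
  "hom_0 q A B = {S \<in> Mat (dim_row B) (dim_row A) mero_plane.
     qshift_mat q S * const_mat A = const_mat B * S}"

definition hom_inf :: "complex \<Rightarrow> complex mat \<Rightarrow> complex mat \<Rightarrow> mero mat set" where
  "hom_inf q A B = {S \<in> Mat (dim_row B) (dim_row A) mero_inf.
     qshift_mat q S * const_mat A = const_mat B * S}"

type_synonym conn_ob = "complex mat \<times> mero mat \<times> complex mat"
type_synonym conn_mor = "mero mat \<times> mero mat"

definition cat_C :: "complex \<Rightarrow> (conn_ob, conn_mor) tensor_cat" where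
  "cat_C q = \<lparr>
     cOb = {(A0, M, Ai). \<exists>n. A0 \<in> GL n UNIV \<and> Ai \<in> GL n UNIV \<and> M \<in> GL n UNIV \<and>
       qshift_mat q M * const_mat A0 = const_mat Ai * M},
     cHom = (\<lambda>(A0, M, Ai) (B0, N, Bi).
       {(S0, Si). S0 \<in> hom_0 q A0 B0 \<and> Si \<in> hom_inf q Ai Bi \<and> Si * M = N * S0}),
     cId = (\<lambda>(A0, M, Ai). (1\<^sub>m (dim_row A0), 1\<^sub>m (dim_row A0))),
     cComp = (\<lambda>(T0, Ti) (S0, Si). (T0 * S0, Ti * Si)),
     cZero = (\<lambda>(A0, M, Ai) (B0, N, Bi).
       (0\<^sub>m (dim_row B0) (dim_row A0), 0\<^sub>m (dim_row B0) (dim_row A0))),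
     cAdd = (\<lambda>(S0, Si) (T0, Ti). (S0 + T0, Si + Ti)),
     cScale = (\<lambda>s (S0, Si). (const_mero s \<cdot>\<^sub>m S0, const_mero s \<cdot>\<^sub>m Si)),
     tOb = (\<lambda>(A0, M, Ai) (B0, N, Bi). (kron A0 B0, kron M N, kron Ai Bi)),
     tMor = (\<lambda>(S0, Si) (T0, Ti). (kron S0 T0, kron Si Ti)),
     tUnit = (1\<^sub>m 1, 1\<^sub>m 1, 1\<^sub>m 1),
     tAssoc = (\<lambda>(A0, _, _) (B0, _, _) (C0, _, _).
       let I = 1\<^sub>m (dim_row A0 * dim_row B0 * dim_row C0) in (I, I)),
     tLunit = (\<lambda>(A0, _, _). (1\<^sub>m (dim_row A0), 1\<^sub>m (dim_row A0))),
     tRunit = (\<lambda>(A0, _, _). (1\<^sub>m (dim_row A0), 1\<^sub>m (dim_row A0))),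
     tBraid = (\<lambda>(A0, _, _) (B0, _, _).
       let P = flip_mat (dim_row A0) (dim_row B0) in (P, P)) \<rparr>"

type_synonym sol_ob = "complex mat \<times> mero mat \<times> complex mat \<times> mero mat"
type_synonym sol_mor = "mero mat \<times> mero mat \<times> mero mat"

text \<open>The first component of a morphism is not assumed rational: this follows from the equations.\<close>

definition cat_S :: "complex \<Rightarrow> (sol_ob, sol_mor) tensor_cat" where
  "cat_S q = \<lparr>
     cOb = {(A0, M0, Ai, Mi). \<exists>n. A0 \<in> GL n UNIV \<and> M0 \<in> GL n mero_plane \<and>
       Ai \<in> GL n UNIV \<and> Mi \<in> GL n mero_inf \<and>
       qshift_mat q Mi * const_mat Ai * inv_mat Mi = qshift_mat q M0 * const_mat A0 * inv_mat M0},
     cHom = (\<lambda>(A0, M0, Ai, Mi) (B0, N0, Bi, Ni).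
       {(F, S0, Si). F \<in> carrier_mat (dim_row B0) (dim_row A0) \<and>
         S0 \<in> hom_0 q A0 B0 \<and> Si \<in> hom_inf q Ai Bi \<and> F * M0 = N0 * S0 \<and> F * Mi = Ni * Si}),
     cId = (\<lambda>(A0, _, _, _). let I = 1\<^sub>m (dim_row A0) in (I, I, I)),
     cComp = (\<lambda>(G, T0, Ti) (F, S0, Si). (G * F, T0 * S0, Ti * Si)),
     cZero = (\<lambda>(A0, _, _, _) (B0, _, _, _).
       let Z = 0\<^sub>m (dim_row B0) (dim_row A0) in (Z, Z, Z)),
     cAdd = (\<lambda>(F, S0, Si) (G, T0, Ti). (F + G, S0 + T0, Si + Ti)),
     cScale = (\<lambda>s (F, S0, Si).
       (const_mero s \<cdot>\<^sub>m F, const_mero s \<cdot>\<^sub>m S0, const_mero s \<cdot>\<^sub>m Si)),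
     tOb = (\<lambda>(A0, M0, Ai, Mi) (B0, N0, Bi, Ni).
       (kron A0 B0, kron M0 N0, kron Ai Bi, kron Mi Ni)),
     tMor = (\<lambda>(F, S0, Si) (G, T0, Ti). (kron F G, kron S0 T0, kron Si Ti)),
     tUnit = (1\<^sub>m 1, 1\<^sub>m 1, 1\<^sub>m 1, 1\<^sub>m 1),
     tAssoc = (\<lambda>(A0, _, _, _) (B0, _, _, _) (C0, _, _, _).
       let I = 1\<^sub>m (dim_row A0 * dim_row B0 * dim_row C0) in (I, I, I)),
     tLunit = (\<lambda>(A0, _, _, _). let I = 1\<^sub>m (dim_row A0) in (I, I, I)),
     tRunit = (\<lambda>(A0, _, _, _). let I = 1\<^sub>m (dim_row A0) in (I, I, I)),
     tBraid = (\<lambda>(A0, _, _, _) (B0, _, _, _).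
       let P = flip_mat (dim_row A0) (dim_row B0) in (P, P, P)) \<rparr>"


section \<open>The two functors\<close>

definition SE_ob :: "complex \<Rightarrow> sol_ob \<Rightarrow> mero mat" where
  "SE_ob q = (\<lambda>(A0, M0, Ai, Mi). qshift_mat q M0 * const_mat A0 * inv_mat M0)"

definition SE_mor :: "sol_ob \<Rightarrow> sol_ob \<Rightarrow> sol_mor \<Rightarrow> mero mat" where
  "SE_mor X Y = (\<lambda>(F, S0, Si). F)"

definition SC_ob :: "sol_ob \<Rightarrow> conn_ob" where
  "SC_ob = (\<lambda>(A0, M0, Ai, Mi). (A0, inv_mat Mi * M0, Ai))"

definition SC_mor :: "sol_ob \<Rightarrow> sol_ob \<Rightarrow> sol_mor \<Rightarrow> conn_mor" where
  "SC_mor X Y = (\<lambda>(F, S0, Si). (S0, Si))"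

end

theory Submission
  imports Defs "Jordan_Normal_Form.Schur_Decomposition"
begin

text \<open>
  A solution of a fuchsian system consists of gauge transformations \<open>M0\<close> over the plane and \<open>Mi\<close> over
  the sphere without the origin, which bring the system \<open>A\<close> to constant systems \<open>A0\<close> and \<open>Ai\<close>.
  Both functors forget part of such a datum, and the forgotten part can be recovered:

  \<^item> A morphism is determined by \<open>F\<close>, because \<open>S0 = N0\<inverse> F M0\<close> and \<open>Si = Ni\<inverse> F Mi\<close>, and also by
    \<open>(S0, Si)\<close>, because \<open>F = N0 S0 M0\<inverse> = Ni Si Mi\<inverse>\<close>.  The intertwining equations for \<open>F\<close>, \<open>S0\<close> and
    \<open>Si\<close> are equivalent (\<open>intertwine_transport\<close>).  A matrix \<open>F\<close> obtained from \<open>S0\<close> and \<open>Si\<close> is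
    meromorphic on the whole sphere, hence rational: after multiplication by a polynomial that cancels
    the finite poles, it is entire of polynomial growth, and Liouville's theorem applies
    (\<open>sphere_meromorphic_imp_rational\<close>).  So both functors are fully faithful.

  \<^item> Every fuchsian system has a solution.  At the origin the system may be assumed to have an
    invertible value there (\<open>fundamental_solution_0\<close>).  Gauge transformations with entries \<open>1 / z\<close>
    multiply single eigenvalues of the value by \<open>q\<close> until all their moduli lie in one interval
    \<open>[R, \<bar>q\<bar> R)\<close>.  A constant gauge transformation makes the value \<open>A0\<close> nearly diagonal.  Then the
    products \<open>B (z / q) \<cdots> B (z / q\<^sup>m) D\<^sup>m\<close> with \<open>D = A0\<inverse>\<close> converge near the origin, because each
    step multiplies the error by less than \<open>\<bar>q\<bar>\<close> while the argument is divided by \<open>q\<close>; the functional equation extends the limit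
    to the plane.  The substitution of \<open>1 / z\<close> for \<open>z\<close> and an inversion carry this to infinity
    (\<open>fundamental_solution_inf\<close>).

  \<^item> Every connection matrix \<open>M\<close> has the form \<open>Mi\<inverse> M0\<close> (\<open>birkhoff_factorization\<close>).  Choose a circle
    about the origin on which \<open>M\<close> and \<open>M\<inverse>\<close> are analytic.  A Laurent polynomial \<open>P\<close> close to \<open>M\<inverse>\<close> near the
    circle gives \<open>P M = 1 + E\<close> with \<open>E\<close> small, and a linear contraction on Laurent coefficients
    produces \<open>V\<close>, analytic outside and zero at infinity, such that \<open>W = (1 + V) (1 + E)\<close> is analytic inside.
    Then \<open>W\<close> inside the circle and \<open>(1 + V) P\<close> outside it extend meromorphically by means of \<open>M\<close> to
    matrices \<open>M0\<close> and \<open>Mi\<close>.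

  Hence both functors are surjective on objects and bijective on morphisms, and they preserve the
  tensor operations on the nose, since conjugation is compatible with Kronecker products.  The
  axioms of a tensor category hold because, entry by entry, all operations are those of matrices
  (\<open>matrix_category\<close>).
\<close>

section \<open>Matrices over a subfield\<close>

locale subfield_set =
  fixes K :: "'a :: field set"
  assumes zero_mem: "0 \<in> K" and one_mem: "1 \<in> K"
    and add_mem: "a \<in> K \<Longrightarrow> b \<in> K \<Longrightarrow> a + b \<in> K"
    and uminus_mem: "a \<in> K \<Longrightarrow> - a \<in> K"
    and mult_mem: "a \<in> K \<Longrightarrow> b \<in> K \<Longrightarrow> a * b \<in> K"
    and inverse_mem: "a \<in> K \<Longrightarrow> inverse a \<in> K"

lemma subfield_set_UNIV: "subfield_set UNIV"
  by unfold_locales auto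

lemma Mat_iff: "A \<in> Mat r c K \<longleftrightarrow> A \<in> carrier_mat r c \<and> (\<forall>i<r. \<forall>j<c. A $$ (i, j) \<in> K)"
  unfolding Mat_def by blast

lemma Mat_UNIV: "Mat r c UNIV = carrier_mat r c"
  by (auto simp: Mat_iff)

lemma MatD: "A \<in> Mat r c K \<Longrightarrow> A \<in> carrier_mat r c"
  "A \<in> Mat r c K \<Longrightarrow> i < r \<Longrightarrow> j < c \<Longrightarrow> A $$ (i, j) \<in> K"
  by (auto simp: Mat_iff)

lemma GL_carrier: "A \<in> GL n K \<Longrightarrow> A \<in> carrier_mat n n"
  by (auto simp: GL_def Mat_def)

lemma GL_Mat: "A \<in> GL n K \<Longrightarrow> A \<in> Mat n n K"
  by (auto simp: GL_def)

lemma inv_mat_eqI: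
  assumes "A \<in> carrier_mat n n" "B \<in> carrier_mat n n" "A * B = 1\<^sub>m n" "B * A = 1\<^sub>m n"
  shows "inv_mat A = B"
  unfolding inv_mat_def
proof (rule the_equality)
  show "B \<in> carrier_mat (dim_row A) (dim_row A) \<and> A * B = 1\<^sub>m (dim_row A) \<and> B * A = 1\<^sub>m (dim_row A)"
    using assms by auto
next
  fix C assume C: "C \<in> carrier_mat (dim_row A) (dim_row A) \<and> A * C = 1\<^sub>m (dim_row A) \<and> C * A = 1\<^sub>m (dim_row A)"
  then have Cc: "C \<in> carrier_mat n n" and AC: "A * C = 1\<^sub>m n"
    using assms by auto
  have "C = (B * A) * C"
    using assms Cc by simp
  also have "\<dots> = B * (A * C)"
    using assms Cc by (intro assoc_mult_mat) auto
  also have "\<dots> = B"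
    using assms AC by simp
  finally show "C = B" .
qed

lemma GL_inv_mat:
  assumes "A \<in> GL n K"
  shows "inv_mat A \<in> GL n K" "A * inv_mat A = 1\<^sub>m n" "inv_mat A * A = 1\<^sub>m n"
proof -
  obtain B where B: "B \<in> Mat n n K" "A * B = 1\<^sub>m n" "B * A = 1\<^sub>m n"
    using assms by (auto simp: GL_def)
  have "inv_mat A = B"
    using inv_mat_eqI[OF GL_carrier[OF assms] MatD(1)[OF B(1)] B(2,3)] .
  with B assms show "inv_mat A \<in> GL n K" "A * inv_mat A = 1\<^sub>m n" "inv_mat A * A = 1\<^sub>m n"
    by (auto simp: GL_def)
qed

lemma GL_inv_carrier: "A \<in> GL n K \<Longrightarrow> inv_mat A \<in> carrier_mat n n"
  by (intro GL_carrier[of _ _ K] GL_inv_mat)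

context
  fixes X :: "'a :: comm_ring_1 mat" and n K
  assumes X: "X \<in> GL n K"
begin

lemma GL_cancel_left:
  assumes "A \<in> carrier_mat n m"
  shows "inv_mat X * (X * A) = A" "X * (inv_mat X * A) = A"
proof -
  note [simp] = GL_carrier[OF X] GL_inv_carrier[OF X] GL_inv_mat(2,3)[OF X]
  show "inv_mat X * (X * A) = A"
    using assms by (subst assoc_mult_mat[symmetric, of _ n n _ n _ m]) auto
  show "X * (inv_mat X * A) = A"
    using assms by (subst assoc_mult_mat[symmetric, of _ n n _ n _ m]) auto
qed

lemma GL_cancel_right:
  assumes "A \<in> carrier_mat m n"
  shows "A * X * inv_mat X = A" "A * inv_mat X * X = A"
proof -
  note [simp] = GL_carrier[OF X] GL_inv_carrier[OF X] GL_inv_mat(2,3)[OF X]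
  show "A * X * inv_mat X = A"
    using assms by (subst assoc_mult_mat[of _ m n _ n _ n]) auto
  show "A * inv_mat X * X = A"
    using assms by (subst assoc_mult_mat[of _ m n _ n _ n]) auto
qed

end

context subfield_set
begin

lemma sum_mem: "(\<And>i. i \<in> I \<Longrightarrow> f i \<in> K) \<Longrightarrow> sum f I \<in> K"
  by (induction I rule: infinite_finite_induct) (auto simp: zero_mem add_mem)

lemma prod_mem: "(\<And>i. i \<in> I \<Longrightarrow> f i \<in> K) \<Longrightarrow> prod f I \<in> K"
  by (induction I rule: infinite_finite_induct) (auto simp: one_mem mult_mem)

lemma Mat_mult: "A \<in> Mat r m K \<Longrightarrow> B \<in> Mat m c K \<Longrightarrow> A * B \<in> Mat r c K"
  by (auto simp: Mat_iff scalar_prod_def intro!: sum_mem mult_mem)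

lemma Mat_add: "A \<in> Mat r c K \<Longrightarrow> B \<in> Mat r c K \<Longrightarrow> A + B \<in> Mat r c K"
  by (auto simp: Mat_iff intro!: add_mem)

lemma Mat_smult: "k \<in> K \<Longrightarrow> A \<in> Mat r c K \<Longrightarrow> k \<cdot>\<^sub>m A \<in> Mat r c K"
  by (auto simp: Mat_iff intro!: mult_mem)

lemma Mat_zero: "0\<^sub>m r c \<in> Mat r c K"
  by (auto simp: Mat_iff zero_mem)

lemma Mat_one: "1\<^sub>m n \<in> Mat n n K"
  by (auto simp: Mat_iff zero_mem one_mem)

lemma det_mem:
  assumes "A \<in> Mat n n K"
  shows "Determinant.det A \<in> K"
proof -
  have "signof p \<in> K" for p :: "nat \<Rightarrow> nat"
    using sign_cases[of p] one_mem uminus_mem by (auto simp: sign_def)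
  then show ?thesis
    using assms unfolding Determinant.det_def
    by (auto simp: Mat_iff permutes_in_image intro!: sum_mem mult_mem prod_mem)
qed

lemma adj_mem:
  assumes "A \<in> Mat n n K"
  shows "adj_mat A \<in> Mat n n K"
proof -
  have "cofactor A j i \<in> K" if "i < n" "j < n" for i j
  proof -
    have "mat_delete A j i \<in> Mat (n - 1) (n - 1) K"
      using assms that by (auto simp: Mat_iff mat_delete_def)
    then have "Determinant.det (mat_delete A j i) \<in> K"
      by (rule det_mem)
    moreover have "(- 1) ^ (j + i) \<in> K"
      using one_mem uminus_mem by (cases "even (j + i)") auto
    ultimately show ?thesis
      by (auto simp: cofactor_def intro: mult_mem)
  qed
  then show ?thesis
    using assms by (auto simp: Mat_iff adj_mat_def)
qed

lemma GL_det:
  assumes "A \<in> Mat n n K" "Determinant.det A \<noteq> 0"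
  shows "A \<in> GL n K" "inv_mat A = inverse (Determinant.det A) \<cdot>\<^sub>m adj_mat A"
proof -
  define B where "B = inverse (Determinant.det A) \<cdot>\<^sub>m adj_mat A"
  have A: "A \<in> carrier_mat n n"
    using assms by (auto simp: Mat_iff)
  note adj = adj_mat[OF A]
  have B: "B \<in> Mat n n K"
    unfolding B_def by (intro Mat_smult adj_mem[OF assms(1)] inverse_mem det_mem[OF assms(1)])
  have one: "inverse (Determinant.det A) \<cdot>\<^sub>m (Determinant.det A \<cdot>\<^sub>m 1\<^sub>m n) = 1\<^sub>m n"
    using assms(2) by (intro eq_matI) auto
  have "A * B = 1\<^sub>m n"
    unfolding B_def using A adj one by (simp add: mult_smult_distrib)
  moreover have "B * A = 1\<^sub>m n"
    unfolding B_def using A adj one by (simp add: mult_smult_assoc_mat)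
  ultimately show "A \<in> GL n K" "inv_mat A = B"
    using B assms(1) inv_mat_eqI[OF A, of B] by (auto simp: GL_def Mat_iff)
qed

lemma GL_one: "1\<^sub>m n \<in> GL n K"
  using GL_det(1)[OF Mat_one] by simp

end

lemma GL_det_nz:
  fixes A :: "'a :: field mat"
  assumes "A \<in> GL n K"
  shows "Determinant.det A \<noteq> 0"
proof -
  obtain B where "B \<in> carrier_mat n n" "A * B = 1\<^sub>m n"
    using assms by (auto simp: GL_def Mat_iff)
  then have "Determinant.det A * Determinant.det B = 1"
    using det_mult[of A n B] GL_carrier[OF assms] by simp
  then show ?thesis by auto
qed

lemma (in subfield_set) GL_iff:
  "A \<in> GL n K \<longleftrightarrow> A \<in> Mat n n K \<and> Determinant.det A \<noteq> 0"
  using GL_det GL_Mat GL_det_nz by metis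

lemma GL_UNIV_iff:
  "(A :: 'a :: field mat) \<in> GL n UNIV \<longleftrightarrow> A \<in> carrier_mat n n \<and> Determinant.det A \<noteq> 0"
  using subfield_set.GL_iff[OF subfield_set_UNIV] by (simp add: Mat_UNIV)

lemma (in subfield_set) GL_mult: "A \<in> GL n K \<Longrightarrow> B \<in> GL n K \<Longrightarrow> A * B \<in> GL n K"
  by (auto simp: GL_iff Mat_mult det_mult[OF MatD(1) MatD(1)])

lemma GL_mono: "K \<subseteq> L \<Longrightarrow> A \<in> GL n K \<Longrightarrow> A \<in> GL n L"
  unfolding GL_def Mat_def by blast

lemma GL_UNIV: "A \<in> GL n K \<Longrightarrow> A \<in> GL n UNIV"
  by (rule GL_mono) auto

section \<open>Kronecker products and flips\<close>

lemma dim_kron [simp]: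
  "dim_row (kron A B) = dim_row A * dim_row B" "dim_col (kron A B) = dim_col A * dim_col B"
  by (simp_all add: kron_def)

lemma kron_carrier [simp, intro]:
  "A \<in> carrier_mat a b \<Longrightarrow> B \<in> carrier_mat c d \<Longrightarrow> kron A B \<in> carrier_mat (a * c) (b * d)"
  by (auto simp: kron_def)

lemma div_less_of_less_mult: "i < a * b \<Longrightarrow> i div b < (a :: nat)"
  by (simp add: less_mult_imp_div_less)

lemma mod_less_of_less_mult: "i < a * b \<Longrightarrow> i mod b < (b :: nat)"
  by (cases b) auto

lemma kron_index:
  "A \<in> carrier_mat a b \<Longrightarrow> B \<in> carrier_mat c d \<Longrightarrow> i < a * c \<Longrightarrow> j < b * d \<Longrightarrow>
   kron A B $$ (i, j) = A $$ (i div c, j div d) * B $$ (i mod c, j mod d)"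
  by (auto simp: kron_def)

lemma (in subfield_set) Mat_kron:
  "A \<in> Mat a b K \<Longrightarrow> B \<in> Mat c d K \<Longrightarrow> kron A B \<in> Mat (a * c) (b * d) K"
  by (auto simp: Mat_iff kron_def div_less_of_less_mult mod_less_of_less_mult intro!: mult_mem)

lemma combine_less: "u < m \<Longrightarrow> v < r \<Longrightarrow> u * r + v < m * (r :: nat)"
proof -
  assume uv: "u < m" "v < r"
  have "u * r + v < Suc u * r" using uv by simp
  also have "\<dots> \<le> m * r" using uv by (intro mult_right_mono) auto
  finally show ?thesis .
qed

lemma eq_combine_iff: "v < r \<Longrightarrow> j = u * r + v \<longleftrightarrow> j div r = u \<and> j mod r = (v :: nat)"
  by (auto simp: mult.commute)

lemma sum_div_mod:
  fixes f :: "nat \<Rightarrow> nat \<Rightarrow> 'a :: comm_monoid_add"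
  shows "(\<Sum>k<m * r. f (k div r) (k mod r)) = (\<Sum>u<m. \<Sum>v<r. f u v)"
proof -
  have "(\<Sum>u<m. \<Sum>v<r. f u v) = (\<Sum>(u, v)\<in>{..<m} \<times> {..<r}. f u v)"
    by (simp add: sum.cartesian_product)
  also have "\<dots> = (\<Sum>k<m * r. f (k div r) (k mod r))"
    by (rule sum.reindex_bij_witness[of _ "\<lambda>k. (k div r, k mod r)" "\<lambda>(u, v). u * r + v"])
       (auto intro!: combine_less simp: div_less_of_less_mult mod_less_of_less_mult)
  finally show ?thesis ..
qed

lemma kron_mult:
  assumes A: "A \<in> carrier_mat n m" and C: "C \<in> carrier_mat m l"
    and B: "B \<in> carrier_mat p r" and D: "D \<in> carrier_mat r s"
  shows "kron (A * C) (B * D) = kron A B * kron C D"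
proof (rule eq_matI)
  show "dim_row (kron (A * C) (B * D)) = dim_row (kron A B * kron C D)"
    "dim_col (kron (A * C) (B * D)) = dim_col (kron A B * kron C D)"
    using assms by auto
next
  fix i j assume "i < dim_row (kron A B * kron C D)" "j < dim_col (kron A B * kron C D)"
  then have ij: "i < n * p" "j < l * s"
    using assms by auto
  note [simp] = div_less_of_less_mult[OF ij(1)] div_less_of_less_mult[OF ij(2)]
    mod_less_of_less_mult[OF ij(1)] mod_less_of_less_mult[OF ij(2)]
  have AC: "A * C \<in> carrier_mat n l" and BD: "B * D \<in> carrier_mat p s"
    using assms by auto
  have "kron (A * C) (B * D) $$ (i, j) =
      (\<Sum>u<m. A $$ (i div p, u) * C $$ (u, j div s)) * (\<Sum>v<r. B $$ (i mod p, v) * D $$ (v, j mod s))"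
    using assms by (simp add: kron_index[OF AC BD ij] scalar_prod_def atLeast0LessThan)
  also have "\<dots> = (\<Sum>u<m. \<Sum>v<r. (A $$ (i div p, u) * C $$ (u, j div s)) * (B $$ (i mod p, v) * D $$ (v, j mod s)))"
    by (rule sum_product)
  also have "\<dots> = (\<Sum>k<m * r. (A $$ (i div p, k div r) * C $$ (k div r, j div s)) *
      (B $$ (i mod p, k mod r) * D $$ (k mod r, j mod s)))"
    by (rule sum_div_mod[symmetric])
  also have "\<dots> = (\<Sum>k<m * r. kron A B $$ (i, k) * kron C D $$ (k, j))"
    using ij by (intro sum.cong) (auto simp: kron_index[OF A B] kron_index[OF C D] mult_ac)
  also have "\<dots> = (kron A B * kron C D) $$ (i, j)"
    using assms ij by (simp add: scalar_prod_def atLeast0LessThan)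
  finally show "kron (A * C) (B * D) $$ (i, j) = (kron A B * kron C D) $$ (i, j)" .
qed

lemma mod_mult_div_eq: "(i :: nat) mod (b * c) div c = i div c mod b"
proof (cases "c = 0")
  case False
  have "i mod (b * c) = c * (i div c mod b) + i mod c"
    by (metis mod_mult2_eq mult.commute)
  then show ?thesis using False by simp
qed simp

lemma mod_mult_mod_right: "(i :: nat) mod (b * c) mod c = i mod c"
  by (simp add: mod_mod_cancel)

lemma div_mult2_nat: "(i :: nat) div c div b = i div (b * c)"
  by (metis div_mult2_eq mult.commute)

lemma kron_assoc: "kron (kron A B) C = kron A (kron B C)"
proof (rule eq_matI)
  fix i j assume *: "i < dim_row (kron A (kron B C))" "j < dim_col (kron A (kron B C))"
  then have ij: "i < dim_row A * dim_row B * dim_row C" "j < dim_col A * dim_col B * dim_col C"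
    by (auto simp: mult_ac)
  then show "kron (kron A B) C $$ (i, j) = kron A (kron B C) $$ (i, j)"
    using * mod_less_of_less_mult[of i "dim_row A" "dim_row B * dim_row C"]
      mod_less_of_less_mult[of j "dim_col A" "dim_col B * dim_col C"]
    by (simp add: kron_def div_less_of_less_mult mod_less_of_less_mult mod_mult_div_eq
        mod_mult_mod_right div_mult2_nat mult_ac)
qed (auto simp: mult_ac)

lemma kron_one_left [simp]: "kron (1\<^sub>m (Suc 0)) A = A"
  by (rule eq_matI) (auto simp: kron_def)

lemma kron_one_right [simp]: "kron A (1\<^sub>m (Suc 0)) = A"
  by (rule eq_matI) (auto simp: kron_def)

lemma kron_one: "kron (1\<^sub>m n) (1\<^sub>m p) = 1\<^sub>m (n * p)"
proof (rule eq_matI)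
  fix i j assume "i < dim_row (1\<^sub>m (n * p) :: 'a mat)" "j < dim_col (1\<^sub>m (n * p) :: 'a mat)"
  then have *: "i < n * p" "j < n * p" by auto
  have "i = j" if "i div p = j div p" "i mod p = j mod p"
    using that by (metis div_mult_mod_eq)
  then show "kron (1\<^sub>m n) (1\<^sub>m p) $$ (i, j) = (1\<^sub>m (n * p) :: 'a mat) $$ (i, j)"
    using * by (auto simp: kron_def div_less_of_less_mult mod_less_of_less_mult)
qed auto

lemma kron_add_left:
  "A \<in> carrier_mat a b \<Longrightarrow> A' \<in> carrier_mat a b \<Longrightarrow> kron (A + A') B = kron A B + kron A' B"
  by (rule eq_matI) (auto simp: kron_def div_less_of_less_mult distrib_right)

lemma kron_add_right:
  "B \<in> carrier_mat a b \<Longrightarrow> B' \<in> carrier_mat a b \<Longrightarrow> kron A (B + B') = kron A B + kron A B'"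
  by (rule eq_matI) (auto simp: kron_def mod_less_of_less_mult distrib_left)

lemma kron_smult_left: "kron (k \<cdot>\<^sub>m A) B = k \<cdot>\<^sub>m kron A B"
  by (rule eq_matI) (auto simp: kron_def div_less_of_less_mult mult_ac)

lemma kron_smult_right: "kron A (k \<cdot>\<^sub>m B) = k \<cdot>\<^sub>m kron A B"
  by (rule eq_matI) (auto simp: kron_def mod_less_of_less_mult mult_ac)

lemma map_mat_kron:
  assumes "\<And>a b. h (a * b) = h a * h b"
  shows "map_mat h (kron A B) = kron (map_mat h A) (map_mat h B)"
  by (rule eq_matI) (auto simp: kron_def div_less_of_less_mult mod_less_of_less_mult assms)

lemma kron_inverse:
  fixes A B :: "'a :: comm_ring_1 mat"
  assumes "A \<in> GL n K" "B \<in> GL p L"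
  shows "kron A B * kron (inv_mat A) (inv_mat B) = 1\<^sub>m (n * p)"
    "kron (inv_mat A) (inv_mat B) * kron A B = 1\<^sub>m (n * p)"
    "inv_mat (kron A B) = kron (inv_mat A) (inv_mat B)"
proof -
  note c = GL_carrier[OF assms(1)] GL_carrier[OF assms(2)]
    GL_inv_carrier[OF assms(1)] GL_inv_carrier[OF assms(2)]
  show 1: "kron A B * kron (inv_mat A) (inv_mat B) = 1\<^sub>m (n * p)"
    using kron_mult[OF c(1,3) c(2,4)] GL_inv_mat[OF assms(1)] GL_inv_mat[OF assms(2)] by (simp add: kron_one)
  show 2: "kron (inv_mat A) (inv_mat B) * kron A B = 1\<^sub>m (n * p)"
    using kron_mult[OF c(3,1) c(4,2)] GL_inv_mat[OF assms(1)] GL_inv_mat[OF assms(2)] by (simp add: kron_one)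
  show "inv_mat (kron A B) = kron (inv_mat A) (inv_mat B)"
    by (rule inv_mat_eqI[OF _ _ 1 2]) (use c in auto)
qed

lemma (in subfield_set) GL_kron:
  assumes "A \<in> GL n K" "B \<in> GL p K"
  shows "kron A B \<in> GL (n * p) K"
  using kron_inverse[OF assms] Mat_kron GL_Mat[OF assms(1)] GL_Mat[OF assms(2)]
    Mat_kron[OF GL_Mat[OF GL_inv_mat(1)[OF assms(1)]] GL_Mat[OF GL_inv_mat(1)[OF assms(2)]]]
  unfolding GL_def by blast

text \<open>
  Identity matrices, flips and their Kronecker products each have one entry \<open>1\<close> per row.  Described by
  the position \<open>f r\<close> of that entry in row \<open>r\<close>, they multiply by composing index functions, so identities
  between them become arithmetic of \<open>div\<close> and \<open>mod\<close>.
\<close>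

definition row_selector :: "nat \<Rightarrow> nat \<Rightarrow> (nat \<Rightarrow> nat) \<Rightarrow> 'a :: comm_ring_1 mat" where
  "row_selector m n f = mat m n (\<lambda>(r, c). if c = f r then 1 else 0)"

lemma row_selector_carrier [simp, intro]: "row_selector m n f \<in> carrier_mat m n"
  by (simp add: row_selector_def)

lemma row_selector_cong: "(\<And>r. r < m \<Longrightarrow> f r = g r) \<Longrightarrow> row_selector m n f = row_selector m n g"
  by (rule eq_matI) (auto simp: row_selector_def)

lemma row_selector_index:
  assumes X: "X \<in> carrier_mat n l" and "r < m" "c < l" "f r < n"
  shows "(row_selector m n f * X) $$ (r, c) = X $$ (f r, c)"
proof -
  have "(row_selector m n f * X) $$ (r, c) = (\<Sum>k<n. (if k = f r then 1 else 0) * X $$ (k, c))"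
    using assms by (simp add: row_selector_def scalar_prod_def atLeast0LessThan)
  also have "\<dots> = (\<Sum>k<n. if k = f r then X $$ (k, c) else 0)"
    by (intro sum.cong) auto
  finally show ?thesis
    using assms by simp
qed

lemma row_selector_mult:
  assumes "\<And>r. r < m \<Longrightarrow> f r < n"
  shows "row_selector m n f * row_selector n l g = row_selector m l (\<lambda>r. g (f r))"
proof (rule eq_matI)
  fix i j assume "i < dim_row (row_selector m l (\<lambda>r. g (f r)) :: 'a mat)"
    "j < dim_col (row_selector m l (\<lambda>r. g (f r)) :: 'a mat)"
  then have ij: "i < m" "j < l" by (auto simp: row_selector_def)
  show "(row_selector m n f * row_selector n l g) $$ (i, j) = (row_selector m l (\<lambda>r. g (f r)) :: 'a mat) $$ (i, j)"
    using ij assms[OF ij(1)]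
    by (subst row_selector_index[OF row_selector_carrier ij]) (auto simp: row_selector_def)
qed (auto simp: row_selector_def)

lemma row_selector_one: "1\<^sub>m n = row_selector n n (\<lambda>r. r)"
  by (rule eq_matI) (auto simp: row_selector_def)

lemma kron_row_selector:
  assumes "\<And>r. r < p \<Longrightarrow> g r < s"
  shows "kron (row_selector n m f) (row_selector p s g) =
    row_selector (n * p) (m * s) (\<lambda>r. f (r div p) * s + g (r mod p))"
proof (rule eq_matI)
  fix i j assume "i < dim_row (row_selector (n * p) (m * s) (\<lambda>r. f (r div p) * s + g (r mod p)) :: 'a mat)"
    "j < dim_col (row_selector (n * p) (m * s) (\<lambda>r. f (r div p) * s + g (r mod p)) :: 'a mat)"
  then have ij: "i < n * p" "j < m * s" by (auto simp: row_selector_def)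
  note [simp] = div_less_of_less_mult[OF ij(1)] div_less_of_less_mult[OF ij(2)]
    mod_less_of_less_mult[OF ij(1)] mod_less_of_less_mult[OF ij(2)]
  have g: "g (i mod p) < s" using assms by simp
  have "j = f (i div p) * s + g (i mod p) \<longleftrightarrow> j div s = f (i div p) \<and> j mod s = g (i mod p)"
    using g by (rule eq_combine_iff)
  then show "kron (row_selector n m f) (row_selector p s g) $$ (i, j) =
     (row_selector (n * p) (m * s) (\<lambda>r. f (r div p) * s + g (r mod p)) :: 'a mat) $$ (i, j)"
    using ij by (auto simp: row_selector_def kron_def)
qed (auto simp: row_selector_def)

lemma flip_index_less: "r < p * n \<Longrightarrow> (r mod n) * p + r div n < n * (p :: nat)"
  by (rule combine_less) (auto simp: div_less_of_less_mult mod_less_of_less_mult)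

lemma flip_mat_row_selector:
  "flip_mat n p = row_selector (p * n) (n * p) (\<lambda>r. (r mod n) * p + r div n)"
proof (rule eq_matI)
  fix i j assume "i < dim_row (row_selector (p * n) (n * p) (\<lambda>r. (r mod n) * p + r div n) :: 'a mat)"
    "j < dim_col (row_selector (p * n) (n * p) (\<lambda>r. (r mod n) * p + r div n) :: 'a mat)"
  then have ij: "i < p * n" "j < n * p" by (auto simp: row_selector_def)
  have "i div n < p" using ij by (simp add: div_less_of_less_mult)
  then have "j = (i mod n) * p + i div n \<longleftrightarrow> i div n = j mod p \<and> i mod n = j div p"
    by (subst eq_combine_iff) auto
  then show "flip_mat n p $$ (i, j) =
     (row_selector (p * n) (n * p) (\<lambda>r. (r mod n) * p + r div n) :: 'a mat) $$ (i, j)"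
    using ij by (simp add: row_selector_def flip_mat_def)
qed (auto simp: row_selector_def flip_mat_def)

lemma flip_mat_carrier [simp, intro]: "flip_mat n p \<in> carrier_mat (p * n) (n * p)"
  by (simp add: flip_mat_def)

lemma flip_mat_involution: "flip_mat p n * flip_mat n p = 1\<^sub>m (n * p)"
proof -
  have "flip_mat p n * flip_mat n p = row_selector (n * p) (n * p)
     (\<lambda>r. ((r mod p * n + r div p) mod n) * p + (r mod p * n + r div p) div n)"
    unfolding flip_mat_row_selector
    by (subst row_selector_mult) (auto simp: flip_index_less)
  also have "\<dots> = row_selector (n * p) (n * p) (\<lambda>r. r)"
  proof (rule row_selector_cong)
    fix r assume r: "r < n * p"
    have "r div p < n" using r by (rule div_less_of_less_mult)
    then show "((r mod p * n + r div p) mod n) * p + (r mod p * n + r div p) div n = r"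
      by (auto)
  qed
  finally show ?thesis by (simp add: row_selector_one)
qed

lemma col_flip_index:
  assumes X: "X \<in> carrier_mat l (p * n)" and "i < l" "c < n * p"
  shows "(X * flip_mat n p) $$ (i, c) = X $$ (i, (c mod p) * n + c div p)"
proof -
  have d: "c div p < n" "c mod p < p"
    using assms by (auto simp: div_less_of_less_mult mod_less_of_less_mult)
  define k0 where "k0 = (c mod p) * n + c div p"
  have k0: "k0 < p * n" unfolding k0_def by (rule combine_less) (use d in auto)
  have "(X * flip_mat n p) $$ (i, c) = (\<Sum>k<p * n. X $$ (i, k) * flip_mat n p $$ (k, c))"
    using assms by (simp add: flip_mat_def scalar_prod_def atLeast0LessThan)
  also have "\<dots> = (\<Sum>k<p * n. if k = k0 then X $$ (i, k) else 0)"
  proof (intro sum.cong refl)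
    fix k assume "k \<in> {..<p * n}"
    moreover have "k = k0 \<longleftrightarrow> k div n = c mod p \<and> k mod n = c div p"
      unfolding k0_def using d by (intro eq_combine_iff)
    ultimately show "X $$ (i, k) * flip_mat n p $$ (k, c) = (if k = k0 then X $$ (i, k) else 0)"
      using assms by (simp add: flip_mat_def)
  qed
  finally show ?thesis
    using k0 by (simp add: k0_def)
qed

lemma flip_mat_natural:
  assumes F: "F \<in> carrier_mat n' n" and G: "G \<in> carrier_mat p' p"
  shows "flip_mat n' p' * kron F G = kron G F * flip_mat n p"
proof (rule eq_matI)
  fix i c assume "i < dim_row (kron G F * flip_mat n p)" "c < dim_col (kron G F * flip_mat n p)"
  then have ij: "i < p' * n'" "c < n * p"
    using assms by (auto simp: flip_mat_def)
  have d: "i div n' < p'" "i mod n' < n'" "c div p < n" "c mod p < p"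
    using ij by (auto simp: div_less_of_less_mult mod_less_of_less_mult)
  have k: "i mod n' * p' + i div n' < n' * p'" "c mod p * n + c div p < p * n"
    using d by (auto intro!: combine_less)
  have "(flip_mat n' p' * kron F G) $$ (i, c) = kron F G $$ (i mod n' * p' + i div n', c)"
    unfolding flip_mat_row_selector using k ij assms by (intro row_selector_index) auto
  also have "\<dots> = F $$ (i mod n', c div p) * G $$ (i div n', c mod p)"
    using k ij d by (simp add: kron_index[OF F G])
  also have "\<dots> = kron G F $$ (i, c mod p * n + c div p)"
    using k ij d by (simp add: kron_index[OF G F])
  also have "\<dots> = (kron G F * flip_mat n p) $$ (i, c)"
    using ij assms by (intro col_flip_index[symmetric]) auto
  finally show "(flip_mat n' p' * kron F G) $$ (i, c) = (kron G F * flip_mat n p) $$ (i, c)" .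
qed (use assms in \<open>auto simp: flip_mat_def\<close>)

lemma flip_mat_hexagon:
  "flip_mat x (y * z) = kron (1\<^sub>m y) (flip_mat x z) * kron (flip_mat x y) (1\<^sub>m z)"
proof -
  have 1: "kron (1\<^sub>m y) (flip_mat x z) =
      (row_selector (y * (z * x)) (y * (x * z))
        (\<lambda>r. r div (z * x) * (x * z) + (r mod (z * x) mod x * z + r mod (z * x) div x)) :: 'a mat)"
    unfolding row_selector_one flip_mat_row_selector
    by (rule kron_row_selector) (rule flip_index_less)
  have 2: "kron (flip_mat x y) (1\<^sub>m z) =
      (row_selector (y * x * z) (x * y * z) (\<lambda>r. (r div z mod x * y + r div z div x) * z + r mod z) :: 'a mat)"
    unfolding row_selector_one flip_mat_row_selector
    by (rule kron_row_selector) auto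
  have eq: "y * (x * z) = y * x * z" by simp
  show ?thesis
    unfolding 1 2 eq
  proof (subst row_selector_mult)
    fix r assume "r < y * (z * x)"
    then have "r div (z * x) < y" "r mod (z * x) < z * x"
      by (auto simp: div_less_of_less_mult mod_less_of_less_mult)
    then have "r div (z * x) * (x * z) + (r mod (z * x) mod x * z + r mod (z * x) div x) < y * (x * z)"
      by (intro combine_less flip_index_less)
    then show "r div (z * x) * (x * z) + (r mod (z * x) mod x * z + r mod (z * x) div x) < y * x * z"
      by (simp add: mult_ac)
  next
    \<comment> \<open>A row index is \<open>(j z + k) x + i\<close>; the first factor sends it to \<open>(j x + i) z + k\<close> and the second to \<open>(i y + j) z + k\<close>.\<close>
    have "flip_mat x (y * z) = (row_selector (y * (z * x)) (x * y * z)
       (\<lambda>r. (r mod x) * (y * z) + r div x) :: 'a mat)"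
      by (simp add: flip_mat_row_selector mult.assoc)
    also have "\<dots> = row_selector (y * (z * x)) (x * y * z)
       (\<lambda>r. ((r div (z * x) * (x * z) + (r mod (z * x) mod x * z + r mod (z * x) div x)) div z mod x * y +
          (r div (z * x) * (x * z) + (r mod (z * x) mod x * z + r mod (z * x) div x)) div z div x) * z +
         (r div (z * x) * (x * z) + (r mod (z * x) mod x * z + r mod (z * x) div x)) mod z)"
    proof (rule row_selector_cong)
      fix r assume r: "r < y * (z * x)"
      define i j k where "i = r mod x" and "j = r div (z * x)" and "k = r div x mod z"
      have i: "i < x" and k: "k < z"
        using r by (cases "x = 0"; cases "z = 0"; simp add: i_def k_def)+
      have rx: "r div x = j * z + k"
        unfolding j_def k_def using div_mult_mod_eq[of "r div x" z] by (metis div_mult2_nat)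
      have a: "r mod (z * x) mod x = i" "r mod (z * x) div x = k"
        by (auto simp: i_def k_def mod_mult_mod_right mod_mult_div_eq)
      have b: "j * (x * z) + (i * z + k) = (j * x + i) * z + k"
        by (simp add: algebra_simps)
      have c: "((j * x + i) * z + k) div z = j * x + i" "((j * x + i) * z + k) mod z = k"
        using k by auto
      have d: "(j * x + i) div x = j" "(j * x + i) mod x = i"
        using i by auto
      show "(r mod x) * (y * z) + r div x =
        ((r div (z * x) * (x * z) + (r mod (z * x) mod x * z + r mod (z * x) div x)) div z mod x * y +
          (r div (z * x) * (x * z) + (r mod (z * x) mod x * z + r mod (z * x) div x)) div z div x) * z +
         (r div (z * x) * (x * z) + (r mod (z * x) mod x * z + r mod (z * x) div x)) mod z"
        unfolding a i_def[symmetric] j_def[symmetric] b c d rx by (simp add: algebra_simps)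
    qed
    finally show "flip_mat x (y * z) = (row_selector (y * (z * x)) (x * y * z)
       (\<lambda>r. ((r div (z * x) * (x * z) + (r mod (z * x) mod x * z + r mod (z * x) div x)) div z mod x * y +
          (r div (z * x) * (x * z) + (r mod (z * x) mod x * z + r mod (z * x) div x)) div z div x) * z +
         (r div (z * x) * (x * z) + (r mod (z * x) mod x * z + r mod (z * x) div x)) mod z) :: 'a mat)" .
  qed
qed

lemma (in subfield_set) Mat_flip: "flip_mat n p \<in> Mat (p * n) (n * p) K"
  by (auto simp: Mat_iff flip_mat_def zero_mem one_mem)

section \<open>Calculus in the field of meromorphic functions\<close>

declare meromorphic_on_const [simp] meromorphic_on_id [simp]

lemma mero_cases:
  obtains f where "f meromorphic_on -{0}" "a = abs_mero f"
proof -
  have "mero_eq (rep_mero a) (rep_mero a)"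
    using Quotient_rep_reflp[OF Quotient_mero] .
  then have "rep_mero a meromorphic_on -{0}"
    by (simp add: mero_eq_def)
  moreover have "a = abs_mero (rep_mero a)"
    using Quotient_abs_rep[OF Quotient_mero] by metis
  ultimately show ?thesis by (rule that)
qed

lemma mero_eq_refl_iff: "mero_eq f f \<longleftrightarrow> f meromorphic_on -{0}"
  by (auto simp: mero_eq_def)

lemma abs_mero_eqI:
  assumes "f meromorphic_on -{0}" "\<forall>\<^sub>\<approx>z\<in>-{0}. f z = g z"
  shows "abs_mero f = abs_mero g"
proof -
  have "g meromorphic_on -{0}"
    using meromorphic_on_cong'[OF assms(2) refl] assms(1) by simp
  with assms show ?thesis by (simp add: abs_mero_eq_iff)
qed

lemma abs_mero_add:
  "f meromorphic_on -{0} \<Longrightarrow> g meromorphic_on -{0} \<Longrightarrow> abs_mero f + abs_mero g = abs_mero (\<lambda>z. f z + g z)"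
  by (rule plus_mero.abs_eq) (auto simp: mero_eq_refl_iff)

lemma abs_mero_mult:
  "f meromorphic_on -{0} \<Longrightarrow> g meromorphic_on -{0} \<Longrightarrow> abs_mero f * abs_mero g = abs_mero (\<lambda>z. f z * g z)"
  by (rule times_mero.abs_eq) (auto simp: mero_eq_refl_iff)

lemma abs_mero_divide:
  "f meromorphic_on -{0} \<Longrightarrow> g meromorphic_on -{0} \<Longrightarrow> abs_mero f / abs_mero g = abs_mero (\<lambda>z. f z / g z)"
  by (rule divide_mero.abs_eq) (auto simp: mero_eq_refl_iff)

lemma abs_mero_uminus:
  "f meromorphic_on -{0} \<Longrightarrow> - abs_mero f = abs_mero (\<lambda>z. - f z)"
  by (rule uminus_mero.abs_eq) (auto simp: mero_eq_refl_iff)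

lemma abs_mero_inverse:
  "f meromorphic_on -{0} \<Longrightarrow> inverse (abs_mero f) = abs_mero (\<lambda>z. inverse (f z))"
  by (rule inverse_mero.abs_eq) (auto simp: mero_eq_refl_iff)

lemma abs_mero_zero: "0 = abs_mero (\<lambda>_. 0)"
  by (rule zero_mero.abs_eq)

lemma abs_mero_one: "1 = abs_mero (\<lambda>_. 1)"
  by (rule one_mero.abs_eq)

lemma abs_mero_sum:
  assumes "\<And>i. i \<in> I \<Longrightarrow> f i meromorphic_on -{0}"
  shows "(\<Sum>i\<in>I. abs_mero (f i)) = abs_mero (\<lambda>z. \<Sum>i\<in>I. f i z)"
  using assms
proof (induction I rule: infinite_finite_induct)
  case (insert i I)
  have "(\<lambda>z. \<Sum>i\<in>I. f i z) meromorphic_on -{0}"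
    using insert by (auto intro!: meromorphic_intros)
  with insert show ?case
    by (simp add: abs_mero_add)
qed (auto simp: abs_mero_zero)

lemma abs_mero_nonzeroI:
  assumes "f meromorphic_on -{0}" "x \<noteq> 0" "eventually (\<lambda>z. f z \<noteq> 0) (at x)"
  shows "abs_mero f \<noteq> 0"
proof
  assume "abs_mero f = 0"
  then have "\<forall>\<^sub>\<approx>z\<in>-{0}. f z = 0"
    using assms abs_mero_eq_iff[of f "\<lambda>_. 0"] by (auto simp: abs_mero_zero)
  then have "eventually (\<lambda>z. f z = 0) (at x)"
    using assms(2) by (intro eventually_cosparse_imp_eventually_at) auto
  with assms(3) have "eventually (\<lambda>z. False) (at x)"
    by eventually_elim auto
  then show False by simp
qed

lemma meromorphic_punctured: "f meromorphic_on UNIV \<Longrightarrow> f meromorphic_on -{0}"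
  by (rule meromorphic_on_subset) auto

subsection \<open>Substitutions\<close>

lemma cosparse_substitute:
  assumes \<phi>: "\<phi> analytic_on -{0 :: complex}" "inj_on \<phi> (-{0})" "\<phi> ` (-{0}) \<subseteq> -{0}"
    and ev: "\<forall>\<^sub>\<approx>z\<in>-{0}. P z"
  shows "\<forall>\<^sub>\<approx>z\<in>-{0}. P (\<phi> z)"
proof -
  have "eventually (\<lambda>z. P (\<phi> z)) (at x)" if "x \<noteq> 0" for x
  proof -
    have "eventually P (at (\<phi> x))"
      using that \<phi> by (intro eventually_cosparse_imp_eventually_at[OF ev]) auto
    moreover have "filterlim \<phi> (at (\<phi> x)) (at x)"
    proof (rule filterlim_atI)
      have "\<phi> analytic_on {x}"
        using \<phi>(1) by (rule analytic_on_subset) (use that in auto)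
      then show "\<phi> \<midarrow>x\<rightarrow> \<phi> x"
        using analytic_at_imp_isCont isContD by blast
      have "eventually (\<lambda>z. z \<in> -{0} - {x}) (at x)"
        using that by (intro eventually_at_in_open) auto
      then show "eventually (\<lambda>z. \<phi> z \<noteq> \<phi> x) (at x)"
        by eventually_elim (use \<phi>(2) that in \<open>auto simp: inj_on_def\<close>)
    qed
    ultimately show ?thesis
      by (rule eventually_compose_filterlim)
  qed
  then show ?thesis
    by (subst eventually_cosparse_open_eq) auto
qed

lemma mero_eq_rep_abs:
  assumes "f meromorphic_on -{0}"
  shows "rep_mero (abs_mero f) meromorphic_on -{0}" "\<forall>\<^sub>\<approx>z\<in>-{0}. rep_mero (abs_mero f) z = f z"
proof -
  have "mero_eq f f"
    using assms by (simp add: mero_eq_def)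
  then have "mero_eq (rep_mero (abs_mero f)) f"
    using Quotient_rel_rep[OF Quotient_mero] Quotient_abs_rep[OF Quotient_mero]
      Quotient_rep_reflp[OF Quotient_mero] Quotient_rel[OF Quotient_mero] by metis
  then show "rep_mero (abs_mero f) meromorphic_on -{0}" "\<forall>\<^sub>\<approx>z\<in>-{0}. rep_mero (abs_mero f) z = f z"
    by (auto simp: mero_eq_def)
qed

text \<open>
  Pullback along \<open>z \<mapsto> 1 / z\<close>.  It exchanges the plane with the sphere minus the origin, and \<open>\<sigma>\<^sub>q\<close>
  with its inverse; statements at infinity are reduced to the origin in this way.
\<close>

definition recip :: "mero \<Rightarrow> mero" where
  "recip a = abs_mero (\<lambda>z. rep_mero a (1 / z))"

lemma meromorphic_recip:
  assumes "f meromorphic_on -{0}"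
  shows "(\<lambda>z. f (1 / z)) meromorphic_on -{0}"
  by (rule meromorphic_on_compose[OF assms]) (auto intro!: analytic_intros)

lemma recip_abs_mero:
  assumes f: "f meromorphic_on -{0}"
  shows "recip (abs_mero f) = abs_mero (\<lambda>z. f (1 / z))"
  unfolding recip_def
proof (rule abs_mero_eqI)
  show "(\<lambda>z. rep_mero (abs_mero f) (1 / z)) meromorphic_on -{0}"
    by (intro meromorphic_recip mero_eq_rep_abs f)
  show "\<forall>\<^sub>\<approx>z\<in>-{0}. rep_mero (abs_mero f) (1 / z) = f (1 / z)"
    by (rule cosparse_substitute[OF _ _ _ mero_eq_rep_abs(2)[OF f]])
       (auto intro!: analytic_intros simp: inj_on_def)
qed

lemma meromorphic_scale:
  assumes "f meromorphic_on -{0}" "q \<noteq> 0"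
  shows "(\<lambda>z. f (q * z)) meromorphic_on -{0}"
  by (rule meromorphic_on_compose[OF assms(1)]) (use assms in \<open>auto intro!: analytic_intros\<close>)

lemma recip_recip [simp]: "recip (recip a) = a"
proof -
  obtain f where f: "f meromorphic_on -{0}" "a = abs_mero f" by (rule mero_cases)
  then show ?thesis by (simp add: recip_abs_mero meromorphic_recip)
qed

lemma
  shows recip_add: "recip (a + b) = recip a + recip b"
    and recip_mult: "recip (a * b) = recip a * recip b"
proof -
  obtain f where f: "f meromorphic_on -{0}" "a = abs_mero f" by (rule mero_cases)
  obtain g where g: "g meromorphic_on -{0}" "b = abs_mero g" by (rule mero_cases)
  note mer = f(1) g(1) meromorphic_recip[OF f(1)] meromorphic_recip[OF g(1)]
  show "recip (a + b) = recip a + recip b"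
    using mer by (simp add: f(2) g(2) recip_abs_mero abs_mero_add meromorphic_on_add)
  show "recip (a * b) = recip a * recip b"
    using mer by (simp add: f(2) g(2) recip_abs_mero abs_mero_mult meromorphic_on_mult)
qed

lemma recip_const [simp]: "recip (const_mero c) = const_mero c"
  by (simp add: const_mero_def recip_abs_mero)

lemma recip_qshift:
  assumes "q \<noteq> 0"
  shows "recip (qshift q a) = qshift (1 / q) (recip a)"
proof -
  obtain f where f: "f meromorphic_on -{0}" "a = abs_mero f" by (rule mero_cases)
  then show ?thesis
    using assms by (simp add: recip_abs_mero meromorphic_recip qshift_abs_mero meromorphic_scale)
qed

lemma qshift_qshift:
  assumes "q \<noteq> 0" "r \<noteq> 0"
  shows "qshift q (qshift r a) = qshift (q * r) a"
proof -
  obtain f where f: "f meromorphic_on -{0}" "a = abs_mero f" by (rule mero_cases)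
  then show ?thesis
    using assms qshift_abs_mero[OF assms(1) meromorphic_scale[OF f(1) assms(2)]]
    by (simp add: qshift_abs_mero mult.assoc mult.left_commute)
qed

lemma qshift_one: "qshift 1 a = a"
proof -
  obtain f where f: "f meromorphic_on -{0}" "a = abs_mero f" by (rule mero_cases)
  then show ?thesis by (simp add: qshift_abs_mero)
qed

lemma
  assumes "q \<noteq> 0"
  shows qshift_add: "qshift q (a + b) = qshift q a + qshift q b"
    and qshift_mult: "qshift q (a * b) = qshift q a * qshift q b"
proof -
  obtain f where f: "f meromorphic_on -{0}" "a = abs_mero f" by (rule mero_cases)
  obtain g where g: "g meromorphic_on -{0}" "b = abs_mero g" by (rule mero_cases)
  note mer = f(1) g(1) meromorphic_scale[OF f(1) assms] meromorphic_scale[OF g(1) assms]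
  show "qshift q (a + b) = qshift q a + qshift q b"
    using mer assms by (simp add: f(2) g(2) qshift_abs_mero abs_mero_add meromorphic_on_add)
  show "qshift q (a * b) = qshift q a * qshift q b"
    using mer assms by (simp add: f(2) g(2) qshift_abs_mero abs_mero_mult meromorphic_on_mult)
qed

lemma qshift_const [simp]: "q \<noteq> 0 \<Longrightarrow> qshift q (const_mero c) = const_mero c"
  by (simp add: const_mero_def qshift_abs_mero)

lemma const_mero_add: "const_mero (a + b) = const_mero a + const_mero b"
  by (simp add: const_mero_def abs_mero_add)

lemma const_mero_mult: "const_mero (a * b) = const_mero a * const_mero b"
  by (simp add: const_mero_def abs_mero_mult)

lemma const_mero_0 [simp]: "const_mero 0 = 0"
  by (simp add: const_mero_def abs_mero_zero)

lemma const_mero_1 [simp]: "const_mero 1 = 1"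
  by (simp add: const_mero_def abs_mero_one)

lemma const_mero_minus_1: "const_mero (- 1) = - 1"
  using const_mero_add[of "- 1" 1] by (simp add: eq_neg_iff_add_eq_0)

lemma qshift_0 [simp]: "q \<noteq> 0 \<Longrightarrow> qshift q 0 = 0"
  using qshift_const[of q 0] by simp

lemma qshift_1 [simp]: "q \<noteq> 0 \<Longrightarrow> qshift q 1 = 1"
  using qshift_const[of q 1] by simp

lemma recip_0 [simp]: "recip 0 = 0"
  using recip_const[of 0] by simp

lemma recip_1 [simp]: "recip 1 = 1"
  using recip_const[of 1] by simp

subsection \<open>The subfields of functions on the plane, at infinity and on the sphere\<close>

lemma mero_plane_I: "f meromorphic_on UNIV \<Longrightarrow> abs_mero f \<in> mero_plane"
  by (auto simp: mero_plane_def)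

lemma mero_plane_E:
  assumes "a \<in> mero_plane"
  obtains f where "f meromorphic_on UNIV" "a = abs_mero f"
  using assms by (auto simp: mero_plane_def)

lemma subfield_plane: "subfield_set mero_plane"
proof unfold_locales
  show "0 \<in> mero_plane" "1 \<in> mero_plane"
    by (auto simp: abs_mero_zero abs_mero_one intro: mero_plane_I)
next
  fix a b assume "a \<in> mero_plane" "b \<in> mero_plane"
  then obtain f g where fg: "f meromorphic_on UNIV" "a = abs_mero f" "g meromorphic_on UNIV" "b = abs_mero g"
    by (auto elim!: mero_plane_E)
  note mer = fg(1,3) fg(1)[THEN meromorphic_punctured] fg(3)[THEN meromorphic_punctured]
  show "a + b \<in> mero_plane" "a * b \<in> mero_plane"
    using mer by (auto simp: fg(2,4) abs_mero_add abs_mero_mult intro!: mero_plane_I meromorphic_intros)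
next
  fix a assume "a \<in> mero_plane"
  then obtain f where fg: "f meromorphic_on UNIV" "a = abs_mero f"
    by (auto elim!: mero_plane_E)
  note mer = fg(1) fg(1)[THEN meromorphic_punctured]
  show "- a \<in> mero_plane" "inverse a \<in> mero_plane"
    using mer by (auto simp: fg(2) abs_mero_uminus abs_mero_inverse intro!: mero_plane_I meromorphic_intros)
qed

lemma recip_plane: "a \<in> mero_plane \<Longrightarrow> recip a \<in> mero_inf"
proof -
  assume "a \<in> mero_plane"
  then obtain f where f: "f meromorphic_on UNIV" "a = abs_mero f" by (rule mero_plane_E)
  have "(\<lambda>w. f (1 / (1 / w))) meromorphic_on {0}"
    using f(1) by (auto intro: meromorphic_on_subset)
  then show ?thesis
    unfolding mero_inf_def using meromorphic_recip[OF meromorphic_punctured[OF f(1)]]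
    by (auto simp: f(2) recip_abs_mero meromorphic_punctured[OF f(1)]
         intro!: exI[of _ "\<lambda>z. f (1 / z)"])
qed

lemma recip_inf: "a \<in> mero_inf \<Longrightarrow> recip a \<in> mero_plane"
proof -
  assume "a \<in> mero_inf"
  then obtain f where f: "f meromorphic_on -{0}" "(\<lambda>w. f (1 / w)) meromorphic_on {0}" "a = abs_mero f"
    by (auto simp: mero_inf_def)
  have "(\<lambda>w. f (1 / w)) meromorphic_on (-{0} \<union> {0})"
    by (intro meromorphic_on_Un meromorphic_recip f)
  moreover have "-{0} \<union> {0 :: complex} = UNIV" by auto
  ultimately show ?thesis
    using f by (auto simp: recip_abs_mero intro!: mero_plane_I)
qed

lemma mero_inf_iff: "a \<in> mero_inf \<longleftrightarrow> recip a \<in> mero_plane"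
  using recip_inf recip_plane recip_recip by metis

lemma recip_uminus: "recip (- a) = - recip a"
  using recip_add[of a "- a"] by (simp add: eq_neg_iff_add_eq_0 add.commute)

lemma recip_inverse: "recip (inverse a) = inverse (recip a)"
proof (cases "a = 0")
  case False
  then have "recip a * recip (inverse a) = 1"
    by (simp flip: recip_mult)
  then show ?thesis by (metis inverse_unique)
qed auto

lemma subfield_inf: "subfield_set mero_inf"
proof -
  interpret subfield_set mero_plane by (rule subfield_plane)
  show ?thesis
    by unfold_locales
       (simp_all add: mero_inf_iff recip_add recip_mult recip_uminus recip_inverse
          zero_mem one_mem add_mem mult_mem uminus_mem inverse_mem)
qed

lemma const_plane: "const_mero c \<in> mero_plane"
  by (auto simp: const_mero_def intro: mero_plane_I)

lemma const_inf: "const_mero c \<in> mero_inf"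
  by (simp add: mero_inf_iff const_plane)

lemma qshift_plane:
  assumes "q \<noteq> 0" "a \<in> mero_plane"
  shows "qshift q a \<in> mero_plane"
proof -
  obtain f where f: "f meromorphic_on UNIV" "a = abs_mero f"
    using assms(2) by (rule mero_plane_E)
  have "(\<lambda>z. f (q * z)) meromorphic_on UNIV"
    by (rule meromorphic_on_compose[OF f(1)]) (auto intro!: analytic_intros)
  then show ?thesis
    using assms f meromorphic_punctured[OF f(1)] by (auto simp: qshift_abs_mero intro: mero_plane_I)
qed

lemma qshift_inf:
  assumes "q \<noteq> 0" "a \<in> mero_inf"
  shows "qshift q a \<in> mero_inf"
  using assms by (simp add: mero_inf_iff recip_qshift qshift_plane)

definition poly_mero :: "complex poly \<Rightarrow> mero" where
  "poly_mero p = abs_mero (poly p)"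

lemma analytic_poly: "poly p analytic_on A" for p :: "complex poly"
  by (rule analytic_on_subset[of _ UNIV]) (auto simp: analytic_on_open poly_holomorphic_on)

lemma meromorphic_poly: "poly p meromorphic_on A" for p :: "complex poly"
  by (rule analytic_on_imp_meromorphic_on) (rule analytic_poly)

lemma poly_mero_add: "poly_mero (p + r) = poly_mero p + poly_mero r"
  by (simp add: poly_mero_def abs_mero_add meromorphic_poly poly_add[abs_def])

lemma poly_mero_mult: "poly_mero (p * r) = poly_mero p * poly_mero r"
  by (simp add: poly_mero_def abs_mero_mult meromorphic_poly poly_mult[abs_def])

lemma poly_mero_minus: "poly_mero (- p) = - poly_mero p"
  by (simp add: poly_mero_def abs_mero_uminus meromorphic_poly poly_minus[abs_def])

lemma poly_mero_pCons: "poly_mero [:c:] = const_mero c"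
proof -
  have "poly [:c:] = (\<lambda>_. c)" by auto
  then show ?thesis by (simp add: poly_mero_def const_mero_def)
qed

lemma eventually_poly_nonzero:
  "d \<noteq> 0 \<Longrightarrow> eventually (\<lambda>z. poly d z \<noteq> 0) (at (x :: complex))"
  using islimpt_finite[OF poly_roots_finite, of d x]
  by (auto simp: islimpt_iff_eventually)

lemma poly_mero_nonzero: "d \<noteq> 0 \<Longrightarrow> poly_mero d \<noteq> 0"
  unfolding poly_mero_def
  by (rule abs_mero_nonzeroI[of _ 1]) (auto simp: meromorphic_poly eventually_poly_nonzero)

lemma rat_mero_eq: "rat_mero = {poly_mero p / poly_mero d | p d. d \<noteq> 0}"
  by (auto simp: rat_mero_def poly_mero_def abs_mero_divide meromorphic_poly)

lemma subfield_rat: "subfield_set rat_mero"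
proof unfold_locales
  have *: "const_mero c \<in> rat_mero" for c
  proof -
    have "const_mero c = poly_mero [:c:] / poly_mero [:1:]"
      unfolding poly_mero_pCons by simp
    then show ?thesis unfolding rat_mero_eq by fastforce
  qed
  show "0 \<in> rat_mero" "1 \<in> rat_mero"
    using *[of 0] *[of 1] by auto
next
  fix a b assume "a \<in> rat_mero" "b \<in> rat_mero"
  then obtain p d p' d' where *: "a = poly_mero p / poly_mero d" "b = poly_mero p' / poly_mero d'"
    "d \<noteq> 0" "d' \<noteq> 0"
    by (auto simp: rat_mero_eq)
  have "a + b = poly_mero (p * d' + p' * d) / poly_mero (d * d')"
    using * poly_mero_nonzero[OF *(3)] poly_mero_nonzero[OF *(4)]
    by (simp add: poly_mero_add poly_mero_mult field_simps)
  moreover have "a * b = poly_mero (p * p') / poly_mero (d * d')"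
    using * by (simp add: poly_mero_mult)
  moreover have "d * d' \<noteq> 0" using * by simp
  ultimately show "a + b \<in> rat_mero" "a * b \<in> rat_mero"
    unfolding rat_mero_eq by blast+
next
  fix a assume "a \<in> rat_mero"
  then obtain p d where *: "a = poly_mero p / poly_mero d" "d \<noteq> 0"
    by (auto simp: rat_mero_eq)
  have "- a = poly_mero (- p) / poly_mero d"
    using * by (simp add: poly_mero_minus)
  then show "- a \<in> rat_mero"
    unfolding rat_mero_eq using * by blast
  show "inverse a \<in> rat_mero"
  proof (cases "p = 0")
    case True
    then have "inverse a = poly_mero 0 / poly_mero 1"
      using * poly_mero_pCons[of 0] by simp
    then show ?thesis unfolding rat_mero_eq by (smt (verit) mem_Collect_eq one_neq_zero)
  next
    case False
    have "inverse a = poly_mero d / poly_mero p"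
      using * by simp
    then show ?thesis unfolding rat_mero_eq using False by blast
  qed
qed

lemma poly_mero_plane: "poly_mero p \<in> mero_plane"
  unfolding poly_mero_def by (intro mero_plane_I meromorphic_poly)

lemma poly_mero_inf: "poly_mero p \<in> mero_inf"
proof -
  have "(\<lambda>w. poly p (1 / w)) meromorphic_on {0}"
    unfolding poly_altdef by (intro meromorphic_intros)
  then show ?thesis
    unfolding mero_inf_def poly_mero_def using meromorphic_poly by blast
qed

lemma rat_subset: "rat_mero \<subseteq> mero_plane \<inter> mero_inf"
proof -
  have "a / b \<in> mero_plane" if "a \<in> mero_plane" "b \<in> mero_plane" for a b
    using subfield_set.mult_mem[OF subfield_plane that(1) subfield_set.inverse_mem[OF subfield_plane that(2)]]
    by (simp add: field_class.field_divide_inverse)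
  moreover have "a / b \<in> mero_inf" if "a \<in> mero_inf" "b \<in> mero_inf" for a b
    using subfield_set.mult_mem[OF subfield_inf that(1) subfield_set.inverse_mem[OF subfield_inf that(2)]]
    by (simp add: field_class.field_divide_inverse)
  ultimately show ?thesis
    unfolding rat_mero_eq using poly_mero_plane poly_mero_inf by blast
qed

text \<open>
  Used at the finite poles, where the power becomes a polynomial factor, and in the chart at infinity,
  where it bounds the growth of the function.
\<close>

lemma meromorphic_times_power:
  assumes "f meromorphic_on {z}"
  shows "\<exists>n c. (\<lambda>w. (w - z) ^ n * f w) \<midarrow>z\<rightarrow> c"
proof -
  have *: "isolated_singularity_at f z" "not_essential f z"
    using assms by (auto simp: meromorphic_at_iff)
  show ?thesis
  proof (cases "\<exists>\<^sub>F w in at z. f w \<noteq> 0")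
    case False
    then have ev: "eventually (\<lambda>w. f w = 0) (at z)"
      by (simp add: not_frequently)
    have "(\<lambda>w. (w - z) ^ 0 * f w) \<midarrow>z\<rightarrow> 0"
      using ev by (intro tendsto_eventually) (simp add: eventually_mono)
    then show ?thesis by blast
  next
    case True
    define n g where "n = zorder f z" and "g = zor_poly f z"
    from zorder_exist[OF * True] obtain r where r: "r > 0" "g holomorphic_on cball z r"
      "\<forall>w\<in>cball z r - {z}. f w = g w * (w - z) powi n"
      unfolding n_def g_def by blast
    define k where "k = nat (- n)"
    have "g analytic_on {z}"
      using r by (intro holomorphic_on_imp_analytic_at[of g "ball z r"]) (auto intro: holomorphic_on_subset)
    then have "g \<midarrow>z\<rightarrow> g z"
      using analytic_at_imp_isCont isContD by blast
    then have "(\<lambda>w. g w * (w - z) ^ nat (n + int k)) \<midarrow>z\<rightarrow> g z * (z - z) ^ nat (n + int k)"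
      by (intro tendsto_intros)
    moreover have "eventually (\<lambda>w. w \<in> ball z r - {z}) (at z)"
      using r by (intro eventually_at_in_open) auto
    then have "eventually (\<lambda>w. g w * (w - z) ^ nat (n + int k) = (w - z) ^ k * f w) (at z)"
    proof eventually_elim
      case (elim w)
      then have "f w = g w * (w - z) powi n" "w \<noteq> z" using r by auto
      moreover have "(w - z) ^ nat (n + int k) = (w - z) powi (n + int k)"
        by (simp add: power_int_def k_def)
      ultimately show ?case
        by (simp add: power_int_add mult_ac)
    qed
    ultimately have "(\<lambda>w. (w - z) ^ k * f w) \<midarrow>z\<rightarrow> g z * (z - z) ^ nat (n + int k)"
      by (rule Lim_transform_eventually)
    then show ?thesis by blast
  qed
qed

lemma cancel_poles:
  assumes "finite S" "f meromorphic_on UNIV"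
  shows "\<exists>d :: complex poly. d \<noteq> 0 \<and> (\<forall>z\<in>S. \<exists>c. (\<lambda>w. poly d w * f w) \<midarrow>z\<rightarrow> c)"
  using assms(1)
proof (induction S)
  case empty
  show ?case by (intro exI[of _ 1]) auto
next
  case (insert s S)
  then obtain d where d: "d \<noteq> 0" "\<forall>z\<in>S. \<exists>c. (\<lambda>w. poly d w * f w) \<midarrow>z\<rightarrow> c" by blast
  have "f meromorphic_on {s}" using assms(2) by (rule meromorphic_on_subset) auto
  from meromorphic_times_power[OF this] obtain n c where nc: "(\<lambda>w. (w - s) ^ n * f w) \<midarrow>s\<rightarrow> c" by blast
  define d' where "d' = d * [:- s, 1:] ^ n"
  have d': "poly d' w * f w = poly d w * ((w - s) ^ n * f w)" "poly d' w * f w = (w - s) ^ n * (poly d w * f w)" for w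
    by (simp_all add: d'_def)
  have "\<exists>c. (\<lambda>w. poly d' w * f w) \<midarrow>s\<rightarrow> c"
  proof -
    have "(\<lambda>w. poly d w * ((w - s) ^ n * f w)) \<midarrow>s\<rightarrow> poly d s * c"
      by (rule tendsto_mult[OF isContD[OF poly_isCont] nc])
    then show ?thesis unfolding d'(1) by blast
  qed
  moreover have "\<exists>c. (\<lambda>w. poly d' w * f w) \<midarrow>z\<rightarrow> c" if z: "z \<in> S" for z
  proof -
    obtain c' where "(\<lambda>w. poly d w * f w) \<midarrow>z\<rightarrow> c'"
      using bspec[OF d(2) z] by (elim exE)
    then have "(\<lambda>w. (w - s) ^ n * (poly d w * f w)) \<midarrow>z\<rightarrow> (z - s) ^ n * c'"
      by (intro tendsto_intros)
    then show ?thesis unfolding d'(2) by (rule exI)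
  qed
  ultimately show ?case
    using d(1) by (intro exI[of _ d']) (auto simp: d'_def)
qed

text \<open>
  The chart at infinity is free of poles in a punctured neighbourhood, so there are only finitely many
  finite poles.  Multiplied by a polynomial that cancels them, the function is entire, and its behaviour
  at infinity bounds its growth by a power; by Liouville's theorem it is a polynomial.
\<close>

lemma sphere_meromorphic_imp_rational: "mero_plane \<inter> mero_inf \<subseteq> rat_mero"
proof
  fix a assume a: "a \<in> mero_plane \<inter> mero_inf"
  obtain f0 where f0: "f0 meromorphic_on UNIV" "a = abs_mero f0"
    using a by (auto elim: mero_plane_E)
  obtain g0 where g0: "g0 meromorphic_on -{0}" "(\<lambda>w. g0 (1 / w)) meromorphic_on {0}" "a = abs_mero g0"
    using a by (auto simp: mero_inf_def)
  have f0g0: "\<forall>\<^sub>\<approx>z\<in>-{0}. f0 z = g0 z"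
    using f0 g0 abs_mero_eq_iff[OF meromorphic_punctured[OF f0(1)] g0(1)] by simp
  \<comment> \<open>Removing singularities selects the same representative for both descriptions of \<open>a\<close>.\<close>
  define f where "f = remove_sings f0"
  have f: "f meromorphic_on UNIV" "f nicely_meromorphic_on UNIV"
    unfolding f_def using f0 by (auto intro: meromorphic_intros remove_sings_nicely_meromorphic)
  have "abs_mero f = abs_mero f0"
    unfolding f_def
    by (intro abs_mero_eqI meromorphic_punctured remove_sings_meromorphic f0 eventually_remove_sings_eq)
  then have af: "a = abs_mero f" using f0 by simp
  have fg: "f z = remove_sings g0 z" if "z \<noteq> 0" for z
    unfolding f_def
    by (rule remove_sings_cong) (use that in \<open>auto intro: eventually_cosparse_imp_eventually_at[OF f0g0]\<close>)
  \<comment> \<open>In the chart at infinity, the reduced representatives are analytic off the origin.\<close>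
  obtain r where r: "r > 0" "(\<lambda>w. g0 (1 / w)) analytic_on ball 0 r - {0}"
    using g0(2) by (auto simp: meromorphic_at_iff isolated_singularity_at_def)
  have g0_an: "g0 analytic_on {z}" if "norm z > 1 / r" for z
  proof -
    have "z \<noteq> 0" using that r(1) by auto
    moreover from this have "1 / z \<in> ball 0 r - {0}"
      using that r(1) by (auto simp: norm_divide field_simps)
    ultimately have "((\<lambda>w. g0 (1 / w)) \<circ> (\<lambda>z. 1 / z)) analytic_on {z}"
      by (intro analytic_on_compose analytic_intros) (auto intro: analytic_on_subset[OF r(2)])
    then show ?thesis by (simp add: o_def)
  qed
  have f_eq: "f z = g0 z" if "norm z > 1 / r" for z
  proof -
    have "z \<noteq> 0" using that r(1) by auto
    then show ?thesis using fg[of z] g0_an[OF that] by simp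
  qed
  define S where "S = {z. \<not> f analytic_on {z}}"
  have S_sub: "S \<subseteq> cball 0 (1 / r)"
  proof
    fix z assume z: "z \<in> S"
    show "z \<in> cball 0 (1 / r)"
    proof (rule ccontr)
      assume "z \<notin> cball 0 (1 / r)"
      then have n: "norm z > 1 / r" by auto
      have "open {z. norm (z :: complex) > 1 / r}"
        by (intro open_Collect_less continuous_intros)
      then have "eventually (\<lambda>x. x \<in> {z. norm (z :: complex) > 1 / r}) (nhds z)"
        using n by (intro eventually_nhds_in_open) auto
      then have "eventually (\<lambda>x. f x = g0 x) (nhds z)"
        by eventually_elim (use f_eq in auto)
      then have "f analytic_on {z} \<longleftrightarrow> g0 analytic_on {z}"
        by (intro analytic_at_cong) auto
      with z g0_an[OF n] show False by (auto simp: S_def)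
    qed
  qed
  have "finite S"
  proof -
    have "S sparse_in UNIV"
      unfolding S_def using meromorphic_on_imp_sparse_singularities[OF f(1)] .
    then have "S sparse_in (cball 0 (1 / r))"
      by (rule sparse_in_subset) auto
    then have "finite (cball 0 (1 / r) \<inter> S)"
      by (intro sparse_in_compact_finite) auto
    moreover have "cball 0 (1 / r) \<inter> S = S" using S_sub by auto
    ultimately show ?thesis by simp
  qed
  then obtain d where d: "d \<noteq> 0" "\<forall>z\<in>S. \<exists>c. (\<lambda>w. poly d w * f w) \<midarrow>z\<rightarrow> c"
    using cancel_poles f(1) by blast
  define h where "h = (\<lambda>z. poly d z * f z)"
  have h_mer: "h meromorphic_on UNIV"
    unfolding h_def by (intro meromorphic_intros meromorphic_poly f)
  define H where "H = remove_sings h"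
  have h_an: "h analytic_on {z}" if "z \<notin> S" for z
    using that analytic_poly unfolding h_def S_def by (intro analytic_intros) auto
  have "H analytic_on {z}" for z
  proof (cases "z \<in> S")
    case True
    then obtain c where "h \<midarrow>z\<rightarrow> c" using d unfolding h_def by blast
    moreover have "isolated_singularity_at h z"
      using h_mer by (auto simp: meromorphic_on_altdef)
    ultimately show ?thesis unfolding H_def by (intro remove_sings_analytic_at)
  next
    case False
    then show ?thesis unfolding H_def by (intro remove_sings_analytic_on h_an)
  qed
  then have "H analytic_on UNIV"
    by (subst analytic_on_analytic_at) auto
  then have H_hol: "H holomorphic_on UNIV"
    by (rule analytic_imp_holomorphic)
  have H_eq: "H z = poly d z * g0 z" if "norm z > 1 / r" for z
  proof -
    have "z \<notin> S" using S_sub that by auto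
    then have "H z = h z" unfolding H_def by (intro remove_sings_at_analytic h_an)
    then show ?thesis using f_eq[OF that] by (simp add: h_def)
  qed
  have "(\<lambda>w. poly d (1 / w)) meromorphic_on {0}"
    unfolding poly_altdef by (intro meromorphic_intros)
  then have "(\<lambda>w. poly d (1 / w) * g0 (1 / w)) meromorphic_on {0}"
    by (intro meromorphic_intros g0)
  from meromorphic_times_power[OF this] obtain n c
    where "(\<lambda>w. w ^ n * (poly d (1 / w) * g0 (1 / w))) \<midarrow>0\<rightarrow> c" by auto
  then have "((\<lambda>w. norm (w ^ n * (poly d (1 / w) * g0 (1 / w)))) \<longlongrightarrow> norm c) (at 0)"
    by (intro tendsto_intros)
  then have "eventually (\<lambda>w. norm (w ^ n * (poly d (1 / w) * g0 (1 / w))) < norm c + 1) (at 0)"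
    by (rule order_tendstoD) auto
  then obtain \<delta> where \<delta>: "\<delta> > 0"
    "\<And>w. w \<noteq> 0 \<Longrightarrow> norm w < \<delta> \<Longrightarrow> norm (w ^ n * (poly d (1 / w) * g0 (1 / w))) < norm c + 1"
    by (auto simp: eventually_at)
  have bound: "norm (H z) \<le> (norm c + 1) * norm z ^ n" if "norm z \<ge> 1 / r + 1 / \<delta> + 1" for z
  proof -
    have z: "norm z > 1 / r" "norm z > 1 / \<delta>" "z \<noteq> 0"
      using that r(1) \<delta>(1) by (auto simp: add_pos_pos) (smt (verit) divide_pos_pos)+
    then have "norm (1 / z) < \<delta>"
      using \<delta>(1) by (auto simp: norm_divide field_simps)
    with z have "norm ((1 / z) ^ n * (poly d z * g0 z)) < norm c + 1"
      using \<delta>(2)[of "1 / z"] by simp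
    then have "norm (H z) / norm z ^ n < norm c + 1"
      using H_eq[OF z(1)] by (simp add: norm_mult norm_divide norm_power power_one_over)
    then show ?thesis using z(3) by (simp add: field_simps)
  qed
  define p where "p = (\<Sum>k\<le>n. monom ((deriv ^^ k) H 0 / fact k) k)"
  have Hp: "H z = poly p z" for z
    using Liouville_polynomial[OF H_hol bound, where \<xi> = z] by (simp add: p_def poly_sum poly_monom)
  have "abs_mero h = abs_mero H"
    unfolding H_def using eventually_remove_sings_eq[OF meromorphic_punctured[OF h_mer]]
    by (intro abs_mero_eqI meromorphic_punctured h_mer) (auto elim: eventually_mono)
  also have "\<dots> = poly_mero p"
    unfolding poly_mero_def Hp[abs_def] by simp
  finally have "poly_mero d * a = poly_mero p"
    unfolding af poly_mero_def h_def
    by (simp add: abs_mero_mult meromorphic_poly meromorphic_punctured f(1))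
  then have "a = poly_mero p / poly_mero d"
    using poly_mero_nonzero[OF d(1)] by (simp add: field_simps)
  then show "a \<in> rat_mero" using d(1) by (auto simp: rat_mero_eq)
qed

lemma rat_mero_iff: "a \<in> rat_mero \<longleftrightarrow> a \<in> mero_plane \<and> a \<in> mero_inf"
  using rat_subset sphere_meromorphic_imp_rational by blast

lemma const_rat: "const_mero c \<in> rat_mero"
  by (simp add: rat_mero_iff const_plane const_inf)

subsection \<open>Values at the origin\<close>

lemma value_at_0E:
  assumes "value_at_0 a c"
  obtains f where "f meromorphic_on UNIV" "a = abs_mero f" "f analytic_on {0}" "f 0 = c"
proof -
  obtain f where f: "f meromorphic_on UNIV" "a = abs_mero f" "f \<midarrow>0\<rightarrow> c"
    using assms by (auto simp: value_at_0_def)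
  show ?thesis
  proof (rule that)
    show "remove_sings f meromorphic_on UNIV"
      using f by (intro meromorphic_intros)
    show "a = abs_mero (remove_sings f)"
      unfolding f(2) using eventually_remove_sings_eq[OF meromorphic_punctured[OF f(1)]]
      by (intro abs_mero_eqI meromorphic_punctured f(1)) (auto elim: eventually_mono)
    show "remove_sings f analytic_on {0}"
      using f by (intro remove_sings_analytic_at[of _ _ c]) (auto simp: meromorphic_on_altdef)
    show "remove_sings f 0 = c"
      using f by auto
  qed
qed

lemma value_at_0I:
  assumes "f meromorphic_on UNIV" "f analytic_on {0}" "f 0 = c"
  shows "value_at_0 (abs_mero f) c"
  unfolding value_at_0_def using assms analytic_at_imp_isCont[of f 0] by (auto dest: isContD)

lemma value_const: "value_at_0 (const_mero c) c"
  unfolding const_mero_def by (rule value_at_0I) auto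

lemma value_add:
  assumes "value_at_0 a c" "value_at_0 b d"
  shows "value_at_0 (a + b) (c + d)"
proof -
  obtain f g where f: "f meromorphic_on UNIV" "a = abs_mero f" "f analytic_on {0}" "f 0 = c"
    and g: "g meromorphic_on UNIV" "b = abs_mero g" "g analytic_on {0}" "g 0 = d"
    using assms by (auto elim!: value_at_0E)
  show ?thesis
    unfolding f(2) g(2) using f g
    by (subst abs_mero_add) (auto intro!: value_at_0I meromorphic_intros analytic_intros meromorphic_punctured)
qed

lemma value_mult:
  assumes "value_at_0 a c" "value_at_0 b d"
  shows "value_at_0 (a * b) (c * d)"
proof -
  obtain f g where f: "f meromorphic_on UNIV" "a = abs_mero f" "f analytic_on {0}" "f 0 = c"
    and g: "g meromorphic_on UNIV" "b = abs_mero g" "g analytic_on {0}" "g 0 = d"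
    using assms by (auto elim!: value_at_0E)
  show ?thesis
    unfolding f(2) g(2) using f g
    by (subst abs_mero_mult) (auto intro!: value_at_0I meromorphic_intros analytic_intros meromorphic_punctured)
qed

lemma value_inverse:
  assumes "value_at_0 a c" "c \<noteq> 0"
  shows "value_at_0 (inverse a) (inverse c)"
proof -
  obtain f where f: "f meromorphic_on UNIV" "a = abs_mero f" "f analytic_on {0}" "f 0 = c"
    using assms by (auto elim!: value_at_0E)
  show ?thesis
    unfolding f(2) using f assms(2)
    by (subst abs_mero_inverse) (auto intro!: value_at_0I meromorphic_intros analytic_intros meromorphic_punctured)
qed

lemma value_sum:
  "(\<And>i. i \<in> I \<Longrightarrow> value_at_0 (f i) (c i)) \<Longrightarrow> value_at_0 (sum f I) (sum c I)"
  using value_const[of 0]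
  by (induction I rule: infinite_finite_induct) (auto intro: value_add)

lemma value_prod:
  "(\<And>i. i \<in> I \<Longrightarrow> value_at_0 (f i) (c i)) \<Longrightarrow> value_at_0 (prod f I) (prod c I)"
  using value_const[of 1]
  by (induction I rule: infinite_finite_induct) (auto intro: value_mult)

lemma value_nonzero:
  assumes "value_at_0 a c" "c \<noteq> 0"
  shows "a \<noteq> 0"
proof
  assume "a = 0"
  then obtain f where f: "f meromorphic_on UNIV" "0 = abs_mero f" "f analytic_on {0}" "f 0 = c"
    using assms by (auto elim!: value_at_0E)
  have "f \<midarrow>0\<rightarrow> c"
    using f analytic_at_imp_isCont[of f 0] by (auto dest: isContD)
  then have "eventually (\<lambda>z. f z \<noteq> 0) (at 0)"
    using assms(2) by (rule tendsto_imp_eventually_ne)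
  then obtain e where e: "e > 0" "\<And>z. z \<noteq> 0 \<Longrightarrow> norm z < e \<Longrightarrow> f z \<noteq> 0"
    by (auto simp: eventually_at)
  have "eventually (\<lambda>z. z \<in> ball 0 e - {0}) (at (complex_of_real (e / 2)))"
    using e(1) by (intro eventually_at_in_open' open_Diff) (auto simp: dist_norm norm_divide)
  then have "eventually (\<lambda>z. f z \<noteq> 0) (at (complex_of_real (e / 2)))"
    by eventually_elim (use e in auto)
  then have "abs_mero f \<noteq> 0"
    using e(1) f(1) by (intro abs_mero_nonzeroI meromorphic_punctured) auto
  with f show False by simp
qed

lemma value_qshift:
  assumes "q \<noteq> 0" "value_at_0 a c"
  shows "value_at_0 (qshift q a) c"
proof -
  obtain f where f: "f meromorphic_on UNIV" "a = abs_mero f" "f analytic_on {0}" "f 0 = c"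
    using assms by (auto elim!: value_at_0E)
  have "(f \<circ> (\<lambda>z. q * z)) analytic_on {0}"
    using f by (intro analytic_on_compose) (auto intro!: analytic_intros)
  moreover have "(\<lambda>z. f (q * z)) meromorphic_on UNIV"
    by (rule meromorphic_on_compose[OF f(1)]) (auto intro!: analytic_intros)
  ultimately show ?thesis
    unfolding f(2) using f assms
    by (subst qshift_abs_mero) (auto intro!: value_at_0I meromorphic_punctured simp: o_def)
qed

lemma value_recip:
  assumes "value_at_inf a c"
  shows "value_at_0 (recip a) c"
proof -
  obtain f where f: "f meromorphic_on -{0}" "(\<lambda>w. f (1 / w)) meromorphic_on {0}" "a = abs_mero f"
    "(f \<longlongrightarrow> c) at_infinity"
    using assms by (auto simp: value_at_inf_def)
  have "(\<lambda>w. f (1 / w)) meromorphic_on (-{0} \<union> {0})"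
    by (intro meromorphic_on_Un meromorphic_recip f)
  moreover have "-{0} \<union> {0 :: complex} = UNIV" by auto
  moreover have "((\<lambda>w. f (1 / w)) \<longlongrightarrow> c) (at 0)"
    using f(4) by (simp add: lim_at_infinity_0 o_def divide_inverse)
  ultimately show ?thesis
    unfolding value_at_0_def using f by (auto simp: recip_abs_mero)
qed

lemma value_at_inf_const: "value_at_inf (const_mero c) c"
  unfolding value_at_inf_def const_mero_def by (intro exI[of _ "\<lambda>_. c"]) auto

definition coord :: mero where
  "coord = abs_mero (\<lambda>z. z)"

lemma coord_nonzero: "coord \<noteq> 0"
  unfolding coord_def
  by (rule abs_mero_nonzeroI[of _ 1]) (auto intro!: eventually_neq_at_within)

lemma coord_plane: "coord \<in> mero_plane"
  unfolding coord_def by (intro mero_plane_I) auto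

lemma qshift_coord: "q \<noteq> 0 \<Longrightarrow> qshift q coord = const_mero q * coord"
  unfolding coord_def const_mero_def by (subst qshift_abs_mero) (auto simp: abs_mero_mult)

lemma value_coord: "value_at_0 coord 0"
  unfolding coord_def by (rule value_at_0I) auto

text \<open>
  A function vanishing at the origin remains regular after division by the coordinate.  This is what
  allows a shearing transformation with a pole.
\<close>

lemma value_divide_coord:
  assumes "value_at_0 a 0"
  shows "\<exists>c. value_at_0 (a / coord) c"
proof -
  obtain f where f: "f meromorphic_on UNIV" "a = abs_mero f" "f analytic_on {0}" "f 0 = 0"
    using assms by (auto elim!: value_at_0E)
  have "f field_differentiable (at 0)"
    using f(3) by (rule analytic_on_imp_differentiable_at) auto
  then obtain c where "(f has_field_derivative c) (at 0)"
    by (auto simp: field_differentiable_def)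
  then have "(\<lambda>z. f z / z) \<midarrow>0\<rightarrow> c"
    by (simp add: has_field_derivative_iff f(4))
  moreover have "(\<lambda>z. f z / z) meromorphic_on UNIV"
    using f by (intro meromorphic_intros)
  moreover have "a / coord = abs_mero (\<lambda>z. f z / z)"
    unfolding coord_def f(2) using f(1) by (subst abs_mero_divide) (auto intro: meromorphic_punctured)
  ultimately show ?thesis unfolding value_at_0_def by blast
qed

section \<open>Laurent expansions on an annulus\<close>

definition annulus :: "real \<Rightarrow> complex set" where
  "annulus T = {z. 1 / T < norm z \<and> norm z < T}"

lemma open_annulus: "open (annulus T)"
  unfolding annulus_def by (intro open_Collect_conj open_Collect_less continuous_intros)

text \<open>
  In the form \<open>1 / (1 - u \<psi>)\<close> with \<open>\<bar>\<psi>\<bar> \<le> 1 / \<rho>\<close>, the Cauchy kernel of the outer circle and, in the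
  coordinate \<open>u = 1 / z\<close>, that of the inner circle are instances of the same expression.
\<close>

lemma holomorphic_geometric_kernel:
  fixes \<phi> \<psi> :: "real \<Rightarrow> complex"
  assumes \<phi>: "continuous_on {a..b} \<phi>" and \<psi>: "continuous_on {a..b} \<psi>"
    and bound: "\<And>s. s \<in> {a..b} \<Longrightarrow> norm (\<psi> s) \<le> 1 / \<rho>" and "\<rho> > 0"
  shows "(\<lambda>u :: complex. integral {a..b} (\<lambda>s. \<phi> s / (1 - u * \<psi> s))) holomorphic_on ball 0 \<rho>"
proof -
  have nz: "1 - u * \<psi> s \<noteq> 0" if "u \<in> ball 0 \<rho>" "s \<in> {a..b}" for u :: complex and s
  proof
    assume "1 - u * \<psi> s = 0"
    then have "norm u * norm (\<psi> s) = 1"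
      by (metis eq_iff_diff_eq_0 norm_mult norm_one)
    moreover have "norm u * norm (\<psi> s) \<le> norm u * (1 / \<rho>)"
      by (intro mult_left_mono bound that) auto
    moreover have "norm u * (1 / \<rho>) < 1"
      using that(1) \<open>\<rho> > 0\<close> by (simp add: field_simps)
    ultimately show False by linarith
  qed
  have "(\<lambda>u. integral (cbox a b) (\<lambda>s. \<phi> s / (1 - u * \<psi> s))) holomorphic_on ball 0 \<rho>"
  proof (rule leibniz_rule_holomorphic[where fx = "\<lambda>u s. \<phi> s * \<psi> s / (1 - u * \<psi> s)\<^sup>2"])
    fix u :: complex and s assume "u \<in> ball 0 \<rho>" "s \<in> cbox a b"
    then have "1 - u * \<psi> s \<noteq> 0" using nz by auto
    then show "((\<lambda>u. \<phi> s / (1 - u * \<psi> s)) has_field_derivative \<phi> s * \<psi> s / (1 - u * \<psi> s)\<^sup>2)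
        (at u within ball 0 \<rho>)"
      by (auto intro!: derivative_eq_intros simp: power2_eq_square)
  next
    fix u :: complex assume "u \<in> ball 0 \<rho>"
    then show "(\<lambda>s. \<phi> s / (1 - u * \<psi> s)) integrable_on cbox a b"
      using \<phi> \<psi> nz by (intro integrable_continuous continuous_intros) auto
  next
    have "continuous_on (ball 0 \<rho> \<times> cbox a b) (\<lambda>p :: complex \<times> real. \<phi> (snd p))"
      by (rule continuous_on_compose2[OF \<phi>]) (auto intro: continuous_intros)
    moreover have "continuous_on (ball 0 \<rho> \<times> cbox a b) (\<lambda>p :: complex \<times> real. \<psi> (snd p))"
      by (rule continuous_on_compose2[OF \<psi>]) (auto intro: continuous_intros)
    ultimately have "continuous_on (ball 0 \<rho> \<times> cbox a b)
        (\<lambda>p. \<phi> (snd p) * \<psi> (snd p) / (1 - fst p * \<psi> (snd p))\<^sup>2)"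
      using nz by (intro continuous_intros) auto
    then show "continuous_on (ball 0 \<rho> \<times> cbox a b) (\<lambda>(u, s). \<phi> s * \<psi> s / (1 - u * \<psi> s)\<^sup>2)"
      by (simp add: case_prod_beta')
  qed auto
  then show ?thesis by simp
qed

text \<open>
  Cauchy's formula for the two boundary circles.  The outer integral is analytic inside the outer
  circle and the inner one outside the inner circle; \<open>h\<close> is normalized by \<open>h 0 = 0\<close>.
\<close>

lemma laurent_split:
  assumes f: "f holomorphic_on annulus T" and t: "1 < t" "t < T"
  obtains g h where "g holomorphic_on ball 0 t" "h holomorphic_on ball 0 t"
    "\<And>z. z \<in> annulus t \<Longrightarrow> f z = g z + h (1 / z)"
proof -
  define \<phi>1 \<phi>2 where "\<phi>1 s = f (of_real t * cis s)" and "\<phi>2 s = f (of_real (1 / t) * cis s)" for s :: real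
  define \<psi>1 \<psi>2 where "\<psi>1 s = of_real (1 / t) * cis (- s)" and "\<psi>2 s = of_real (1 / t) * cis s" for s :: real
  define g where "g z = integral {0..2 * pi} (\<lambda>s. \<phi>1 s / (1 - z * \<psi>1 s)) / of_real (2 * pi)" for z
  define h where "h u = (integral {0..2 * pi} (\<lambda>s. \<phi>2 s / (1 - u * \<psi>2 s)) - integral {0..2 * pi} \<phi>2) / of_real (2 * pi)" for u
  have tt: "1 / T < 1 / t" "1 / t < 1" "1 / t < t" "1 / t < T" "1 / T < t"
  proof -
    show a: "1 / T < 1 / t" using t by (intro divide_strict_left_mono) auto
    show b: "1 / t < 1" using t by simp
    show "1 / t < t" "1 / t < T" "1 / T < t" using a b t by linarith+
  qed
  have circ: "of_real t * cis s \<in> annulus T" "of_real (1 / t) * cis s \<in> annulus T" for s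
    using t tt by (auto simp: annulus_def norm_mult norm_divide)
  have fc: "continuous_on (annulus T) f"
    using f by (rule holomorphic_on_imp_continuous_on)
  have \<phi>c: "continuous_on {0..2 * pi} \<phi>1" "continuous_on {0..2 * pi} \<phi>2"
    unfolding \<phi>1_def \<phi>2_def
    by (rule continuous_on_compose2[OF fc]; use circ t in \<open>auto intro!: continuous_intros\<close>)+
  have \<psi>c: "continuous_on {0..2 * pi} \<psi>1" "continuous_on {0..2 * pi} \<psi>2"
    unfolding \<psi>1_def \<psi>2_def using t by (auto intro!: continuous_intros)
  have \<psi>n: "norm (\<psi>1 s) \<le> 1 / t" "norm (\<psi>2 s) \<le> 1 / t" for s
    using t by (auto simp: \<psi>1_def \<psi>2_def norm_mult norm_divide)
  have hg: "g holomorphic_on ball 0 t" "h holomorphic_on ball 0 t"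
    unfolding g_def h_def using t \<phi>c \<psi>c \<psi>n
    by (auto intro!: holomorphic_intros holomorphic_geometric_kernel)
  have "f z = g z + h (1 / z)" if z: "z \<in> annulus t" for z
  proof -
    have zn: "1 / t < norm z" "norm z < t" using z by (auto simp: annulus_def)
    have z0: "z \<noteq> 0" using zn t by auto
    have zT: "z \<in> annulus T"
      using zn t tt by (auto simp: annulus_def)
    define F where "F w = (if w = z then deriv f z else (f w - f z) / (w - z))" for w
    have F: "F holomorphic_on annulus T"
      unfolding F_def by (rule pole_lemma_open[OF f open_annulus])
    define c where "c \<rho> = circlepath (0 :: complex) \<rho>" for \<rho>
    have im: "path_image (c \<rho>) = sphere 0 \<rho>" if "\<rho> > 0" for \<rho>
      using that by (simp add: c_def)
    have val: "valid_path (c \<rho>)" for \<rho> by (simp add: c_def)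
    have sph: "sphere 0 t \<subseteq> annulus T" "sphere 0 (1 / t) \<subseteq> annulus T"
      using t tt by (auto simp: annulus_def)
    have zs: "z \<notin> sphere 0 t" "z \<notin> sphere 0 (1 / t)" using zn by auto
    \<comment> \<open>The difference quotient of \<open>f\<close> at \<open>z\<close> is holomorphic, so both circles give the same integral.\<close>
    have "homotopic_loops (annulus T) (c t) (c (1 / t))"
    proof (rule homotopic_loops_linear)
      fix s :: real assume "s \<in> {0..1}"
      have cs: "c \<rho> s = of_real \<rho> * exp (2 * of_real pi * \<i> * of_real s)" for \<rho>
        by (simp add: c_def circlepath)
      show "closed_segment (c t s) (c (1 / t) s) \<subseteq> annulus T"
      proof
        fix x assume "x \<in> closed_segment (c t s) (c (1 / t) s)"
        then obtain u where u: "0 \<le> u" "u \<le> 1" "x = (1 - u) *\<^sub>R c t s + u *\<^sub>R c (1 / t) s"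
          by (auto simp: in_segment)
        define r where "r = (1 - u) * t + u * (1 / t)"
        have x: "x = of_real r * exp (2 * of_real pi * \<i> * of_real s)"
          unfolding u(3) cs r_def by (simp add: scaleR_conv_of_real algebra_simps)
        have "(1 - u) * (1 / t) \<le> (1 - u) * t" "u * (1 / t) \<le> u * t"
          by (rule mult_left_mono; use u(1,2) tt in linarith)+
        moreover have "(1 - u) * x + u * x = x" for x :: real by (simp add: algebra_simps)
        note this[of t] this[of "1 / t"]
        ultimately have r: "1 / t \<le> r" "r \<le> t"
          unfolding r_def by linarith+
        have "norm x = \<bar>r\<bar>"
          by (simp add: x norm_mult)
        moreover have "1 / t > 0" using t by simp
        ultimately show "x \<in> annulus T"
          using r t tt by (auto simp: annulus_def)
      qed
    qed (auto simp: c_def)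
    then have eq: "contour_integral (c t) F = contour_integral (c (1 / t)) F"
      by (rule Cauchy_theorem_homotopic_loops[OF _ open_annulus F val val])
    have int_q: "(\<lambda>w. f w / (w - z)) contour_integrable_on c \<rho>"
      and int_1: "(\<lambda>w. f z / (w - z)) contour_integrable_on c \<rho>"
      if "sphere 0 \<rho> \<subseteq> annulus T" "z \<notin> sphere 0 \<rho>" "\<rho> > 0" for \<rho>
    proof -
      have h: "(\<lambda>w. f w / (w - z)) holomorphic_on annulus T - {z}"
        "(\<lambda>w. f z / (w - z)) holomorphic_on annulus T - {z}"
        using f by (auto intro!: holomorphic_intros intro: holomorphic_on_subset)
      have sub: "path_image (c \<rho>) \<subseteq> annulus T - {z}"
        using that im[OF that(3)] by auto
      show "(\<lambda>w. f w / (w - z)) contour_integrable_on c \<rho>"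
        "(\<lambda>w. f z / (w - z)) contour_integrable_on c \<rho>"
        by (rule contour_integrable_holomorphic_simple[OF h(1) _ val sub]
                 contour_integrable_holomorphic_simple[OF h(2) _ val sub];
            intro open_delete open_annulus)+
    qed
    have split: "contour_integral (c \<rho>) F = contour_integral (c \<rho>) (\<lambda>w. f w / (w - z)) -
        contour_integral (c \<rho>) (\<lambda>w. f z / (w - z))"
      if "sphere 0 \<rho> \<subseteq> annulus T" "z \<notin> sphere 0 \<rho>" "\<rho> > 0" for \<rho>
    proof -
      have "contour_integral (c \<rho>) F = contour_integral (c \<rho>) (\<lambda>w. f w / (w - z) - f z / (w - z))"
        by (rule contour_integral_eq) (use that im[OF that(3)] in \<open>auto simp: F_def diff_divide_distrib\<close>)
      also have "\<dots> = contour_integral (c \<rho>) (\<lambda>w. f w / (w - z)) - contour_integral (c \<rho>) (\<lambda>w. f z / (w - z))"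
        by (intro contour_integral_diff int_q int_1 that)
      finally show ?thesis .
    qed
    have "((\<lambda>w. f z / (w - z)) has_contour_integral (2 * of_real pi * \<i> * f z)) (c t)"
      unfolding c_def by (rule Cauchy_integral_circlepath_simple) (use zn in auto)
    then have out: "contour_integral (c t) (\<lambda>w. f z / (w - z)) = 2 * of_real pi * \<i> * f z"
      by (rule contour_integral_unique)
    have "((\<lambda>w. f z / (w - z)) has_contour_integral 0) (c (1 / t))"
      by (rule Cauchy_theorem_disc_simple[of _ 0 "norm z"])
         (use zn t im[of "1 / t"] val in \<open>auto intro!: holomorphic_intros simp: c_def\<close>)
    then have inn: "contour_integral (c (1 / t)) (\<lambda>w. f z / (w - z)) = 0"
      by (rule contour_integral_unique)
    have main: "2 * of_real pi * \<i> * f z = contour_integral (c t) (\<lambda>w. f w / (w - z)) -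
        contour_integral (c (1 / t)) (\<lambda>w. f w / (w - z))"
      using eq split[OF sph(1) zs(1)] split[OF sph(2) zs(2)] out inn t by (simp add: algebra_simps)
    have ci: "contour_integral (c \<rho>) k = integral {0..2 * pi} (\<lambda>s. k (of_real \<rho> * cis s) * of_real \<rho> * \<i> * cis s)"
      for k \<rho>
      unfolding c_def circlepath_def by (subst contour_integral_part_circlepath_eq) auto
    have c1: "contour_integral (c t) (\<lambda>w. f w / (w - z)) = \<i> * (of_real (2 * pi) * g z)"
    proof -
      have "f (of_real t * cis s) / (of_real t * cis s - z) * of_real t * \<i> * cis s = \<i> * (\<phi>1 s / (1 - z * \<psi>1 s))" for s
      proof -
        have "cis s * cis (- s) = 1" by (simp add: cis_mult)
        then have "of_real t * cis s - z = of_real t * cis s * (1 - z * \<psi>1 s)"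
          using t by (simp add: \<psi>1_def algebra_simps)
        moreover have "of_real t * cis s \<noteq> 0" using t by simp
        ultimately show ?thesis by (simp add: \<phi>1_def)
      qed
      then show ?thesis
        unfolding ci g_def by (simp only: integral_mult_right) simp
    qed
    have c2: "contour_integral (c (1 / t)) (\<lambda>w. f w / (w - z)) = - \<i> * (of_real (2 * pi) * h (1 / z))"
    proof -
      have "f (of_real (1 / t) * cis s) / (of_real (1 / t) * cis s - z) * of_real (1 / t) * \<i> * cis s =
          \<i> * (\<phi>2 s - \<phi>2 s / (1 - (1 / z) * \<psi>2 s))" for s
      proof -
        have w: "of_real (1 / t) * cis s = \<psi>2 s" by (simp add: \<psi>2_def)
        have "norm (\<psi>2 s) = 1 / t" using t by (simp add: \<psi>2_def norm_mult norm_divide)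
        then have ne: "\<psi>2 s - z \<noteq> 0" using zn by auto
        have "1 - (1 / z) * \<psi>2 s = - (\<psi>2 s - z) / z" using z0 by (simp add: field_simps)
        then have "\<phi>2 s - \<phi>2 s / (1 - (1 / z) * \<psi>2 s) = \<phi>2 s * (\<psi>2 s / (\<psi>2 s - z))"
          using ne z0 by (simp add: field_simps)
        moreover have "f (of_real (1 / t) * cis s) / (of_real (1 / t) * cis s - z) * of_real (1 / t) * \<i> * cis s
            = \<i> * (\<phi>2 s * (\<psi>2 s / (\<psi>2 s - z)))"
          unfolding \<phi>2_def by (simp add: w[symmetric] mult_ac)
        ultimately show ?thesis by simp
      qed
      moreover have "(\<lambda>s. \<phi>2 s / (1 - (1 / z) * \<psi>2 s)) integrable_on {0..2 * pi}"
      proof (intro integrable_continuous_real continuous_intros \<phi>c \<psi>c ballI)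
        fix s
        have "norm ((1 / z) * \<psi>2 s) < 1"
          using zn t z0 by (simp add: \<psi>2_def norm_mult norm_divide field_simps)
        then show "1 - (1 / z) * \<psi>2 s \<noteq> 0" by auto
      qed
      ultimately show ?thesis
        unfolding ci h_def
        by (simp only: integral_mult_right integral_diff[OF integrable_continuous_real[OF \<phi>c(2)]])
           (simp add: field_simps)
    qed
    have "2 * of_real pi * \<i> * f z = \<i> * of_real (2 * pi) * (g z + h (1 / z))"
      unfolding main c1 c2 by (simp add: algebra_simps)
    then show ?thesis by simp
  qed
  with hg show ?thesis by (rule that)
qed

section \<open>Weighted absolutely convergent Laurent series\<close>

text \<open>
  Weighted \<open>\<ell>\<^sup>1\<close> norms on Laurent coefficients.  The weights \<open>t\<^bsup>\<bar>k\<bar>\<^esup>\<close> are submultiplicative, so the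
  norm is submultiplicative for products, and they dominate \<open>\<bar>z\<^sup>k\<bar>\<close> on the annulus \<open>1 / t \<le> \<bar>z\<bar> \<le> t\<close>, so
  the norm controls values there.
\<close>

definition wt :: "real \<Rightarrow> int \<Rightarrow> real" where
  "wt t k = t ^ nat \<bar>k\<bar>"

definition laurent_sum :: "real \<Rightarrow> (complex \<Rightarrow> complex) \<Rightarrow> (int \<Rightarrow> complex) \<Rightarrow> bool" where
  "laurent_sum t f c \<longleftrightarrow> (\<lambda>k. norm (c k) * wt t k) summable_on UNIV \<and>
     (\<forall>z. 1 / t \<le> norm z \<and> norm z \<le> t \<longrightarrow> ((\<lambda>k. c k * z powi k) has_sum f z) UNIV)"

definition wnorm :: "real \<Rightarrow> (int \<Rightarrow> complex) \<Rightarrow> real" where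
  "wnorm t c = infsum (\<lambda>k. norm (c k) * wt t k) UNIV"

definition conv :: "(int \<Rightarrow> complex) \<Rightarrow> (int \<Rightarrow> complex) \<Rightarrow> int \<Rightarrow> complex" where
  "conv c d k = infsum (\<lambda>j. c j * d (k - j)) UNIV"

lemma wt_ge_1: "1 \<le> t \<Longrightarrow> 1 \<le> wt t k"
  by (simp add: wt_def)

lemma wt_pos: "1 \<le> t \<Longrightarrow> 0 < wt t k"
  by (simp add: wt_def)

lemma wt_add: "1 \<le> t \<Longrightarrow> wt t (j + k) \<le> wt t j * wt t k"
  unfolding wt_def power_add[symmetric] by (intro power_increasing) auto

lemma wt_mono: "0 \<le> s \<Longrightarrow> s \<le> t \<Longrightarrow> wt s k \<le> wt t k"
  unfolding wt_def by (intro power_mono) auto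

lemma norm_powi_le_wt:
  assumes "1 \<le> t" "1 / t \<le> norm (z :: complex)" "norm z \<le> t"
  shows "norm (z powi k) \<le> wt t k"
proof (cases "k \<ge> 0")
  case True
  then show ?thesis
    using assms by (auto simp: wt_def power_int_def norm_power intro!: power_mono)
next
  case False
  have "norm z > 0" using assms by (smt (verit) divide_pos_pos)
  then have "inverse (norm z) \<le> t"
    using assms by (simp add: field_simps)
  then show ?thesis
    using False \<open>norm z > 0\<close>
    by (auto simp: wt_def power_int_def norm_power norm_inverse abs_if power_inverse[symmetric] intro!: power_mono)
qed

lemma wnorm_nonneg: "1 \<le> t \<Longrightarrow> 0 \<le> wnorm t c"
  unfolding wnorm_def by (intro infsum_nonneg) (auto simp: wt_def)

lemma laurent_sum_summable: "laurent_sum t f c \<Longrightarrow> (\<lambda>k. norm (c k) * wt t k) summable_on UNIV"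
  by (simp add: laurent_sum_def)

lemma laurent_sum_has_sum:
  "laurent_sum t f c \<Longrightarrow> 1 / t \<le> norm z \<Longrightarrow> norm z \<le> t \<Longrightarrow> ((\<lambda>k. c k * z powi k) has_sum f z) UNIV"
  by (simp add: laurent_sum_def)

lemma laurent_sum_abs:
  assumes "laurent_sum t f c" "1 \<le> t" "1 / t \<le> norm z" "norm z \<le> t"
  shows "(\<lambda>k. norm (c k * z powi k)) summable_on UNIV"
  by (rule summable_on_comparison_test[OF laurent_sum_summable[OF assms(1)]])
     (auto simp: norm_mult intro!: mult_left_mono norm_powi_le_wt assms)

lemma laurent_sum_bound:
  assumes "laurent_sum t f c" "1 \<le> t" "1 / t \<le> norm z" "norm z \<le> t"
  shows "norm (f z) \<le> wnorm t c"
  unfolding wnorm_def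
  by (rule norm_infsum_le[OF laurent_sum_has_sum[OF assms(1,3,4)] has_sum_infsum[OF laurent_sum_summable[OF assms(1)]]])
     (auto simp: norm_mult intro!: mult_left_mono norm_powi_le_wt assms)

lemma wnorm_coeff:
  assumes "laurent_sum t f c" "1 \<le> t"
  shows "norm (c k) * wt t k \<le> wnorm t c"
proof -
  have "(\<Sum>k\<in>{k}. norm (c k) * wt t k) \<le> wnorm t c"
    unfolding wnorm_def
    by (rule finite_sum_le_infsum[OF laurent_sum_summable[OF assms(1)]])
       (use assms(2) in \<open>auto simp: wt_def\<close>)
  then show ?thesis by simp
qed

lemma laurent_sum_cong:
  assumes "laurent_sum t f c" "\<And>z. 1 / t \<le> norm z \<Longrightarrow> norm z \<le> t \<Longrightarrow> f z = g z" "\<And>k. c k = d k"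
  shows "laurent_sum t g d"
proof -
  have "c = d" using assms(3) by blast
  then show ?thesis using assms(1,2) by (simp add: laurent_sum_def)
qed

lemma laurent_sum_mono:
  assumes "laurent_sum t f c" "1 \<le> s" "s \<le> t"
  shows "laurent_sum s f c"
proof -
  have *: "1 / t \<le> 1 / s" using assms by (intro divide_left_mono) auto
  have "(\<lambda>k. norm (c k) * wt s k) summable_on UNIV"
    by (rule summable_on_comparison_test[OF laurent_sum_summable[OF assms(1)]])
       (use assms(2,3) wt_pos[of s] in \<open>auto intro!: mult_left_mono wt_mono mult_nonneg_nonneg simp: less_imp_le\<close>)
  then show ?thesis
    using assms * by (auto simp: laurent_sum_def)
qed

lemma laurent_sum_add:
  assumes "laurent_sum t f c" "laurent_sum t g d" "1 \<le> t"
  shows "laurent_sum t (\<lambda>z. f z + g z) (\<lambda>k. c k + d k)" "wnorm t (\<lambda>k. c k + d k) \<le> wnorm t c + wnorm t d"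
proof -
  note s = laurent_sum_summable[OF assms(1)] laurent_sum_summable[OF assms(2)]
  have le: "norm (c k + d k) * wt t k \<le> norm (c k) * wt t k + norm (d k) * wt t k" for k
    unfolding distrib_right[symmetric]
    using wt_pos[OF assms(3), of k] by (intro mult_right_mono norm_triangle_ineq) auto
  have sm: "(\<lambda>k. norm (c k + d k) * wt t k) summable_on UNIV"
    by (rule summable_on_comparison_test[OF summable_on_add[OF s]])
       (use le wt_pos[OF assms(3)] in \<open>auto intro!: mult_nonneg_nonneg simp: less_imp_le\<close>)
  then show "laurent_sum t (\<lambda>z. f z + g z) (\<lambda>k. c k + d k)"
    using assms by (auto simp: laurent_sum_def distrib_right intro!: has_sum_add)
  show "wnorm t (\<lambda>k. c k + d k) \<le> wnorm t c + wnorm t d"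
    unfolding wnorm_def infsum_add[OF s, symmetric]
    by (rule infsum_mono[OF sm summable_on_add[OF s]]) (use le in auto)
qed

lemma laurent_sum_uminus:
  assumes "laurent_sum t f c"
  shows "laurent_sum t (\<lambda>z. - f z) (\<lambda>k. - c k)" "wnorm t (\<lambda>k. - c k) = wnorm t c"
  using assms by (auto simp: laurent_sum_def wnorm_def has_sum_uminus)

lemma laurent_sum_zero: "laurent_sum t (\<lambda>_. 0) (\<lambda>_. 0)"
  by (simp add: laurent_sum_def)

lemma laurent_sum_sum:
  assumes "finite I" "\<And>i. i \<in> I \<Longrightarrow> laurent_sum t (f i) (c i)" "1 \<le> t"
  shows "laurent_sum t (\<lambda>z. \<Sum>i\<in>I. f i z) (\<lambda>k. \<Sum>i\<in>I. c i k) \<and>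
    wnorm t (\<lambda>k. \<Sum>i\<in>I. c i k) \<le> (\<Sum>i\<in>I. wnorm t (c i))"
  using assms(1,2)
proof (induction I)
  case empty
  show ?case by (simp add: laurent_sum_zero wnorm_def)
next
  case (insert x F)
  then have IH: "laurent_sum t (\<lambda>z. \<Sum>i\<in>F. f i z) (\<lambda>k. \<Sum>i\<in>F. c i k)"
    "wnorm t (\<lambda>k. \<Sum>i\<in>F. c i k) \<le> (\<Sum>i\<in>F. wnorm t (c i))" by auto
  note a = laurent_sum_add[OF insert.prems[of x] IH(1) assms(3)]
  show ?case using a IH(2) insert.hyps by auto
qed

lemma laurent_sum_monomials:
  assumes "finite F" "\<And>k. k \<notin> F \<Longrightarrow> c k = 0"
  shows "laurent_sum t (\<lambda>z. \<Sum>k\<in>F. c k * z powi k) c"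
proof -
  have "(\<lambda>k. norm (c k) * wt t k) summable_on F"
    using assms(1) by simp
  then have "(\<lambda>k. norm (c k) * wt t k) summable_on UNIV"
    by (rule summable_on_cong_neutral[THEN iffD1, rotated -1]) (use assms in auto)
  moreover have "((\<lambda>k. c k * z powi k) has_sum (\<Sum>k\<in>F. c k * z powi k)) UNIV" for z :: complex
    using assms by (intro has_sum_finite_neutralI) auto
  ultimately show ?thesis by (simp add: laurent_sum_def)
qed

lemma convolution_has_sum:
  fixes x y :: "int \<Rightarrow> 'a :: {banach, real_normed_div_algebra}"
  assumes x: "(\<lambda>k. norm (x k)) summable_on UNIV" and y: "(\<lambda>k. norm (y k)) summable_on UNIV"
  shows "(\<lambda>j. x j * y (k - j)) summable_on UNIV"
    "((\<lambda>k. infsum (\<lambda>j. x j * y (k - j)) UNIV) has_sum (infsum x UNIV * infsum y UNIV)) UNIV"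
proof -
  have xs: "(x has_sum infsum x UNIV) UNIV" and ys: "(y has_sum infsum y UNIV) UNIV"
    using abs_summable_summable[of x UNIV] abs_summable_summable[of y UNIV] x y by auto
  define G where "G = (\<lambda>(j, l). x j * y l)"
  have "(\<lambda>p. norm (G p)) summable_on UNIV \<times> UNIV"
  proof (rule Infinite_Sum.abs_summable_on_Sigma_iff[THEN iffD2], intro conjI ballI)
    fix j
    show "(\<lambda>l. norm (G (j, l))) summable_on UNIV"
      by (auto simp: G_def norm_mult intro!: summable_on_cmult_right y)
    have "(\<lambda>j. norm (x j) * infsum (\<lambda>l. norm (y l)) UNIV) summable_on UNIV"
      by (intro summable_on_cmult_left x)
    moreover have "norm (infsum (\<lambda>l. norm (G (j, l))) UNIV) = norm (x j) * infsum (\<lambda>l. norm (y l)) UNIV" for j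
      using infsum_nonneg[of UNIV "\<lambda>l. norm (y l)"]
      by (simp add: G_def norm_mult infsum_cmult_right' abs_mult)
    ultimately show "(\<lambda>j. norm (infsum (\<lambda>l. norm (G (j, l))) UNIV)) summable_on UNIV"
      by simp
  qed
  then have Gs: "G summable_on UNIV \<times> UNIV"
    by (rule abs_summable_summable)
  have "(G has_sum (infsum x UNIV * infsum y UNIV)) (UNIV \<times> UNIV)"
  proof (rule has_sum_SigmaI[OF _ _ Gs])
    show "((\<lambda>l. G (j, l)) has_sum (x j * infsum y UNIV)) UNIV" for j
      by (auto simp: G_def intro!: has_sum_cmult_right ys)
    show "((\<lambda>j. x j * infsum y UNIV) has_sum (infsum x UNIV * infsum y UNIV)) UNIV"
      by (intro has_sum_cmult_left xs)
  qed
  also have "?this \<longleftrightarrow> ((\<lambda>(k, j). x j * y (k - j)) has_sum (infsum x UNIV * infsum y UNIV)) (UNIV \<times> UNIV)"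
    by (rule has_sum_reindex_bij_witness[of _ "\<lambda>(k, j). (j, k - j)" "\<lambda>(j, l). (j + l, j)"])
       (auto simp: G_def)
  finally have H: "((\<lambda>(k, j). x j * y (k - j)) has_sum (infsum x UNIV * infsum y UNIV)) (UNIV \<times> UNIV)" .
  show inner: "(\<lambda>j. x j * y (k - j)) summable_on UNIV" for k
  proof -
    have yb: "norm (y l) \<le> infsum (\<lambda>l. norm (y l)) UNIV" for l
      using finite_sum_le_infsum[OF y, of "{l}"] by simp
    have "(\<lambda>j. norm (x j) * infsum (\<lambda>l. norm (y l)) UNIV) summable_on UNIV"
      by (intro summable_on_cmult_left x)
    then have "(\<lambda>j. norm (x j * y (k - j))) summable_on UNIV"
      by (rule summable_on_comparison_test) (auto simp: norm_mult intro!: mult_left_mono yb)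
    then show ?thesis by (rule abs_summable_summable)
  qed
  show "((\<lambda>k. infsum (\<lambda>j. x j * y (k - j)) UNIV) has_sum (infsum x UNIV * infsum y UNIV)) UNIV"
    by (rule has_sum_SigmaD[OF H]) (use inner in auto)
qed

lemma laurent_sum_mult:
  assumes f: "laurent_sum t f c" and g: "laurent_sum t g d" and t: "1 \<le> t"
  shows "laurent_sum t (\<lambda>z. f z * g z) (conv c d)" "wnorm t (conv c d) \<le> wnorm t c * wnorm t d"
proof -
  define x y where "x k = norm (c k) * wt t k" and "y k = norm (d k) * wt t k" for k
  have xy0: "x k \<ge> 0" "y k \<ge> 0" for k
    using wt_pos[OF t, of k] by (auto simp: x_def y_def)
  have sx: "(\<lambda>k. norm (x k)) summable_on UNIV" and sy: "(\<lambda>k. norm (y k)) summable_on UNIV"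
    using laurent_sum_summable[OF f] laurent_sum_summable[OF g] xy0 by (auto simp: x_def y_def)
  note C = convolution_has_sum[OF sx sy]
  have le1: "norm (c j * d (k - j)) * wt t k \<le> x j * y (k - j)" for j k
  proof -
    have "wt t k \<le> wt t j * wt t (k - j)" using wt_add[OF t, of j "k - j"] by simp
    then have "norm (c j * d (k - j)) * wt t k \<le> norm (c j * d (k - j)) * (wt t j * wt t (k - j))"
      by (rule mult_left_mono) simp
    then show ?thesis by (simp add: x_def y_def norm_mult mult_ac)
  qed
  have le2: "norm (c j * d (k - j)) \<le> x j * y (k - j)" for j k
    using le1[of j k] mult_left_mono[OF wt_ge_1[OF t, of k], of "norm (c j * d (k - j))"] by simp
  have abs: "(\<lambda>j. norm (c j * d (k - j))) summable_on UNIV" for k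
    by (rule summable_on_comparison_test[OF C(1)[of k]]) (use le2 in auto)
  have le: "norm (conv c d k) * wt t k \<le> infsum (\<lambda>j. x j * y (k - j)) UNIV" for k
  proof -
    have "norm (conv c d k) * wt t k \<le> infsum (\<lambda>j. norm (c j * d (k - j))) UNIV * wt t k"
      unfolding conv_def using wt_pos[OF t, of k] abs by (intro mult_right_mono norm_infsum_bound) auto
    also have "\<dots> = infsum (\<lambda>j. norm (c j * d (k - j)) * wt t k) UNIV"
      by (rule infsum_cmult_left'[symmetric])
    also have "\<dots> \<le> infsum (\<lambda>j. x j * y (k - j)) UNIV"
      by (rule infsum_mono[OF summable_on_cmult_left[OF abs] C(1)]) (use le1 in auto)
    finally show ?thesis .
  qed
  have sm: "(\<lambda>k. norm (conv c d k) * wt t k) summable_on UNIV"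
    by (rule summable_on_comparison_test[OF has_sum_imp_summable[OF C(2)]])
       (use le wt_pos[OF t] in \<open>auto intro!: mult_nonneg_nonneg simp: less_imp_le\<close>)
  show "wnorm t (conv c d) \<le> wnorm t c * wnorm t d"
  proof -
    have "wnorm t (conv c d) \<le> infsum (\<lambda>k. infsum (\<lambda>j. x j * y (k - j)) UNIV) UNIV"
      unfolding wnorm_def by (rule infsum_mono[OF sm has_sum_imp_summable[OF C(2)]]) (use le in auto)
    also have "\<dots> = infsum x UNIV * infsum y UNIV"
      using C(2) by (rule infsumI)
    finally show ?thesis by (simp add: wnorm_def x_def[abs_def] y_def[abs_def])
  qed
  have "((\<lambda>k. conv c d k * z powi k) has_sum (f z * g z)) UNIV" if z: "1 / t \<le> norm z" "norm z \<le> t" for z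
  proof -
    have z0: "z \<noteq> 0" using z t by auto
    have *: "infsum (\<lambda>k. c k * z powi k) UNIV = f z" "infsum (\<lambda>k. d k * z powi k) UNIV = g z"
      using laurent_sum_has_sum[OF f z] laurent_sum_has_sum[OF g z] by (auto intro: infsumI)
    have "((\<lambda>k. infsum (\<lambda>j. (c j * z powi j) * (d (k - j) * z powi (k - j))) UNIV) has_sum (f z * g z)) UNIV"
      using convolution_has_sum(2)[OF laurent_sum_abs[OF f t z] laurent_sum_abs[OF g t z]] * by simp
    moreover have "(c j * z powi j) * (d (k - j) * z powi (k - j)) = c j * d (k - j) * z powi k" for j k
      using power_int_add[of z j "k - j"] z0 by (simp add: mult_ac)
    ultimately show ?thesis
      by (simp add: conv_def infsum_cmult_left')
  qed
  then show "laurent_sum t (\<lambda>z. f z * g z) (conv c d)"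
    using sm by (simp add: laurent_sum_def)
qed

lemma has_sum_int_nonneg:
  fixes f :: "nat \<Rightarrow> 'a :: {comm_monoid_add, topological_space}"
  shows "((\<lambda>k :: int. if k \<ge> 0 then f (nat k) else 0) has_sum S) UNIV \<longleftrightarrow> (f has_sum S) UNIV"
proof -
  have "((\<lambda>k :: int. if k \<ge> 0 then f (nat k) else 0) has_sum S) UNIV \<longleftrightarrow> ((\<lambda>k. f (nat k)) has_sum S) {0..}"
    by (rule has_sum_cong_neutral) auto
  also have "\<dots> \<longleftrightarrow> (f has_sum S) UNIV"
    by (rule has_sum_reindex_bij_witness[of _ int nat]) auto
  finally show ?thesis .
qed

lemma has_sum_int_nonpos:
  fixes f :: "nat \<Rightarrow> 'a :: {comm_monoid_add, topological_space}"
  shows "((\<lambda>k :: int. if k \<le> 0 then f (nat (- k)) else 0) has_sum S) UNIV \<longleftrightarrow> (f has_sum S) UNIV"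
proof -
  have "((\<lambda>k :: int. if k \<le> 0 then f (nat (- k)) else 0) has_sum S) UNIV \<longleftrightarrow> ((\<lambda>k. f (nat (- k))) has_sum S) {..0}"
    by (rule has_sum_cong_neutral) auto
  also have "\<dots> \<longleftrightarrow> (f has_sum S) UNIV"
    by (rule has_sum_reindex_bij_witness[of _ "\<lambda>k. - int k" "\<lambda>k. nat (- k)"]) auto
  finally show ?thesis .
qed

lemma laurent_sum_of_power_series:
  assumes t: "1 \<le> t" and s: "summable (\<lambda>n. norm (a n) * t ^ n)"
    and f: "\<And>z. norm z \<le> t \<Longrightarrow> (\<lambda>n. a n * z ^ n) sums f z"
  shows "laurent_sum t f (\<lambda>k. if k \<ge> 0 then a (nat k) else 0)"
    "laurent_sum t (\<lambda>z. f (1 / z)) (\<lambda>k. if k \<le> 0 then a (nat (- k)) else 0)"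
proof -
  have as: "summable (\<lambda>n. norm (a n * z ^ n))" if "norm z \<le> t" for z
    by (rule summable_comparison_test'[OF s, of 0])
       (use that in \<open>auto simp: norm_mult norm_power intro!: mult_left_mono power_mono\<close>)
  have fs: "((\<lambda>n. a n * z ^ n) has_sum f z) UNIV" if "norm z \<le> t" for z
    by (rule norm_summable_imp_has_sum[OF as f]) (use that in auto)
  have "(\<lambda>n. norm (a n) * t ^ n) summable_on UNIV"
    by (rule summable_nonneg_imp_summable_on) (use s t in auto)
  then obtain S where S: "((\<lambda>n. norm (a n) * t ^ n) has_sum S) UNIV" by (auto simp: summable_on_def)
  have "((\<lambda>k. norm (if k \<ge> 0 then a (nat k) else 0) * wt t k) has_sum S) UNIV"
    using S unfolding has_sum_int_nonneg[symmetric]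
    by (rule has_sum_cong[THEN iffD1, rotated]) (auto simp: wt_def)
  moreover have "((\<lambda>k. (if k \<ge> 0 then a (nat k) else 0) * z powi k) has_sum f z) UNIV" if "norm z \<le> t" for z
    using fs[OF that] unfolding has_sum_int_nonneg[symmetric]
    by (rule has_sum_cong[THEN iffD1, rotated]) (auto simp: power_int_def)
  ultimately show "laurent_sum t f (\<lambda>k. if k \<ge> 0 then a (nat k) else 0)"
    by (auto simp: laurent_sum_def has_sum_imp_summable)
  have "((\<lambda>k. norm (if k \<le> 0 then a (nat (- k)) else 0) * wt t k) has_sum S) UNIV"
    using S unfolding has_sum_int_nonpos[symmetric]
    by (rule has_sum_cong[THEN iffD1, rotated]) (auto simp: wt_def)
  moreover have "((\<lambda>k. (if k \<le> 0 then a (nat (- k)) else 0) * z powi k) has_sum f (1 / z)) UNIV" if "1 / t \<le> norm z" for z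
  proof -
    have "norm z > 0" using that t by (smt (verit) divide_pos_pos)
    then have "norm (1 / z) \<le> t" using that t by (simp add: norm_divide field_simps)
    from fs[OF this] show ?thesis
      unfolding has_sum_int_nonpos[symmetric]
    proof (rule has_sum_cong[THEN iffD1, rotated])
      fix k :: int
      show "(if k \<le> 0 then a (nat (- k)) * (1 / z) ^ nat (- k) else 0) = (if k \<le> 0 then a (nat (- k)) else 0) * z powi k"
        by (cases "k = 0") (auto simp: power_int_def power_one_over field_simps)
    qed
  qed
  ultimately show "laurent_sum t (\<lambda>z. f (1 / z)) (\<lambda>k. if k \<le> 0 then a (nat (- k)) else 0)"
    by (auto simp: laurent_sum_def has_sum_imp_summable)
qed

lemma laurent_sum_exists:
  assumes f: "f holomorphic_on annulus T" and t: "1 \<le> t" "t < T"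
  shows "\<exists>c. laurent_sum t f c"
proof -
  obtain t'' where t'': "t < t''" "t'' < T" using dense[OF t(2)] by blast
  obtain t' where t': "t < t'" "t' < t''" using dense[OF t''(1)] by blast
  have "1 < t''" using t t'' by linarith
  from laurent_split[OF f this t''(2)] obtain g h where gh: "g holomorphic_on ball 0 t''" "h holomorphic_on ball 0 t''"
    "\<And>z. z \<in> annulus t'' \<Longrightarrow> f z = g z + h (1 / z)" by blast
  have ps: "summable (\<lambda>n. norm (a n) * t ^ n) \<and> (\<forall>z. norm z \<le> t \<longrightarrow> (\<lambda>n. a n * z ^ n) sums k z)"
    if k: "k holomorphic_on ball 0 t''" and a: "a = (\<lambda>n. (deriv ^^ n) k 0 / fact n)" for k a
  proof -
    have sums: "(\<lambda>n. a n * z ^ n) sums k z" if "norm z < t''" for z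
      using holomorphic_power_series[OF k, of z] that by (simp add: a)
    have "summable (\<lambda>n. norm (a n * of_real t ^ n))"
      by (rule powser_insidea[of a "of_real t'"])
         (use sums[of "of_real t'"] t t' in \<open>auto simp: sums_iff\<close>)
    then show ?thesis
      using sums t t' by (auto simp: norm_mult norm_power)
  qed
  define a b where "a = (\<lambda>n. (deriv ^^ n) g 0 / fact n)" and "b = (\<lambda>n. (deriv ^^ n) h 0 / fact n)"
  have "laurent_sum t (\<lambda>z. g z + h (1 / z)) (\<lambda>k. (if k \<ge> 0 then a (nat k) else 0) + (if k \<le> 0 then b (nat (- k)) else 0))"
    using ps[OF gh(1) a_def] ps[OF gh(2) b_def] t(1)
    by (intro laurent_sum_add laurent_sum_of_power_series) auto
  moreover have "z \<in> annulus t''" if "1 / t \<le> norm z" "norm z \<le> t" for z :: complex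
  proof -
    have "1 / t'' < 1 / t" using t t'' by (intro divide_strict_left_mono) auto
    then show ?thesis using that t'' by (auto simp: annulus_def)
  qed
  ultimately have "laurent_sum t f (\<lambda>k. (if k \<ge> 0 then a (nat k) else 0) + (if k \<le> 0 then b (nat (- k)) else 0))"
    using gh(3) by (auto elim!: laurent_sum_cong)
  then show ?thesis by blast
qed

lemma laurent_sum_nonneg_holomorphic:
  assumes "laurent_sum t f c" "1 \<le> t" "\<And>k. k < 0 \<Longrightarrow> c k = 0"
  obtains F where "F holomorphic_on ball 0 t" "\<And>z. 1 / t \<le> norm z \<Longrightarrow> norm z \<le> t \<Longrightarrow> F z = f z"
proof -
  define a where "a n = c (int n)" for n
  have ca: "c k = (if k \<ge> 0 then a (nat k) else 0)" for k
    using assms(3) by (auto simp: a_def)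
  obtain S where "((\<lambda>k. norm (c k) * wt t k) has_sum S) UNIV"
    using laurent_sum_summable[OF assms(1)] by (auto simp: summable_on_def)
  then have "((\<lambda>k. if k \<ge> 0 then norm (a (nat k)) * t ^ nat k else 0) has_sum S) UNIV"
    by (rule has_sum_cong[THEN iffD1, rotated]) (auto simp: wt_def ca)
  then have "((\<lambda>n. norm (a n) * t ^ n) has_sum S) UNIV"
    using has_sum_int_nonneg[of "\<lambda>n. norm (a n) * t ^ n"] by simp
  then have s: "summable (\<lambda>n. norm (a n) * t ^ n)"
    using has_sum_imp_sums sums_summable by blast
  define F where "F z = (\<Sum>n. a n * z ^ n)" for z
  have sums: "(\<lambda>n. a n * z ^ n) sums F z" if "norm z \<le> t" for z
  proof -
    have "summable (\<lambda>n. norm (a n * z ^ n))"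
      by (rule summable_comparison_test'[OF s, of 0])
         (use that in \<open>auto simp: norm_mult norm_power intro!: mult_left_mono power_mono\<close>)
    then show ?thesis unfolding F_def by (rule summable_sums[OF summable_norm_cancel])
  qed
  have "F holomorphic_on ball 0 t"
    by (rule power_series_holomorphic[of 0 t a]) (use sums in auto)
  moreover have "F z = f z" if z: "1 / t \<le> norm z" "norm z \<le> t" for z
  proof -
    have "laurent_sum t F (\<lambda>k. if k \<ge> 0 then a (nat k) else 0)"
      using sums by (intro laurent_sum_of_power_series(1) assms(2) s) auto
    then have "((\<lambda>k. c k * z powi k) has_sum F z) UNIV"
      unfolding ca by (rule laurent_sum_has_sum[OF _ z])
    with laurent_sum_has_sum[OF assms(1) z] show ?thesis
      using has_sum_unique by blast
  qed
  ultimately show ?thesis by (rule that)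
qed

section \<open>Factorization of matrices close to the identity\<close>

text \<open>
  A contraction in the space of bounded families indexed by \<open>J \<times> A\<close>, with the supremum norm: the
  iterates from \<open>0\<close> form a geometric telescoping series.  The bound \<open>G / (1 - \<theta>)\<close> is the sum of that series.
\<close>

lemma linear_fixpoint:
  fixes g :: "'j \<Rightarrow> 'a \<Rightarrow> complex" and K :: "'j \<Rightarrow> 'a \<Rightarrow> 'j \<Rightarrow> 'a \<Rightarrow> complex"
  assumes G: "\<And>i a. i \<in> J \<Longrightarrow> a \<in> A \<Longrightarrow> norm (g i a) \<le> G" "0 \<le> G"
    and K: "\<And>i a j. i \<in> J \<Longrightarrow> a \<in> A \<Longrightarrow> j \<in> J \<Longrightarrow> (\<lambda>b. norm (K i a j b)) summable_on A"
    and \<theta>: "\<And>i a. i \<in> J \<Longrightarrow> a \<in> A \<Longrightarrow> (\<Sum>j\<in>J. infsum (\<lambda>b. norm (K i a j b)) A) \<le> \<theta>" "0 \<le> \<theta>" "\<theta> < 1"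
  obtains v where "\<And>i a. i \<in> J \<Longrightarrow> a \<in> A \<Longrightarrow> norm (v i a) \<le> G / (1 - \<theta>)"
    "\<And>i a. i \<in> J \<Longrightarrow> a \<in> A \<Longrightarrow> v i a = g i a + (\<Sum>j\<in>J. infsum (\<lambda>b. K i a j b * v j b) A)"
proof -
  define Op where "Op v i a = (\<Sum>j\<in>J. infsum (\<lambda>b. K i a j b * v j b) A)" for v i a
  have abs: "(\<lambda>b. norm (K i a j b * v j b)) summable_on A"
    if "i \<in> J" "a \<in> A" "j \<in> J" "\<And>j b. j \<in> J \<Longrightarrow> b \<in> A \<Longrightarrow> norm (v j b) \<le> B" for i a j v B
  proof (rule summable_on_comparison_test)
    show "(\<lambda>b. norm (K i a j b) * B) summable_on A"
      by (intro summable_on_cmult_left K that)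
  qed (use that in \<open>auto simp: norm_mult intro!: mult_left_mono\<close>)
  have bound: "norm (Op v i a) \<le> \<theta> * B"
    if ia: "i \<in> J" "a \<in> A" and v: "\<And>j b. j \<in> J \<Longrightarrow> b \<in> A \<Longrightarrow> norm (v j b) \<le> B" and "0 \<le> B" for v i a B
  proof -
    have "norm (Op v i a) \<le> (\<Sum>j\<in>J. infsum (\<lambda>b. norm (K i a j b)) A * B)"
      unfolding Op_def
    proof (rule sum_norm_le)
      fix j assume j: "j \<in> J"
      have "norm (infsum (\<lambda>b. K i a j b * v j b) A) \<le> infsum (\<lambda>b. norm (K i a j b * v j b)) A"
        by (rule norm_infsum_bound) (rule abs[OF ia j v])
      also have "\<dots> \<le> infsum (\<lambda>b. norm (K i a j b) * B) A"
        by (rule infsum_mono[OF abs[OF ia j v] summable_on_cmult_left[OF K[OF ia j]]])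
           (use v j in \<open>auto simp: norm_mult intro!: mult_left_mono\<close>)
      also have "\<dots> = infsum (\<lambda>b. norm (K i a j b)) A * B"
        by (rule infsum_cmult_left')
      finally show "norm (infsum (\<lambda>b. K i a j b * v j b) A) \<le> infsum (\<lambda>b. norm (K i a j b)) A * B" .
    qed
    also have "\<dots> = (\<Sum>j\<in>J. infsum (\<lambda>b. norm (K i a j b)) A) * B"
      by (simp add: sum_distrib_right)
    also have "\<dots> \<le> \<theta> * B" by (intro mult_right_mono \<theta> ia that)
    finally show ?thesis .
  qed
  have diff: "Op v i a - Op w i a = Op (\<lambda>j b. v j b - w j b) i a"
    if ia: "i \<in> J" "a \<in> A" and v: "\<And>j b. j \<in> J \<Longrightarrow> b \<in> A \<Longrightarrow> norm (v j b) \<le> B"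
      and w: "\<And>j b. j \<in> J \<Longrightarrow> b \<in> A \<Longrightarrow> norm (w j b) \<le> B'" for v w i a B B'
    unfolding Op_def sum_subtractf[symmetric]
  proof (intro sum.cong refl)
    fix j assume j: "j \<in> J"
    have s1: "(\<lambda>b. K i a j b * v j b) summable_on A"
      by (rule abs_summable_summable, rule abs[OF ia j], erule (1) v)
    have s2: "(\<lambda>b. K i a j b * w j b) summable_on A"
      by (rule abs_summable_summable, rule abs[OF ia j], erule (1) w)
    show "infsum (\<lambda>b. K i a j b * v j b) A - infsum (\<lambda>b. K i a j b * w j b) A =
        infsum (\<lambda>b. K i a j b * (v j b - w j b)) A"
      using infsum_add[OF s1 summable_on_uminus[THEN iffD2, OF s2]]
      by (simp add: right_diff_distrib infsum_uminus)
  qed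
  define C where "C = G / (1 - \<theta>)"
  have C: "0 \<le> C" "G + \<theta> * C = C" "G \<le> C"
  proof -
    show "0 \<le> C" using G \<theta> by (simp add: C_def)
    show c: "G + \<theta> * C = C" using \<theta>(3) by (simp add: C_def field_simps)
    show "G \<le> C" using c mult_nonneg_nonneg[OF \<theta>(2) \<open>0 \<le> C\<close>] by linarith
  qed
  define s where "s N = ((\<lambda>v i a. g i a + Op v i a) ^^ N) (\<lambda>_ _. 0)" for N
  have s0: "s 0 = (\<lambda>_ _. 0)" and sS: "s (Suc N) i a = g i a + Op (s N) i a" for N i a
    by (simp_all add: s_def)
  have sb: "norm (s N i a) \<le> C" if "i \<in> J" "a \<in> A" for N i a
    using that
  proof (induction N arbitrary: i a)
    case (Suc N)
    have "norm (s (Suc N) i a) \<le> norm (g i a) + norm (Op (s N) i a)"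
      unfolding sS by (rule norm_triangle_ineq)
    also have "\<dots> \<le> G + \<theta> * C"
      using Suc C by (intro add_mono G bound) auto
    finally show ?case using C by simp
  qed (use C in \<open>simp add: s0\<close>)
  have step: "norm (s (Suc N) i a - s N i a) \<le> \<theta> ^ N * G" if "i \<in> J" "a \<in> A" for N i a
    using that
  proof (induction N arbitrary: i a)
    case 0
    have "Op (\<lambda>_ _. 0) i a = 0" by (simp add: Op_def)
    then show ?case using G 0 by (simp add: s0 sS)
  next
    case (Suc N)
    have "s (Suc (Suc N)) i a - s (Suc N) i a = Op (s (Suc N)) i a - Op (s N) i a"
      by (simp add: sS)
    also have "\<dots> = Op (\<lambda>j b. s (Suc N) j b - s N j b) i a"
      by (rule diff[OF Suc.prems sb sb])
    also have "norm \<dots> \<le> \<theta> * (\<theta> ^ N * G)"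
      using Suc G \<theta> by (intro bound) auto
    finally show ?case by (simp add: mult_ac)
  qed
  have geo: "summable (\<lambda>N. \<theta> ^ N * G)"
    using \<theta> by (intro summable_mult2 summable_geometric) auto
  define v where "v i a = (\<Sum>N. s (Suc N) i a - s N i a)" for i a
  have sm: "summable (\<lambda>N. norm (s (Suc N) i a - s N i a))" if "i \<in> J" "a \<in> A" for i a
    by (rule summable_comparison_test'[OF geo, of 0]) (use step that in auto)
  have lim: "(\<lambda>N. s N i a) \<longlonglongrightarrow> v i a" if "i \<in> J" "a \<in> A" for i a
  proof -
    have "(\<lambda>N. s (Suc N) i a - s N i a) sums v i a"
      unfolding v_def by (rule summable_sums[OF summable_norm_cancel[OF sm[OF that]]])
    then have "(\<lambda>N. \<Sum>m<N. s (Suc m) i a - s m i a) \<longlonglongrightarrow> v i a"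
      by (simp add: sums_def)
    then show ?thesis by (simp add: sum_lessThan_telescope[of "\<lambda>m. s m i a"] s0)
  qed
  have vb: "norm (v i a) \<le> C" if "i \<in> J" "a \<in> A" for i a
    by (rule Lim_norm_ubound[OF _ lim[OF that]]) (use sb that in auto)
  \<comment> \<open>The tails of the telescoping series are bounded uniformly in the index, so \<open>Op\<close> commutes with the limit.\<close>
  have tail: "norm (v i a - s N i a) \<le> \<theta> ^ N * C" if "i \<in> J" "a \<in> A" for N i a
  proof (rule Lim_norm_ubound[OF _ tendsto_diff[OF lim[OF that] tendsto_const]])
    have "norm (s m i a - s N i a) \<le> \<theta> ^ N * C" if "m \<ge> N" for m
    proof -
      have "norm (s m i a - s N i a) \<le> \<theta> ^ N * C - \<theta> ^ m * C"
        using that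
      proof (induction m rule: dec_induct)
        case (step m)
        have "norm (s (Suc m) i a - s N i a) \<le> norm (s (Suc m) i a - s m i a) + norm (s m i a - s N i a)"
          using norm_triangle_ineq[of "s (Suc m) i a - s m i a" "s m i a - s N i a"] by simp
        also have "\<dots> \<le> \<theta> ^ m * G + (\<theta> ^ N * C - \<theta> ^ m * C)"
          using step.IH \<open>\<And>N i a. i \<in> J \<Longrightarrow> a \<in> A \<Longrightarrow> norm (s (Suc N) i a - s N i a) \<le> \<theta> ^ N * G\<close> \<open>i \<in> J\<close> \<open>a \<in> A\<close>
          by (intro add_mono) auto
        also have "\<theta> ^ m * G = \<theta> ^ m * C - \<theta> ^ Suc m * C"
        proof -
          have "G = C - \<theta> * C" using C(2) by linarith
          then show ?thesis by (subst \<open>G = C - \<theta> * C\<close>) (simp add: algebra_simps)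
        qed
        finally show ?case by simp
      qed simp
      moreover have "\<theta> ^ m * C \<ge> 0" using \<theta> C by simp
      ultimately show ?thesis by linarith
    qed
    then show "eventually (\<lambda>m. norm (s m i a - s N i a) \<le> \<theta> ^ N * C) sequentially"
      using eventually_sequentially by blast
  qed simp
  have "v i a = g i a + Op v i a" if ia: "i \<in> J" "a \<in> A" for i a
  proof -
    have "norm (Op (s N) i a - Op v i a) \<le> \<theta> ^ N * C" for N
    proof -
      have "norm (Op (\<lambda>j b. s N j b - v j b) i a) \<le> \<theta> * (\<theta> ^ N * C)"
        by (rule bound[OF ia]) (use tail \<theta> C in \<open>auto simp: norm_minus_commute\<close>)
      also have "\<dots> \<le> 1 * (\<theta> ^ N * C)"
        using \<theta> C by (intro mult_right_mono) auto
      finally show ?thesis by (simp add: diff[OF ia sb vb])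
    qed
    moreover have "(\<lambda>N. \<theta> ^ N * C) \<longlonglongrightarrow> 0"
      using \<theta> by (intro tendsto_mult_left_zero LIMSEQ_realpow_zero) auto
    ultimately have "(\<lambda>N. Op (s N) i a - Op v i a) \<longlonglongrightarrow> 0"
      by (intro Lim_null_comparison[of "\<lambda>N. Op (s N) i a - Op v i a" "\<lambda>N. \<theta> ^ N * C"]) auto
    then have "(\<lambda>N. Op (s N) i a) \<longlonglongrightarrow> Op v i a"
      by (rule LIM_zero_cancel)
    then have "(\<lambda>N. g i a + Op (s N) i a) \<longlonglongrightarrow> g i a + Op v i a"
      by (intro tendsto_intros)
    then have "(\<lambda>N. s (Suc N) i a) \<longlonglongrightarrow> g i a + Op v i a"
      by (simp add: sS)
    then show ?thesis
      using LIMSEQ_unique lim[OF ia] LIMSEQ_Suc by blast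
  qed
  then show ?thesis
    using vb that[of v] unfolding Op_def C_def by blast
qed

lemma power_tail_bound:
  assumes "0 \<le> C" "1 < t" "norm \<zeta> < t" "\<And>n. norm (a n :: complex) * t ^ n \<le> C"
  shows "summable (\<lambda>n. norm (a n * \<zeta> ^ n))"
    "norm \<zeta> \<le> 1 \<Longrightarrow> norm (\<Sum>n. a n * \<zeta> ^ n) \<le> C * (t / (t - 1))"
proof -
  have le: "norm (a n * \<zeta> ^ n) \<le> C * (norm \<zeta> / t) ^ n" for n
  proof -
    have "norm (a n) \<le> C / t ^ n"
      using assms(4)[of n] assms(2) by (simp add: field_simps)
    then have "norm (a n) * norm \<zeta> ^ n \<le> C / t ^ n * norm \<zeta> ^ n"
      by (intro mult_right_mono) auto
    then show ?thesis by (simp add: norm_mult norm_power power_divide)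
  qed
  have g: "summable (\<lambda>n. C * (norm \<zeta> / t) ^ n)"
    using assms by (intro summable_mult summable_geometric) auto
  show s: "summable (\<lambda>n. norm (a n * \<zeta> ^ n))"
    by (rule summable_comparison_test'[OF g, of 0]) (use le in auto)
  assume \<zeta>: "norm \<zeta> \<le> 1"
  have g1: "(\<lambda>n. C * (1 / t) ^ n) sums (C * (1 / (1 - 1 / t)))"
    using assms by (intro sums_mult geometric_sums) auto
  have "norm (\<Sum>n. a n * \<zeta> ^ n) \<le> (\<Sum>n. norm (a n * \<zeta> ^ n))"
    by (rule summable_norm[OF s])
  also have "\<dots> \<le> (\<Sum>n. C * (1 / t) ^ n)"
  proof (rule suminf_le[OF _ s])
    fix n
    have "C * (norm \<zeta> / t) ^ n \<le> C * (1 / t) ^ n"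
      using \<zeta> assms by (intro mult_left_mono power_mono divide_right_mono) auto
    with le[of n] show "norm (a n * \<zeta> ^ n) \<le> C * (1 / t) ^ n" by linarith
  qed (use g1 in \<open>auto simp: sums_iff\<close>)
  also have "\<dots> = C * (t / (t - 1))"
    using g1 assms by (simp add: sums_iff field_simps)
  finally show "norm (\<Sum>n. a n * \<zeta> ^ n) \<le> C * (t / (t - 1))" .
qed

text \<open>
  In \<open>W = (1 + V) (1 + E)\<close>, with \<open>V\<close> a series in \<open>1 / z\<close>, the negative Laurent coefficients of \<open>W\<close>
  vanish if and only if \<open>v = - (e + v * e)\<close> in negative degrees, where \<open>v\<close> and \<open>e\<close> are the coefficients of
  \<open>V\<close> and \<open>E\<close>.  For small \<open>E\<close> this is a contraction in the supremum norm with weights \<open>wt t\<close>, since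
  convolution by \<open>e\<close> has norm at most \<open>wnorm t e\<close>.  The rows of \<open>V\<close> satisfy independent equations.
  The series of \<open>V\<close> need not converge on the circles bounding the annulus of \<open>t\<close>, so \<open>W\<close> is treated on
  the smaller annulus of \<open>s\<close>.
\<close>

lemma factor_near_identity:
  fixes E :: "nat \<Rightarrow> nat \<Rightarrow> complex \<Rightarrow> complex"
  assumes E: "\<And>i j. i < n \<Longrightarrow> j < n \<Longrightarrow> laurent_sum t (E i j) (e i j)"
    and small: "\<And>i j. i < n \<Longrightarrow> j < n \<Longrightarrow> wnorm t (e i j) \<le> \<delta>" "0 \<le> \<delta>" "real n * \<delta> \<le> 1 / 2"
    and t: "1 < t" and s: "1 < s" "s < t"
  obtains V W where
    "\<And>i j. i < n \<Longrightarrow> j < n \<Longrightarrow> V i j holomorphic_on ball 0 t"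
    "\<And>i j \<zeta>. i < n \<Longrightarrow> j < n \<Longrightarrow> norm \<zeta> \<le> 1 \<Longrightarrow> norm (V i j \<zeta>) \<le> 2 * \<delta> * (t / (t - 1))"
    "\<And>i j. i < n \<Longrightarrow> j < n \<Longrightarrow> W i j holomorphic_on ball 0 s"
    "\<And>i j z. i < n \<Longrightarrow> j < n \<Longrightarrow> 1 / s \<le> norm z \<Longrightarrow> norm z \<le> s \<Longrightarrow>
       W i j z = (\<Sum>m<n. ((if i = m then 1 else 0) + V i m (1 / z)) * ((if m = j then 1 else 0) + E m j z))"
proof -
  have t1: "1 \<le> t" and s1: "1 \<le> s" using t s by auto
  have wp: "wt t k > 0" for k using wt_pos[OF t1] .
  \<comment> \<open>The unknown is \<open>u = v * wt t\<close>, so that the weighted norm of \<open>v\<close> is the plain supremum norm of \<open>u\<close>.\<close>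
  define g where "g r j k = - of_real (wt t k) * e r j k" for r j k
  define K where "K j k m l = - of_real (wt t k / wt t l) * e m j (k - l)" for j k m l
  have esum: "(\<lambda>k. norm (e m j k) * wt t k) summable_on UNIV" if "m < n" "j < n" for m j
    using laurent_sum_summable[OF E[OF that]] .
  have K1: "(\<lambda>l. norm (K j k m l)) summable_on {..<0}" "infsum (\<lambda>l. norm (K j k m l)) {..<0} \<le> \<delta>"
    if "m < n" "j < n" for j k m
  proof -
    have r: "(\<lambda>l. norm (e m j (k - l)) * wt t (k - l)) summable_on UNIV"
      "infsum (\<lambda>l. norm (e m j (k - l)) * wt t (k - l)) UNIV = wnorm t (e m j)"
      unfolding wnorm_def
      using summable_on_reindex_bij_witness[of UNIV "\<lambda>l. k - l" "\<lambda>l. k - l" UNIV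
          "\<lambda>l. norm (e m j l) * wt t l" "\<lambda>l. norm (e m j (k - l)) * wt t (k - l)"]
        infsum_reindex_bij_witness[of UNIV "\<lambda>l. k - l" "\<lambda>l. k - l" UNIV
          "\<lambda>l. norm (e m j l) * wt t l" "\<lambda>l. norm (e m j (k - l)) * wt t (k - l)"] esum[OF that]
      by auto
    have r': "(\<lambda>l. norm (e m j (k - l)) * wt t (k - l)) summable_on {..<0}"
      by (rule summable_on_subset[OF r(1)]) auto
    have le: "norm (K j k m l) \<le> norm (e m j (k - l)) * wt t (k - l)" for l
    proof -
      have "wt t k \<le> wt t l * wt t (k - l)" using wt_add[OF t1, of l "k - l"] by simp
      then have "wt t k / wt t l \<le> wt t (k - l)"
        using wp[of l] by (simp add: field_simps)
      then have "(wt t k / wt t l) * norm (e m j (k - l)) \<le> wt t (k - l) * norm (e m j (k - l))"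
        by (intro mult_right_mono) auto
      then show ?thesis
        using wp[of l] wp[of k] by (simp add: K_def norm_mult norm_divide mult_ac)
    qed
    show Ks: "(\<lambda>l. norm (K j k m l)) summable_on {..<0}"
      by (rule summable_on_comparison_test[OF r']) (use le in auto)
    have "infsum (\<lambda>l. norm (K j k m l)) {..<0} \<le> infsum (\<lambda>l. norm (e m j (k - l)) * wt t (k - l)) {..<0}"
      by (rule infsum_mono[OF Ks r']) (use le in auto)
    also have "\<dots> \<le> infsum (\<lambda>l. norm (e m j (k - l)) * wt t (k - l)) UNIV"
      by (rule infsum_mono2[OF r' r(1)]) (use wp in \<open>auto simp: less_imp_le\<close>)
    also have "\<dots> \<le> \<delta>"
      using r(2) small(1)[OF that] by simp
    finally show "infsum (\<lambda>l. norm (K j k m l)) {..<0} \<le> \<delta>" .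
  qed
  define solves where "solves r u \<longleftrightarrow> (\<forall>j<n. \<forall>k<0. norm (u j k) \<le> 2 * \<delta>) \<and>
      (\<forall>j<n. \<forall>k<0. u j k = g r j k + (\<Sum>m<n. infsum (\<lambda>l. K j k m l * u m l) {..<0}))" for r u
  have ex: "\<exists>u. solves r u" if r: "r < n" for r
  proof -
    obtain u where u: "\<And>j k. j \<in> {..<n} \<Longrightarrow> k \<in> {..<0} \<Longrightarrow> norm (u j k) \<le> \<delta> / (1 - 1 / 2)"
      "\<And>j k. j \<in> {..<n} \<Longrightarrow> k \<in> {..<0} \<Longrightarrow> u j k = g r j k + (\<Sum>m<n. infsum (\<lambda>l. K j k m l * u m l) {..<0})"
    proof (rule linear_fixpoint[of "{..<n}" "{..<0 :: int}" "g r" \<delta> K "1 / 2"])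
      fix j k assume jk: "j \<in> {..<n}" "k \<in> {..<0 :: int}"
      then have "norm (e r j k) * wt t k \<le> wnorm t (e r j)"
        using r by (intro wnorm_coeff[OF E t1]) auto
      also have "\<dots> \<le> \<delta>" using jk r by (intro small) auto
      finally show "norm (g r j k) \<le> \<delta>"
        using wp[of k] by (simp add: g_def norm_mult mult_ac)
      have "(\<Sum>m<n. infsum (\<lambda>l. norm (K j k m l)) {..<0}) \<le> (\<Sum>m<n. \<delta>)"
        using jk by (intro sum_mono K1) auto
      then show "(\<Sum>m<n. infsum (\<lambda>l. norm (K j k m l)) {..<0}) \<le> 1 / 2"
        using small(3) by simp
      show "(\<lambda>l. norm (K j k m l)) summable_on {..<0}" if "m \<in> {..<n}" for m
        using K1 jk that by auto
    qed (use small in auto)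
    have "norm (u j k) \<le> 2 * \<delta>" if "j < n" "k < 0" for j k
      using u(1)[of j k] that by simp
    moreover have "u j k = g r j k + (\<Sum>m<n. infsum (\<lambda>l. K j k m l * u m l) {..<0})" if "j < n" "k < 0" for j k
      by (rule u(2)) (use that in auto)
    ultimately show ?thesis unfolding solves_def by blast
  qed
  then have "\<exists>u. \<forall>r\<in>{..<n}. solves r (u r)"
    by (intro bchoice) auto
  then obtain u where "\<forall>r\<in>{..<n}. solves r (u r)" by blast
  then have u: "\<And>r j k. r < n \<Longrightarrow> j < n \<Longrightarrow> k < 0 \<Longrightarrow> norm (u r j k) \<le> 2 * \<delta>"
    "\<And>r j k. r < n \<Longrightarrow> j < n \<Longrightarrow> k < 0 \<Longrightarrow> u r j k = g r j k + (\<Sum>m<n. infsum (\<lambda>l. K j k m l * u r m l) {..<0})"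
    unfolding solves_def by blast+
  define v where "v r j k = (if k < 0 then u r j k / of_real (wt t k) else 0)" for r j k
  define a where "a r j N = v r j (- int N)" for r j N
  have ab: "norm (a r j N) * t ^ N \<le> 2 * \<delta>" if "r < n" "j < n" for r j N
    using u(1)[OF that, of "- int N"] small(2) t wp[of "- int N"]
    by (auto simp: a_def v_def norm_divide norm_power wt_def)
  define V where "V r j \<zeta> = (\<Sum>N. a r j N * \<zeta> ^ N)" for r j \<zeta>
  have pt: "summable (\<lambda>N. norm (a r j N * \<zeta> ^ N))" if "r < n" "j < n" "norm \<zeta> < t" for r j \<zeta>
    by (rule power_tail_bound(1)[OF _ t that(3) ab[OF that(1,2)]]) (use small(2) in auto)
  have Vs: "(\<lambda>N. a r j N * \<zeta> ^ N) sums V r j \<zeta>" if "r < n" "j < n" "norm \<zeta> < t" for r j \<zeta>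
    unfolding V_def by (rule summable_sums[OF summable_norm_cancel[OF pt[OF that]]])
  have Vh: "V r j holomorphic_on ball 0 t" if "r < n" "j < n" for r j
    by (rule power_series_holomorphic[of 0 t "a r j"]) (use Vs that in auto)
  have Vb: "norm (V r j \<zeta>) \<le> 2 * \<delta> * (t / (t - 1))" if "r < n" "j < n" "norm \<zeta> \<le> 1" for r j \<zeta>
    unfolding V_def by (rule power_tail_bound(2)[OF _ t _ ab[OF that(1,2)] that(3)]) (use small(2) t that in auto)
  have va: "v r j k = (if k \<le> 0 then a r j (nat (- k)) else 0)" for r j k
    by (auto simp: a_def v_def)
  have Vl: "laurent_sum s (\<lambda>z. V r j (1 / z)) (v r j)" if rj: "r < n" "j < n" for r j
  proof -
    have "norm (of_real s :: complex) < t" using s by simp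
    from pt[OF rj this] have "summable (\<lambda>N. norm (a r j N) * s ^ N)"
      using small(2) s by (simp add: norm_mult norm_power)
    then show ?thesis
      unfolding va[abs_def] using Vs[OF rj] s by (intro laurent_sum_of_power_series(2)) auto
  qed
  have El: "laurent_sum s (E r j) (e r j)" if "r < n" "j < n" for r j
    using laurent_sum_mono[OF E[OF that] s1] s by simp
  define w where "w r j k = (if r = j \<and> k = 0 then 1 else 0) + e r j k + v r j k + (\<Sum>m<n. conv (v r m) (e m j) k)" for r j k
  define w0 where "w0 r j z = (if r = j then 1 else 0) + E r j z + V r j (1 / z) + (\<Sum>m<n. V r m (1 / z) * E m j z)" for r j z
  have wl: "laurent_sum s (w0 r j) (w r j)" if rj: "r < n" "j < n" for r j
  proof -
    have "laurent_sum s (\<lambda>z. \<Sum>k\<in>{0}. (if r = j \<and> k = 0 then 1 else 0) * z powi k) (\<lambda>k. if r = j \<and> k = 0 then 1 else 0)"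
      by (rule laurent_sum_monomials) auto
    then have 1: "laurent_sum s (\<lambda>z. if r = j then 1 else 0) (\<lambda>k. if r = j \<and> k = 0 then 1 else 0)"
      by (rule laurent_sum_cong) auto
    have 2: "laurent_sum s (\<lambda>z. \<Sum>m<n. V r m (1 / z) * E m j z) (\<lambda>k. \<Sum>m<n. conv (v r m) (e m j) k)"
      using rj s1 by (intro laurent_sum_sum[THEN conjunct1] laurent_sum_mult Vl El) auto
    show ?thesis
      unfolding w_def w0_def using 1 2 rj s1 by (intro laurent_sum_add(1) Vl El)
  qed
  \<comment> \<open>The fixed point equation says that the coefficients of negative index vanish.\<close>
  have w_neg: "w r j k = 0" if rj: "r < n" "j < n" and k: "k < 0" for r j k
  proof -
    have ck: "complex_of_real (wt t k) \<noteq> 0" using wp[of k] by simp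
    have "infsum (\<lambda>l. K j k m l * u r m l) {..<0} = - of_real (wt t k) * conv (v r m) (e m j) k" for m
    proof -
      have "infsum (\<lambda>l. K j k m l * u r m l) {..<0} = infsum (\<lambda>l. - of_real (wt t k) * (v r m l * e m j (k - l))) UNIV"
        by (rule infsum_cong_neutral) (use wp in \<open>auto simp: v_def K_def mult_ac\<close>)
      then show ?thesis
        unfolding conv_def by (simp only: infsum_cmult_right')
    qed
    then have "u r j k = - of_real (wt t k) * (e r j k + (\<Sum>m<n. conv (v r m) (e m j) k))"
      unfolding u(2)[OF rj k] by (simp add: g_def sum_distrib_left distrib_left)
    then have "v r j k = - (e r j k + (\<Sum>m<n. conv (v r m) (e m j) k))"
      using k ck by (simp add: v_def)
    then show ?thesis
      using k by (simp add: w_def)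
  qed
  have "\<exists>F. F holomorphic_on ball 0 s \<and> (\<forall>z. 1 / s \<le> norm z \<longrightarrow> norm z \<le> s \<longrightarrow> F z = w0 r j z)"
    if "r < n" "j < n" for r j
    using laurent_sum_nonneg_holomorphic[OF wl[OF that] s1 w_neg[OF that]] by metis
  then obtain W where W: "\<And>r j. r < n \<Longrightarrow> j < n \<Longrightarrow> W r j holomorphic_on ball 0 s"
    "\<And>r j z. r < n \<Longrightarrow> j < n \<Longrightarrow> 1 / s \<le> norm z \<Longrightarrow> norm z \<le> s \<Longrightarrow> W r j z = w0 r j z"
    by metis
  have w0: "w0 r j z = (\<Sum>m<n. ((if r = m then 1 else 0) + V r m (1 / z)) * ((if m = j then 1 else 0) + E m j z))"
    if rj: "r < n" "j < n" for r j z
  proof -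
    have "(\<Sum>m<n. ((if r = m then 1 else 0) + V r m (1 / z)) * ((if m = j then 1 else 0) + E m j z)) =
        (\<Sum>m<n. (if r = m then (if m = j then 1 else 0) + E m j z else 0) +
          (if m = j then V r m (1 / z) else 0) + V r m (1 / z) * E m j z)"
      by (intro sum.cong refl) (auto simp: algebra_simps)
    also have "\<dots> = w0 r j z"
      using rj by (simp add: sum.distrib w0_def)
    finally show ?thesis ..
  qed
  show ?thesis
    by (rule that[of V W]) (use Vh Vb W w0 in auto)
qed

text \<open>
  Diagonal dominance: the largest coordinate of a vector in the kernel would be smaller than itself.
\<close>

lemma det_nonzero_near_identity:
  fixes A :: "complex mat"
  assumes A: "A \<in> carrier_mat n n"
    and small: "\<And>i. i < n \<Longrightarrow> (\<Sum>j<n. norm (A $$ (i, j) - (if i = j then 1 else 0))) < 1"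
  shows "Determinant.det A \<noteq> 0"
proof
  assume "Determinant.det A = 0"
  then obtain v where v: "v \<in> carrier_vec n" "v \<noteq> 0\<^sub>v n" "A *\<^sub>v v = 0\<^sub>v n"
    using det_0_iff_vec_prod_zero_field[OF A] by auto
  define x where "x j = vec_index v j" for j
  obtain j0 where j0: "j0 < n" "x j0 \<noteq> 0"
    using v by (auto simp: x_def vec_eq_iff)
  obtain i where i: "i < n" "\<And>j. j < n \<Longrightarrow> norm (x j) \<le> norm (x i)"
  proof -
    have ne: "(\<lambda>i. norm (x i)) ` {..<n} \<noteq> {}" using j0 by auto
    have "Max ((\<lambda>i. norm (x i)) ` {..<n}) \<in> (\<lambda>i. norm (x i)) ` {..<n}"
      using ne by (intro Max_in) auto
    then obtain i where "i < n" "norm (x i) = Max ((\<lambda>i. norm (x i)) ` {..<n})" by auto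
    then show ?thesis by (intro that[of i]) auto
  qed
  have xi: "norm (x i) > 0" using i(2)[OF j0(1)] j0(2) by auto
  have "(\<Sum>j<n. A $$ (i, j) * x j) = vec_index (A *\<^sub>v v) i"
    using A v(1) i(1) by (simp add: scalar_prod_def x_def atLeast0LessThan)
  also have "\<dots> = 0" using v i by simp
  finally have "x i = - (\<Sum>j<n. (A $$ (i, j) - (if i = j then 1 else 0)) * x j)"
    using i(1) by (simp add: left_diff_distrib sum_subtractf if_distrib[of "\<lambda>c. c * _"] cong: if_cong)
  then have "norm (x i) \<le> (\<Sum>j<n. norm (A $$ (i, j) - (if i = j then 1 else 0)) * norm (x j))"
    by (metis (no_types, lifting) norm_minus_cancel norm_mult sum_norm_le order_refl)
  also have "\<dots> \<le> (\<Sum>j<n. norm (A $$ (i, j) - (if i = j then 1 else 0)) * norm (x i))"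
    by (intro sum_mono mult_left_mono i) auto
  also have "\<dots> = (\<Sum>j<n. norm (A $$ (i, j) - (if i = j then 1 else 0))) * norm (x i)"
    by (simp add: sum_distrib_right)
  also have "\<dots> < 1 * norm (x i)"
    using small[OF i(1)] xi by (intro mult_strict_right_mono)
  finally show False by simp
qed

section \<open>Birkhoff factorization of meromorphic matrices\<close>

lemma infsum_tail:
  fixes f :: "'a \<Rightarrow> real"
  assumes f: "f summable_on UNIV" "\<And>x. 0 \<le> f x" and "0 < \<epsilon>"
  obtains F where "finite F" "\<And>F'. finite F' \<Longrightarrow> F \<subseteq> F' \<Longrightarrow> infsum f (- F') \<le> \<epsilon>"
proof -
  obtain F where F: "finite F" "dist (sum f F) (infsum f UNIV) \<le> \<epsilon>"
    using infsum_finite_approximation[OF f(1) \<open>0 < \<epsilon>\<close>] by auto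
  show ?thesis
  proof (rule that[OF F(1)])
    fix F' assume F': "finite F'" "F \<subseteq> F'"
    have "infsum f (F' \<union> - F') = infsum f F' + infsum f (- F')"
      by (rule infsum_Un_disjoint) (use F' summable_on_subset[OF f(1)] in auto)
    moreover have "F' \<union> - F' = UNIV" by blast
    moreover have "infsum f F' = sum f F'" using F' by simp
    moreover have "sum f F \<le> sum f F'" by (rule sum_mono2) (use F' f in auto)
    ultimately show "infsum f (- F') \<le> \<epsilon>"
      using F(2) by (auto simp: dist_real_def)
  qed
qed

text \<open>
  Truncating the Laurent series of \<open>N = M\<inverse>\<close> to a finite index set \<open>F\<close> gives a Laurent polynomial \<open>P\<close>
  with \<open>P M = 1 + E\<close>, where \<open>E = - (N - P) M\<close> is as small as desired.  Laurent polynomials are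
  meromorphic on the sphere, so the factor \<open>P\<close> is harmless and only \<open>1 + E\<close> needs to be factored.
\<close>

lemma annulus_factorization:
  fixes M N :: "nat \<Rightarrow> nat \<Rightarrow> complex \<Rightarrow> complex"
  assumes T: "1 < T"
    and M: "\<And>i j. i < n \<Longrightarrow> j < n \<Longrightarrow> M i j holomorphic_on annulus T"
    and N: "\<And>i j. i < n \<Longrightarrow> j < n \<Longrightarrow> N i j holomorphic_on annulus T"
    and NM: "\<And>i j z. i < n \<Longrightarrow> j < n \<Longrightarrow> z \<in> annulus T \<Longrightarrow> (\<Sum>l<n. N i l z * M l j z) = (if i = j then 1 else 0)"
  obtains s V W F p where "1 < s" "s < T" "finite F"
    "\<And>i j. i < n \<Longrightarrow> j < n \<Longrightarrow> V i j holomorphic_on ball 0 s"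
    "\<And>i j. i < n \<Longrightarrow> j < n \<Longrightarrow> W i j holomorphic_on ball 0 s"
    "\<And>i j z. i < n \<Longrightarrow> j < n \<Longrightarrow> 1 / s \<le> norm z \<Longrightarrow> norm z \<le> s \<Longrightarrow>
       (\<Sum>l<n. (\<Sum>m<n. ((if i = m then 1 else 0) + V i m (1 / z)) * (\<Sum>k\<in>F. p m l k * z powi k)) * M l j z) = W i j z"
    "Determinant.det (mat n n (\<lambda>(i, j). W i j 1)) \<noteq> 0"
proof -
  obtain t where t: "1 < t" "t < T" using dense[OF T] by blast
  obtain s where s: "1 < s" "s < t" using dense[OF t(1)] by blast
  have t1: "1 \<le> t" using t by simp
  have wp: "wt t k > 0" for k using wt_pos[OF t1] .
  have sub: "z \<in> annulus T" if "1 / t \<le> norm z" "norm z \<le> t" for z :: complex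
  proof -
    have "1 / T < 1 / t" using t by (intro divide_strict_left_mono) auto
    then show ?thesis using that t by (auto simp: annulus_def)
  qed
  have "\<exists>c. laurent_sum t (M i j) c" "\<exists>c. laurent_sum t (N i j) c" if "i < n" "j < n" for i j
    using laurent_sum_exists[OF M[OF that] t1 t(2)] laurent_sum_exists[OF N[OF that] t1 t(2)] by auto
  then obtain cM cN where cM: "\<And>i j. i < n \<Longrightarrow> j < n \<Longrightarrow> laurent_sum t (M i j) (cM i j)"
    and cN: "\<And>i j. i < n \<Longrightarrow> j < n \<Longrightarrow> laurent_sum t (N i j) (cN i j)"
    by metis
  define c0 where "c0 = t / (t - 1)"
  have c0: "c0 > 0" using t by (simp add: c0_def)
  \<comment> \<open>\<open>\<delta>\<close> bounds \<open>E\<close>, then \<open>2 \<delta> c0\<close> bounds \<open>V\<close> on \<open>\<bar>z\<bar> = 1\<close> and \<open>\<delta> D\<close> bounds \<open>W 1 - 1\<close>.\<close>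
  define D where "D = 1 + 2 * c0 + real n * (2 * c0)"
  have D: "D \<ge> 1" using c0 by (simp add: D_def)
  define \<delta> where "\<delta> = 1 / (2 * (real n + 1) * D)"
  have n1: "2 * (real n + 1) * D \<ge> 2 * (real n + 1)"
    using D mult_left_mono[of 1 D "2 * (real n + 1)"] by simp
  have \<delta>: "\<delta> > 0" "\<delta> \<le> 1" "real n * \<delta> \<le> 1 / 2" "real n * (\<delta> * D) < 1"
  proof -
    have p: "2 * (real n + 1) * D > 0" using D by simp
    show "\<delta> > 0" using p by (simp add: \<delta>_def)
    have "1 \<le> 2 * (real n + 1) * D" using n1 by (rule order_trans[rotated]) simp
    then show "\<delta> \<le> 1" unfolding \<delta>_def by (subst divide_le_eq_1_pos[OF p])
    have "real n * \<delta> = real n / (2 * (real n + 1) * D)" by (simp add: \<delta>_def)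
    also have "\<dots> \<le> real n / (2 * (real n + 1))"
      using n1 by (intro divide_left_mono) (use p in auto)
    also have "\<dots> \<le> 1 / 2" by (simp add: field_simps)
    finally show "real n * \<delta> \<le> 1 / 2" .
    have "real n * (\<delta> * D) = real n / (2 * (real n + 1))" using D by (simp add: \<delta>_def)
    also have "\<dots> < 1" by (simp add: field_simps)
    finally show "real n * (\<delta> * D) < 1" .
  qed
  define C where "C = 1 + (\<Sum>l<n. \<Sum>j<n. wnorm t (cM l j))"
  have C: "C \<ge> 1" by (auto simp: C_def intro!: sum_nonneg wnorm_nonneg t1)
  have Cj: "(\<Sum>l<n. wnorm t (cM l j)) \<le> C" if "j < n" for j
  proof -
    have "wnorm t (cM l j) \<le> (\<Sum>j<n. wnorm t (cM l j))" for l
      using that by (intro member_le_sum wnorm_nonneg t1) auto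
    then have "(\<Sum>l<n. wnorm t (cM l j)) \<le> (\<Sum>l<n. \<Sum>j<n. wnorm t (cM l j))"
      by (intro sum_mono)
    then show ?thesis by (simp add: C_def)
  qed
  have \<delta>C: "\<delta> / C > 0" using \<delta> C by simp
  have "\<exists>F. finite F \<and> (\<forall>F'. finite F' \<longrightarrow> F \<subseteq> F' \<longrightarrow> infsum (\<lambda>k. norm (cN i l k) * wt t k) (- F') \<le> \<delta> / C)"
    if "i < n" "l < n" for i l
    by (rule infsum_tail[OF laurent_sum_summable[OF cN[OF that]] _ \<delta>C]) (use wp in \<open>auto simp: less_imp_le\<close>)
  then obtain G where G: "\<And>i l. i < n \<Longrightarrow> l < n \<Longrightarrow> finite (G i l)"
    "\<And>i l F'. i < n \<Longrightarrow> l < n \<Longrightarrow> finite F' \<Longrightarrow> G i l \<subseteq> F' \<Longrightarrow> infsum (\<lambda>k. norm (cN i l k) * wt t k) (- F') \<le> \<delta> / C"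
    by metis
  \<comment> \<open>One index set serves all entries.\<close>
  define F where "F = (\<Union>i<n. \<Union>l<n. G i l)"
  have F: "finite F" "\<And>i l. i < n \<Longrightarrow> l < n \<Longrightarrow> G i l \<subseteq> F"
    using G(1) by (auto simp: F_def)
  define p where "p i l k = (if k \<in> F then cN i l k else 0)" for i l k
  define d where "d i l k = cN i l k + - p i l k" for i l k
  define P where "P i l z = (\<Sum>k\<in>F. p i l k * z powi k)" for i l and z :: complex
  have Pl: "laurent_sum t (P i l) (p i l)" for i l
    unfolding P_def by (rule laurent_sum_monomials) (use F in \<open>auto simp: p_def\<close>)
  have dl: "laurent_sum t (\<lambda>z. N i l z + - P i l z) (d i l)" if "i < n" "l < n" for i l
    unfolding d_def by (intro laurent_sum_add(1) laurent_sum_uminus(1) Pl cN that t1)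
  have dn: "wnorm t (d i l) \<le> \<delta> / C" if "i < n" "l < n" for i l
  proof -
    have "wnorm t (d i l) = infsum (\<lambda>k. norm (cN i l k) * wt t k) (- F)"
      unfolding wnorm_def by (rule infsum_cong_neutral) (auto simp: d_def p_def)
    also have "\<dots> \<le> \<delta> / C" using that F by (intro G)
    finally show ?thesis .
  qed
  define e where "e i j k = - (\<Sum>l<n. conv (d i l) (cM l j) k)" for i j k
  define E where "E i j z = (\<Sum>l<n. P i l z * M l j z) - (if i = j then 1 else 0)" for i j z
  have El: "laurent_sum t (E i j) (e i j)" and en: "wnorm t (e i j) \<le> \<delta>" if ij: "i < n" "j < n" for i j
  proof -
    note sm = laurent_sum_sum[of "{..<n}" t "\<lambda>l z. (N i l z + - P i l z) * M l j z" "\<lambda>l. conv (d i l) (cM l j)"]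
    have m: "laurent_sum t (\<lambda>z. (N i l z + - P i l z) * M l j z) (conv (d i l) (cM l j))"
      "wnorm t (conv (d i l) (cM l j)) \<le> \<delta> / C * wnorm t (cM l j)" if "l < n" for l
    proof -
      note lm = laurent_sum_mult[OF dl[OF ij(1) that] cM[OF that ij(2)] t1]
      show "laurent_sum t (\<lambda>z. (N i l z + - P i l z) * M l j z) (conv (d i l) (cM l j))" by (rule lm)
      have "wnorm t (d i l) * wnorm t (cM l j) \<le> \<delta> / C * wnorm t (cM l j)"
        by (intro mult_right_mono dn wnorm_nonneg ij that t1)
      with lm(2) show "wnorm t (conv (d i l) (cM l j)) \<le> \<delta> / C * wnorm t (cM l j)" by linarith
    qed
    have a: "laurent_sum t (\<lambda>z. - (\<Sum>l<n. (N i l z + - P i l z) * M l j z)) (e i j)"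
      unfolding e_def using sm m t1 by (intro laurent_sum_uminus) auto
    show "laurent_sum t (E i j) (e i j)"
    proof (rule laurent_sum_cong[OF a])
      fix z :: complex assume "1 / t \<le> norm z" "norm z \<le> t"
      then have "z \<in> annulus T" by (rule sub)
      then show "- (\<Sum>l<n. (N i l z + - P i l z) * M l j z) = E i j z"
        using NM[OF ij] by (simp add: E_def algebra_simps sum_subtractf sum.distrib)
    qed simp
    have "wnorm t (e i j) = wnorm t (\<lambda>k. \<Sum>l<n. conv (d i l) (cM l j) k)"
      unfolding e_def wnorm_def by simp
    also have "\<dots> \<le> (\<Sum>l<n. wnorm t (conv (d i l) (cM l j)))"
      using sm m t1 by auto
    also have "\<dots> \<le> (\<Sum>l<n. \<delta> / C * wnorm t (cM l j))"
      by (intro sum_mono m) auto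
    also have "\<dots> = \<delta> / C * (\<Sum>l<n. wnorm t (cM l j))"
      by (simp add: sum_distrib_left)
    also have "\<dots> \<le> \<delta> / C * C"
      using Cj[OF ij(2)] \<delta>C by (intro mult_left_mono) auto
    finally show "wnorm t (e i j) \<le> \<delta>" using C by simp
  qed
  obtain V W where VW: "\<And>i j. i < n \<Longrightarrow> j < n \<Longrightarrow> V i j holomorphic_on ball 0 t"
    "\<And>i j \<zeta>. i < n \<Longrightarrow> j < n \<Longrightarrow> norm \<zeta> \<le> 1 \<Longrightarrow> norm (V i j \<zeta>) \<le> 2 * \<delta> * (t / (t - 1))"
    "\<And>i j. i < n \<Longrightarrow> j < n \<Longrightarrow> W i j holomorphic_on ball 0 s"
    "\<And>i j z. i < n \<Longrightarrow> j < n \<Longrightarrow> 1 / s \<le> norm z \<Longrightarrow> norm z \<le> s \<Longrightarrow>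
       W i j z = (\<Sum>m<n. ((if i = m then 1 else 0) + V i m (1 / z)) * ((if m = j then 1 else 0) + E m j z))"
  proof (rule factor_near_identity[of n t E e \<delta> s])
    show "laurent_sum t (E i j) (e i j)" "wnorm t (e i j) \<le> \<delta>" if "i < n" "j < n" for i j
      using that by (rule El en)+
  qed (use \<delta> t s in \<open>auto intro: less_imp_le\<close>)
  have ts: "ball 0 s \<subseteq> ball (0 :: complex) t" using s by auto
  show ?thesis
  proof (rule that[of s F V W p])
    show "1 < s" "s < T" "finite F" using s t F by auto
    show "V i j holomorphic_on ball 0 s" "W i j holomorphic_on ball 0 s" if "i < n" "j < n" for i j
      using VW(3)[OF that] holomorphic_on_subset[OF VW(1)[OF that] ts] by auto
  next
    fix i j :: nat and z :: complex assume ij: "i < n" "j < n" and z: "1 / s \<le> norm z" "norm z \<le> s"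
    have "(\<Sum>l<n. (\<Sum>m<n. ((if i = m then 1 else 0) + V i m (1 / z)) * P m l z) * M l j z) =
        (\<Sum>m<n. ((if i = m then 1 else 0) + V i m (1 / z)) * (\<Sum>l<n. P m l z * M l j z))"
      unfolding sum_distrib_left sum_distrib_right by (subst sum.swap) (simp add: mult_ac)
    also have "\<dots> = W i j z"
      unfolding VW(4)[OF ij z] by (simp add: E_def)
    finally show "(\<Sum>l<n. (\<Sum>m<n. ((if i = m then 1 else 0) + V i m (1 / z)) * (\<Sum>k\<in>F. p m l k * z powi k)) * M l j z) = W i j z"
      unfolding P_def .
  next
    show "Determinant.det (mat n n (\<lambda>(i, j). W i j 1)) \<noteq> 0"
    proof (rule det_nonzero_near_identity[of _ n])
      fix i assume i: "i < n"
      have b: "norm (W i j 1 - (if i = j then 1 else 0)) \<le> \<delta> * D" if j: "j < n" for j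
      proof -
        have Eb: "norm (E m j 1) \<le> \<delta>" if "m < n" for m
          using laurent_sum_bound[OF El[OF that j] t1, of 1] en[OF that j] t by auto
        have Vb: "norm (V i m 1) \<le> 2 * \<delta> * c0" if "m < n" for m
          using VW(2)[OF i that, of 1] by (simp add: c0_def)
        have "W i j 1 = (\<Sum>m<n. ((if i = m then 1 else 0) + V i m (1 / 1)) * ((if m = j then 1 else 0) + E m j 1))"
          using s by (intro VW(4) i j) auto
        also have "\<dots> = (\<Sum>m<n. (if i = m then (if m = j then 1 else 0) + E m j 1 else 0) +
          (if m = j then V i m 1 else 0) + V i m 1 * E m j 1)"
          by (intro sum.cong refl) (auto simp: algebra_simps)
        finally have "W i j 1 - (if i = j then 1 else 0) = E i j 1 + V i j 1 + (\<Sum>m<n. V i m 1 * E m j 1)"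
          using i j by (simp add: sum.distrib)
        also have "norm \<dots> \<le> norm (E i j 1) + norm (V i j 1) + norm (\<Sum>m<n. V i m 1 * E m j 1)"
          by (intro order_trans[OF norm_triangle_ineq] add_mono norm_triangle_ineq order_refl)
        also have "norm (\<Sum>m<n. V i m 1 * E m j 1) \<le> (\<Sum>m<n. 2 * \<delta> * c0 * \<delta>)"
          by (intro sum_norm_le) (use Vb Eb \<delta>(1) c0 in \<open>auto simp: norm_mult intro!: mult_mono\<close>)
        also have "\<dots> = real n * (2 * \<delta> * c0) * \<delta>" by simp
        also have "\<dots> \<le> real n * (2 * \<delta> * c0) * 1"
          using \<delta> c0 by (intro mult_left_mono) auto
        finally have "norm (W i j 1 - (if i = j then 1 else 0)) \<le> \<delta> + 2 * \<delta> * c0 + real n * (2 * \<delta> * c0)"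
          using Eb[OF i] Vb[OF j] by simp
        then show ?thesis by (simp add: D_def algebra_simps)
      qed
      have "(\<Sum>j<n. norm (mat n n (\<lambda>(i, j). W i j 1) $$ (i, j) - (if i = j then 1 else 0))) =
          (\<Sum>j<n. norm (W i j 1 - (if i = j then 1 else 0)))"
        using i by (intro sum.cong) auto
      also have "\<dots> \<le> (\<Sum>j<n. \<delta> * D)" by (intro sum_mono b) auto
      also have "\<dots> < 1" using \<delta>(4) by simp
      finally show "(\<Sum>j<n. norm (mat n n (\<lambda>(i, j). W i j 1) $$ (i, j) - (if i = j then 1 else 0))) < 1" .
    qed simp
  qed
qed

subsection \<open>Matrices of meromorphic functions\<close>

lemma abs_mero_prod:
  assumes "finite I" "\<And>i. i \<in> I \<Longrightarrow> f i meromorphic_on -{0}"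
  shows "(\<Prod>i\<in>I. abs_mero (f i)) = abs_mero (\<lambda>z. \<Prod>i\<in>I. f i z) \<and> (\<lambda>z. \<Prod>i\<in>I. f i z) meromorphic_on -{0}"
  using assms
proof (induction I)
  case (insert i I)
  then show ?case
    by (auto simp: abs_mero_mult intro!: meromorphic_on_mult)
qed (auto simp: abs_mero_one)

lemma abs_mero_of_int: "of_int k = abs_mero (\<lambda>_. of_int k)"
proof -
  have n: "of_nat m = abs_mero (\<lambda>_. of_nat m)" for m
    by (induction m) (auto simp: abs_mero_zero abs_mero_one abs_mero_add)
  show ?thesis
    by (cases k rule: int_cases2) (auto simp: n abs_mero_uminus)
qed

lemma det_abs_mero:
  assumes "\<And>i j. i < n \<Longrightarrow> j < n \<Longrightarrow> f i j meromorphic_on -{0}"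
  shows "Determinant.det (mat n n (\<lambda>(i, j). abs_mero (f i j))) =
      abs_mero (\<lambda>z. Determinant.det (mat n n (\<lambda>(i, j). f i j z)))"
    "(\<lambda>z. Determinant.det (mat n n (\<lambda>(i, j). f i j z))) meromorphic_on -{0}"
proof -
  let ?P = "{p. p permutes {0..<n}}"
  have pr: "(\<Prod>i = 0..<n. abs_mero (f i (p i))) = abs_mero (\<lambda>z. \<Prod>i = 0..<n. f i (p i) z)"
    "(\<lambda>z. \<Prod>i = 0..<n. f i (p i) z) meromorphic_on -{0}" if "p \<in> ?P" for p
    using abs_mero_prod[of "{0..<n}" "\<lambda>i. f i (p i)"] assms that by (auto simp: permutes_in_image)
  have d1: "Determinant.det (mat n n (\<lambda>(i, j). g i j)) = (\<Sum>p\<in>?P. signof p * (\<Prod>i = 0..<n. g i (p i)))"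
    for g :: "nat \<Rightarrow> nat \<Rightarrow> 'b :: comm_ring_1"
    unfolding Determinant.det_def
    by (auto intro!: sum.cong prod.cong arg_cong2[of _ _ _ _ "(*)"] simp: permutes_in_image)
  have sg: "signof p = abs_mero (\<lambda>_. signof p)" for p :: "nat \<Rightarrow> nat"
    using abs_mero_of_int[of "sign p"] by simp
  have tm: "signof p * (\<Prod>i = 0..<n. abs_mero (f i (p i))) = abs_mero (\<lambda>z. signof p * (\<Prod>i = 0..<n. f i (p i) z))"
    "(\<lambda>z. signof p * (\<Prod>i = 0..<n. f i (p i) z)) meromorphic_on -{0}" if "p \<in> ?P" for p
    using pr[OF that] by (auto simp: sg abs_mero_mult intro!: meromorphic_on_mult)
  show "Determinant.det (mat n n (\<lambda>(i, j). abs_mero (f i j))) =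
      abs_mero (\<lambda>z. Determinant.det (mat n n (\<lambda>(i, j). f i j z)))"
    unfolding d1 using tm abs_mero_sum[of ?P "\<lambda>p z. signof p * (\<Prod>i = 0..<n. f i (p i) z)"] by simp
  show "(\<lambda>z. Determinant.det (mat n n (\<lambda>(i, j). f i j z))) meromorphic_on -{0}"
    unfolding d1 using tm by (auto intro!: meromorphic_on_sum)
qed

lemma mat_mult_index:
  assumes "A \<in> carrier_mat n m" "B \<in> carrier_mat m l" "i < n" "j < l"
  shows "(A * B) $$ (i, j) = (\<Sum>k<m. A $$ (i, k) * B $$ (k, j))"
  using assms by (simp add: scalar_prod_def atLeast0LessThan)

lemma meromorphic_glue:
  assumes F: "F meromorphic_on {z. norm z < R}" and G: "G meromorphic_on {z. r < norm z}"
    and r: "0 < r" "r < \<rho>" "\<rho> < R"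
    and eq: "\<And>z. r < norm z \<Longrightarrow> norm z < R \<Longrightarrow> F z = G z"
  defines "H \<equiv> \<lambda>z :: complex. if norm z < \<rho> then F z else G z"
  shows "H meromorphic_on UNIV"
    "\<And>z. r < norm z \<Longrightarrow> H z = G z"
    "\<And>z. norm z < R \<Longrightarrow> H z = F z"
proof -
  show HG: "H z = G z" if "r < norm z" for z
    using that r eq[of z] by (auto simp: H_def)
  show HF: "H z = F z" if "norm z < R" for z
    using that r eq[of z] by (auto simp: H_def)
  have o: "open {z :: complex. norm z < R}" "open {z :: complex. r < norm z}"
    by (auto intro!: open_Collect_less continuous_intros)
  have "H meromorphic_on {z. norm z < R}"
  proof (rule meromorphic_on_cong[THEN iffD2, OF _ refl F])
    fix z :: complex assume "z \<in> {z. norm z < R}"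
    then have "eventually (\<lambda>z. z \<in> {z. norm z < R}) (at z)" using o by (intro eventually_at_in_open')
    then show "eventually (\<lambda>z. H z = F z) (at z)" by eventually_elim (auto simp: HF)
  qed
  moreover have "H meromorphic_on {z. r < norm z}"
  proof (rule meromorphic_on_cong[THEN iffD2, OF _ refl G])
    fix z :: complex assume "z \<in> {z. r < norm z}"
    then have "eventually (\<lambda>z. z \<in> {z. r < norm z}) (at z)" using o by (intro eventually_at_in_open')
    then show "eventually (\<lambda>z. H z = G z) (at z)" by eventually_elim (auto simp: HG)
  qed
  moreover have "{z :: complex. norm z < R} \<union> {z. r < norm z} = UNIV" using r by auto
  ultimately show "H meromorphic_on UNIV"
    using meromorphic_on_Un by metis
qed

text \<open>
  The exceptional points in the ring \<open>1 \<le> \<bar>z\<bar> \<le> 2\<close> are finite in number, so some radius in between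
  keeps a positive distance from all their moduli.
\<close>

lemma cosparse_avoiding_annulus:
  assumes "\<forall>\<^sub>\<approx>z\<in>-{0 :: complex}. Q z"
  obtains \<rho> T where "0 < \<rho>" "1 < T" "\<And>z. \<rho> / T < norm z \<Longrightarrow> norm z < \<rho> * T \<Longrightarrow> Q z"
proof -
  define K where "K = cball (0 :: complex) 2 - ball 0 1"
  have "{z. \<not> Q z} sparse_in -{0}"
    using assms by (simp add: eventually_cosparse)
  then have "{z. \<not> Q z} sparse_in K"
    by (rule sparse_in_subset) (auto simp: K_def)
  moreover have "compact K" unfolding K_def by (intro compact_diff) auto
  ultimately have fin: "finite (K \<inter> {z. \<not> Q z})"
    by (intro sparse_in_compact_finite) auto
  define B where "B = norm ` (K \<inter> {z. \<not> Q z}) \<union> {1, 2}"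
  have "finite B" using fin by (simp add: B_def)
  then have "open ({1<..<2} - B)"
    by (intro open_Diff finite_imp_closed) auto
  moreover have "infinite {1<..<2 :: real}" by simp
  then have "{1<..<2} - B \<noteq> {}"
    using \<open>finite B\<close> by (metis Diff_eq_empty_iff finite_subset)
  then obtain \<rho> where \<rho>: "\<rho> \<in> {1<..<2} - B" by blast
  ultimately obtain e where e: "e > 0" "ball \<rho> e \<subseteq> {1<..<2} - B"
    by (meson openE)
  define T where "T = 1 + min 1 (e / 4)"
  have T: "1 < T" "T \<le> 1 + e / 4" "T \<le> 2" using e by (auto simp: T_def)
  show ?thesis
  proof (rule that[of \<rho> T])
    fix z :: complex assume z: "\<rho> / T < norm z" "norm z < \<rho> * T"
    have r2: "1 < \<rho>" "\<rho> < 2" using \<rho> by auto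
    have "\<rho> * T \<le> \<rho> * (1 + e / 4)" using T r2 by (intro mult_left_mono) auto
    also have "\<dots> < \<rho> + e" using r2 e by (simp add: algebra_simps)
    finally have u: "norm z < \<rho> + e" using z by linarith
    have "\<rho> - \<rho> / T = \<rho> * (T - 1) / T" using T by (simp add: field_simps)
    also have "\<dots> \<le> \<rho> * (T - 1) / 1" using T r2 by (intro divide_left_mono) auto
    also have "\<dots> \<le> \<rho> * (e / 4)" using T r2 by simp
    also have "\<dots> < e" using r2 e by simp
    finally have l: "\<rho> - e < norm z" using z by linarith
    have "norm z \<in> ball \<rho> e" using u l by (auto simp: dist_real_def)
    then have *: "norm z \<in> {1<..<2} - B" using e(2) by blast
    then have "z \<in> K" by (auto simp: K_def)
    with * show "Q z" by (auto simp: B_def)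
  qed (use \<rho> T in auto)
qed

text \<open>
  On an annulus around a circle \<open>\<bar>z\<bar> = \<rho>\<close> where \<open>M\<close> and \<open>M\<inverse>\<close> are analytic, \<open>Y M = W\<close> with \<open>W\<close>
  analytic inside and \<open>Y = (1 + V) P\<close> meromorphic outside, including infinity.  The matrix \<open>M0\<close> is \<open>W\<close>
  inside and \<open>Y M\<close> outside, and \<open>Mi\<close> is \<open>W M\<inverse>\<close> inside and \<open>Y\<close> outside.  As \<open>W\<close> is invertible at a
  point of the circle, \<open>det M0\<close> does not vanish identically.
\<close>

theorem birkhoff_factorization:
  assumes M: "M \<in> GL n (UNIV :: mero set)"
  obtains M0 Mi where "M0 \<in> GL n mero_plane" "Mi \<in> GL n mero_inf" "Mi * M = M0"
proof -
  have Mc: "M \<in> carrier_mat n n" and Nc: "inv_mat M \<in> carrier_mat n n"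
    using GL_carrier[OF M] GL_inv_carrier[OF M] by auto
  have "\<exists>f. f meromorphic_on -{0} \<and> a = abs_mero f" for a
    by (rule mero_cases[of a]) blast
  then obtain rp where rp: "\<And>a. rp a meromorphic_on -{0}" "\<And>a. a = abs_mero (rp a)"
    by metis
  define f g where "f i j = rp (M $$ (i, j))" and "g i j = rp (inv_mat M $$ (i, j))" for i j
  have fm: "f i j meromorphic_on -{0}" "M $$ (i, j) = abs_mero (f i j)"
    and gm: "g i j meromorphic_on -{0}" "inv_mat M $$ (i, j) = abs_mero (g i j)" for i j
    using rp by (auto simp: f_def g_def)
  have one: "\<forall>\<^sub>\<approx>z\<in>-{0}. (\<Sum>l<n. u i l z * v l j z) = (if i = j then 1 else 0)"
    if u: "\<And>i j. u i j meromorphic_on -{0}" "\<And>i j. A $$ (i, j) = abs_mero (u i j)" "A \<in> carrier_mat n n"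
      and v: "\<And>i j. v i j meromorphic_on -{0}" "\<And>i j. B $$ (i, j) = abs_mero (v i j)" "B \<in> carrier_mat n n"
      and AB: "A * B = 1\<^sub>m n" and ij: "i < n" "j < n" for A B u v i j
  proof -
    have "abs_mero (\<lambda>z. \<Sum>l<n. u i l z * v l j z) = (A * B) $$ (i, j)"
      unfolding mat_mult_index[OF u(3) v(3) ij]
      by (simp add: u(1,2) v(1,2) abs_mero_mult abs_mero_sum meromorphic_on_mult)
    also have "\<dots> = abs_mero (\<lambda>z. if i = j then 1 else 0)"
      using ij by (simp add: AB flip: abs_mero_zero abs_mero_one)
    finally show ?thesis
      by (subst (asm) abs_mero_eq_iff) (auto intro!: meromorphic_intros u v)
  qed
  define Q where "Q z \<longleftrightarrow> (\<forall>i\<in>{..<n}. \<forall>j\<in>{..<n}. f i j analytic_on {z} \<and> g i j analytic_on {z} \<and>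
      (\<Sum>l<n. g i l z * f l j z) = (if i = j then 1 else 0) \<and>
      (\<Sum>l<n. f i l z * g l j z) = (if i = j then 1 else 0))" for z
  have "\<forall>\<^sub>\<approx>z\<in>-{0}. Q z"
    unfolding Q_def
    using meromorphic_on_imp_analytic_cosparse[OF fm(1)] meromorphic_on_imp_analytic_cosparse[OF gm(1)]
      one[OF gm Nc fm Mc GL_inv_mat(3)[OF M]] one[OF fm Mc gm Nc GL_inv_mat(2)[OF M]]
    by (intro eventually_ball_finite ballI eventually_conj finite_lessThan) auto
  then obtain \<rho> T where \<rho>: "0 < \<rho>" "1 < T" "\<And>z. \<rho> / T < norm z \<Longrightarrow> norm z < \<rho> * T \<Longrightarrow> Q z"
    using cosparse_avoiding_annulus[of Q] by blast
  have Qa: "Q (of_real \<rho> * w)" if "w \<in> annulus T" for w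
    using that \<rho> by (intro \<rho>(3)) (auto simp: annulus_def norm_mult field_simps)
  have hol: "(\<lambda>w. h (of_real \<rho> * w)) holomorphic_on annulus T"
    if "\<And>w. w \<in> annulus T \<Longrightarrow> h analytic_on {of_real \<rho> * w}" for h
  proof (rule analytic_imp_holomorphic, subst analytic_on_analytic_at, rule ballI)
    fix w assume "w \<in> annulus T"
    then have "(h \<circ> (\<lambda>w. of_real \<rho> * w)) analytic_on {w}"
      using that by (intro analytic_on_compose) (auto intro!: analytic_intros)
    then show "(\<lambda>w. h (of_real \<rho> * w)) analytic_on {w}" by (simp add: o_def)
  qed
  obtain s V W F p where s: "1 < s" "s < T" and F: "finite F"
    and V: "\<And>i j. i < n \<Longrightarrow> j < n \<Longrightarrow> V i j holomorphic_on ball 0 s"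
    and W: "\<And>i j. i < n \<Longrightarrow> j < n \<Longrightarrow> W i j holomorphic_on ball 0 s"
    and VW: "\<And>i j z. i < n \<Longrightarrow> j < n \<Longrightarrow> 1 / s \<le> norm z \<Longrightarrow> norm z \<le> s \<Longrightarrow>
       (\<Sum>l<n. (\<Sum>m<n. ((if i = m then 1 else 0) + V i m (1 / z)) * (\<Sum>k\<in>F. p m l k * z powi k)) * f l j (of_real \<rho> * z)) = W i j z"
    and dW: "Determinant.det (mat n n (\<lambda>(i, j). W i j 1)) \<noteq> 0"
  proof (rule annulus_factorization[of T n "\<lambda>i j w. f i j (of_real \<rho> * w)" "\<lambda>i j w. g i j (of_real \<rho> * w)"])
    show "1 < T" by (rule \<rho>)
    show "(\<lambda>w. f i j (of_real \<rho> * w)) holomorphic_on annulus T"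
      "(\<lambda>w. g i j (of_real \<rho> * w)) holomorphic_on annulus T" if "i < n" "j < n" for i j
      using Qa that by (auto intro!: hol simp: Q_def)
    show "(\<Sum>l<n. g i l (of_real \<rho> * w) * f l j (of_real \<rho> * w)) = (if i = j then 1 else 0)"
      if "i < n" "j < n" "w \<in> annulus T" for i j w
      using Qa[OF that(3)] that(1,2) by (auto simp: Q_def)
  qed blast
  define r R where "r = \<rho> / s" and "R = \<rho> * s"
  have rR: "0 < r" "r < \<rho>" "\<rho> < R" using s \<rho> by (auto simp: r_def R_def field_simps)
  have QrR: "Q z" if "r < norm z" "norm z < R" for z
  proof (rule \<rho>(3))
    have "\<rho> / T < \<rho> / s" "\<rho> * s < \<rho> * T"
      using \<rho> s by (auto intro!: divide_strict_left_mono mult_strict_left_mono)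
    then show "\<rho> / T < norm z" "norm z < \<rho> * T" using that by (auto simp: r_def R_def)
  qed
  define Ws where "Ws i j z = W i j (z / of_real \<rho>)" for i j z
  define Ys where "Ys i l z = (\<Sum>m<n. ((if i = m then 1 else 0) + V i m (of_real \<rho> / z)) * (\<Sum>k\<in>F. p m l k * (z / of_real \<rho>) powi k))" for i l z
  have WY: "(\<Sum>l<n. Ys i l z * f l j z) = Ws i j z" if "i < n" "j < n" "r < norm z" "norm z < R" for i j z
  proof -
    have "1 / s \<le> norm (z / of_real \<rho>)" "norm (z / of_real \<rho>) \<le> s"
      using that \<rho> s by (auto simp: r_def R_def norm_divide field_simps)
    from VW[OF that(1,2) this] show ?thesis
      using \<rho> by (simp add: Ys_def Ws_def)
  qed
  have Wh: "Ws i j holomorphic_on {z. norm z < R}" if ij: "i < n" "j < n" for i j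
  proof -
    have "(W i j \<circ> (\<lambda>z. z / of_real \<rho>)) holomorphic_on {z. norm z < R}"
      by (rule holomorphic_on_compose_gen[OF _ W[OF ij]])
         (use \<rho> in \<open>auto intro!: holomorphic_intros simp: R_def norm_divide field_simps\<close>)
    then show ?thesis by (simp add: Ws_def[abs_def] o_def)
  qed
  have oR: "open {z :: complex. norm z < R}" "open {z :: complex. r < norm z}"
    by (auto intro!: open_Collect_less continuous_intros)
  have Wm: "Ws i j meromorphic_on {z. norm z < R}" if "i < n" "j < n" for i j
    using Wh[OF that] oR by (intro analytic_on_imp_meromorphic_on) (simp add: analytic_on_open)
  have Ym: "Ys i l meromorphic_on {z. r < norm z}" if il: "i < n" "l < n" for i l
  proof -
    have "(\<lambda>z. V i m (of_real \<rho> / z)) meromorphic_on {z. r < norm z}" if m: "m < n" for m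
    proof (rule meromorphic_on_compose[of "V i m" "ball 0 s" "\<lambda>z. of_real \<rho> / z"])
      show "V i m meromorphic_on ball 0 s"
        using V[OF il(1) m] by (intro analytic_on_imp_meromorphic_on) (simp add: analytic_on_open)
      show "(\<lambda>z :: complex. of_real \<rho> / z) analytic_on {z. r < norm z}"
        using rR by (auto intro!: analytic_intros)
      show "(\<lambda>z :: complex. of_real \<rho> / z) ` {z. r < norm z} \<subseteq> ball 0 s"
      proof (rule image_subsetI)
        fix z :: complex assume "z \<in> {z. r < norm z}"
        then have z: "r < norm z" by simp
        then have "norm z > 0" using rR by linarith
        then show "of_real \<rho> / z \<in> ball 0 s"
          using z \<rho> s by (simp add: r_def norm_divide field_simps)
      qed
    qed
    then show ?thesis
      unfolding Ys_def by (auto intro!: meromorphic_intros)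
  qed
  have Yi: "(\<lambda>w. Ys i l (1 / w)) meromorphic_on {0}" if il: "i < n" "l < n" for i l
  proof -
    have "(\<lambda>w. V i m (of_real \<rho> / (1 / w))) meromorphic_on {0}" if m: "m < n" for m
    proof (rule meromorphic_on_compose[of "V i m" "ball 0 s" "\<lambda>w. of_real \<rho> / (1 / w)"])
      show "V i m meromorphic_on ball 0 s"
        using V[OF il(1) m] by (intro analytic_on_imp_meromorphic_on) (simp add: analytic_on_open)
      show "(\<lambda>w. of_real \<rho> / (1 / w)) analytic_on {0}"
        by (auto intro!: analytic_intros)
    qed (use s in auto)
    then show ?thesis
      unfolding Ys_def by (auto intro!: meromorphic_intros)
  qed
  define A where "A = {z :: complex. norm z < R} - {0}"
  define Wg where "Wg i l z = (\<Sum>j<n. Ws i j z * g j l z)" for i l z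
  define Yf where "Yf i j z = (\<Sum>l<n. Ys i l z * f l j z)" for i j z
  have Yfm: "Yf i j meromorphic_on {z. r < norm z}" if "i < n" for i j
    unfolding Yf_def using that rR
    by (auto intro!: meromorphic_intros Ym meromorphic_on_subset[OF fm(1)])
  define h0 where "h0 i j z = (if norm z < \<rho> then Ws i j z else Yf i j z)" for i j and z :: complex
  note glue0 = meromorphic_glue[OF Wm Yfm rR WY[symmetric, folded Yf_def]]
  have h0: "h0 i j meromorphic_on UNIV" "\<And>z. r < norm z \<Longrightarrow> h0 i j z = Yf i j z"
    "\<And>z. norm z < R \<Longrightarrow> h0 i j z = Ws i j z" if "i < n" "j < n" for i j
    unfolding h0_def using glue0[OF that that(1) that] by auto
  \<comment> \<open>The value \<open>0\<close> at the origin is arbitrary: \<open>Mi\<close> lives on the sphere minus the origin.\<close>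
  define hi where "hi i l z = (if norm z < \<rho> then (if z = 0 then 0 else Wg i l z) else Ys i l z)" for i l and z :: complex
  have WgY: "Wg i l z = Ys i l z" if il: "i < n" "l < n" and z: "r < norm z" "norm z < R" for i l z
  proof -
    have "Wg i l z = (\<Sum>j<n. (\<Sum>k<n. Ys i k z * f k j z) * g j l z)"
      unfolding Wg_def using WY[OF il(1) _ z] by simp
    also have "\<dots> = (\<Sum>k<n. Ys i k z * (\<Sum>j<n. f k j z * g j l z))"
      unfolding sum_distrib_left sum_distrib_right by (subst sum.swap) (simp add: mult_ac)
    also have "\<dots> = (\<Sum>k<n. Ys i k z * (if k = l then 1 else 0))"
      using QrR[OF z] il by (intro sum.cong) (auto simp: Q_def)
    finally show ?thesis using il by (simp add: if_distrib cong: if_cong)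
  qed
  have him: "hi i l meromorphic_on -{0}" "\<And>z. r < norm z \<Longrightarrow> hi i l z = Ys i l z"
    "\<And>z. z \<noteq> 0 \<Longrightarrow> norm z < R \<Longrightarrow> hi i l z = Wg i l z" if il: "i < n" "l < n" for i l
  proof -
    show hY: "hi i l z = Ys i l z" if "r < norm z" for z
      using that rR WgY[OF il, of z] by (auto simp: hi_def)
    show hW: "hi i l z = Wg i l z" if "z \<noteq> 0" "norm z < R" for z
      using that rR WgY[OF il, of z] by (auto simp: hi_def)
    have oA: "open A" unfolding A_def using oR by auto
    have Wgm: "Wg i l meromorphic_on A"
      unfolding Wg_def A_def using il
      by (auto intro!: meromorphic_intros intro: meromorphic_on_subset[OF Wm] meromorphic_on_subset[OF gm(1)])
    have "hi i l meromorphic_on A"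
    proof (rule meromorphic_on_cong[THEN iffD2, OF _ refl Wgm])
      fix z assume "z \<in> A"
      then have "eventually (\<lambda>z. z \<in> A) (at z)" using oA by (intro eventually_at_in_open')
      then show "eventually (\<lambda>z. hi i l z = Wg i l z) (at z)"
        by eventually_elim (auto simp: A_def hW)
    qed
    moreover have "hi i l meromorphic_on {z. r < norm z}"
    proof (rule meromorphic_on_cong[THEN iffD2, OF _ refl Ym[OF il]])
      fix z :: complex assume "z \<in> {z. r < norm z}"
      then have "eventually (\<lambda>z. z \<in> {z. r < norm z}) (at z)" using oR by (intro eventually_at_in_open')
      then show "eventually (\<lambda>z. hi i l z = Ys i l z) (at z)"
        by eventually_elim (auto simp: hY)
    qed
    ultimately have "hi i l meromorphic_on (A \<union> {z. r < norm z})" by (rule meromorphic_on_Un)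
    then show "hi i l meromorphic_on -{0}"
      by (rule meromorphic_on_subset) (use rR in \<open>auto simp: A_def\<close>)
  qed
  have hi_inf: "(\<lambda>w. hi i l (1 / w)) meromorphic_on {0}" if il: "i < n" "l < n" for i l
  proof (rule meromorphic_on_cong[THEN iffD2, OF _ refl Yi[OF il]])
    fix z :: complex assume "z \<in> {0}"
    have "eventually (\<lambda>w :: complex. w \<in> ball 0 (1 / r) - {0}) (at 0)"
      using rR by (intro eventually_at_in_open) auto
    then have "eventually (\<lambda>w. hi i l (1 / w) = Ys i l (1 / w)) (at 0)"
      by eventually_elim (use rR in \<open>auto intro!: him(2)[OF il] simp: norm_divide field_simps\<close>)
    then show "eventually (\<lambda>w. hi i l (1 / w) = Ys i l (1 / w)) (at z)" using \<open>z \<in> {0}\<close> by simp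
  qed
  define M0 where "M0 = mat n n (\<lambda>(i, j). abs_mero (h0 i j))"
  define Mi where "Mi = mat n n (\<lambda>(i, j). abs_mero (hi i j))"
  have M0: "M0 \<in> Mat n n mero_plane"
    using h0(1) by (auto simp: Mat_iff M0_def intro!: mero_plane_I)
  have Mi: "Mi \<in> Mat n n mero_inf"
    using him(1) hi_inf by (auto simp: Mat_iff Mi_def mero_inf_def)
  have prod: "Mi * M = M0"
  proof (rule eq_matI)
    fix i j assume "i < dim_row M0" "j < dim_col M0"
    then have ij: "i < n" "j < n" by (auto simp: M0_def)
    have "(Mi * M) $$ (i, j) = (\<Sum>l<n. abs_mero (hi i l) * abs_mero (f l j))"
      unfolding mat_mult_index[OF MatD(1)[OF Mi] Mc ij] using ij by (simp add: Mi_def fm(2))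
    also have "\<dots> = abs_mero (\<lambda>z. \<Sum>l<n. hi i l z * f l j z)"
      using ij him(1) fm(1) abs_mero_sum[of "{..<n}" "\<lambda>l z. hi i l z * f l j z"]
      by (simp add: abs_mero_mult meromorphic_on_mult)
    also have "\<dots> = abs_mero (h0 i j)"
    proof (rule abs_mero_eqI)
      show "(\<lambda>z. \<Sum>l<n. hi i l z * f l j z) meromorphic_on -{0}"
        using ij him(1) fm(1) by (auto intro!: meromorphic_intros)
      have "\<forall>\<^sub>\<approx>z\<in>-{0 :: complex}. z \<in> -{0}"
        by (intro eventually_in_cosparse) auto
      then show "\<forall>\<^sub>\<approx>z\<in>-{0}. (\<Sum>l<n. hi i l z * f l j z) = h0 i j z"
        using \<open>\<forall>\<^sub>\<approx>z\<in>-{0}. Q z\<close>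
      proof eventually_elim
        case (elim z)
        show ?case
        proof (cases "r < norm z")
          case True
          then show ?thesis using ij by (simp add: him(2) h0(2) Yf_def)
        next
          case False
          then have z: "z \<noteq> 0" "norm z < R" using elim rR by auto
          have "(\<Sum>l<n. hi i l z * f l j z) = (\<Sum>l<n. (\<Sum>k<n. Ws i k z * g k l z) * f l j z)"
            using ij z him(3) by (simp add: Wg_def)
          also have "\<dots> = (\<Sum>k<n. Ws i k z * (\<Sum>l<n. g k l z * f l j z))"
            unfolding sum_distrib_left sum_distrib_right by (subst sum.swap) (simp add: mult_ac)
          also have "\<dots> = (\<Sum>k<n. Ws i k z * (if k = j then 1 else 0))"
            using elim ij by (intro sum.cong) (auto simp: Q_def)
          also have "\<dots> = h0 i j z"
            using ij z h0(3) by (simp add: if_distrib cong: if_cong)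
          finally show ?thesis .
        qed
      qed
    qed
    finally show "(Mi * M) $$ (i, j) = M0 $$ (i, j)" using ij by (simp add: M0_def)
  qed (use Mc in \<open>auto simp: Mi_def M0_def\<close>)
  have det0: "Determinant.det M0 \<noteq> 0"
  proof -
    define D where "D z = Determinant.det (mat n n (\<lambda>(i, j). h0 i j z))" for z
    have D: "Determinant.det M0 = abs_mero D" "D meromorphic_on -{0}"
      unfolding M0_def D_def by (rule det_abs_mero; use h0(1) meromorphic_punctured in blast)+
    define D' where "D' z = Determinant.det (mat n n (\<lambda>(i, j). Ws i j z))" for z
    have d1: "Determinant.det (mat n n (\<lambda>(i, j). g i j)) = (\<Sum>p | p permutes {0..<n}. signof p * (\<Prod>i = 0..<n. g i (p i)))"
      for g :: "nat \<Rightarrow> nat \<Rightarrow> complex"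
      unfolding Determinant.det_def
      by (auto intro!: sum.cong prod.cong arg_cong2[of _ _ _ _ "(*)"] simp: permutes_in_image)
    have "D' holomorphic_on {z. norm z < R}"
      unfolding D'_def d1 by (intro holomorphic_intros Wh) (auto simp: permutes_in_image)
    then have "continuous_on {z. norm z < R} D'" by (rule holomorphic_on_imp_continuous_on)
    then have "isCont D' (of_real \<rho>)"
      using oR rR \<rho> by (subst (asm) continuous_on_eq_continuous_at) auto
    moreover have "D' (of_real \<rho>) \<noteq> 0"
      using dW \<rho> by (simp add: D'_def Ws_def)
    ultimately have "eventually (\<lambda>z. D' z \<noteq> 0) (at (of_real \<rho>))"
      by (auto simp: isCont_def dest: tendsto_imp_eventually_ne)
    moreover have "eventually (\<lambda>z. z \<in> {z. norm z < R}) (at (complex_of_real \<rho>))"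
      using oR rR \<rho> by (intro eventually_at_in_open') auto
    ultimately have "eventually (\<lambda>z. D z \<noteq> 0) (at (of_real \<rho>))"
    proof eventually_elim
      case (elim z)
      have "mat n n (\<lambda>(i, j). h0 i j z) = mat n n (\<lambda>(i, j). Ws i j z)"
        using elim h0(3) by (intro eq_matI) auto
      then show ?case using elim by (simp add: D_def D'_def)
    qed
    then show ?thesis
      unfolding D(1) by (intro abs_mero_nonzeroI[OF D(2)]) (use \<rho> in auto)
  qed
  have "Determinant.det Mi * Determinant.det M = Determinant.det M0"
    using det_mult[OF MatD(1)[OF Mi] Mc] prod by simp
  with det0 have "Determinant.det Mi \<noteq> 0" by auto
  with det0 M0 Mi prod show ?thesis
    by (intro that[of M0 Mi]) (simp_all add: subfield_set.GL_iff[OF subfield_plane] subfield_set.GL_iff[OF subfield_inf])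
qed

section \<open>Matrices with a value at the origin\<close>

definition value_mat :: "nat \<Rightarrow> mero mat \<Rightarrow> complex mat \<Rightarrow> bool" where
  "value_mat n B C \<longleftrightarrow> B \<in> carrier_mat n n \<and> C \<in> carrier_mat n n \<and>
     (\<forall>i<n. \<forall>j<n. value_at_0 (B $$ (i, j)) (C $$ (i, j)))"

lemma value_plane: "value_at_0 a c \<Longrightarrow> a \<in> mero_plane"
  by (auto simp: value_at_0_def intro: mero_plane_I)

lemma value_matD:
  "value_mat n B C \<Longrightarrow> B \<in> carrier_mat n n" "value_mat n B C \<Longrightarrow> C \<in> carrier_mat n n"
  "value_mat n B C \<Longrightarrow> i < n \<Longrightarrow> j < n \<Longrightarrow> value_at_0 (B $$ (i, j)) (C $$ (i, j))"
  "value_mat n B C \<Longrightarrow> B \<in> Mat n n mero_plane"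
  by (auto simp: value_mat_def Mat_iff intro: value_plane)

lemma value_mat_const: "C \<in> carrier_mat n n \<Longrightarrow> value_mat n (const_mat C) C"
  by (auto simp: value_mat_def intro: value_const)

lemma value_mat_mult:
  assumes "value_mat n A A0" "value_mat n B B0"
  shows "value_mat n (A * B) (A0 * B0)"
  using assms unfolding value_mat_def
  by (auto simp: scalar_prod_def intro!: value_sum value_mult)

lemma const_mero_of_int: "const_mero (of_int k) = of_int k"
  by (simp add: const_mero_def abs_mero_of_int)

lemma value_det:
  assumes "value_mat n B C"
  shows "value_at_0 (Determinant.det B) (Determinant.det C)"
proof -
  have sg: "value_at_0 (signof p) (signof p)" for p :: "nat \<Rightarrow> nat"
    using value_const[of "of_int (sign p)"] by (simp add: const_mero_of_int)
  show ?thesis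
    using assms unfolding Determinant.det_def value_mat_def
    by (auto simp: permutes_in_image intro!: value_sum value_mult value_prod sg)
qed

lemma value_adj:
  assumes "value_mat n B C"
  shows "value_mat n (adj_mat B) (adj_mat C)"
proof -
  have "value_at_0 (cofactor B j i) (cofactor C j i)" if "i < n" "j < n" for i j
  proof -
    have "value_mat (n - 1) (mat_delete B j i) (mat_delete C j i)"
      using assms that by (auto simp: value_mat_def mat_delete_def)
    moreover have "value_at_0 ((- 1) ^ (j + i)) ((- 1) ^ (j + i))"
      using value_const[of 1] value_const[of "- 1"]
      by (cases "even (j + i)") (auto simp: const_mero_minus_1)
    ultimately show ?thesis
      unfolding cofactor_def by (intro value_mult value_det)
  qed
  then show ?thesis
    using assms by (auto simp: value_mat_def adj_mat_def)
qed

lemma value_mat_invertible: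
  assumes "value_mat n B C" "Determinant.det C \<noteq> 0"
  shows "B \<in> GL n mero_plane" "value_mat n (inv_mat B) (inv_mat C)"
proof -
  interpret subfield_set mero_plane by (rule subfield_plane)
  note d = value_nonzero[OF value_det[OF assms(1)] assms(2)]
  show "B \<in> GL n mero_plane"
    using value_matD(4)[OF assms(1)] d by (rule GL_det)
  have "inv_mat B = inverse (Determinant.det B) \<cdot>\<^sub>m adj_mat B"
    using value_matD(4)[OF assms(1)] d by (rule GL_det)
  moreover have "inv_mat C = inverse (Determinant.det C) \<cdot>\<^sub>m adj_mat C"
    using subfield_set.GL_det(2)[OF subfield_set_UNIV _ assms(2)] value_matD(2)[OF assms(1)]
    by (simp add: Mat_UNIV)
  ultimately show "value_mat n (inv_mat B) (inv_mat C)"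
    using value_adj[OF assms(1)] value_inverse[OF value_det[OF assms(1)] assms(2)]
    by (auto simp: value_mat_def intro!: value_mult)
qed

section \<open>Gauge equivalence\<close>

lemma map_mat_hom_mult:
  assumes "A \<in> carrier_mat n m" "B \<in> carrier_mat m l"
    and "h 0 = 0" "\<And>a b. h (a + b) = h a + h b" "\<And>a b. h (a * b) = h a * h b"
  shows "map_mat h (A * B) = map_mat h A * map_mat h B"
proof (rule eq_matI)
  fix i j assume "i < dim_row (map_mat h A * map_mat h B)" "j < dim_col (map_mat h A * map_mat h B)"
  then have ij: "i < n" "j < l" using assms by auto
  have s: "h (sum f {..<k}) = (\<Sum>i<k. h (f i))" for f and k :: nat
    by (induction k) (auto simp: assms)
  have AB: "map_mat h A \<in> carrier_mat n m" "map_mat h B \<in> carrier_mat m l" using assms by auto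
  have "map_mat h (A * B) $$ (i, j) = h ((A * B) $$ (i, j))"
    using assms ij by (intro index_map_mat(1)) auto
  also have "\<dots> = (\<Sum>k<m. h (A $$ (i, k)) * h (B $$ (k, j)))"
    unfolding mat_mult_index[OF assms(1,2) ij] by (simp add: s assms)
  also have "\<dots> = (map_mat h A * map_mat h B) $$ (i, j)"
    unfolding mat_mult_index[OF AB ij] using assms ij by simp
  finally show "map_mat h (A * B) $$ (i, j) = (map_mat h A * map_mat h B) $$ (i, j)" .
qed (use assms in auto)

lemma qshift_mat_mult:
  "q \<noteq> 0 \<Longrightarrow> A \<in> carrier_mat n m \<Longrightarrow> B \<in> carrier_mat m l \<Longrightarrow>
    qshift_mat q (A * B) = qshift_mat q A * qshift_mat q B"
  by (rule map_mat_hom_mult) (auto simp: qshift_add qshift_mult)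

lemma const_mat_mult:
  "A \<in> carrier_mat n m \<Longrightarrow> B \<in> carrier_mat m l \<Longrightarrow> const_mat (A * B) = const_mat A * const_mat B"
  by (rule map_mat_hom_mult) (auto simp: const_mero_add const_mero_mult)

lemma recip_mat_mult:
  "A \<in> carrier_mat n m \<Longrightarrow> B \<in> carrier_mat m l \<Longrightarrow> map_mat recip (A * B) = map_mat recip A * map_mat recip B"
  by (rule map_mat_hom_mult) (auto simp: recip_add recip_mult)

lemma map_mat_one: "h 0 = 0 \<Longrightarrow> h 1 = 1 \<Longrightarrow> map_mat h (1\<^sub>m n) = 1\<^sub>m n"
  by (rule eq_matI) auto

lemma qshift_const_mat [simp]: "q \<noteq> 0 \<Longrightarrow> qshift_mat q (const_mat A) = const_mat A"
  by (rule eq_matI) auto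

lemma map_mat_Mat: "A \<in> Mat r c K \<Longrightarrow> (\<And>a. a \<in> K \<Longrightarrow> h a \<in> L) \<Longrightarrow> map_mat h A \<in> Mat r c L"
  unfolding Mat_iff by (elim conjE, intro conjI allI impI) simp_all

lemma map_mat_GL:
  assumes A: "A \<in> GL n K" and KL: "\<And>a. a \<in> K \<Longrightarrow> h a \<in> L"
    and h: "h 0 = 0" "h 1 = 1" "\<And>a b. h (a + b) = h a + h b" "\<And>a b. h (a * b) = h a * h b"
  shows "map_mat h A \<in> GL n L" "inv_mat (map_mat h A) = map_mat h (inv_mat A)"
proof -
  have Ac: "A \<in> Mat n n K" "inv_mat A \<in> Mat n n K"
    using GL_Mat[OF A] GL_Mat[OF GL_inv_mat(1)[OF A]] by auto
  note m = map_mat_Mat[OF Ac(1), of h L, OF KL] map_mat_Mat[OF Ac(2), of h L, OF KL]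
  have "map_mat h (A * inv_mat A) = map_mat h A * map_mat h (inv_mat A)"
    "map_mat h (inv_mat A * A) = map_mat h (inv_mat A) * map_mat h A"
    by (rule map_mat_hom_mult[OF MatD(1)[OF Ac(1)] MatD(1)[OF Ac(2)] h(1,3,4)],
        rule map_mat_hom_mult[OF MatD(1)[OF Ac(2)] MatD(1)[OF Ac(1)] h(1,3,4)])
  then have e: "map_mat h A * map_mat h (inv_mat A) = 1\<^sub>m n" "map_mat h (inv_mat A) * map_mat h A = 1\<^sub>m n"
    using GL_inv_mat[OF A] h by (auto simp: map_mat_one)
  show "map_mat h A \<in> GL n L" using m e by (auto simp: GL_def)
  show "inv_mat (map_mat h A) = map_mat h (inv_mat A)"
    using m e by (intro inv_mat_eqI) (auto simp: Mat_iff)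
qed

lemma const_mat_GL:
  assumes "A \<in> GL n UNIV" "\<And>c. const_mero c \<in> K"
  shows "const_mat A \<in> GL n K" "inv_mat (const_mat A) = const_mat (inv_mat A)"
  by (rule map_mat_GL[OF assms(1), where L = K]; use assms(2) in \<open>simp add: const_mero_add const_mero_mult\<close>)+

lemma qshift_mat_GL:
  assumes "q \<noteq> 0" "A \<in> GL n K" "\<And>a. a \<in> K \<Longrightarrow> qshift q a \<in> L"
  shows "qshift_mat q A \<in> GL n L" "inv_mat (qshift_mat q A) = qshift_mat q (inv_mat A)"
  by (rule map_mat_GL[OF assms(2), where L = L]; use assms(1,3) in \<open>simp add: qshift_add qshift_mult\<close>)+

text \<open>
  The equation says \<open>B' = (\<sigma>\<^sub>q X)\<inverse> B X\<close>; without inverses it composes by associativity alone.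
\<close>

definition gauge_equiv :: "complex \<Rightarrow> nat \<Rightarrow> mero mat \<Rightarrow> mero mat \<Rightarrow> bool" where
  "gauge_equiv q n B B' \<longleftrightarrow> (\<exists>X \<in> GL n mero_plane. qshift_mat q X * B' = B * X)"

lemma gauge_trans:
  assumes "q \<noteq> 0" and c: "B \<in> carrier_mat n n" "B' \<in> carrier_mat n n" "B'' \<in> carrier_mat n n"
    and "gauge_equiv q n B B'" "gauge_equiv q n B' B''"
  shows "gauge_equiv q n B B''"
proof -
  obtain X Y where X: "X \<in> GL n mero_plane" "qshift_mat q X * B' = B * X"
    and Y: "Y \<in> GL n mero_plane" "qshift_mat q Y * B'' = B' * Y"
    using assms by (auto simp: gauge_equiv_def)
  have XY: "X \<in> carrier_mat n n" "Y \<in> carrier_mat n n" "qshift_mat q X \<in> carrier_mat n n" "qshift_mat q Y \<in> carrier_mat n n"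
    using GL_carrier[OF X(1)] GL_carrier[OF Y(1)] by auto
  have "qshift_mat q (X * Y) * B'' = qshift_mat q X * qshift_mat q Y * B''"
    unfolding qshift_mat_mult[OF assms(1) XY(1,2)] ..
  also have "\<dots> = qshift_mat q X * (B' * Y)"
    unfolding assoc_mult_mat[OF XY(3,4) c(3)] Y(2) ..
  also have "\<dots> = B * X * Y"
    unfolding assoc_mult_mat[OF XY(3) c(2) XY(2), symmetric] X(2) ..
  also have "\<dots> = B * (X * Y)"
    by (rule assoc_mult_mat[OF c(1) XY(1,2)])
  finally show ?thesis
    using subfield_set.GL_mult[OF subfield_plane X(1) Y(1)] by (auto simp: gauge_equiv_def)
qed

text \<open>
  A constant gauge transformation conjugates the value at the origin.
\<close>

lemma gauge_const_conjugate:
  assumes q: "q \<noteq> 0" and B: "value_mat n B B0" and sim: "similar_mat B0 C"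
  shows "\<exists>B'. gauge_equiv q n B B' \<and> value_mat n B' C"
proof -
  obtain m P Q where "{B0, C, P, Q} \<subseteq> carrier_mat m m" "P * Q = 1\<^sub>m m" "Q * P = 1\<^sub>m m" "B0 = P * C * Q"
    using similar_matD[OF sim] by blast
  moreover from this value_matD(2)[OF B] have "m = n" by auto
  ultimately have PQ: "C \<in> carrier_mat n n" "P \<in> carrier_mat n n" "Q \<in> carrier_mat n n"
    "P * Q = 1\<^sub>m n" "Q * P = 1\<^sub>m n" and B0: "B0 = P * C * Q" by auto
  define B' where "B' = const_mat Q * B * const_mat P"
  have "value_mat n B' (Q * B0 * P)"
    unfolding B'_def by (intro value_mat_mult value_mat_const B PQ)
  moreover have "Q * B0 * P = C"
  proof -
    have "Q * B0 * P = (Q * P) * C * (Q * P)"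
      unfolding B0 using PQ(1-3) by (simp add: assoc_mult_mat[where n\<^sub>1 = n and n\<^sub>2 = n and n\<^sub>3 = n and n\<^sub>4 = n])
    then show ?thesis using PQ by simp
  qed
  moreover have "gauge_equiv q n B B'"
    unfolding gauge_equiv_def
  proof (rule bexI)
    have PG: "P \<in> GL n UNIV" using PQ by (auto simp: GL_def Mat_UNIV)
    show "const_mat P \<in> GL n mero_plane" by (rule const_mat_GL[OF PG]) (rule const_plane)
    have c: "const_mat P \<in> carrier_mat n n" "const_mat Q \<in> carrier_mat n n" "B \<in> carrier_mat n n"
      using PQ value_matD(1)[OF B] by auto
    have one: "const_mat P * const_mat Q = 1\<^sub>m n"
      using PQ by (simp add: map_mat_one flip: const_mat_mult)
    have "const_mat P * B' = (const_mat P * const_mat Q) * B * const_mat P"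
      unfolding B'_def using c by (simp add: assoc_mult_mat[of _ n n _ n _ n])
    then show "qshift_mat q (const_mat P) * B' = B * const_mat P"
      using one c q by simp
  qed
  ultimately show ?thesis by auto
qed

lemma diag_mult_index:
  fixes A :: "'a :: comm_ring_1 mat"
  assumes "A \<in> carrier_mat n n" "i < n" "j < n"
  shows "(A * mat n n (\<lambda>(i, j). if i = j then c j else 0)) $$ (i, j) = A $$ (i, j) * c j"
    "(mat n n (\<lambda>(i, j). if i = j then c j else 0) * A) $$ (i, j) = c i * A $$ (i, j)"
proof -
  have "(A * mat n n (\<lambda>(i, j). if i = j then c j else 0)) $$ (i, j) = (\<Sum>k<n. A $$ (i, k) * (if k = j then c j else 0))"
    using assms by (simp add: scalar_prod_def atLeast0LessThan)
  also have "\<dots> = A $$ (i, j) * c j" using assms by (simp add: if_distrib cong: if_cong)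
  finally show "(A * mat n n (\<lambda>(i, j). if i = j then c j else 0)) $$ (i, j) = A $$ (i, j) * c j" .
  have "(mat n n (\<lambda>(i, j). if i = j then c j else 0) * A) $$ (i, j) = (\<Sum>k<n. (if i = k then c i else 0) * A $$ (k, j))"
    using assms by (simp add: scalar_prod_def atLeast0LessThan if_distrib cong: if_cong)
  also have "\<dots> = c i * A $$ (i, j)" using assms by (simp add: if_distrib[of "\<lambda>x. x * _"] cong: if_cong)
  finally show "(mat n n (\<lambda>(i, j). if i = j then c j else 0) * A) $$ (i, j) = c i * A $$ (i, j)" .
qed

lemma gauge_diagonal:
  assumes q: "q \<noteq> 0" and B: "B \<in> carrier_mat n n"
    and c: "\<And>i. i < n \<Longrightarrow> c i \<in> mero_plane" "\<And>i. i < n \<Longrightarrow> c i \<noteq> 0"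
  shows "gauge_equiv q n B (mat n n (\<lambda>(i, j). B $$ (i, j) * c j / qshift q (c i)))"
  unfolding gauge_equiv_def
proof (rule bexI)
  let ?X = "mat n n (\<lambda>(i, j). if i = j then c j else 0)"
  let ?B' = "mat n n (\<lambda>(i, j). B $$ (i, j) * c j / qshift q (c i))"
  have qX: "qshift_mat q ?X = mat n n (\<lambda>(i, j). if i = j then qshift q (c j) else 0)"
    using q by (intro eq_matI) auto
  have nz: "qshift q (c i) \<noteq> 0" if "i < n" for i
  proof
    assume "qshift q (c i) = 0"
    then have "qshift (1 / q) (qshift q (c i)) = 0" using q by simp
    then show False using q c(2)[OF that] by (simp add: qshift_qshift qshift_one)
  qed
  show "qshift_mat q ?X * ?B' = B * ?X"
    unfolding qX
  proof (rule eq_matI)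
    fix i j assume "i < dim_row (B * ?X)" "j < dim_col (B * ?X)"
    then have ij: "i < n" "j < n" using B by auto
    show "(mat n n (\<lambda>(i, j). if i = j then qshift q (c j) else 0) * ?B') $$ (i, j) = (B * ?X) $$ (i, j)"
      using ij nz[OF ij(1)] diag_mult_index(2)[of ?B' n i j "\<lambda>i. qshift q (c i)"] diag_mult_index(1)[OF B ij, of c]
      by simp
  qed (use B in auto)
  have "upper_triangular ?X" by (auto simp: upper_triangular_def)
  then have "Determinant.det ?X = prod_list (diag_mat ?X)"
    by (rule det_upper_triangular) auto
  then have "Determinant.det ?X \<noteq> 0"
    using c(2) by (auto simp: diag_mat_def prod_list_zero_iff)
  then show "?X \<in> GL n mero_plane"
    using c(1) by (auto simp: subfield_set.GL_iff[OF subfield_plane] Mat_iff subfield_set.zero_mem[OF subfield_plane])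
qed

section \<open>Shearing\<close>

text \<open>
  A Schur form with \<open>\<mu>\<close> in the first place makes the first column of the value vanish below the diagonal.
  Hence the gauge transformation by \<open>diag (1 / z, 1, \<dots>, 1)\<close>, which divides that column by \<open>z\<close> and
  multiplies the first row by \<open>q z\<close>, keeps the system regular at the origin.  The new value is block
  triangular with diagonal blocks \<open>q \<mu>\<close> and the old remaining block.
\<close>

lemma shear_step:
  assumes q: "q \<noteq> 0" and B: "value_mat n B B0" and cp: "char_poly B0 = (\<Prod>e\<leftarrow>\<mu> # es. [:- e, 1:])"
  shows "\<exists>B' C. gauge_equiv q n B B' \<and> value_mat n B' C \<and> char_poly C = (\<Prod>e\<leftarrow>(q * \<mu>) # es. [:- e, 1:])"
proof -
  obtain T P Q where "schur_decomposition B0 (\<mu> # es) = (T, P, Q)"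
    by (cases "schur_decomposition B0 (\<mu> # es)") auto
  from schur_decomposition[OF value_matD(2)[OF B] cp this]
  have T: "similar_mat B0 T" "upper_triangular T" "diag_mat T = \<mu> # es"
    by (auto simp: similar_mat_def)
  obtain B1 where B1: "gauge_equiv q n B B1" "value_mat n B1 T"
    using gauge_const_conjugate[OF q B T(1)] by blast
  note Tc = value_matD(2)[OF B1(2)]
  define m where "m = length es"
  have n: "n = Suc m"
    using arg_cong[OF T(3), of length] Tc by (simp add: diag_mat_def m_def)
  have dT: "T $$ (i, i) = (\<mu> # es) ! i" if "i < n" for i
    using arg_cong[OF T(3), of "\<lambda>xs. xs ! i"] Tc that by (simp add: diag_mat_def)
  have lT: "T $$ (i, j) = 0" if "i < n" "j < i" for i j
    using T(2) Tc that by (auto simp: upper_triangular_def)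
  define c where "c i = (if i = 0 then inverse coord else 1)" for i :: nat
  define B' where "B' = mat n n (\<lambda>(i, j). B1 $$ (i, j) * c j / qshift q (c i))"
  have g: "gauge_equiv q n B1 B'"
    unfolding B'_def
    by (rule gauge_diagonal[OF q value_matD(1)[OF B1(2)]])
       (auto simp: c_def coord_nonzero subfield_set.one_mem[OF subfield_plane]
          subfield_set.inverse_mem[OF subfield_plane] coord_plane)
  have qi: "qshift q (inverse coord) = inverse (const_mero q * coord)"
  proof -
    have "qshift q (inverse coord) * qshift q coord = 1"
      using q coord_nonzero by (simp flip: qshift_mult)
    then show ?thesis
      using q inverse_unique[of "const_mero q * coord" "qshift q (inverse coord)"]
      by (simp add: qshift_coord mult.commute)
  qed
  note v = value_matD(3)[OF B1(2)]
  have "\<exists>d. value_at_0 (B1 $$ (i, 0) / coord) d" if "i < n" "i > 0" for i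
    using v[of i 0] lT[of i 0] that n by (intro value_divide_coord) auto
  then obtain d where d: "\<And>i. i < n \<Longrightarrow> i > 0 \<Longrightarrow> value_at_0 (B1 $$ (i, 0) / coord) (d i)"
    by metis
  define C where "C = mat n n (\<lambda>(i, j). if i = 0 then if j = 0 then q * \<mu> else 0
     else if j = 0 then d i else T $$ (i, j))"
  have vC: "value_mat n B' C"
    unfolding value_mat_def
  proof (intro conjI allI impI)
    show "B' \<in> carrier_mat n n" "C \<in> carrier_mat n n" by (auto simp: B'_def C_def)
    fix i j assume ij: "i < n" "j < n"
    consider "i = 0" "j = 0" | "i = 0" "j > 0" | "i > 0" "j = 0" | "i > 0" "j > 0" by auto
    then show "value_at_0 (B' $$ (i, j)) (C $$ (i, j))"
    proof cases
      case 1
      have "B' $$ (0, 0) = const_mero q * B1 $$ (0, 0)"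
        using n coord_nonzero q by (simp add: B'_def c_def qi divide_inverse mult.commute)
      moreover have "value_at_0 (const_mero q * B1 $$ (0, 0)) (q * \<mu>)"
        using v[of 0 0] dT[of 0] n by (intro value_mult value_const) auto
      ultimately show ?thesis using 1 n by (simp add: C_def)
    next
      case 2
      have "B' $$ (0, j) = B1 $$ (0, j) * const_mero q * coord"
        using 2 ij n by (simp add: B'_def c_def qi divide_inverse)
      moreover have "value_at_0 (B1 $$ (0, j) * const_mero q * coord) (T $$ (0, j) * q * 0)"
        using v[of 0 j] ij n by (intro value_mult value_const value_coord) auto
      ultimately show ?thesis using 2 ij n by (simp add: C_def)
    next
      case 3
      then show ?thesis
        using d ij q by (simp add: B'_def C_def c_def divide_inverse)
    next
      case 4
      then show ?thesis
        using v ij q by (simp add: B'_def C_def c_def)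
    qed
  qed
  define T' where "T' = mat m m (\<lambda>(i, j). T $$ (Suc i, Suc j))"
  have "upper_triangular T'"
    using lT n by (auto simp: T'_def upper_triangular_def)
  moreover have "T' \<in> carrier_mat m m" by (simp add: T'_def)
  ultimately have "char_poly T' = (\<Prod>e\<leftarrow>diag_mat T'. [:- e, 1:])"
    by (rule char_poly_upper_triangular[rotated])
  moreover have "diag_mat T' = es"
    using dT n by (intro nth_equalityI) (auto simp: diag_mat_def T'_def m_def)
  ultimately have cT': "char_poly T' = (\<Prod>e\<leftarrow>es. [:- e, 1:])" by simp
  define L where "L = mat 1 1 (\<lambda>_. q * \<mu>)"
  have cL: "char_poly L = [:- (q * \<mu>), 1:]"
    using char_poly_upper_triangular[of L 1] by (simp add: L_def upper_triangular_def diag_mat_def)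
  \<comment> \<open>The first row of \<open>C\<close> is zero off the diagonal, so it is the transpose that is block upper triangular.\<close>
  have "transpose_mat C = four_block_mat L (mat 1 m (\<lambda>(_, j). d (Suc j))) (0\<^sub>m m 1) (transpose_mat T')"
    by (rule eq_matI) (auto simp: C_def L_def T'_def n four_block_mat_def Let_def)
  moreover have "L \<in> carrier_mat 1 1" "mat 1 m (\<lambda>(_, j). d (Suc j)) \<in> carrier_mat 1 m"
    "transpose_mat T' \<in> carrier_mat m m" by (auto simp: L_def T'_def)
  ultimately have "char_poly (transpose_mat C) = char_poly L * char_poly (transpose_mat T')"
    by (simp only: char_poly_four_block_zeros_col)
  then have "char_poly C = (\<Prod>e\<leftarrow>(q * \<mu>) # es. [:- e, 1:])"
    using char_poly_transpose_mat[OF value_matD(2)[OF vC]] char_poly_transpose_mat[of T' m] cT' cL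
    by (simp add: T'_def)
  moreover have "gauge_equiv q n B B'"
    using gauge_trans[OF q _ _ _ B1(1) g] value_matD(1)[OF B] value_matD(1)[OF B1(2)] value_matD(1)[OF vC] by blast
  ultimately show ?thesis using vC by blast
qed

text \<open>
  Multiplying the eigenvalues of modulus below \<open>R\<close> by \<open>q\<close>, one at a time, keeps all moduli below
  \<open>\<bar>q\<bar> R\<close>.  The number of steps still needed decreases.
\<close>

lemma normalize_exponents:
  assumes q: "norm q > 1" and "R > 0"
    and "value_mat n B B0" "char_poly B0 = (\<Prod>e\<leftarrow>es. [:- e, 1:])"
    and "\<And>e. e \<in> set es \<Longrightarrow> e \<noteq> 0 \<and> norm e < norm q * R"
  shows "\<exists>B' C es'. gauge_equiv q n B B' \<and> value_mat n B' C \<and> char_poly C = (\<Prod>e\<leftarrow>es'. [:- e, 1:]) \<and>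
     (\<forall>e\<in>set es'. R \<le> norm e \<and> norm e < norm q * R)"
proof -
  have q0: "q \<noteq> 0" using q by auto
  define m where "m e = (LEAST k. R \<le> norm q ^ k * norm e)" for e :: complex
  have ex: "\<exists>k. R \<le> norm q ^ k * norm e" if "e \<noteq> 0" for e :: complex
  proof -
    obtain k where "R / norm e < norm q ^ k" using real_arch_pow[OF q] by blast
    then show ?thesis using that by (intro exI[of _ k]) (simp add: field_simps)
  qed
  have dec: "m (q * e) < m e" if e: "e \<noteq> 0" "norm e < R" for e
  proof -
    have le: "R \<le> norm q ^ m e * norm e" unfolding m_def by (rule LeastI_ex[OF ex[OF e(1)]])
    have "m e \<noteq> 0" using le e(2) by (intro notI) simp
    then obtain k where k: "m e = Suc k" using not0_implies_Suc by blast
    have "R \<le> norm q ^ k * norm (q * e)" using le k by (simp add: norm_mult mult_ac)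
    then have "m (q * e) \<le> k" unfolding m_def by (rule Least_le)
    then show ?thesis using k by simp
  qed
  show ?thesis
    using assms(3-)
  proof (induction "sum_list (map m es)" arbitrary: B B0 es rule: less_induct)
    case less
    show ?case
    proof (cases "\<forall>e\<in>set es. R \<le> norm e")
      case True
      have "gauge_equiv q n B B"
        unfolding gauge_equiv_def using value_matD(1)[OF less.prems(1)] q0
        by (intro bexI[of _ "1\<^sub>m n"]) (auto simp: map_mat_one subfield_set.GL_one[OF subfield_plane])
      with True less.prems show ?thesis by blast
    next
      case False
      then obtain e where e: "e \<in> set es" "norm e < R" by auto
      define es1 where "es1 = remove1 e es"
      have mset: "mset es = mset (e # es1)" using e by (simp add: es1_def)
      have e0: "e \<noteq> 0" using less.prems(3) e(1) by auto
      have pl: "prod_list (map f es) = prod_list (map f (e # es1))" for f :: "complex \<Rightarrow> complex poly"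
        using mset by (metis mset_map prod_mset_prod_list)
      have sl: "sum_list (map m es) = sum_list (map m (e # es1))"
        using mset by (metis mset_map sum_mset_sum_list)
      obtain B' C where B': "gauge_equiv q n B B'" "value_mat n B' C"
        "char_poly C = (\<Prod>e\<leftarrow>(q * e) # es1. [:- e, 1:])"
        using shear_step[OF q0 less.prems(1), of e es1] less.prems(2) pl by auto
      have "sum_list (map m ((q * e) # es1)) < sum_list (map m es)"
        unfolding sl using dec[OF e0 e(2)] by simp
      moreover have "x \<noteq> 0 \<and> norm x < norm q * R" if "x \<in> set ((q * e) # es1)" for x
      proof -
        have "set es1 \<subseteq> set es" unfolding es1_def by (rule set_remove1_subset)
        moreover have "norm (q * e) < norm q * R"
          unfolding norm_mult using e q by (intro mult_strict_left_mono) auto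
        ultimately show ?thesis using that less.prems(3) e0 q0 by auto
      qed
      ultimately obtain B'' D es' where *: "gauge_equiv q n B' B''" "value_mat n B'' D"
        "char_poly D = (\<Prod>e\<leftarrow>es'. [:- e, 1:])" "\<forall>e\<in>set es'. R \<le> norm e \<and> norm e < norm q * R"
        using less.hyps[OF _ B'(2,3)] by blast
      have "gauge_equiv q n B B''"
        using gauge_trans[OF q0 _ _ _ B'(1) *(1)] value_matD(1)[OF less.prems(1)] value_matD(1)[OF B'(2)] value_matD(1)[OF *(2)]
        by blast
      with * show ?thesis by blast
    qed
  qed
qed

section \<open>The fundamental solution at the origin\<close>

text \<open>
  For this norm, left multiplication is bounded by column sums, and right multiplication by a nearly
  diagonal matrix expands by nearly the smallest diagonal entry.
\<close>

definition entry_norm :: "complex mat \<Rightarrow> real" where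
  "entry_norm A = (\<Sum>i<dim_row A. \<Sum>j<dim_col A. norm (A $$ (i, j)))"

lemma entry_norm_carrier: "A \<in> carrier_mat n m \<Longrightarrow> entry_norm A = (\<Sum>i<n. \<Sum>j<m. norm (A $$ (i, j)))"
  by (simp add: entry_norm_def)

lemma entry_norm_nonneg: "0 \<le> entry_norm A"
  by (simp add: entry_norm_def sum_nonneg)

lemma norm_entry_le: "A \<in> carrier_mat n m \<Longrightarrow> i < n \<Longrightarrow> j < m \<Longrightarrow> norm (A $$ (i, j)) \<le> entry_norm A"
proof -
  assume A: "A \<in> carrier_mat n m" "i < n" "j < m"
  have "norm (A $$ (i, j)) \<le> (\<Sum>j<m. norm (A $$ (i, j)))"
    using A by (intro member_le_sum) auto
  also have "\<dots> \<le> (\<Sum>i<n. \<Sum>j<m. norm (A $$ (i, j)))"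
    using A by (intro member_le_sum[of i _ "\<lambda>i. \<Sum>j<m. norm (A $$ (i, j))"]) (auto intro: sum_nonneg)
  finally show ?thesis using A by (simp add: entry_norm_carrier)
qed

lemma entry_norm_mult_le:
  assumes B: "B \<in> carrier_mat n n" and X: "X \<in> carrier_mat n n"
    and col: "\<And>k. k < n \<Longrightarrow> (\<Sum>i<n. norm (B $$ (i, k))) \<le> b"
  shows "entry_norm (B * X) \<le> b * entry_norm X"
proof -
  have "entry_norm (B * X) = (\<Sum>i<n. \<Sum>j<n. norm (\<Sum>k<n. B $$ (i, k) * X $$ (k, j)))"
    unfolding entry_norm_carrier[OF mult_carrier_mat[OF B X]]
    by (intro sum.cong refl) (simp add: mat_mult_index[OF B X] del: index_mult_mat)
  also have "\<dots> \<le> (\<Sum>i<n. \<Sum>j<n. \<Sum>k<n. norm (B $$ (i, k)) * norm (X $$ (k, j)))"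
    by (intro sum_mono order_trans[OF norm_sum]) (simp add: norm_mult)
  also have "\<dots> = (\<Sum>i<n. \<Sum>k<n. \<Sum>j<n. norm (B $$ (i, k)) * norm (X $$ (k, j)))"
    by (intro sum.cong refl sum.swap)
  also have "\<dots> = (\<Sum>k<n. \<Sum>i<n. \<Sum>j<n. norm (B $$ (i, k)) * norm (X $$ (k, j)))"
    by (rule sum.swap)
  also have "\<dots> = (\<Sum>k<n. \<Sum>j<n. (\<Sum>i<n. norm (B $$ (i, k))) * norm (X $$ (k, j)))"
    unfolding sum_distrib_right by (intro sum.cong refl sum.swap)
  also have "\<dots> \<le> (\<Sum>k<n. \<Sum>j<n. b * norm (X $$ (k, j)))"
    by (intro sum_mono mult_right_mono col) auto
  also have "\<dots> = b * entry_norm X"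
    using X by (simp add: entry_norm_carrier sum_distrib_left)
  finally show ?thesis .
qed

lemma entry_norm_mult_ge:
  assumes A: "A \<in> carrier_mat n n" and Y: "Y \<in> carrier_mat n n"
    and diag: "\<And>i. i < n \<Longrightarrow> R \<le> norm (A $$ (i, i))"
    and off: "\<And>i j. i < n \<Longrightarrow> j < n \<Longrightarrow> i \<noteq> j \<Longrightarrow> norm (A $$ (i, j)) \<le> \<epsilon>" and "0 \<le> \<epsilon>"
  shows "(R - real n * \<epsilon>) * entry_norm Y \<le> entry_norm (Y * A)"
proof -
  have e: "R * norm (Y $$ (i, j)) - \<epsilon> * (\<Sum>k<n. norm (Y $$ (i, k))) \<le> norm ((Y * A) $$ (i, j))" if ij: "i < n" "j < n" for i j
  proof -
    have "(Y * A) $$ (i, j) = (\<Sum>k<n. Y $$ (i, k) * A $$ (k, j))" by (rule mat_mult_index[OF Y A ij])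
    also have "\<dots> = Y $$ (i, j) * A $$ (j, j) + (\<Sum>k\<in>{..<n} - {j}. Y $$ (i, k) * A $$ (k, j))"
      using ij by (subst sum.remove[of _ j]) auto
    finally have eq: "Y $$ (i, j) * A $$ (j, j) = (Y * A) $$ (i, j) - (\<Sum>k\<in>{..<n} - {j}. Y $$ (i, k) * A $$ (k, j))"
      by simp
    have "R * norm (Y $$ (i, j)) \<le> norm (Y $$ (i, j) * A $$ (j, j))"
      using diag[OF ij(2)] mult_left_mono[of R "norm (A $$ (j, j))" "norm (Y $$ (i, j))"] by (simp add: norm_mult mult.commute)
    also have "\<dots> \<le> norm ((Y * A) $$ (i, j)) + norm (\<Sum>k\<in>{..<n} - {j}. Y $$ (i, k) * A $$ (k, j))"
      unfolding eq by (rule norm_triangle_ineq4)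
    also have "norm (\<Sum>k\<in>{..<n} - {j}. Y $$ (i, k) * A $$ (k, j)) \<le> (\<Sum>k\<in>{..<n} - {j}. norm (Y $$ (i, k)) * \<epsilon>)"
      by (intro sum_norm_le) (use off ij in \<open>auto simp: norm_mult intro!: mult_left_mono\<close>)
    also have "\<dots> \<le> (\<Sum>k<n. norm (Y $$ (i, k)) * \<epsilon>)"
      by (rule sum_mono2) (use \<open>0 \<le> \<epsilon>\<close> in auto)
    also have "\<dots> = \<epsilon> * (\<Sum>k<n. norm (Y $$ (i, k)))"
      by (simp add: sum_distrib_left mult.commute)
    finally show ?thesis by simp
  qed
  have "(\<Sum>j<n. R * norm (Y $$ (i, j)) - \<epsilon> * (\<Sum>k<n. norm (Y $$ (i, k)))) = (R - real n * \<epsilon>) * (\<Sum>k<n. norm (Y $$ (i, k)))" for i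
    by (simp add: sum_subtractf sum_distrib_left[symmetric] algebra_simps)
  then have "(R - real n * \<epsilon>) * entry_norm Y = (\<Sum>i<n. \<Sum>j<n. R * norm (Y $$ (i, j)) - \<epsilon> * (\<Sum>k<n. norm (Y $$ (i, k))))"
    using Y by (simp add: entry_norm_carrier sum_distrib_left)
  also have "\<dots> \<le> (\<Sum>i<n. \<Sum>j<n. norm ((Y * A) $$ (i, j)))"
    by (intro sum_mono e) auto
  also have "\<dots> = entry_norm (Y * A)"
    by (rule entry_norm_carrier[OF mult_carrier_mat[OF Y A], symmetric])
  finally show ?thesis .
qed

lemma lipschitz_at_analytic:
  assumes "f analytic_on {0 :: complex}" "\<epsilon> > 0"
  shows "\<exists>\<delta>>0. \<exists>L\<ge>0. f holomorphic_on ball 0 \<delta> \<and>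
    (\<forall>w. norm w < \<delta> \<longrightarrow> norm (f w - f 0) \<le> L * norm w \<and> norm (f w - f 0) \<le> \<epsilon>)"
proof -
  obtain r where r: "r > 0" "f holomorphic_on ball 0 r"
    using assms(1) by (auto simp: analytic_on_def)
  have "f field_differentiable (at 0)"
    using assms(1) by (rule analytic_on_imp_differentiable_at) auto
  then obtain c where "(f has_field_derivative c) (at 0)"
    by (auto simp: field_differentiable_def)
  then have "(\<lambda>w. (f w - f 0) / w) \<midarrow>0\<rightarrow> c"
    by (simp add: has_field_derivative_iff)
  then have "((\<lambda>w. norm ((f w - f 0) / w)) \<longlongrightarrow> norm c) (at 0)"
    by (rule tendsto_norm)
  then have "eventually (\<lambda>w. norm ((f w - f 0) / w) < norm c + 1) (at 0)"
    by (rule order_tendstoD) auto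
  then obtain d where d: "d > 0" "\<And>w. w \<noteq> 0 \<Longrightarrow> norm w < d \<Longrightarrow> norm ((f w - f 0) / w) < norm c + 1"
    by (auto simp: eventually_at)
  define L where "L = norm c + 1"
  have L: "L > 0" by (simp add: L_def add_nonneg_pos)
  have lip: "norm (f w - f 0) \<le> L * norm w" if "norm w < d" for w
  proof (cases "w = 0")
    case False
    then show ?thesis using d(2)[OF False that] by (simp add: L_def norm_divide field_simps)
  qed simp
  define \<delta> where "\<delta> = min (min r d) (\<epsilon> / L)"
  have "\<delta> > 0" using r d L assms by (simp add: \<delta>_def)
  moreover have "f holomorphic_on ball 0 \<delta>"
    using r(2) by (rule holomorphic_on_subset) (auto simp: \<delta>_def)
  moreover have "norm (f w - f 0) \<le> L * norm w \<and> norm (f w - f 0) \<le> \<epsilon>" if "norm w < \<delta>" for w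
  proof -
    have w: "norm w < d" "norm w < \<epsilon> / L" using that by (auto simp: \<delta>_def)
    then have "L * norm w \<le> \<epsilon>" using L by (simp add: field_simps)
    with lip[OF w(1)] show ?thesis by linarith
  qed
  ultimately show ?thesis using L by (intro exI[of _ \<delta>] conjI exI[of _ L]) auto
qed

text \<open>
  The iterates of \<open>W z = F (z / q) W (z / q) A'\<close> starting at \<open>1\<close> are the products
  \<open>F (z / q) \<cdots> F (z / q\<^sup>m) A'\<^sup>m\<close>.  Successive differences are multiplied by \<open>\<kappa> \<bar>q\<bar>\<close> at most, but are taken
  at \<open>z / q\<close>, and the first one is \<open>O(z)\<close>; this yields convergence like \<open>\<kappa>\<^sup>m\<close>.
\<close>

lemma local_solution:
  fixes F :: "complex \<Rightarrow> complex mat"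
  assumes q: "norm q > 1" and \<delta>: "\<delta> > 0"
    and F: "\<And>z. F z \<in> carrier_mat n n" "\<And>i j. i < n \<Longrightarrow> j < n \<Longrightarrow> (\<lambda>z. F z $$ (i, j)) holomorphic_on ball 0 \<delta>"
    and A: "A \<in> carrier_mat n n" "A' \<in> carrier_mat n n" "A * A' = 1\<^sub>m n" "A' * A = 1\<^sub>m n"
    and L: "\<And>z. norm z < \<delta> \<Longrightarrow> entry_norm (F z * A' - 1\<^sub>m n) \<le> L * norm z" "L \<ge> 0"
    and \<kappa>: "\<And>z X. norm z < \<delta> \<Longrightarrow> X \<in> carrier_mat n n \<Longrightarrow> entry_norm (F z * X * A') \<le> \<kappa> * norm q * entry_norm X"
      "0 \<le> \<kappa>" "\<kappa> < 1"
  obtains W where "\<And>z. W z \<in> carrier_mat n n"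
    "\<And>i j. i < n \<Longrightarrow> j < n \<Longrightarrow> (\<lambda>z. W z $$ (i, j)) holomorphic_on ball 0 \<delta>"
    "W 0 = 1\<^sub>m n"
    "\<And>z. norm z < \<delta> \<Longrightarrow> W z = F (z / q) * W (z / q) * A'"
proof -
  have q0: "q \<noteq> 0" using q by auto
  have zq: "norm (z / q) \<le> norm z" for z
    using q by (simp add: norm_divide divide_le_eq mult_left_le_one_le mult_le_cancel_left1)
  have zq_ball: "norm (z / q) < \<delta>" if "norm z < \<delta>" for z
    using zq[of z] that by linarith
  define w where "w m = ((\<lambda>W z. F (z / q) * W (z / q) * A') ^^ m) (\<lambda>_. 1\<^sub>m n)" for m
  have w0: "w 0 z = 1\<^sub>m n" and wS: "w (Suc m) z = F (z / q) * w m (z / q) * A'" for m z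
    by (simp_all add: w_def)
  have wc: "w m z \<in> carrier_mat n n" for m z
    by (induction m arbitrary: z) (auto simp: w0 wS intro!: mult_carrier_mat[of _ n n _ n] F A)
  have ent: "(F z * X * A') $$ (i, j) = (\<Sum>l<n. (\<Sum>k<n. F z $$ (i, k) * X $$ (k, l)) * A' $$ (l, j))"
    if "X \<in> carrier_mat n n" "i < n" "j < n" for z X i j
    using that by (simp add: mat_mult_index[OF mult_carrier_mat[OF F(1) that(1)] A(2) that(2,3)]
        mat_mult_index[OF F(1) that(1)] del: index_mult_mat)
  have wh: "(\<lambda>z. w m z $$ (i, j)) holomorphic_on ball 0 \<delta>" if "i < n" "j < n" for m i j
    using that
  proof (induction m arbitrary: i j)
    case (Suc m)
    have comp: "(\<lambda>z. g (z / q)) holomorphic_on ball 0 \<delta>" if "g holomorphic_on ball 0 \<delta>" for g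
    proof -
      have "(g \<circ> (\<lambda>z. z / q)) holomorphic_on ball 0 \<delta>"
        by (rule holomorphic_on_compose_gen[OF _ that]) (use zq_ball q0 in \<open>auto intro!: holomorphic_intros\<close>)
      then show ?thesis by (simp add: o_def)
    qed
    show ?case
      unfolding wS ent[OF wc Suc.prems] using Suc.IH F(2) Suc.prems
      by (auto intro!: holomorphic_intros comp)
  qed (simp add: w0)
  define d where "d m z = w (Suc m) z - w m z" for m z
  have dc: "d m z \<in> carrier_mat n n" for m z unfolding d_def by (rule minus_carrier_mat[OF wc])
  have dS: "d (Suc m) z = F (z / q) * d m (z / q) * A'" for m z
  proof -
    note c = F(1)[of "z / q"] wc[of "Suc m" "z / q"] wc[of m "z / q"]
    have "d (Suc m) z = F (z / q) * w (Suc m) (z / q) * A' - F (z / q) * w m (z / q) * A'"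
      by (simp only: d_def wS)
    also have "\<dots> = (F (z / q) * w (Suc m) (z / q) - F (z / q) * w m (z / q)) * A'"
      by (rule minus_mult_distrib_mat[symmetric, OF mult_carrier_mat[OF c(1,2)] mult_carrier_mat[OF c(1,3)] A(2)])
    also have "F (z / q) * w (Suc m) (z / q) - F (z / q) * w m (z / q) = F (z / q) * d m (z / q)"
      unfolding d_def by (rule mult_minus_distrib_mat[symmetric, OF c])
    finally show ?thesis .
  qed
  \<comment> \<open>Evaluation at \<open>z / q\<close> gains a factor \<open>1 / \<bar>q\<bar>\<close>, which beats the growth of the products.\<close>
  have db: "entry_norm (d m z) \<le> \<kappa> ^ m * L * norm z" if "norm z < \<delta>" for m z
    using that
  proof (induction m arbitrary: z)
    case 0
    have "d 0 z = F (z / q) * A' - 1\<^sub>m n"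
      using F(1)[of "z / q"] by (simp add: d_def wS w0)
    then have "entry_norm (d 0 z) \<le> L * norm (z / q)" using L(1) zq_ball[OF 0] by simp
    also have "\<dots> \<le> L * norm z" using L(2) zq by (intro mult_left_mono)
    finally show ?case by simp
  next
    case (Suc m)
    have "entry_norm (d (Suc m) z) \<le> \<kappa> * norm q * entry_norm (d m (z / q))"
      unfolding dS by (intro \<kappa>(1) zq_ball Suc dc)
    also have "\<dots> \<le> \<kappa> * norm q * (\<kappa> ^ m * L * norm (z / q))"
      using Suc.IH[OF zq_ball[OF Suc.prems]] \<kappa> by (intro mult_left_mono) auto
    also have "\<dots> = \<kappa> ^ Suc m * L * norm z"
      using q0 by (simp add: norm_divide)
    finally show ?case .
  qed
  define M where "M m = \<kappa> ^ m * (L * \<delta>)" for m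
  have Ms: "summable M"
    unfolding M_def using \<kappa> by (intro summable_mult2 summable_geometric) auto
  define W where "W z = mat n n (\<lambda>(i, j). (if i = j then 1 else 0) + (\<Sum>m. d m z $$ (i, j)))" for z
  have deb: "norm (d m z $$ (i, j)) \<le> M m" if "i < n" "j < n" "norm z < \<delta>" for m i j z
  proof -
    have "norm (d m z $$ (i, j)) \<le> \<kappa> ^ m * L * norm z"
      using norm_entry_le[OF dc that(1,2)] db[OF that(3)] by (rule order_trans)
    also have "\<dots> \<le> \<kappa> ^ m * L * \<delta>"
      using that \<kappa> L by (intro mult_left_mono) auto
    finally show ?thesis by (simp add: M_def)
  qed
  have tele: "(\<Sum>m<N. d m z $$ (i, j)) = w N z $$ (i, j) - (if i = j then 1 else 0)" if ij: "i < n" "j < n" for i j z N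
  proof -
    have "d m z $$ (i, j) = w (Suc m) z $$ (i, j) - w m z $$ (i, j)" for m
      unfolding d_def using wc[of m z] ij by simp
    then show ?thesis
      using ij sum_lessThan_telescope[of "\<lambda>m. w m z $$ (i, j)" N] by (simp add: w0)
  qed
  have lim: "(\<lambda>N. w N z $$ (i, j)) \<longlonglongrightarrow> W z $$ (i, j)" if "i < n" "j < n" "norm z < \<delta>" for i j z
  proof -
    have "summable (\<lambda>m. d m z $$ (i, j))"
      by (rule summable_comparison_test'[OF Ms, of 0]) (use deb that in auto)
    then have "(\<lambda>N. \<Sum>m<N. d m z $$ (i, j)) \<longlonglongrightarrow> (\<Sum>m. d m z $$ (i, j))"
      by (rule summable_LIMSEQ)
    then have "(\<lambda>N. (if i = j then 1 else 0) + (\<Sum>m<N. d m z $$ (i, j))) \<longlonglongrightarrow> (if i = j then 1 else 0) + (\<Sum>m. d m z $$ (i, j))"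
      by (intro tendsto_intros)
    then show ?thesis using that by (simp add: tele W_def)
  qed
  show ?thesis
  proof (rule that[of W])
    show Wc: "W z \<in> carrier_mat n n" for z by (simp add: W_def)
    show "(\<lambda>z. W z $$ (i, j)) holomorphic_on ball 0 \<delta>" if ij: "i < n" "j < n" for i j
    proof (rule holomorphic_uniform_sequence[OF open_ball wh[OF ij]])
      fix x :: complex assume "x \<in> ball 0 \<delta>"
      then obtain e where e: "e > 0" "cball x e \<subseteq> ball 0 \<delta>"
        using open_contains_cball[THEN iffD1, OF open_ball] by blast
      have "uniform_limit (cball x e) (\<lambda>N z. \<Sum>m<N. d m z $$ (i, j)) (\<lambda>z. \<Sum>m. d m z $$ (i, j)) sequentially"
        by (rule Weierstrass_m_test[OF _ Ms]) (use deb ij e in auto)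
      then have "uniform_limit (cball x e) (\<lambda>N z. (if i = j then 1 else 0) + (\<Sum>m<N. d m z $$ (i, j)))
          (\<lambda>z. (if i = j then 1 else 0) + (\<Sum>m. d m z $$ (i, j))) sequentially"
        by (intro uniform_limit_intros)
      then have "uniform_limit (cball x e) (\<lambda>N z. w N z $$ (i, j)) (\<lambda>z. W z $$ (i, j)) sequentially"
        using ij by (simp add: tele W_def)
      with e show "\<exists>d>0. cball x d \<subseteq> ball 0 \<delta> \<and> uniform_limit (cball x d) (\<lambda>N z. w N z $$ (i, j)) (\<lambda>z. W z $$ (i, j)) sequentially"
        by blast
    qed
    show "W 0 = 1\<^sub>m n"
    proof (rule eq_matI)
      fix i j assume "i < dim_row (1\<^sub>m n :: complex mat)" "j < dim_col (1\<^sub>m n :: complex mat)"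
      then have ij: "i < n" "j < n" by auto
      have "d m 0 $$ (i, j) = 0" for m
        using order_trans[OF norm_entry_le[OF dc[of m 0] ij] db[of 0 m]] \<delta> by simp
      then show "W 0 $$ (i, j) = 1\<^sub>m n $$ (i, j)" using ij by (simp add: W_def)
    qed (auto simp: W_def)
    show "W z = F (z / q) * W (z / q) * A'" if z: "norm z < \<delta>" for z
    proof (rule eq_matI)
      fix i j assume "i < dim_row (F (z / q) * W (z / q) * A')" "j < dim_col (F (z / q) * W (z / q) * A')"
      then have ij: "i < n" "j < n" using F(1)[of "z / q"] A by auto
      have "(\<lambda>N. \<Sum>l<n. (\<Sum>k<n. F (z / q) $$ (i, k) * w N (z / q) $$ (k, l)) * A' $$ (l, j)) \<longlonglongrightarrow>
          (\<Sum>l<n. (\<Sum>k<n. F (z / q) $$ (i, k) * W (z / q) $$ (k, l)) * A' $$ (l, j))"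
        using zq_ball[OF z] by (intro tendsto_intros lim) auto
      then have "(\<lambda>N. w (Suc N) z $$ (i, j)) \<longlonglongrightarrow> (F (z / q) * W (z / q) * A') $$ (i, j)"
        unfolding ent[OF Wc ij] wS ent[OF wc ij] .
      moreover have "(\<lambda>N. w (Suc N) z $$ (i, j)) \<longlonglongrightarrow> W z $$ (i, j)"
        by (rule LIMSEQ_Suc[OF lim[OF ij z]])
      ultimately show "W z $$ (i, j) = (F (z / q) * W (z / q) * A') $$ (i, j)"
        using LIMSEQ_unique by blast
    qed (use F(1)[of "z / q"] A in \<open>auto simp: W_def\<close>)
  qed
qed

text \<open>
  The right-hand side of the functional equation at \<open>z\<close> involves \<open>W\<close> only at \<open>z / q\<close>, so each application
  enlarges the disc by the factor \<open>\<bar>q\<bar>\<close>, and the successive extensions \<open>G m\<close> agree on common discs.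
\<close>

lemma extend_solution:
  fixes F W :: "complex \<Rightarrow> complex mat"
  assumes q: "norm q > 1" and \<delta>: "\<delta> > 0"
    and F: "\<And>z. F z \<in> carrier_mat n n" "\<And>i j. i < n \<Longrightarrow> j < n \<Longrightarrow> (\<lambda>z. F z $$ (i, j)) meromorphic_on UNIV"
    and A': "A' \<in> carrier_mat n n"
    and W: "\<And>z. W z \<in> carrier_mat n n"
      "\<And>i j. i < n \<Longrightarrow> j < n \<Longrightarrow> (\<lambda>z. W z $$ (i, j)) holomorphic_on ball 0 \<delta>"
      "\<And>z. norm z < \<delta> \<Longrightarrow> W z = F (z / q) * W (z / q) * A'"
  obtains H where "\<And>z. H z \<in> carrier_mat n n"
    "\<And>i j. i < n \<Longrightarrow> j < n \<Longrightarrow> (\<lambda>z. H z $$ (i, j)) meromorphic_on UNIV"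
    "\<And>z. norm z < \<delta> \<Longrightarrow> H z = W z"
    "\<And>z. H (q * z) = F z * H z * A'"
proof -
  have q0: "q \<noteq> 0" using q by auto
  define G where "G m = ((\<lambda>W z. F (z / q) * W (z / q) * A') ^^ m) W" for m
  have G0: "G 0 z = W z" and GS: "G (Suc m) z = F (z / q) * G m (z / q) * A'" for m z
    by (simp_all add: G_def)
  have Gc: "G m z \<in> carrier_mat n n" for m z
    by (induction m arbitrary: z) (auto simp: G0 GS W intro!: mult_carrier_mat[of _ n n _ n] F A')
  define D where "D m = ball (0 :: complex) (\<delta> * norm q ^ m)" for m
  have Dq: "z / q \<in> D m \<longleftrightarrow> z \<in> D (Suc m)" for z m
    using q0 by (simp add: D_def norm_divide field_simps)
  have Dmono: "D m \<subseteq> D (m + k)" for m k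
    unfolding D_def using q \<delta> by (intro subset_ball mult_left_mono power_increasing) auto
  have stable1: "G (Suc m) z = G m z" if "z \<in> D m" for m z
    using that
  proof (induction m arbitrary: z)
    case 0
    then show ?case using W(3)[of z] by (simp add: G0 GS D_def)
  next
    case (Suc m)
    then show ?case using Suc.IH[of "z / q"] Dq by (simp only: GS)
  qed
  have stable: "G (m + k) z = G m z" if "z \<in> D m" for m k z
  proof (induction k)
    case (Suc k)
    have "z \<in> D (m + k)" using that Dmono by blast
    from stable1[OF this] Suc show ?case by simp
  qed simp
  have ent: "(F z * X * A') $$ (i, j) = (\<Sum>l<n. (\<Sum>k<n. F z $$ (i, k) * X $$ (k, l)) * A' $$ (l, j))"
    if "X \<in> carrier_mat n n" "i < n" "j < n" for z X i j
    using that by (simp add: mat_mult_index[OF mult_carrier_mat[OF F(1) that(1)] A' that(2,3)]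
        mat_mult_index[OF F(1) that(1)] del: index_mult_mat)
  have Gm: "(\<lambda>z. G m z $$ (i, j)) meromorphic_on D m" if "i < n" "j < n" for m i j
    using that
  proof (induction m arbitrary: i j)
    case 0
    then show ?case
      using W(2)[OF 0] by (intro analytic_on_imp_meromorphic_on) (simp add: G0 D_def analytic_on_open)
  next
    case (Suc m)
    have FF: "(\<lambda>z. F (z / q) $$ (i, k)) meromorphic_on D (Suc m)" if "i < n" "k < n" for i k
      by (rule meromorphic_on_compose[OF F(2)[OF that], of "\<lambda>z. z / q"]) (use q0 in \<open>auto intro!: analytic_intros\<close>)
    have GG: "(\<lambda>z. G m (z / q) $$ (k, l)) meromorphic_on D (Suc m)" if "k < n" "l < n" for k l
      by (rule meromorphic_on_compose[OF Suc.IH[OF that], of "\<lambda>z. z / q"])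
         (use q0 Dq in \<open>auto intro!: analytic_intros\<close>)
    show ?case
      unfolding GS ent[OF Gc Suc.prems] using FF GG Suc.prems
      by (auto intro!: meromorphic_intros)
  qed
  define lev where "lev z = (SOME m. z \<in> D m)" for z
  define H where "H z = G (lev z) z" for z
  have lev: "z \<in> D (lev z)" for z
  proof -
    obtain m where "norm z / \<delta> < norm q ^ m" using real_arch_pow[OF q] by blast
    then have "z \<in> D m" using \<delta> by (simp add: D_def field_simps)
    then show ?thesis unfolding lev_def by (rule someI)
  qed
  have HG: "H z = G m z" if "z \<in> D m" for z m
    unfolding H_def using stable[OF that, of "lev z"] stable[OF lev, of z m] by (simp add: add.commute)
  show ?thesis
  proof (rule that[of H])
    show "H z \<in> carrier_mat n n" for z using Gc by (simp add: H_def)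
    show "H z = W z" if "norm z < \<delta>" for z
      using HG[of z 0] that by (simp add: D_def G0)
    show "H (q * z) = F z * H z * A'" for z
    proof -
      have "q * z \<in> D (Suc (lev z))" using lev[of z] Dq[of "q * z" "lev z"] q0 by simp
      then show ?thesis using HG[of "q * z" "Suc (lev z)"] q0 by (simp add: GS H_def)
    qed
    show "(\<lambda>z. H z $$ (i, j)) meromorphic_on UNIV" if ij: "i < n" "j < n" for i j
    proof (subst meromorphic_on_meromorphic_at, rule ballI)
      fix x :: complex
      have "open (D (lev x))" by (simp add: D_def)
      then have "eventually (\<lambda>z. z \<in> D (lev x)) (at x)" using lev by (intro eventually_at_in_open')
      then have ev: "eventually (\<lambda>z. H z $$ (i, j) = G (lev x) z $$ (i, j)) (at x)"
        by eventually_elim (simp add: HG)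
      have "(\<lambda>z. G (lev x) z $$ (i, j)) meromorphic_on {x}"
        by (rule meromorphic_on_subset[OF Gm[OF ij]]) (use lev in auto)
      then show "(\<lambda>z. H z $$ (i, j)) meromorphic_on {x}"
        by (rule meromorphic_on_cong[THEN iffD2, OF _ refl, rotated]) (use ev in auto)
    qed
  qed
qed

text \<open>
  Here \<open>B z X A\<inverse>\<close> exceeds \<open>X\<close> in norm by a factor of at most the quotient of \<open>a + 2 n \<epsilon>\<close>, a bound for the column sums
  of \<open>B\<close> near the origin, and \<open>R - n \<epsilon>\<close>, a lower bound for right multiplication by \<open>A\<close>.
  The hypothesis on \<open>\<epsilon>\<close> says that this quotient is smaller than \<open>\<bar>q\<bar>\<close>.
\<close>

lemma gauge_near_diagonal:
  assumes q: "norm q > 1" and B: "value_mat n B A" and R: "0 < R" "R \<le> a"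
    and diag: "\<And>i. i < n \<Longrightarrow> R \<le> norm (A $$ (i, i)) \<and> norm (A $$ (i, i)) \<le> a"
    and off: "\<And>i j. i < n \<Longrightarrow> j < n \<Longrightarrow> i \<noteq> j \<Longrightarrow> norm (A $$ (i, j)) \<le> \<epsilon>"
    and \<epsilon>: "0 < \<epsilon>" "real n * \<epsilon> < R" "a + 2 * real n * \<epsilon> < norm q * (R - real n * \<epsilon>)"
    and det: "Determinant.det A \<noteq> 0"
  shows "gauge_equiv q n B (const_mat A)"
proof -
  have q0: "q \<noteq> 0" using q by auto
  note c = value_matD(1,2)[OF B]
  have AG: "A \<in> GL n UNIV" using det c by (simp add: GL_UNIV_iff)
  define A' where "A' = inv_mat A"
  have A': "A' \<in> carrier_mat n n" "A * A' = 1\<^sub>m n" "A' * A = 1\<^sub>m n"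
    using GL_inv_carrier[OF AG] GL_inv_mat[OF AG] by (auto simp: A'_def)
  define represents where "represents i j g \<longleftrightarrow> g meromorphic_on UNIV \<and> B $$ (i, j) = abs_mero g \<and>
      g analytic_on {0} \<and> g 0 = A $$ (i, j)" for i j g
  define f where "f i j = (SOME g. represents i j g)" for i j
  have "represents i j (f i j)" if "i < n" "j < n" for i j
  proof -
    have "\<exists>g. represents i j g"
      using value_matD(3)[OF B that] unfolding represents_def by (auto elim!: value_at_0E)
    then show ?thesis unfolding f_def by (rule someI_ex)
  qed
  then have f: "f i j meromorphic_on UNIV" "B $$ (i, j) = abs_mero (f i j)" "f i j analytic_on {0}"
    "f i j 0 = A $$ (i, j)" if "i < n" "j < n" for i j
    using that by (auto simp: represents_def)
  define near where "near i j \<delta> L \<longleftrightarrow> \<delta> > 0 \<and> L \<ge> 0 \<and> f i j holomorphic_on ball 0 \<delta> \<and>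
    (\<forall>w. norm w < \<delta> \<longrightarrow> norm (f i j w - A $$ (i, j)) \<le> L * norm w \<and> norm (f i j w - A $$ (i, j)) \<le> \<epsilon>)" for i j \<delta> L
  have "\<exists>\<delta> L. near i j \<delta> L" if "i < n" "j < n" for i j
    using lipschitz_at_analytic[OF f(3)[OF that] \<epsilon>(1)] f(4)[OF that] unfolding near_def by auto
  then obtain \<delta>0 L0 where "\<And>i j. i < n \<Longrightarrow> j < n \<Longrightarrow> near i j (\<delta>0 i j) (L0 i j)"
    by metis
  then have l0: "\<delta>0 i j > 0" "L0 i j \<ge> 0" "f i j holomorphic_on ball 0 (\<delta>0 i j)"
    "norm w < \<delta>0 i j \<Longrightarrow> norm (f i j w - A $$ (i, j)) \<le> L0 i j * norm w"
    "norm w < \<delta>0 i j \<Longrightarrow> norm (f i j w - A $$ (i, j)) \<le> \<epsilon>" if "i < n" "j < n" for i j w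
    using that unfolding near_def by blast+
  define \<delta> where "\<delta> = Min (insert 1 ((\<lambda>(i, j). \<delta>0 i j) ` ({..<n} \<times> {..<n})))"
  have \<delta>: "\<delta> > 0" "\<And>i j. i < n \<Longrightarrow> j < n \<Longrightarrow> \<delta> \<le> \<delta>0 i j"
    using l0(1) by (auto simp: \<delta>_def intro!: Min_le)
  define F where "F z = mat n n (\<lambda>(i, j). f i j z)" for z
  have Fc: "F z \<in> carrier_mat n n" for z by (simp add: F_def)
  define \<rho> where "\<rho> = R - real n * \<epsilon>"
  have \<rho>: "\<rho> > 0" using \<epsilon> by (simp add: \<rho>_def)
  have inv_bound: "entry_norm (Y * A') \<le> entry_norm Y / \<rho>" if Y: "Y \<in> carrier_mat n n" for Y
  proof -
    have "\<rho> * entry_norm (Y * A') \<le> entry_norm (Y * A' * A)"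
      unfolding \<rho>_def by (rule entry_norm_mult_ge[OF c(2) mult_carrier_mat[OF Y A'(1)]]) (use diag off \<epsilon> in auto)
    also have "Y * A' * A = Y"
      using assoc_mult_mat[OF Y A'(1) c(2)] A'(3) Y by simp
    finally show ?thesis using \<rho> by (simp add: field_simps)
  qed
  have col: "(\<Sum>i<n. norm (F z $$ (i, k))) \<le> a + 2 * real n * \<epsilon>" if "k < n" "norm z < \<delta>" for k z
  proof -
    have "norm (F z $$ (i, k)) \<le> (if i = k then a else 0) + 2 * \<epsilon>" if i: "i < n" for i
    proof -
      have "norm (f i k z - A $$ (i, k)) \<le> \<epsilon>"
        using \<delta>(2)[OF i \<open>k < n\<close>] \<open>norm z < \<delta>\<close> by (intro l0(5) i \<open>k < n\<close>) linarith
      moreover have "norm (f i k z) \<le> norm (f i k z - A $$ (i, k)) + norm (A $$ (i, k))"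
        using norm_triangle_ineq[of "f i k z - A $$ (i, k)" "A $$ (i, k)"] by simp
      moreover have "norm (A $$ (i, k)) \<le> (if i = k then a else 0) + \<epsilon>"
        using diag[OF i] off[OF i \<open>k < n\<close>] \<epsilon>(1) by (cases "i = k") auto
      ultimately show ?thesis using i \<open>k < n\<close> by (simp add: F_def)
    qed
    then have "(\<Sum>i<n. norm (F z $$ (i, k))) \<le> (\<Sum>i<n. (if i = k then a else 0) + 2 * \<epsilon>)"
      by (intro sum_mono) auto
    also have "\<dots> = a + 2 * real n * \<epsilon>"
      using that by (simp add: sum.distrib)
    finally show ?thesis .
  qed
  define \<kappa> where "\<kappa> = (a + 2 * real n * \<epsilon>) / (\<rho> * norm q)"
  have \<kappa>: "0 \<le> \<kappa>" "\<kappa> < 1"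
    using \<rho> \<epsilon> R q0 by (auto simp: \<kappa>_def \<rho>_def mult.commute)
  have k: "entry_norm (F z * X * A') \<le> \<kappa> * norm q * entry_norm X" if "norm z < \<delta>" "X \<in> carrier_mat n n" for z X
  proof -
    have "entry_norm (F z * X * A') \<le> entry_norm (F z * X) / \<rho>"
      by (rule inv_bound[OF mult_carrier_mat[OF Fc that(2)]])
    also have "\<dots> \<le> (a + 2 * real n * \<epsilon>) * entry_norm X / \<rho>"
      using \<rho> by (intro divide_right_mono entry_norm_mult_le[OF Fc that(2)] col that) auto
    also have "\<dots> = \<kappa> * norm q * entry_norm X"
      using q0 by (simp add: \<kappa>_def)
    finally show ?thesis .
  qed
  define L where "L = (\<Sum>i<n. \<Sum>j<n. L0 i j) / \<rho>"
  have L0: "0 \<le> L" using \<rho> l0(2) by (auto simp: L_def intro!: divide_nonneg_pos sum_nonneg)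
  have L: "entry_norm (F z * A' - 1\<^sub>m n) \<le> L * norm z" if z: "norm z < \<delta>" for z
  proof -
    have "F z * A' - 1\<^sub>m n = (F z - A) * A'"
      using minus_mult_distrib_mat[OF Fc c(2) A'(1)] A' by simp
    then have "entry_norm (F z * A' - 1\<^sub>m n) \<le> entry_norm (F z - A) / \<rho>"
      using inv_bound[OF minus_carrier_mat[OF c(2)]] by simp
    also have "entry_norm (F z - A) \<le> (\<Sum>i<n. \<Sum>j<n. L0 i j * norm z)"
      unfolding entry_norm_carrier[OF minus_carrier_mat[OF c(2)]]
    proof (intro sum_mono)
      fix i j assume "i \<in> {..<n}" "j \<in> {..<n}"
      then have ij: "i < n" "j < n" by auto
      have "norm (f i j z - A $$ (i, j)) \<le> L0 i j * norm z"
        using \<delta>(2)[OF ij] z by (intro l0(4) ij) linarith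
      then show "norm ((F z - A) $$ (i, j)) \<le> L0 i j * norm z"
        using ij c(2) by (simp add: F_def)
    qed
    then have "entry_norm (F z - A) / \<rho> \<le> (\<Sum>i<n. \<Sum>j<n. L0 i j * norm z) / \<rho>"
      using \<rho> by (intro divide_right_mono) auto
    also have "\<dots> = L * norm z" by (simp add: L_def sum_distrib_right)
    finally show ?thesis by simp
  qed
  have Fh: "(\<lambda>z. F z $$ (i, j)) holomorphic_on ball 0 \<delta>" if "i < n" "j < n" for i j
    using holomorphic_on_subset[OF l0(3)[OF that], of "ball 0 \<delta>"] \<delta>(2)[OF that] that by (simp add: F_def subset_ball)
  obtain W where W: "\<And>z. W z \<in> carrier_mat n n"
    "\<And>i j. i < n \<Longrightarrow> j < n \<Longrightarrow> (\<lambda>z. W z $$ (i, j)) holomorphic_on ball 0 \<delta>" "W 0 = 1\<^sub>m n"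
    "\<And>z. norm z < \<delta> \<Longrightarrow> W z = F (z / q) * W (z / q) * A'"
    by (rule local_solution[OF q \<delta>(1) Fc Fh c(2) A' L L0 k \<kappa>]) blast+
  have Fm: "(\<lambda>z. F z $$ (i, j)) meromorphic_on UNIV" if "i < n" "j < n" for i j
    using f(1)[OF that] that by (simp add: F_def)
  obtain H where H: "\<And>z. H z \<in> carrier_mat n n"
    "\<And>i j. i < n \<Longrightarrow> j < n \<Longrightarrow> (\<lambda>z. H z $$ (i, j)) meromorphic_on UNIV"
    "\<And>z. norm z < \<delta> \<Longrightarrow> H z = W z" "\<And>z. H (q * z) = F z * H z * A'"
    by (rule extend_solution[OF q \<delta>(1) Fc Fm A'(1) W(1,2,4)]) blast+
  define X where "X = mat n n (\<lambda>(i, j). abs_mero (\<lambda>z. H z $$ (i, j)))"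
  have Xc: "X \<in> carrier_mat n n" by (simp add: X_def)
  have Hp: "(\<lambda>z. H z $$ (i, j)) meromorphic_on -{0}" if "i < n" "j < n" for i j
    using H(2)[OF that] by (rule meromorphic_punctured)
  have "value_mat n X (1\<^sub>m n)"
    unfolding value_mat_def
  proof (intro conjI allI impI Xc)
    fix i j assume ij: "i < n" "j < n"
    have "(\<lambda>z. H z $$ (i, j)) holomorphic_on ball 0 \<delta>"
      by (rule holomorphic_transform[OF W(2)[OF ij]]) (simp add: H(3))
    then have "(\<lambda>z. H z $$ (i, j)) analytic_on {0}"
      using \<delta>(1) by (intro holomorphic_on_imp_analytic_at[of _ "ball 0 \<delta>"]) auto
    then have "value_at_0 (abs_mero (\<lambda>z. H z $$ (i, j))) (1\<^sub>m n $$ (i, j))"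
      by (intro value_at_0I H(2) ij) (use H(3)[of 0] W(3) \<delta>(1) in auto)
    then show "value_at_0 (X $$ (i, j)) (1\<^sub>m n $$ (i, j))" using ij by (simp add: X_def)
  qed simp
  then have XG: "X \<in> GL n mero_plane" by (rule value_mat_invertible) simp
  have "qshift_mat q X * const_mat A = B * X"
  proof (rule eq_matI)
    fix i j assume "i < dim_row (B * X)" "j < dim_col (B * X)"
    then have ij: "i < n" "j < n" using c Xc by auto
    have HA: "H (q * z) * A = F z * H z" for z
    proof -
      have "H (q * z) * A = F z * H z * (A' * A)"
        unfolding H(4) by (rule assoc_mult_mat[OF mult_carrier_mat[OF Fc H(1)] A'(1) c(2)])
      then show ?thesis unfolding A'(3) right_mult_one_mat[OF mult_carrier_mat[OF Fc H(1)]] .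
    qed
    have qX: "qshift_mat q X \<in> carrier_mat n n" "const_mat A \<in> carrier_mat n n" using Xc c by auto
    have Hq: "(\<lambda>z. H (q * z) $$ (i, k)) meromorphic_on -{0}" if "k < n" for k
      using meromorphic_scale[OF Hp[OF ij(1) that] q0] .
    have "(qshift_mat q X * const_mat A) $$ (i, j) =
        (\<Sum>k<n. abs_mero (\<lambda>z. H (q * z) $$ (i, k)) * abs_mero (\<lambda>_. A $$ (k, j)))"
      unfolding mat_mult_index[OF qX ij] using ij c Xc q0 Hp
      by (intro sum.cong) (auto simp: X_def qshift_abs_mero const_mero_def)
    also have "\<dots> = abs_mero (\<lambda>z. \<Sum>k<n. H (q * z) $$ (i, k) * A $$ (k, j))"
      using Hq abs_mero_sum[of "{..<n}" "\<lambda>k z. H (q * z) $$ (i, k) * A $$ (k, j)"]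
      by (simp add: abs_mero_mult meromorphic_on_mult)
    also have "(\<lambda>z. \<Sum>k<n. H (q * z) $$ (i, k) * A $$ (k, j)) = (\<lambda>z. \<Sum>k<n. f i k z * H z $$ (k, j))"
    proof
      fix z
      have "(\<Sum>k<n. H (q * z) $$ (i, k) * A $$ (k, j)) = (H (q * z) * A) $$ (i, j)"
        by (rule mat_mult_index[OF H(1) c(2) ij, symmetric])
      also have "\<dots> = (\<Sum>k<n. F z $$ (i, k) * H z $$ (k, j))"
        unfolding HA by (rule mat_mult_index[OF Fc H(1) ij])
      also have "\<dots> = (\<Sum>k<n. f i k z * H z $$ (k, j))"
        using ij by (simp add: F_def)
      finally show "(\<Sum>k<n. H (q * z) $$ (i, k) * A $$ (k, j)) = (\<Sum>k<n. f i k z * H z $$ (k, j))" .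
    qed
    also have "abs_mero \<dots> = (\<Sum>k<n. abs_mero (f i k) * abs_mero (\<lambda>z. H z $$ (k, j)))"
      using Hp f(1) ij meromorphic_punctured abs_mero_sum[of "{..<n}" "\<lambda>k z. f i k z * H z $$ (k, j)"]
      by (simp add: abs_mero_mult meromorphic_on_mult)
    also have "\<dots> = (B * X) $$ (i, j)"
      unfolding mat_mult_index[OF c(1) Xc ij] using ij by (simp add: X_def f(2))
    finally show "(qshift_mat q X * const_mat A) $$ (i, j) = (B * X) $$ (i, j)" .
  qed (use c Xc in auto)
  with XG show ?thesis by (auto simp: gauge_equiv_def)
qed

lemma upper_triangular_det_nonzero:
  fixes T :: "complex mat"
  assumes "T \<in> carrier_mat n n" "upper_triangular T" "\<And>i. i < n \<Longrightarrow> T $$ (i, i) \<noteq> 0"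
  shows "Determinant.det T \<noteq> 0"
  using assms by (auto simp: det_upper_triangular[OF assms(2,1)] diag_mat_def prod_list_zero_iff)

text \<open>
  Eigenvalues with moduli in \<open>[R, \<bar>q\<bar> R)\<close> have quotients of modulus below \<open>\<bar>q\<bar>\<close>, which leaves room
  for an error \<open>\<epsilon>\<close> off the diagonal of a triangular form.
\<close>

lemma gauge_normalized:
  assumes q: "norm q > 1" and B: "value_mat n B B0" and cp: "char_poly B0 = (\<Prod>e\<leftarrow>es. [:- e, 1:])"
    and R: "0 < R" "\<And>e. e \<in> set es \<Longrightarrow> R \<le> norm e \<and> norm e < norm q * R"
  shows "\<exists>A \<in> GL n UNIV. gauge_equiv q n B (const_mat A)"
proof -
  have q0: "q \<noteq> 0" using q by auto
  obtain T P Q where "schur_decomposition B0 es = (T, P, Q)"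
    by (cases "schur_decomposition B0 es") auto
  from schur_decomposition[OF value_matD(2)[OF B] cp this]
  have T: "similar_mat B0 T" "upper_triangular T" "diag_mat T = es"
    by (auto simp: similar_mat_def)
  obtain B1 where B1: "gauge_equiv q n B B1" "value_mat n B1 T"
    using gauge_const_conjugate[OF q0 B T(1)] by blast
  note Tc = value_matD(2)[OF B1(2)]
  have dT: "T $$ (i, i) \<in> set es" if "i < n" for i
    using T(3)[symmetric] Tc that by (auto simp: diag_mat_def)
  have lT: "T $$ (i, j) = 0" if "i < n" "j < i" for i j
    using T(2) Tc that by (auto simp: upper_triangular_def)
  define a where "a = Max (insert R (norm ` set es))"
  have a: "R \<le> a" "\<And>e. e \<in> set es \<Longrightarrow> norm e \<le> a" "a < norm q * R"
    using R q by (auto simp: a_def)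
  define g where "g = norm q * R - a"
  have g: "g > 0" using a by (simp add: g_def)
  \<comment> \<open>\<open>N\<close> is chosen so that \<open>\<epsilon> = min R g / N\<close> satisfies both inequalities needed for nearly diagonal values.\<close>
  define N where "N = (real n + 1) * (2 + norm q)"
  have N: "N > 0" "real n * (2 + norm q) < N" "real n < N"
  proof -
    show "real n * (2 + norm q) < N" unfolding N_def using q by (intro mult_strict_right_mono) auto
    moreover have "real n * 1 \<le> real n * (2 + norm q)" using q by (intro mult_left_mono) auto
    ultimately show "real n < N" by simp
    then show "N > 0" by linarith
  qed
  define \<epsilon> where "\<epsilon> = min R g / N"
  have \<epsilon>: "\<epsilon> > 0" "N * \<epsilon> \<le> R" "N * \<epsilon> \<le> g"
    using R(1) g N(1) by (auto simp: \<epsilon>_def)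
  have \<epsilon>1: "real n * \<epsilon> < R" "a + 2 * real n * \<epsilon> < norm q * (R - real n * \<epsilon>)"
  proof -
    have "real n * \<epsilon> < N * \<epsilon>" using N \<epsilon> by (intro mult_strict_right_mono)
    then show "real n * \<epsilon> < R" using \<epsilon> by linarith
    have "real n * (2 + norm q) * \<epsilon> < N * \<epsilon>" using N \<epsilon> by (intro mult_strict_right_mono)
    then have "real n * (2 + norm q) * \<epsilon> < g" using \<epsilon> by linarith
    then show "a + 2 * real n * \<epsilon> < norm q * (R - real n * \<epsilon>)" by (simp add: g_def algebra_simps)
  qed
  \<comment> \<open>Conjugation by the powers of a small number shrinks the entries above the diagonal.\<close>
  define \<tau> where "\<tau> = min 1 (\<epsilon> / (entry_norm T + 1))"
  have \<tau>: "0 < \<tau>" "\<tau> \<le> 1" "\<tau> * entry_norm T \<le> \<epsilon>"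
  proof -
    have p: "entry_norm T + 1 > 0" using entry_norm_nonneg[of T] by linarith
    show "0 < \<tau>" "\<tau> \<le> 1" using p \<epsilon> by (auto simp: \<tau>_def)
    have "\<tau> * entry_norm T \<le> \<epsilon> / (entry_norm T + 1) * entry_norm T"
      using entry_norm_nonneg[of T] by (intro mult_right_mono) (auto simp: \<tau>_def)
    also have "\<dots> \<le> \<epsilon>" using p \<epsilon> by (simp add: field_simps)
    finally show "\<tau> * entry_norm T \<le> \<epsilon>" .
  qed
  define B2 where "B2 = mat n n (\<lambda>(i, j). B1 $$ (i, j) * const_mero (of_real \<tau> ^ j) / qshift q (const_mero (of_real \<tau> ^ i)))"
  define A where "A = mat n n (\<lambda>(i, j). T $$ (i, j) * of_real \<tau> ^ j * inverse (of_real \<tau> ^ i))"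
  have cnz: "const_mero (of_real \<tau> ^ i) \<noteq> 0" for i
    using \<tau> by (intro value_nonzero[OF value_const]) auto
  have "gauge_equiv q n B1 B2"
    unfolding B2_def by (rule gauge_diagonal[OF q0 value_matD(1)[OF B1(2)]]) (auto simp: const_plane cnz)
  moreover have B2: "value_mat n B2 A"
    unfolding value_mat_def B2_def A_def using \<tau> q0
    by (auto simp: divide_inverse intro!: value_mult value_inverse value_const value_matD(3)[OF B1(2)])
  moreover have "gauge_equiv q n B2 (const_mat A)"
  proof (rule gauge_near_diagonal[OF q B2 R(1) a(1) _ _ \<epsilon>(1) \<epsilon>1])
    have diag: "A $$ (i, i) = T $$ (i, i)" if "i < n" for i
      using that \<tau> by (simp add: A_def)
    show "R \<le> norm (A $$ (i, i)) \<and> norm (A $$ (i, i)) \<le> a" if "i < n" for i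
      using R(2)[OF dT[OF that]] a(2)[OF dT[OF that]] diag[OF that] by simp
    show "norm (A $$ (i, j)) \<le> \<epsilon>" if ij: "i < n" "j < n" "i \<noteq> j" for i j
    proof (cases "j < i")
      case True
      then show ?thesis using lT[OF ij(1)] ij \<epsilon> by (simp add: A_def)
    next
      case False
      then obtain k where k: "j = i + Suc k" using ij(3) by (metis less_imp_Suc_add linorder_neqE_nat add_Suc_right)
      have "norm (A $$ (i, j)) = \<tau> ^ Suc k * norm (T $$ (i, j))"
        using ij k \<tau> by (simp add: A_def norm_mult norm_power norm_inverse power_add field_simps)
      also have "\<dots> \<le> \<tau> * entry_norm T"
        using \<tau> norm_entry_le[OF Tc ij(1,2)] power_decreasing[of 1 "Suc k" \<tau>]
        by (intro mult_mono) (auto simp: mult_left_le)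
      finally show ?thesis using \<tau> by linarith
    qed
    show "Determinant.det A \<noteq> 0"
    proof (rule upper_triangular_det_nonzero)
      show "upper_triangular A" using lT by (auto simp: upper_triangular_def A_def)
      show "A $$ (i, i) \<noteq> 0" if "i < n" for i
        using R(1) R(2)[OF dT[OF that]] diag[OF that] by auto
    qed (simp add: A_def)
  qed
  moreover have "Determinant.det A \<noteq> 0"
  proof (rule upper_triangular_det_nonzero)
    show "upper_triangular A" using lT by (auto simp: upper_triangular_def A_def)
    show "A $$ (i, i) \<noteq> 0" if "i < n" for i
      using R(1) R(2)[OF dT[OF that]] that \<tau> by (auto simp: A_def)
  qed (simp add: A_def)
  moreover have Ac: "A \<in> carrier_mat n n" by (simp add: A_def)
  ultimately show ?thesis
    using gauge_trans[OF q0 value_matD(1)[OF B] value_matD(1)[OF B1(2)] _ B1(1)]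
      gauge_trans[OF q0 value_matD(1)[OF B1(2)] value_matD(1)[OF B2]] value_matD(1)[OF B2]
    by (intro bexI[of _ A]) (auto simp: GL_UNIV_iff)
qed

theorem fundamental_solution_0:
  assumes q: "norm q > 1" and B: "value_mat n B B0" and det: "Determinant.det B0 \<noteq> 0"
  shows "\<exists>A \<in> GL n UNIV. gauge_equiv q n B (const_mat A)"
proof -
  have q0: "q \<noteq> 0" using q by auto
  note c = value_matD(1,2)[OF B]
  obtain es where es: "char_poly B0 = (\<Prod>e\<leftarrow>es. [:- e, 1:])"
    using char_poly_factorized[OF c(2)] by blast
  have nz: "e \<noteq> 0" if "e \<in> set es" for e
  proof
    assume "e = 0"
    then have "poly (char_poly B0) 0 = 0"
      using that unfolding es by (induction es) auto
    then have "eigenvalue B0 0" using eigenvalue_root_char_poly[OF c(2)] by simp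
    then obtain v where v: "v \<in> carrier_vec n" "v \<noteq> 0\<^sub>v n" "B0 *\<^sub>v v = 0 \<cdot>\<^sub>v v"
      using c(2) by (auto simp: eigenvalue_def eigenvector_def)
    have "0 \<cdot>\<^sub>v v = 0\<^sub>v n" using v(1) by (intro eq_vecI) auto
    then have "B0 *\<^sub>v v = 0\<^sub>v n" using v(3) by simp
    then have "Determinant.det B0 = 0"
      by (intro det_0_iff_vec_prod_zero_field[OF c(2), THEN iffD2] exI[of _ v] conjI v)
    then show False using det by simp
  qed
  \<comment> \<open>\<open>R\<close> exceeds all eigenvalues, so they only have to be multiplied by powers of \<open>q\<close>.\<close>
  define R where "R = 1 + sum_list (map norm es)"
  have le: "norm e \<le> sum_list (map norm es)" if e: "e \<in> set es" for e
  proof -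
    obtain xs ys where "es = xs @ e # ys" using split_list[OF e] by blast
    moreover have "0 \<le> sum_list (map norm zs)" for zs :: "complex list"
      by (rule sum_list_nonneg) auto
    note this[of xs] this[of ys]
    ultimately show ?thesis by simp
  qed
  have "0 \<le> sum_list (map norm es)" by (rule sum_list_nonneg) auto
  then have R: "R \<ge> 1" unfolding R_def by simp
  have bound: "e \<noteq> 0 \<and> norm e < norm q * R" if "e \<in> set es" for e
  proof -
    have "norm e < R" using le[OF that] by (simp add: R_def)
    also have "R \<le> norm q * R" using q R mult_right_mono[of 1 "norm q" R] by simp
    finally show ?thesis using nz[OF that] by simp
  qed
  obtain B' C es' where *: "gauge_equiv q n B B'" "value_mat n B' C" "char_poly C = (\<Prod>e\<leftarrow>es'. [:- e, 1:])"
    "\<forall>e\<in>set es'. R \<le> norm e \<and> norm e < norm q * R"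
    using normalize_exponents[OF q _ B es bound] R by auto
  obtain A where A: "A \<in> GL n UNIV" "gauge_equiv q n B' (const_mat A)"
    using gauge_normalized[OF q *(2,3), of R] *(4) R by auto
  then show ?thesis
    using gauge_trans[OF q0 c(1) value_matD(1)[OF *(2)] _ *(1)] GL_carrier[OF A(1)] by (intro bexI[of _ A]) auto
qed

text \<open>
  In the coordinate \<open>1 / z\<close>, the equation \<open>(\<sigma>\<^sub>q X) A = B X\<close> becomes one for the inverse of \<open>\<sigma>\<^sub>q\<close>.
  Shifting and inverting it gives an equation for \<open>\<sigma>\<^sub>q\<close> with system \<open>(\<sigma>\<^sub>q B')\<inverse>\<close> and constant \<open>A\<inverse>\<close>, where
  \<open>B'\<close> is \<open>B\<close> in the new coordinate, and this is solved at the origin.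
\<close>

theorem fundamental_solution_inf:
  assumes q: "norm q > 1" and B: "B \<in> carrier_mat n n" and B0: "B0 \<in> GL n UNIV"
    and val: "\<And>i j. i < n \<Longrightarrow> j < n \<Longrightarrow> value_at_inf (B $$ (i, j)) (B0 $$ (i, j))"
  shows "\<exists>A \<in> GL n UNIV. \<exists>X \<in> GL n mero_inf. qshift_mat q X * const_mat A = B * X"
proof -
  have q0: "q \<noteq> 0" using q by auto
  define B' where "B' = map_mat recip B"
  have vB': "value_mat n B' B0"
    using B GL_carrier[OF B0] val by (auto simp: value_mat_def B'_def value_recip)
  have vq: "value_mat n (qshift_mat q B') B0"
    using vB' q0 by (auto simp: value_mat_def value_qshift)
  have d: "Determinant.det B0 \<noteq> 0" using GL_det_nz[OF B0] .
  note inv = value_mat_invertible[OF vq d]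
  have d': "Determinant.det (inv_mat B0) \<noteq> 0" using GL_det_nz[OF GL_inv_mat(1)[OF B0]] .
  obtain A Y where A: "A \<in> GL n UNIV" and Y: "Y \<in> GL n mero_plane"
    and eq: "qshift_mat q Y * const_mat A = inv_mat (qshift_mat q B') * Y"
    using fundamental_solution_0[OF q inv(2) d'] by (auto simp: gauge_equiv_def)
  have c: "B' \<in> carrier_mat n n" "Y \<in> carrier_mat n n" "const_mat A \<in> carrier_mat n n"
    "qshift_mat q B' \<in> carrier_mat n n" "qshift_mat q Y \<in> carrier_mat n n"
    "qshift_mat q Y * const_mat A \<in> carrier_mat n n"
    using value_matD(1)[OF vB'] GL_carrier[OF Y] GL_carrier[OF A] by auto
  have "Y = qshift_mat q B' * (qshift_mat q Y * const_mat A)"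
    using eq GL_cancel_left(2)[OF inv(1) c(2)] c inv by simp
  also have "\<dots> = qshift_mat q (B' * (Y * const_mat A))"
    using qshift_mat_mult[OF q0 c(1) mult_carrier_mat[OF c(2,3)]] qshift_mat_mult[OF q0 c(2,3)] q0 by simp
  finally have Yeq: "Y = qshift_mat q (B' * (Y * const_mat A))" .
  have X: "map_mat recip Y \<in> GL n mero_inf"
    by (rule map_mat_GL(1)[OF Y]) (auto simp: recip_plane recip_add recip_mult)
  have rr: "map_mat recip B' = B" unfolding B'_def by (rule eq_matI) auto
  have "qshift_mat q (map_mat recip Y) = map_mat recip (B' * (Y * const_mat A))"
  proof -
    have "qshift_mat q (map_mat recip (qshift_mat q Z)) = map_mat recip Z" for Z
      using q0 by (intro eq_matI) (auto simp: recip_qshift qshift_qshift qshift_one)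
    then show ?thesis using Yeq by metis
  qed
  also have "\<dots> = B * (map_mat recip Y * const_mat A)"
  proof -
    have "map_mat recip (const_mat A) = const_mat A" by (rule eq_matI) auto
    then show ?thesis
      using recip_mat_mult[OF c(1) mult_carrier_mat[OF c(2,3)]] recip_mat_mult[OF c(2,3)] rr by simp
  qed
  also have "\<dots> = B * map_mat recip Y * const_mat A"
    using assoc_mult_mat[OF B GL_carrier[OF X] c(3)] by simp
  finally have e: "qshift_mat q (map_mat recip Y) = B * map_mat recip Y * const_mat A" .
  have AG: "const_mat A \<in> GL n UNIV" "inv_mat (const_mat A) = const_mat (inv_mat A)"
    by (rule const_mat_GL[OF A, where K = UNIV]; simp)+
  have "qshift_mat q (map_mat recip Y) * const_mat (inv_mat A) = B * map_mat recip Y"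
    unfolding e AG(2)[symmetric] by (rule GL_cancel_right(1)[OF AG(1) mult_carrier_mat[OF B GL_carrier[OF X]]])
  then show ?thesis
    using X GL_inv_mat(1)[OF A] by blast
qed

section \<open>Categories of tuples of matrices\<close>

text \<open>
  Morphisms are finite tuples of matrices of one size, recorded by jointly injective components
  \<open>ent i\<close>, and all operations are those of matrices in each component.  The axioms of a linear tensor
  category are then matrix identities; what depends on the category is only the closure of objects and
  morphisms under the operations, which the second locale adds.
\<close>

locale matrix_operations =
  fixes C :: "('o, 'm) tensor_cat" and rk :: "'o \<Rightarrow> nat" and ent :: "nat \<Rightarrow> 'm \<Rightarrow> mero mat"
  assumes ent_inj: "(\<And>i. ent i f = ent i g) \<Longrightarrow> f = g"
    and ent_id: "ent i (cId C X) = 1\<^sub>m (rk X)"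
    and ent_comp: "ent i (cComp C g f) = ent i g * ent i f"
    and ent_zero: "ent i (cZero C X Y) = 0\<^sub>m (rk Y) (rk X)"
    and ent_add: "ent i (cAdd C f g) = ent i f + ent i g"
    and ent_scale: "ent i (cScale C s f) = const_mero s \<cdot>\<^sub>m ent i f"
    and ent_tensor: "ent i (tMor C f g) = kron (ent i f) (ent i g)"
    and ent_braid: "ent i (tBraid C X Y) = flip_mat (rk X) (rk Y)"
    and rk_tensor: "rk (tOb C X Y) = rk X * rk Y"
    and rk_unit: "rk (tUnit C) = 1"
    and tensor_assoc: "tOb C (tOb C X Y) Z = tOb C X (tOb C Y Z)"
    and tensor_unit_left: "tOb C (tUnit C) X = X"
    and tensor_unit_right: "tOb C X (tUnit C) = X"
    and assoc_eq: "tAssoc C X Y Z = cId C (tOb C (tOb C X Y) Z)"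
    and lunit_eq: "tLunit C X = cId C X"
    and runit_eq: "tRunit C X = cId C X"

locale matrix_category = matrix_operations +
    assumes ent_hom: "\<lbrakk>X \<in> cOb C; Y \<in> cOb C; f \<in> cHom C X Y\<rbrakk> \<Longrightarrow> ent i f \<in> carrier_mat (rk Y) (rk X)"
    and id_closed: "X \<in> cOb C \<Longrightarrow> cId C X \<in> cHom C X X"
    and comp_closed: "\<lbrakk>X \<in> cOb C; Y \<in> cOb C; Z \<in> cOb C; f \<in> cHom C X Y; g \<in> cHom C Y Z\<rbrakk>
      \<Longrightarrow> cComp C g f \<in> cHom C X Z"
    and zero_closed: "\<lbrakk>X \<in> cOb C; Y \<in> cOb C\<rbrakk> \<Longrightarrow> cZero C X Y \<in> cHom C X Y"
    and add_closed: "\<lbrakk>X \<in> cOb C; Y \<in> cOb C; f \<in> cHom C X Y; g \<in> cHom C X Y\<rbrakk>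
      \<Longrightarrow> cAdd C f g \<in> cHom C X Y"
    and scale_closed: "\<lbrakk>X \<in> cOb C; Y \<in> cOb C; f \<in> cHom C X Y\<rbrakk> \<Longrightarrow> cScale C s f \<in> cHom C X Y"
    and unit_closed: "tUnit C \<in> cOb C"
    and tensor_ob_closed: "\<lbrakk>X \<in> cOb C; Y \<in> cOb C\<rbrakk> \<Longrightarrow> tOb C X Y \<in> cOb C"
    and tensor_hom_closed: "\<lbrakk>X \<in> cOb C; X' \<in> cOb C; Y \<in> cOb C; Y' \<in> cOb C;
        f \<in> cHom C X X'; g \<in> cHom C Y Y'\<rbrakk>
      \<Longrightarrow> tMor C f g \<in> cHom C (tOb C X Y) (tOb C X' Y')"
    and braid_closed: "\<lbrakk>X \<in> cOb C; Y \<in> cOb C\<rbrakk> \<Longrightarrow> tBraid C X Y \<in> cHom C (tOb C X Y) (tOb C Y X)"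
begin

lemma is_linear_category: "linear_category C"
proof unfold_locales
  fix X Y f assume "X \<in> cOb C" "Y \<in> cOb C" and f: "f \<in> cHom C X Y"
  note e = ent_hom[OF this]
  show "cComp C (cId C Y) f = f" "cComp C f (cId C X) = f"
    by (auto intro!: ent_inj simp: ent_comp ent_id left_mult_one_mat[OF e] right_mult_one_mat[OF e])
  show "cAdd C (cZero C X Y) f = f"
    using e by (auto intro!: ent_inj simp: ent_add ent_zero)
  show "cScale C 1 f = f"
    using e by (intro ent_inj eq_matI) (auto simp: ent_scale)
  show "cScale C s (cScale C t f) = cScale C (s * t) f" for s t
    using e by (intro ent_inj eq_matI) (auto simp: ent_scale const_mero_mult)
  show "cScale C (s + t) f = cAdd C (cScale C s f) (cScale C t f)" for s t
    using e by (intro ent_inj eq_matI) (auto simp: ent_scale ent_add const_mero_add distrib_right)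
  show "\<exists>g \<in> cHom C X Y. cAdd C g f = cZero C X Y"
  proof (rule bexI)
    show "cAdd C (cScale C (- 1) f) f = cZero C X Y"
    proof (rule ent_inj)
      fix i show "ent i (cAdd C (cScale C (- 1) f) f) = ent i (cZero C X Y)"
        using e[of i] by (intro eq_matI) (auto simp: ent_scale ent_add ent_zero const_mero_minus_1)
    qed
    show "cScale C (- 1) f \<in> cHom C X Y"
      by (rule scale_closed) fact+
  qed
next
  fix W X Y Z f g h
  assume *: "W \<in> cOb C" "X \<in> cOb C" "Y \<in> cOb C" "Z \<in> cOb C"
    "f \<in> cHom C W X" "g \<in> cHom C X Y" "h \<in> cHom C Y Z"
  show "cComp C (cComp C h g) f = cComp C h (cComp C g f)"
    using ent_hom[OF *(1,2,5)] ent_hom[OF *(2,3,6)] ent_hom[OF *(3,4,7)]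
    by (intro ent_inj) (auto simp: ent_comp intro: assoc_mult_mat)
next
  fix X Y f g h
  assume *: "X \<in> cOb C" "Y \<in> cOb C" "f \<in> cHom C X Y" "g \<in> cHom C X Y"
  note e = ent_hom[OF *(1,2,3)] ent_hom[OF *(1,2,4)]
  show "cAdd C f g = cAdd C g f"
    using e by (intro ent_inj) (auto simp: ent_add intro: comm_add_mat)
  show "cScale C s (cAdd C f g) = cAdd C (cScale C s f) (cScale C s g)" for s
    using e by (intro ent_inj) (auto simp: ent_add ent_scale intro: add_smult_distrib_left_mat)
  assume h: "h \<in> cHom C X Y"
  show "cAdd C (cAdd C f g) h = cAdd C f (cAdd C g h)"
    using e ent_hom[OF *(1,2) h] by (intro ent_inj) (auto simp: ent_add intro: assoc_add_mat)
next
  fix X Y Z f f' g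
  assume *: "X \<in> cOb C" "Y \<in> cOb C" "Z \<in> cOb C"
        "f \<in> cHom C X Y" "f' \<in> cHom C X Y" "g \<in> cHom C Y Z"
  show "cComp C g (cAdd C f f') = cAdd C (cComp C g f) (cComp C g f')"
    using ent_hom[OF *(1,2,4)] ent_hom[OF *(1,2,5)] ent_hom[OF *(2,3,6)]
    by (intro ent_inj) (auto simp: ent_add ent_comp intro: mult_add_distrib_mat)
  show "cComp C g (cScale C s f) = cScale C s (cComp C g f)" for s
    using ent_hom[OF *(1,2,4)] ent_hom[OF *(2,3,6)]
    by (intro ent_inj) (auto simp: ent_scale ent_comp intro: mult_smult_distrib)
  show "cComp C (cScale C s g) f = cScale C s (cComp C g f)" for s
    using ent_hom[OF *(1,2,4)] ent_hom[OF *(2,3,6)]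
    by (intro ent_inj) (auto simp: ent_scale ent_comp intro: mult_smult_assoc_mat)
next
  fix X Y Z f g g'
  assume *: "X \<in> cOb C" "Y \<in> cOb C" "Z \<in> cOb C"
        "f \<in> cHom C X Y" "g \<in> cHom C Y Z" "g' \<in> cHom C Y Z"
  show "cComp C (cAdd C g g') f = cAdd C (cComp C g f) (cComp C g' f)"
    using ent_hom[OF *(1,2,4)] ent_hom[OF *(2,3,5)] ent_hom[OF *(2,3,6)]
    by (intro ent_inj) (auto simp: ent_add ent_comp intro: add_mult_distrib_mat)
qed (rule id_closed comp_closed zero_closed add_closed scale_closed; assumption)+

sublocale linear_category C
  by (rule is_linear_category)

lemma is_iso_id: "X \<in> cOb C \<Longrightarrow> is_iso C X X (cId C X)"
  unfolding is_iso_def using id_closed id_left[OF _ _ id_closed] by blast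

lemma tensor_id': "tMor C (cId C X) (cId C Y) = cId C (tOb C X Y)"
  by (rule ent_inj) (simp add: ent_tensor ent_id rk_tensor kron_one)

lemma braid_symmetric': "cComp C (tBraid C Y X) (tBraid C X Y) = cId C (tOb C X Y)"
  by (rule ent_inj) (simp add: ent_comp ent_braid ent_id rk_tensor flip_mat_involution)

lemma is_linear_tensor_category: "linear_tensor_category C"
proof unfold_locales
  fix X Y assume *: "X \<in> cOb C" "Y \<in> cOb C"
  show "is_iso C (tOb C X Y) (tOb C Y X) (tBraid C X Y)"
    unfolding is_iso_def using * braid_closed braid_symmetric' by blast
  show "cComp C (tMor C (cId C X) (tLunit C Y)) (tAssoc C X (tUnit C) Y) = tMor C (tRunit C X) (cId C Y)"
    using id_left[OF _ _ id_closed] *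
    by (simp add: assoc_eq lunit_eq runit_eq tensor_id' tensor_unit_right tensor_ob_closed)
next
  fix X assume X: "X \<in> cOb C"
  show "is_iso C (tOb C (tUnit C) X) X (tLunit C X)" "is_iso C (tOb C X (tUnit C)) X (tRunit C X)"
    using is_iso_id[OF X] by (auto simp: tensor_unit_left tensor_unit_right lunit_eq runit_eq)
next
  fix X Y f assume *: "X \<in> cOb C" "Y \<in> cOb C" "f \<in> cHom C X Y"
  show "cComp C (tLunit C Y) (tMor C (cId C (tUnit C)) f) = cComp C f (tLunit C X)"
    "cComp C (tRunit C Y) (tMor C f (cId C (tUnit C))) = cComp C f (tRunit C X)"
    by (auto intro!: ent_inj simp: ent_comp ent_tensor ent_id lunit_eq runit_eq rk_unit
        left_mult_one_mat[OF ent_hom[OF *]] right_mult_one_mat[OF ent_hom[OF *]])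
next
  fix X Y Z assume *: "X \<in> cOb C" "Y \<in> cOb C" "Z \<in> cOb C"
  show "is_iso C (tOb C (tOb C X Y) Z) (tOb C X (tOb C Y Z)) (tAssoc C X Y Z)"
    using is_iso_id[of "tOb C X (tOb C Y Z)"] * by (simp add: assoc_eq tensor_assoc tensor_ob_closed)
  show "cComp C (tAssoc C Y Z X) (cComp C (tBraid C X (tOb C Y Z)) (tAssoc C X Y Z)) =
          cComp C (tMor C (cId C Y) (tBraid C X Z))
            (cComp C (tAssoc C Y X Z) (tMor C (tBraid C X Y) (cId C Z)))"
  proof (rule ent_inj)
    fix i
    let ?x = "rk X" and ?y = "rk Y" and ?z = "rk Z"
    have k1: "(flip_mat ?x (?y * ?z) :: mero mat) \<in> carrier_mat (?y * ?z * ?x) (?x * ?y * ?z)"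
      using flip_mat_carrier[of ?x "?y * ?z"] by (simp add: mult.assoc)
    have k2: "(kron (flip_mat ?x ?y) (1\<^sub>m ?z) :: mero mat) \<in> carrier_mat (?y * ?x * ?z) (?x * ?y * ?z)"
      by (intro kron_carrier) auto
    show "ent i (cComp C (tAssoc C Y Z X) (cComp C (tBraid C X (tOb C Y Z)) (tAssoc C X Y Z))) =
          ent i (cComp C (tMor C (cId C Y) (tBraid C X Z))
            (cComp C (tAssoc C Y X Z) (tMor C (tBraid C X Y) (cId C Z))))"
      by (simp add: ent_comp ent_tensor ent_braid ent_id assoc_eq rk_tensor left_mult_one_mat[OF k1]
          right_mult_one_mat[OF k1] left_mult_one_mat[OF k2] flip: flip_mat_hexagon)
  qed
next
  fix W X Y Z assume *: "W \<in> cOb C" "X \<in> cOb C" "Y \<in> cOb C" "Z \<in> cOb C"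
  show "cComp C (tAssoc C W X (tOb C Y Z)) (tAssoc C (tOb C W X) Y Z) =
          cComp C (tMor C (cId C W) (tAssoc C X Y Z))
            (cComp C (tAssoc C W (tOb C X Y) Z) (tMor C (tAssoc C W X Y) (cId C Z)))"
    using id_left[OF _ _ id_closed] * by (simp add: assoc_eq tensor_id' tensor_assoc tensor_ob_closed)
next
  fix X X' Y Y' f g
  assume *: "X \<in> cOb C" "X' \<in> cOb C" "Y \<in> cOb C" "Y' \<in> cOb C" "f \<in> cHom C X X'" "g \<in> cHom C Y Y'"
  show "cComp C (tBraid C X' Y') (tMor C f g) = cComp C (tMor C g f) (tBraid C X Y)"
    by (intro ent_inj)
       (simp add: ent_comp ent_braid ent_tensor flip_mat_natural[OF ent_hom[OF *(1,2,5)] ent_hom[OF *(3,4,6)]])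
  show "tMor C (cScale C s f) g = cScale C s (tMor C f g)" "tMor C f (cScale C s g) = cScale C s (tMor C f g)" for s
    by (rule ent_inj, simp add: ent_scale ent_tensor kron_smult_left kron_smult_right)+
  fix f' assume f': "f' \<in> cHom C X X'"
  show "tMor C (cAdd C f f') g = cAdd C (tMor C f g) (tMor C f' g)"
    by (intro ent_inj)
       (simp add: ent_add ent_tensor kron_add_left[OF ent_hom[OF *(1,2,5)] ent_hom[OF *(1,2) f']])
next
  fix X X' Y Y' f g g'
  assume *: "X \<in> cOb C" "X' \<in> cOb C" "Y \<in> cOb C" "Y' \<in> cOb C" "f \<in> cHom C X X'"
    "g \<in> cHom C Y Y'" "g' \<in> cHom C Y Y'"
  show "tMor C f (cAdd C g g') = cAdd C (tMor C f g) (tMor C f g')"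
    by (intro ent_inj)
       (simp add: ent_add ent_tensor kron_add_right[OF ent_hom[OF *(3,4,6)] ent_hom[OF *(3,4,7)]])
next
  fix X X' X'' Y Y' Y'' f f' g g'
  assume *: "X \<in> cOb C" "X' \<in> cOb C" "X'' \<in> cOb C" "Y \<in> cOb C" "Y' \<in> cOb C" "Y'' \<in> cOb C"
        "f \<in> cHom C X X'" "f' \<in> cHom C X' X''" "g \<in> cHom C Y Y'" "g' \<in> cHom C Y' Y''"
  show "tMor C (cComp C f' f) (cComp C g' g) = cComp C (tMor C f' g') (tMor C f g)"
    by (intro ent_inj)
       (simp add: ent_comp ent_tensor kron_mult[OF ent_hom[OF *(2,3,8)] ent_hom[OF *(1,2,7)]
          ent_hom[OF *(5,6,10)] ent_hom[OF *(4,5,9)]])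
next
  fix X X' Y Y' Z Z' f g h
  assume *: "X \<in> cOb C" "X' \<in> cOb C" "Y \<in> cOb C" "Y' \<in> cOb C" "Z \<in> cOb C" "Z' \<in> cOb C"
        "f \<in> cHom C X X'" "g \<in> cHom C Y Y'" "h \<in> cHom C Z Z'"
  show "cComp C (tAssoc C X' Y' Z') (tMor C (tMor C f g) h) =
          cComp C (tMor C f (tMor C g h)) (tAssoc C X Y Z)"
  proof (rule ent_inj)
    fix i
    have "kron (kron (ent i f) (ent i g)) (ent i h) \<in>
        carrier_mat (rk X' * rk Y' * rk Z') (rk X * rk Y * rk Z)"
      by (intro kron_carrier ent_hom *)
    note k = this
    show "ent i (cComp C (tAssoc C X' Y' Z') (tMor C (tMor C f g) h)) =
        ent i (cComp C (tMor C f (tMor C g h)) (tAssoc C X Y Z))"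
      by (simp add: ent_comp ent_tensor assoc_eq ent_id rk_tensor left_mult_one_mat[OF k]
          right_mult_one_mat[OF k] flip: kron_assoc)
  qed
qed (rule tensor_ob_closed tensor_hom_closed tensor_id' unit_closed braid_symmetric'; assumption?)+

end

section \<open>Strict functors\<close>

lemma strict_tensor_functor:
  assumes C: "matrix_category C rkC entC" and D: "matrix_category D rkD entD"
    and F: "cat_functor C D F Fm"
    and ob: "\<And>X Y. X \<in> cOb C \<Longrightarrow> Y \<in> cOb C \<Longrightarrow> F (tOb C X Y) = tOb D (F X) (F Y)"
    and unit: "F (tUnit C) = tUnit D"
    and mor: "\<And>X X' Y Y' f g. \<lbrakk>X \<in> cOb C; X' \<in> cOb C; Y \<in> cOb C; Y' \<in> cOb C;
        f \<in> cHom C X X'; g \<in> cHom C Y Y'\<rbrakk> \<Longrightarrow>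
        Fm (tOb C X Y) (tOb C X' Y') (tMor C f g) = tMor D (Fm X X' f) (Fm Y Y' g)"
    and braid: "\<And>X Y. X \<in> cOb C \<Longrightarrow> Y \<in> cOb C \<Longrightarrow>
        Fm (tOb C X Y) (tOb C Y X) (tBraid C X Y) = tBraid D (F X) (F Y)"
  shows "tensor_functor C D F Fm (\<lambda>X Y. cId D (tOb D (F X) (F Y))) (cId D (tUnit D))"
proof -
  interpret C: matrix_category C rkC entC by (rule C)
  interpret D: matrix_category D rkD entD by (rule D)
  interpret F: cat_functor C D F Fm by (rule F)
  note ob_closed = C.tensor_ob_closed D.tensor_ob_closed F.functor_ob
  note idl = D.id_left[OF _ _ D.id_closed]
  show ?thesis
  proof unfold_locales
    fix X Y assume *: "X \<in> cOb C" "Y \<in> cOb C"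
    show "is_iso D (tOb D (F X) (F Y)) (F (tOb C X Y)) (cId D (tOb D (F X) (F Y)))"
      using * by (simp add: ob D.is_iso_id ob_closed)
    have "tBraid D (F X) (F Y) \<in> cHom D (tOb D (F X) (F Y)) (tOb D (F Y) (F X))"
      using * by (intro D.braid_closed ob_closed)
    then show "cComp D (Fm (tOb C X Y) (tOb C Y X) (tBraid C X Y)) (cId D (tOb D (F X) (F Y))) =
          cComp D (cId D (tOb D (F Y) (F X))) (tBraid D (F X) (F Y))"
      using * D.id_left[of "tOb D (F X) (F Y)" "tOb D (F Y) (F X)"]
        D.id_right[of "tOb D (F X) (F Y)" "tOb D (F Y) (F X)"] by (simp add: braid ob_closed)
  next
    fix X X' Y Y' f g
    assume *: "X \<in> cOb C" "X' \<in> cOb C" "Y \<in> cOb C" "Y' \<in> cOb C" "f \<in> cHom C X X'" "g \<in> cHom C Y Y'"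
    have "tMor D (Fm X X' f) (Fm Y Y' g) \<in> cHom D (tOb D (F X) (F Y)) (tOb D (F X') (F Y'))"
      using * by (intro D.tensor_hom_closed F.functor_hom F.functor_ob)
    then show "cComp D (cId D (tOb D (F X') (F Y'))) (tMor D (Fm X X' f) (Fm Y Y' g)) =
          cComp D (Fm (tOb C X Y) (tOb C X' Y') (tMor C f g)) (cId D (tOb D (F X) (F Y)))"
      using * D.id_left[of "tOb D (F X) (F Y)" "tOb D (F X') (F Y')"]
        D.id_right[of "tOb D (F X) (F Y)" "tOb D (F X') (F Y')"] by (simp add: mor ob_closed)
  next
    show "is_iso D (tUnit D) (F (tUnit C)) (cId D (tUnit D))"
      by (simp add: unit D.is_iso_id D.unit_closed)
  next
    fix X Y Z assume *: "X \<in> cOb C" "Y \<in> cOb C" "Z \<in> cOb C"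
    have "Fm (tOb C (tOb C X Y) Z) (tOb C X (tOb C Y Z)) (tAssoc C X Y Z) =
        cId D (tOb D (F X) (tOb D (F Y) (F Z)))"
      using * F.functor_id[of "tOb C X (tOb C Y Z)"]
      by (simp add: C.assoc_eq C.tensor_assoc ob ob_closed)
    then show "cComp D (Fm (tOb C (tOb C X Y) Z) (tOb C X (tOb C Y Z)) (tAssoc C X Y Z))
            (cComp D (cId D (tOb D (F (tOb C X Y)) (F Z))) (tMor D (cId D (tOb D (F X) (F Y))) (cId D (F Z)))) =
          cComp D (cId D (tOb D (F X) (F (tOb C Y Z))))
            (cComp D (tMor D (cId D (F X)) (cId D (tOb D (F Y) (F Z)))) (tAssoc D (F X) (F Y) (F Z)))"
      using * idl by (simp add: D.assoc_eq D.tensor_id' D.tensor_assoc ob ob_closed)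
  next
    fix X assume X: "X \<in> cOb C"
    show "cComp D (Fm (tOb C (tUnit C) X) X (tLunit C X))
            (cComp D (cId D (tOb D (F (tUnit C)) (F X))) (tMor D (cId D (tUnit D)) (cId D (F X)))) = tLunit D (F X)"
      using X idl by (simp add: C.tensor_unit_left D.tensor_unit_left C.lunit_eq D.lunit_eq F.functor_id
          D.tensor_id' unit F.functor_ob)
    show "cComp D (Fm (tOb C X (tUnit C)) X (tRunit C X))
            (cComp D (cId D (tOb D (F X) (F (tUnit C)))) (tMor D (cId D (F X)) (cId D (tUnit D)))) = tRunit D (F X)"
      using X idl by (simp add: C.tensor_unit_right D.tensor_unit_right C.runit_eq D.runit_eq F.functor_id
          D.tensor_id' unit F.functor_ob)
  qed
qed

text \<open>
  A choice \<open>G\<close> of preimages satisfies \<open>F (G Y) = Y\<close>, so the counit is the identity and the unit is the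
  lift of an identity.
\<close>

lemma equivalence_if_surj_full_faithful:
  assumes C: "category C" and D: "category D" and F: "cat_functor C D F Fm"
    and surj: "\<And>Y. Y \<in> cOb D \<Longrightarrow> \<exists>X \<in> cOb C. F X = Y"
    and full: "\<And>X Y g. \<lbrakk>X \<in> cOb C; Y \<in> cOb C; g \<in> cHom D (F X) (F Y)\<rbrakk> \<Longrightarrow> \<exists>f \<in> cHom C X Y. Fm X Y f = g"
    and faithful: "\<And>X Y f f'. \<lbrakk>X \<in> cOb C; Y \<in> cOb C; f \<in> cHom C X Y; f' \<in> cHom C X Y; Fm X Y f = Fm X Y f'\<rbrakk>
      \<Longrightarrow> f = f'"
  shows "category_equivalence C D F Fm"
proof -
  interpret C: category C by (rule C)
  interpret D: category D by (rule D)
  interpret F: cat_functor C D F Fm by (rule F)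
  obtain G where G: "\<And>Y. Y \<in> cOb D \<Longrightarrow> G Y \<in> cOb C \<and> F (G Y) = Y"
    using surj by metis
  define lift where "lift X Y g = (SOME f. f \<in> cHom C X Y \<and> Fm X Y f = g)" for X Y g
  have lift: "lift X Y g \<in> cHom C X Y" "Fm X Y (lift X Y g) = g"
    if "X \<in> cOb C" "Y \<in> cOb C" "g \<in> cHom D (F X) (F Y)" for X Y g
    using someI_ex[of "\<lambda>f. f \<in> cHom C X Y \<and> Fm X Y f = g"] full[OF that] unfolding lift_def by blast+
  define Gm where "Gm Y Y' g = lift (G Y) (G Y') g" for Y Y' g
  have Gm: "Gm Y Y' g \<in> cHom C (G Y) (G Y')" "Fm (G Y) (G Y') (Gm Y Y' g) = g"
    if "Y \<in> cOb D" "Y' \<in> cOb D" "g \<in> cHom D Y Y'" for Y Y' g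
    unfolding Gm_def using that G by (auto intro!: lift)
  have Gf: "cat_functor D C G Gm"
  proof
    fix Y assume Y: "Y \<in> cOb D"
    show "G Y \<in> cOb C" using G Y by blast
    show "Gm Y Y (cId D Y) = cId C (G Y)"
      using Y G[OF Y] Gm[OF Y Y D.id_hom[OF Y]] F.functor_id[of "G Y"]
      by (intro faithful[of "G Y" "G Y"]) (auto intro: C.id_hom)
  next
    fix X Y f assume "X \<in> cOb D" "Y \<in> cOb D" "f \<in> cHom D X Y"
    then show "Gm X Y f \<in> cHom C (G X) (G Y)" by (rule Gm)
  next
    fix X Y Z f g assume *: "X \<in> cOb D" "Y \<in> cOb D" "Z \<in> cOb D" "f \<in> cHom D X Y" "g \<in> cHom D Y Z"
    note GG = G[OF *(1)] G[OF *(2)] G[OF *(3)]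
    have "Fm (G X) (G Z) (cComp C (Gm Y Z g) (Gm X Y f)) = cComp D g f"
      using GG Gm[OF *(1,2,4)] Gm[OF *(2,3,5)] by (subst F.functor_comp[of _ "G Y"]) auto
    then show "Gm X Z (cComp D g f) = cComp C (Gm Y Z g) (Gm X Y f)"
      using GG Gm[OF *(1,2,4)] Gm[OF *(2,3,5)] Gm[OF *(1,3) D.comp_hom[OF *]]
      by (intro faithful[of "G X" "G Z"]) (auto intro: C.comp_hom[of _ "G Y"])
  qed
  define \<eta> where "\<eta> X = lift X (G (F X)) (cId D (F X))" for X
  have \<eta>: "\<eta> X \<in> cHom C X (G (F X))" "Fm X (G (F X)) (\<eta> X) = cId D (F X)" if "X \<in> cOb C" for X
    unfolding \<eta>_def using that G[OF F.functor_ob[OF that]] D.id_hom[OF F.functor_ob[OF that]]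
    by (auto intro!: lift)
  have "natural_iso C C (\<lambda>X. X) (\<lambda>X Y f. f)
          (\<lambda>X. G (F X)) (\<lambda>X Y f. Gm (F X) (F Y) (Fm X Y f)) \<eta>"
    unfolding natural_iso_def
  proof (intro conjI ballI)
    fix X assume X: "X \<in> cOb C"
    note FX = F.functor_ob[OF X]
    note GX = G[OF FX]
    define \<theta> where "\<theta> = lift (G (F X)) X (cId D (F X))"
    have \<theta>: "\<theta> \<in> cHom C (G (F X)) X" "Fm (G (F X)) X \<theta> = cId D (F X)"
      unfolding \<theta>_def using X GX D.id_hom[OF FX] by (auto intro!: lift)
    have "cComp C \<theta> (\<eta> X) = cId C X"
      using X GX \<eta>[OF X] \<theta> D.id_left[OF FX FX D.id_hom[OF FX]]
      by (intro faithful[OF X X] C.comp_hom[of _ "G (F X)"] C.id_hom)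
         (auto simp: F.functor_id F.functor_comp[of _ "G (F X)"])
    moreover have "cComp C (\<eta> X) \<theta> = cId C (G (F X))"
      using X GX \<eta>[OF X] \<theta> D.id_left[OF FX FX D.id_hom[OF FX]] F.functor_id[of "G (F X)"]
      by (intro faithful[of "G (F X)" "G (F X)"] C.comp_hom[of _ X] C.id_hom)
         (auto simp: F.functor_comp[of _ X])
    ultimately show "is_iso C X (G (F X)) (\<eta> X)"
      unfolding is_iso_def using \<eta>[OF X] \<theta> by blast
  next
    fix X Y f assume *: "X \<in> cOb C" "Y \<in> cOb C" "f \<in> cHom C X Y"
    note FX = F.functor_ob[OF *(1)] and FY = F.functor_ob[OF *(2)]
    note GX = G[OF FX] and GY = G[OF FY]
    note Ff = F.functor_hom[OF *]
    note Gf = Gm[OF FX FY Ff]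
    show "cComp C (\<eta> Y) f = cComp C (Gm (F X) (F Y) (Fm X Y f)) (\<eta> X)"
    proof (rule faithful[of X "G (F Y)"])
      show "Fm X (G (F Y)) (cComp C (\<eta> Y) f) =
          Fm X (G (F Y)) (cComp C (Gm (F X) (F Y) (Fm X Y f)) (\<eta> X))"
        using * GX GY \<eta>[OF *(1)] \<eta>[OF *(2)] Gf D.id_left[OF FX FY Ff] D.id_right[OF FX FY Ff]
        by (simp add: F.functor_comp[of X Y "G (F Y)"] F.functor_comp[of X "G (F X)" "G (F Y)"])
    qed (use * GX GY \<eta>[OF *(1)] \<eta>[OF *(2)] Gf in \<open>auto intro: C.comp_hom[of X Y] C.comp_hom[of X "G (F X)"]\<close>)
  qed
  moreover have "natural_iso D D (\<lambda>X. F (G X)) (\<lambda>X Y f. Fm (G X) (G Y) (Gm X Y f))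
          (\<lambda>X. X) (\<lambda>X Y f. f) (cId D)"
    unfolding natural_iso_def is_iso_def using G Gm D.id_hom D.id_left[OF _ _ D.id_hom] D.id_left D.id_right
    by (auto intro!: bexI[of _ "cId D _"])
  ultimately show ?thesis
    unfolding category_equivalence_def using F Gf by blast
qed

text \<open>
  Under a surjective and full functor, the closure properties of the target are images of those of the
  source; only the source needs to be checked to be a category.
\<close>

lemma linear_tensor_equivalenceI:
  assumes C: "matrix_category C rkC entC" and D: "matrix_operations D rkD entD"
    and rank: "\<And>X Y g i. \<lbrakk>X \<in> cOb D; Y \<in> cOb D; g \<in> cHom D X Y\<rbrakk> \<Longrightarrow> entD i g \<in> carrier_mat (rkD Y) (rkD X)"
    and ob: "cOb D = F ` cOb C"
    and hom: "\<And>X Y. \<lbrakk>X \<in> cOb C; Y \<in> cOb C\<rbrakk> \<Longrightarrow> cHom D (F X) (F Y) = Fm X Y ` cHom C X Y"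
    and faithful: "\<And>X Y. \<lbrakk>X \<in> cOb C; Y \<in> cOb C\<rbrakk> \<Longrightarrow> inj_on (Fm X Y) (cHom C X Y)"
    and id: "\<And>X. X \<in> cOb C \<Longrightarrow> Fm X X (cId C X) = cId D (F X)"
    and comp: "\<And>X Y Z f g. Fm X Z (cComp C g f) = cComp D (Fm Y Z g) (Fm X Y f)"
    and zero: "\<And>X Y. \<lbrakk>X \<in> cOb C; Y \<in> cOb C\<rbrakk> \<Longrightarrow> Fm X Y (cZero C X Y) = cZero D (F X) (F Y)"
    and add: "\<And>X Y f g. Fm X Y (cAdd C f g) = cAdd D (Fm X Y f) (Fm X Y g)"
    and scale: "\<And>X Y s f. Fm X Y (cScale C s f) = cScale D s (Fm X Y f)"
    and tensor: "\<And>X Y. \<lbrakk>X \<in> cOb C; Y \<in> cOb C\<rbrakk> \<Longrightarrow> F (tOb C X Y) = tOb D (F X) (F Y)"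
    and unit: "F (tUnit C) = tUnit D"
    and mor: "\<And>X X' Y Y' f g. Fm (tOb C X Y) (tOb C X' Y') (tMor C f g) = tMor D (Fm X X' f) (Fm Y Y' g)"
    and braid: "\<And>X Y. \<lbrakk>X \<in> cOb C; Y \<in> cOb C\<rbrakk> \<Longrightarrow>
        Fm (tOb C X Y) (tOb C Y X) (tBraid C X Y) = tBraid D (F X) (F Y)"
  shows "linear_tensor_equivalence C D F Fm (\<lambda>X Y. cId D (tOb D (F X) (F Y))) (cId D (tUnit D))"
proof -
  interpret C: matrix_category C rkC entC by (rule C)
  have Fm: "Fm X Y f \<in> cHom D (F X) (F Y)" if "X \<in> cOb C" "Y \<in> cOb C" "f \<in> cHom C X Y" for X Y f
    using hom that by blast
  have lift: "\<exists>f \<in> cHom C X Y. g = Fm X Y f" if "X \<in> cOb C" "Y \<in> cOb C" "g \<in> cHom D (F X) (F Y)" for X Y g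
    using that(3) unfolding hom[OF that(1,2)] by blast
  have D': "matrix_category D rkD entD"
  proof (intro matrix_category.intro D matrix_category_axioms.intro rank)
    fix X assume "X \<in> cOb D"
    then obtain X0 where X: "X0 \<in> cOb C" "X = F X0" using ob by blast
    show "cId D X \<in> cHom D X X" using Fm[OF X(1,1) C.id_closed[OF X(1)]] unfolding id[OF X(1)] X(2) .
  next
    show "tUnit D \<in> cOb D" using C.unit_closed unfolding ob unit[symmetric] by (rule imageI)
  next
    fix X Y Z f g assume *: "X \<in> cOb D" "Y \<in> cOb D" "Z \<in> cOb D" "f \<in> cHom D X Y" "g \<in> cHom D Y Z"
    obtain X0 Y0 Z0 where XYZ: "X0 \<in> cOb C" "X = F X0" "Y0 \<in> cOb C" "Y = F Y0" "Z0 \<in> cOb C" "Z = F Z0"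
      using *(1-3) ob by blast
    obtain f0 g0 where fg: "f0 \<in> cHom C X0 Y0" "f = Fm X0 Y0 f0" "g0 \<in> cHom C Y0 Z0" "g = Fm Y0 Z0 g0"
      using lift[OF XYZ(1,3) *(4)[unfolded XYZ(2,4)]] lift[OF XYZ(3,5) *(5)[unfolded XYZ(4,6)]] by blast
    show "cComp D g f \<in> cHom D X Z"
      using Fm[OF XYZ(1,5) C.comp_closed[OF XYZ(1,3,5) fg(1,3)]] unfolding comp[of _ _ _ _ Y0] XYZ(2,6) fg(2,4) .
  next
    fix X Y assume *: "X \<in> cOb D" "Y \<in> cOb D"
    obtain X0 Y0 where XY: "X0 \<in> cOb C" "X = F X0" "Y0 \<in> cOb C" "Y = F Y0"
      using * ob by blast
    show "cZero D X Y \<in> cHom D X Y"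
      using Fm[OF XY(1,3) C.zero_closed[OF XY(1,3)]] unfolding zero[OF XY(1,3)] XY(2,4) .
    show "tOb D X Y \<in> cOb D"
      using C.tensor_ob_closed[OF XY(1,3)] unfolding ob XY(2,4) tensor[OF XY(1,3), symmetric] by (rule imageI)
    show "tBraid D X Y \<in> cHom D (tOb D X Y) (tOb D Y X)"
      using Fm[OF C.tensor_ob_closed[OF XY(1,3)] C.tensor_ob_closed[OF XY(3,1)] C.braid_closed[OF XY(1,3)]]
      unfolding braid[OF XY(1,3)] tensor[OF XY(1,3)] tensor[OF XY(3,1)] XY(2,4) .
    fix f assume f': "f \<in> cHom D X Y"
    obtain f0 where f: "f0 \<in> cHom C X0 Y0" "f = Fm X0 Y0 f0"
      using lift[OF XY(1,3) f'[unfolded XY(2,4)]] by blast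
    show "cScale D s f \<in> cHom D X Y" for s
      using Fm[OF XY(1,3) C.scale_closed[OF XY(1,3) f(1)]] unfolding scale XY(2,4) f(2) .
    fix g assume g': "g \<in> cHom D X Y"
    obtain g0 where g: "g0 \<in> cHom C X0 Y0" "g = Fm X0 Y0 g0"
      using lift[OF XY(1,3) g'[unfolded XY(2,4)]] by blast
    show "cAdd D f g \<in> cHom D X Y"
      using Fm[OF XY(1,3) C.add_closed[OF XY(1,3) f(1) g(1)]] unfolding add XY(2,4) f(2) g(2) .
  next
    fix X X' Y Y' f g assume *: "X \<in> cOb D" "X' \<in> cOb D" "Y \<in> cOb D" "Y' \<in> cOb D"
      and fg: "f \<in> cHom D X X'" "g \<in> cHom D Y Y'"
    obtain X0 X0' where X: "X0 \<in> cOb C" "X = F X0" "X0' \<in> cOb C" "X' = F X0'"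
      using *(1,2) ob by blast
    obtain Y0 Y0' where Y: "Y0 \<in> cOb C" "Y = F Y0" "Y0' \<in> cOb C" "Y' = F Y0'"
      using *(3,4) ob by blast
    obtain f0 g0 where fg0: "f0 \<in> cHom C X0 X0'" "f = Fm X0 X0' f0" "g0 \<in> cHom C Y0 Y0'" "g = Fm Y0 Y0' g0"
      using lift[OF X(1,3) fg(1)[unfolded X(2,4)]] lift[OF Y(1,3) fg(2)[unfolded Y(2,4)]] by blast
    show "tMor D f g \<in> cHom D (tOb D X Y) (tOb D X' Y')"
      using Fm[OF C.tensor_ob_closed[OF X(1) Y(1)] C.tensor_ob_closed[OF X(3) Y(3)]
          C.tensor_hom_closed[OF X(1,3) Y(1,3) fg0(1,3)]]
      unfolding mor fg0(2,4) tensor[OF X(1) Y(1)] tensor[OF X(3) Y(3)] X(2,4) Y(2,4) .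
  qed
  interpret D: matrix_category D rkD entD by (rule D')
  have F: "cat_functor C D F Fm"
    by unfold_locales (use ob Fm id comp in auto)
  have "linear_functor C D F Fm"
    by (intro linear_functor.intro F linear_functor_axioms.intro add scale)
  moreover have "category_equivalence C D F Fm"
  proof (rule equivalence_if_surj_full_faithful[OF _ _ F])
    show "category C" "category D" by unfold_locales
  qed (use ob hom faithful in \<open>auto simp: inj_on_def\<close>)
  moreover have "tensor_functor C D F Fm (\<lambda>X Y. cId D (tOb D (F X) (F Y))) (cId D (tUnit D))"
    by (rule strict_tensor_functor[OF C D' F]) (rule tensor unit mor braid; assumption)+
  ultimately show ?thesis
    using C.is_linear_tensor_category D.is_linear_tensor_category
    by (simp add: linear_tensor_equivalence_def)
qed

section \<open>Intertwining matrices\<close>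

definition intertwiners :: "complex \<Rightarrow> mero set \<Rightarrow> mero mat \<Rightarrow> mero mat \<Rightarrow> mero mat set" where
  "intertwiners q K A B = {S \<in> Mat (dim_row B) (dim_row A) K. qshift_mat q S * A = B * S}"

lemma hom_0_intertwiners: "hom_0 q A B = intertwiners q mero_plane (const_mat A) (const_mat B)"
  by (simp add: hom_0_def intertwiners_def)

lemma hom_inf_intertwiners: "hom_inf q A B = intertwiners q mero_inf (const_mat A) (const_mat B)"
  by (simp add: hom_inf_def intertwiners_def)

text \<open>
  The two matrices \<open>X\<close> and \<open>Y\<close> cover the equation of a morphism, where \<open>X\<close> is the shift of \<open>Y\<close>, as well as
  the compatibility \<open>F * M0 = N0 * S0\<close> of a morphism of solutions.
\<close>

lemma intertwine_comp:
  assumes c: "A \<in> carrier_mat n n" "B \<in> carrier_mat p p" "D \<in> carrier_mat r r"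
      "X \<in> carrier_mat p n" "Y \<in> carrier_mat p n" "X' \<in> carrier_mat r p" "Y' \<in> carrier_mat r p"
    and "X * A = B * Y" "X' * B = D * Y'"
  shows "(X' * X) * A = D * (Y' * Y)"
proof -
  have "(X' * X) * A = X' * (B * Y)"
    unfolding assms(8)[symmetric] by (rule assoc_mult_mat[OF c(6,4,1)])
  also have "\<dots> = (D * Y') * Y"
    unfolding assms(9)[symmetric] by (rule assoc_mult_mat[OF c(6,2,5), symmetric])
  also have "\<dots> = D * (Y' * Y)"
    by (rule assoc_mult_mat[OF c(3,7,5)])
  finally show ?thesis .
qed

lemma intertwine_add:
  assumes "A \<in> carrier_mat n n" "B \<in> carrier_mat p p" "X \<in> carrier_mat p n" "Y \<in> carrier_mat p n"
      "X' \<in> carrier_mat p n" "Y' \<in> carrier_mat p n"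
    and "X * A = B * Y" "X' * A = B * Y'"
  shows "(X + X') * A = B * (Y + Y')"
  using assms by (simp add: add_mult_distrib_mat[OF assms(3,5,1)] mult_add_distrib_mat[OF assms(2,4,6)])

lemma intertwine_smult:
  fixes A :: "'a :: comm_ring_1 mat"
  assumes "A \<in> carrier_mat n n" "B \<in> carrier_mat p p" "X \<in> carrier_mat p n" "Y \<in> carrier_mat p n"
    and "X * A = B * Y"
  shows "(k \<cdot>\<^sub>m X) * A = B * (k \<cdot>\<^sub>m Y)"
  using mult_smult_assoc_mat[OF assms(3,1), of k] mult_smult_distrib[OF assms(2,4), of k] assms(5) by simp

lemma intertwine_kron:
  assumes c: "A \<in> carrier_mat n n" "B \<in> carrier_mat p p" "X \<in> carrier_mat p n" "Y \<in> carrier_mat p n"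
      "A' \<in> carrier_mat n' n'" "B' \<in> carrier_mat p' p'" "X' \<in> carrier_mat p' n'" "Y' \<in> carrier_mat p' n'"
    and "X * A = B * Y" "X' * A' = B' * Y'"
  shows "kron X X' * kron A A' = kron B B' * kron Y Y'"
  using assms kron_mult[OF c(3,1,7,5)] kron_mult[OF c(2,4,6,8)] by simp

locale shift_subfield = subfield_set K for K :: "mero set" +
  fixes q :: complex
  assumes q0: "q \<noteq> 0" and const_mem: "const_mero c \<in> K"
begin

lemma intertwiners_id: "A \<in> carrier_mat n n \<Longrightarrow> 1\<^sub>m n \<in> intertwiners q K A A"
  using q0 by (auto simp: intertwiners_def Mat_one map_mat_one)

lemma intertwiners_comp:
  assumes c: "A \<in> carrier_mat n n" "B \<in> carrier_mat p p" "D \<in> carrier_mat r r"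
    and F: "F \<in> intertwiners q K A B" and G: "G \<in> intertwiners q K B D"
  shows "G * F \<in> intertwiners q K A D"
proof -
  have FG: "F \<in> Mat p n K" "qshift_mat q F * A = B * F" "G \<in> Mat r p K" "qshift_mat q G * B = D * G"
    using F G c by (auto simp: intertwiners_def)
  have m: "F \<in> carrier_mat p n" "G \<in> carrier_mat r p" "qshift_mat q F \<in> carrier_mat p n" "qshift_mat q G \<in> carrier_mat r p"
    using MatD(1)[OF FG(1)] MatD(1)[OF FG(3)] by auto
  have "qshift_mat q (G * F) * A = D * (G * F)"
    unfolding qshift_mat_mult[OF q0 m(2,1)]
    by (rule intertwine_comp[OF c m(3,1,4,2) FG(2,4)])
  then show ?thesis
    using c Mat_mult[OF FG(3,1)] by (simp add: intertwiners_def)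
qed

lemma intertwiners_zero:
  "A \<in> carrier_mat n n \<Longrightarrow> B \<in> carrier_mat p p \<Longrightarrow> 0\<^sub>m p n \<in> intertwiners q K A B"
proof -
  assume c: "A \<in> carrier_mat n n" "B \<in> carrier_mat p p"
  have "qshift_mat q (0\<^sub>m p n) = 0\<^sub>m p n" using q0 by (intro eq_matI) auto
  then show ?thesis
    using c by (auto simp: intertwiners_def Mat_zero)
qed

lemma intertwiners_add:
  assumes c: "A \<in> carrier_mat n n" "B \<in> carrier_mat p p"
    and F: "F \<in> intertwiners q K A B" and G: "G \<in> intertwiners q K A B"
  shows "F + G \<in> intertwiners q K A B"
proof -
  have FG: "F \<in> Mat p n K" "qshift_mat q F * A = B * F" "G \<in> Mat p n K" "qshift_mat q G * A = B * G"
    using F G c by (auto simp: intertwiners_def)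
  have m: "F \<in> carrier_mat p n" "G \<in> carrier_mat p n" "qshift_mat q F \<in> carrier_mat p n" "qshift_mat q G \<in> carrier_mat p n"
    using MatD(1)[OF FG(1)] MatD(1)[OF FG(3)] by auto
  have "qshift_mat q (F + G) = qshift_mat q F + qshift_mat q G"
    using m q0 by (intro eq_matI) (auto simp: qshift_add)
  then have "qshift_mat q (F + G) * A = B * (F + G)"
    using intertwine_add[OF c m(3,1,4,2) FG(2,4)] by simp
  then show ?thesis
    using c Mat_add[OF FG(1,3)] by (simp add: intertwiners_def)
qed

lemma intertwiners_scale:
  assumes c: "A \<in> carrier_mat n n" "B \<in> carrier_mat p p" and F: "F \<in> intertwiners q K A B"
  shows "const_mero s \<cdot>\<^sub>m F \<in> intertwiners q K A B"
proof -
  have FG: "F \<in> Mat p n K" "qshift_mat q F * A = B * F"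
    using F c by (auto simp: intertwiners_def)
  have m: "F \<in> carrier_mat p n" "qshift_mat q F \<in> carrier_mat p n"
    using MatD(1)[OF FG(1)] by auto
  have "qshift_mat q (const_mero s \<cdot>\<^sub>m F) = const_mero s \<cdot>\<^sub>m qshift_mat q F"
    using m q0 by (intro eq_matI) (auto simp: qshift_mult)
  then have "qshift_mat q (const_mero s \<cdot>\<^sub>m F) * A = B * (const_mero s \<cdot>\<^sub>m F)"
    using intertwine_smult[OF c m(2,1) FG(2)] by simp
  then show ?thesis
    using c Mat_smult[OF const_mem FG(1)] by (simp add: intertwiners_def)
qed

lemma intertwiners_kron:
  assumes c: "A \<in> carrier_mat n n" "B \<in> carrier_mat p p" "A' \<in> carrier_mat n' n'" "B' \<in> carrier_mat p' p'"
    and F: "F \<in> intertwiners q K A B" and G: "G \<in> intertwiners q K A' B'"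
  shows "kron F G \<in> intertwiners q K (kron A A') (kron B B')"
proof -
  have FG: "F \<in> Mat p n K" "qshift_mat q F * A = B * F" "G \<in> Mat p' n' K" "qshift_mat q G * A' = B' * G"
    using F G c by (auto simp: intertwiners_def)
  have m: "F \<in> carrier_mat p n" "G \<in> carrier_mat p' n'" "qshift_mat q F \<in> carrier_mat p n" "qshift_mat q G \<in> carrier_mat p' n'"
    using MatD(1)[OF FG(1)] MatD(1)[OF FG(3)] by auto
  have "qshift_mat q (kron F G) * kron A A' = kron B B' * kron F G"
    unfolding map_mat_kron[OF qshift_mult[OF q0]]
    by (rule intertwine_kron[OF c(1,2) m(3,1) c(3,4) m(4,2) FG(2,4)])
  then show ?thesis
    using c Mat_kron[OF FG(1,3)] by (simp add: intertwiners_def)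
qed

lemma intertwiners_flip:
  assumes c: "A \<in> carrier_mat n n" "B \<in> carrier_mat p p"
  shows "flip_mat n p \<in> intertwiners q K (kron A B) (kron B A)"
proof -
  have "qshift_mat q (flip_mat n p) = flip_mat n p"
    using q0 by (intro eq_matI) (auto simp: flip_mat_def)
  then show ?thesis
    using c Mat_flip flip_mat_natural[OF c] by (simp add: intertwiners_def)
qed

end

lemma shift_subfields:
  assumes "q \<noteq> 0"
  shows "shift_subfield mero_plane q" "shift_subfield mero_inf q" "shift_subfield rat_mero q"
  by (auto intro!: shift_subfield.intro shift_subfield_axioms.intro subfield_plane subfield_inf subfield_rat
      assms const_plane const_inf const_rat)

lemma intertwiners_carrier:
  "S \<in> intertwiners q K A B \<Longrightarrow> A \<in> carrier_mat n n \<Longrightarrow> B \<in> carrier_mat p p \<Longrightarrow> S \<in> carrier_mat p n"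
  by (auto simp: intertwiners_def dest: MatD(1))

lemma GL_right_inject:
  assumes "M \<in> GL n K" "A \<in> carrier_mat m n" "B \<in> carrier_mat m n"
  shows "A * M = B * M \<longleftrightarrow> A = B"
  using GL_cancel_right(1)[OF assms(1)] assms(2,3) by metis

lemma GL_left_inject:
  assumes "M \<in> GL n K" "A \<in> carrier_mat n m" "B \<in> carrier_mat n m"
  shows "M * A = M * B \<longleftrightarrow> A = B"
  using GL_cancel_left(1)[OF assms(1)] assms(2,3) by metis

text \<open>
  Both sides of the first equation, multiplied by \<open>M\<close> on the right, are those of the second one multiplied
  by \<open>\<sigma>\<^sub>q N\<close> on the left.
\<close>

lemma intertwine_transport:
  assumes q0: "q \<noteq> 0" and M: "M \<in> GL n K" and N: "N \<in> GL p L"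
    and c: "A \<in> carrier_mat n n" "A0 \<in> carrier_mat n n" "B \<in> carrier_mat p p" "B0 \<in> carrier_mat p p"
    and MA: "qshift_mat q M * A0 = A * M" and NB: "qshift_mat q N * B0 = B * N"
    and F: "F \<in> carrier_mat p n" "S \<in> carrier_mat p n" "F * M = N * S"
  shows "qshift_mat q F * A = B * F \<longleftrightarrow> qshift_mat q S * A0 = B0 * S"
proof -
  note Mc = GL_carrier[OF M] and Nc = GL_carrier[OF N]
  have qc: "qshift_mat q M \<in> carrier_mat n n" "qshift_mat q N \<in> carrier_mat p p"
    "qshift_mat q F \<in> carrier_mat p n" "qshift_mat q S \<in> carrier_mat p n"
    using Mc Nc F by auto
  have NG: "qshift_mat q N \<in> GL p UNIV" by (rule qshift_mat_GL(1)[OF q0 N]) simp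
  have 1: "(qshift_mat q F * A) * M = qshift_mat q N * (qshift_mat q S * A0)"
  proof -
    have "(qshift_mat q F * A) * M = qshift_mat q F * (qshift_mat q M * A0)"
      unfolding MA by (rule assoc_mult_mat[OF qc(3) c(1) Mc])
    also have "\<dots> = qshift_mat q (F * M) * A0"
      unfolding qshift_mat_mult[OF q0 F(1) Mc] by (rule assoc_mult_mat[OF qc(3,1) c(2), symmetric])
    also have "\<dots> = qshift_mat q N * (qshift_mat q S * A0)"
      unfolding F(3) qshift_mat_mult[OF q0 Nc F(2)] by (rule assoc_mult_mat[OF qc(2,4) c(2)])
    finally show ?thesis .
  qed
  have 2: "(B * F) * M = qshift_mat q N * (B0 * S)"
  proof -
    have "(B * F) * M = B * (N * S)"
      unfolding F(3)[symmetric] by (rule assoc_mult_mat[OF c(3) F(1) Mc])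
    also have "\<dots> = (qshift_mat q N * B0) * S"
      unfolding NB by (rule assoc_mult_mat[OF c(3) Nc F(2), symmetric])
    also have "\<dots> = qshift_mat q N * (B0 * S)"
      by (rule assoc_mult_mat[OF qc(2) c(4) F(2)])
    finally show ?thesis .
  qed
  show ?thesis
    using GL_right_inject[OF M mult_carrier_mat[OF qc(3) c(1)] mult_carrier_mat[OF c(3) F(1)]]
      GL_left_inject[OF NG mult_carrier_mat[OF qc(4) c(2)] mult_carrier_mat[OF c(4) F(2)]] 1 2 by simp
qed

lemma kron_conjugate:
  assumes "M \<in> GL n K" "N \<in> GL p L" "P \<in> carrier_mat n n" "A \<in> carrier_mat n n" "Q \<in> carrier_mat p p" "B \<in> carrier_mat p p"
  shows "kron P Q * kron A B * inv_mat (kron M N) = kron (P * A * inv_mat M) (Q * B * inv_mat N)"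
  unfolding kron_inverse(3)[OF assms(1,2)]
      kron_mult[OF mult_carrier_mat[OF assms(3,4)] GL_inv_carrier[OF assms(1)]
        mult_carrier_mat[OF assms(5,6)] GL_inv_carrier[OF assms(2)]] kron_mult[OF assms(3,4,5,6)] ..

section \<open>Solutions\<close>

lemma S_obE:
  assumes "X \<in> cOb (cat_S q)"
  obtains n A0 M0 Ai Mi where "X = (A0, M0, Ai, Mi)" "A0 \<in> GL n UNIV" "M0 \<in> GL n mero_plane"
    "Ai \<in> GL n UNIV" "Mi \<in> GL n mero_inf"
    "qshift_mat q Mi * const_mat Ai * inv_mat Mi = qshift_mat q M0 * const_mat A0 * inv_mat M0"
    "A0 \<in> carrier_mat n n" "Ai \<in> carrier_mat n n" "M0 \<in> carrier_mat n n" "Mi \<in> carrier_mat n n"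
    "const_mat A0 \<in> carrier_mat n n" "const_mat Ai \<in> carrier_mat n n"
proof -
  obtain A0 M0 Ai Mi where X: "X = (A0, M0, Ai, Mi)" by (cases X)
  obtain n where n: "A0 \<in> GL n UNIV" "M0 \<in> GL n mero_plane" "Ai \<in> GL n UNIV" "Mi \<in> GL n mero_inf"
    "qshift_mat q Mi * const_mat Ai * inv_mat Mi = qshift_mat q M0 * const_mat A0 * inv_mat M0"
    using assms unfolding X cat_S_def by auto
  note c = n(1-4)[THEN GL_carrier]
  show ?thesis
    by (rule that[OF X n c(1,3,2,4)]) (use c in auto)
qed

lemma S_hom_iff:
  assumes "A0 \<in> carrier_mat n n" "B0 \<in> carrier_mat p p"
  shows "(F, S0, Si) \<in> cHom (cat_S q) (A0, M0, Ai, Mi) (B0, N0, Bi, Ni) \<longleftrightarrow>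
    F \<in> carrier_mat p n \<and> S0 \<in> intertwiners q mero_plane (const_mat A0) (const_mat B0) \<and>
    Si \<in> intertwiners q mero_inf (const_mat Ai) (const_mat Bi) \<and> F * M0 = N0 * S0 \<and> F * Mi = Ni * Si"
  using assms by (simp add: cat_S_def hom_0_intertwiners hom_inf_intertwiners)

definition S_ent :: "nat \<Rightarrow> sol_mor \<Rightarrow> mero mat" where
  "S_ent i = (\<lambda>(F, S0, Si). if i = 0 then F else if i = 1 then S0 else Si)"

definition S_rk :: "sol_ob \<Rightarrow> nat" where
  "S_rk = (\<lambda>(A0, M0, Ai, Mi). dim_row A0)"

lemma const_mat_kron: "const_mat (kron A B) = kron (const_mat A) (const_mat B)"
  by (rule map_mat_kron) (rule const_mero_mult)

text \<open>
  A morphism consists of two intertwiners over subfields and two commuting squares, and each operation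
  preserves each of these conditions separately.
\<close>

lemma matrix_category_S:
  assumes q0: "q \<noteq> 0"
  shows "matrix_category (cat_S q) S_rk S_ent"
proof -
  interpret P: shift_subfield mero_plane q by (rule shift_subfields[OF q0])
  interpret I: shift_subfield mero_inf q by (rule shift_subfields[OF q0])
  interpret U: subfield_set "UNIV :: complex set" by (rule subfield_set_UNIV)
  note ic = intertwiners_carrier
  show ?thesis
  proof unfold_locales
    fix f g :: sol_mor assume a: "\<And>i. S_ent i f = S_ent i g"
    show "f = g" using a[of 0] a[of 1] a[of 2] by (auto simp: S_ent_def split: prod.splits)
  next
    fix X Y f i assume X: "X \<in> cOb (cat_S q)" and Y: "Y \<in> cOb (cat_S q)" and f: "f \<in> cHom (cat_S q) X Y"
    obtain n A0 M0 Ai Mi where X: "X = (A0, M0, Ai, Mi)" "A0 \<in> carrier_mat n n" "Ai \<in> carrier_mat n n"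
      "const_mat A0 \<in> carrier_mat n n" "const_mat Ai \<in> carrier_mat n n"
      using X by (rule S_obE) auto
    obtain p B0 N0 Bi Ni where Y: "Y = (B0, N0, Bi, Ni)" "B0 \<in> carrier_mat p p" "Bi \<in> carrier_mat p p"
      "const_mat B0 \<in> carrier_mat p p" "const_mat Bi \<in> carrier_mat p p"
      using Y by (rule S_obE) auto
    obtain F S0 Si where fe: "f = (F, S0, Si)" by (cases f)
    show "S_ent i f \<in> carrier_mat (S_rk Y) (S_rk X)"
      using f ic[of S0 q mero_plane "const_mat A0" "const_mat B0" n p]
        ic[of Si q mero_inf "const_mat Ai" "const_mat Bi" n p] X Y
      unfolding X(1) Y(1) fe S_hom_iff[OF X(2) Y(2)] by (auto simp: S_ent_def S_rk_def)
  next
    fix X assume "X \<in> cOb (cat_S q)"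
    then obtain n A0 M0 Ai Mi where X: "X = (A0, M0, Ai, Mi)" "M0 \<in> carrier_mat n n" "Mi \<in> carrier_mat n n"
      "A0 \<in> carrier_mat n n" "const_mat A0 \<in> carrier_mat n n" "const_mat Ai \<in> carrier_mat n n"
      by (rule S_obE) auto
    have "(1\<^sub>m n, 1\<^sub>m n, 1\<^sub>m n) \<in> cHom (cat_S q) X X"
      unfolding X(1) S_hom_iff[OF X(4,4)] using X(2,3) P.intertwiners_id[OF X(5)] I.intertwiners_id[OF X(6)] by simp
    moreover have "cId (cat_S q) X = (1\<^sub>m n, 1\<^sub>m n, 1\<^sub>m n)" using X by (simp add: cat_S_def Let_def)
    ultimately show "cId (cat_S q) X \<in> cHom (cat_S q) X X" by simp
  next
    fix X Y Z f g
    assume XYZ: "X \<in> cOb (cat_S q)" "Y \<in> cOb (cat_S q)" "Z \<in> cOb (cat_S q)"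
      and fg: "f \<in> cHom (cat_S q) X Y" "g \<in> cHom (cat_S q) Y Z"
    obtain n A0 M0 Ai Mi where X: "X = (A0, M0, Ai, Mi)" "M0 \<in> carrier_mat n n" "Mi \<in> carrier_mat n n"
      "A0 \<in> carrier_mat n n" "const_mat A0 \<in> carrier_mat n n" "const_mat Ai \<in> carrier_mat n n"
      using XYZ(1) by (rule S_obE) auto
    obtain p B0 N0 Bi Ni where Y: "Y = (B0, N0, Bi, Ni)" "N0 \<in> carrier_mat p p" "Ni \<in> carrier_mat p p"
      "B0 \<in> carrier_mat p p" "const_mat B0 \<in> carrier_mat p p" "const_mat Bi \<in> carrier_mat p p"
      using XYZ(2) by (rule S_obE) auto
    obtain r C0 L0 Ci Li where Z: "Z = (C0, L0, Ci, Li)" "L0 \<in> carrier_mat r r" "Li \<in> carrier_mat r r"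
      "C0 \<in> carrier_mat r r" "const_mat C0 \<in> carrier_mat r r" "const_mat Ci \<in> carrier_mat r r"
      using XYZ(3) by (rule S_obE) auto
    obtain F S0 Si G T0 Ti where fe: "f = (F, S0, Si)" "g = (G, T0, Ti)" by (cases f, cases g)
    have f: "F \<in> carrier_mat p n" "S0 \<in> intertwiners q mero_plane (const_mat A0) (const_mat B0)"
      "Si \<in> intertwiners q mero_inf (const_mat Ai) (const_mat Bi)" "F * M0 = N0 * S0" "F * Mi = Ni * Si"
      using fg(1) unfolding fe X(1) Y(1) S_hom_iff[OF X(4) Y(4)] by auto
    have g: "G \<in> carrier_mat r p" "T0 \<in> intertwiners q mero_plane (const_mat B0) (const_mat C0)"
      "Ti \<in> intertwiners q mero_inf (const_mat Bi) (const_mat Ci)" "G * N0 = L0 * T0" "G * Ni = Li * Ti"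
      using fg(2) unfolding fe Y(1) Z(1) S_hom_iff[OF Y(4) Z(4)] by auto
    have "(G * F, T0 * S0, Ti * Si) \<in> cHom (cat_S q) X Z"
      unfolding X(1) Z(1) S_hom_iff[OF X(4) Z(4)]
      using P.intertwiners_comp[OF X(5) Y(5) Z(5) f(2) g(2)] I.intertwiners_comp[OF X(6) Y(6) Z(6) f(3) g(3)]
        intertwine_comp[OF X(2) Y(2) Z(2) f(1) ic[OF f(2) X(5) Y(5)] g(1) ic[OF g(2) Y(5) Z(5)] f(4) g(4)]
        intertwine_comp[OF X(3) Y(3) Z(3) f(1) ic[OF f(3) X(6) Y(6)] g(1) ic[OF g(3) Y(6) Z(6)] f(5) g(5)]
        mult_carrier_mat[OF g(1) f(1)]
      by blast
    then show "cComp (cat_S q) g f \<in> cHom (cat_S q) X Z" by (simp add: fe cat_S_def)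
  next
    fix X Y
    assume XY: "X \<in> cOb (cat_S q)" "Y \<in> cOb (cat_S q)"
    obtain n A0 M0 Ai Mi where X: "X = (A0, M0, Ai, Mi)" "M0 \<in> carrier_mat n n" "Mi \<in> carrier_mat n n"
      "A0 \<in> carrier_mat n n" "const_mat A0 \<in> carrier_mat n n" "const_mat Ai \<in> carrier_mat n n"
      "A0 \<in> GL n UNIV" "M0 \<in> GL n mero_plane" "Ai \<in> GL n UNIV" "Mi \<in> GL n mero_inf"
      "qshift_mat q Mi * const_mat Ai * inv_mat Mi = qshift_mat q M0 * const_mat A0 * inv_mat M0"
      using XY(1) by (rule S_obE) auto
    obtain p B0 N0 Bi Ni where Y: "Y = (B0, N0, Bi, Ni)" "N0 \<in> carrier_mat p p" "Ni \<in> carrier_mat p p"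
      "B0 \<in> carrier_mat p p" "const_mat B0 \<in> carrier_mat p p" "const_mat Bi \<in> carrier_mat p p"
      "B0 \<in> GL p UNIV" "N0 \<in> GL p mero_plane" "Bi \<in> GL p UNIV" "Ni \<in> GL p mero_inf"
      "qshift_mat q Ni * const_mat Bi * inv_mat Ni = qshift_mat q N0 * const_mat B0 * inv_mat N0"
      using XY(2) by (rule S_obE) auto
    show "cZero (cat_S q) X Y \<in> cHom (cat_S q) X Y"
    proof -
      have "(0\<^sub>m p n, 0\<^sub>m p n, 0\<^sub>m p n) \<in> cHom (cat_S q) X Y"
        unfolding X(1) Y(1) S_hom_iff[OF X(4) Y(4)]
        using P.intertwiners_zero[OF X(5) Y(5)] I.intertwiners_zero[OF X(6) Y(6)] X(2,3) Y(2,3) by simp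
      then show ?thesis using X Y by (simp add: cat_S_def Let_def)
    qed
    have qc: "qshift_mat q M0 \<in> carrier_mat n n" "qshift_mat q Mi \<in> carrier_mat n n"
      "qshift_mat q N0 \<in> carrier_mat p p" "qshift_mat q Ni \<in> carrier_mat p p"
      using X(2,3) Y(2,3) by auto
    show "tOb (cat_S q) X Y \<in> cOb (cat_S q)"
    proof -
      have "qshift_mat q (kron Mi Ni) * const_mat (kron Ai Bi) * inv_mat (kron Mi Ni) =
          qshift_mat q (kron M0 N0) * const_mat (kron A0 B0) * inv_mat (kron M0 N0)"
        unfolding const_mat_kron map_mat_kron[OF qshift_mult[OF q0]]
          kron_conjugate[OF X(8) Y(8) qc(1) X(5) qc(3) Y(5)] kron_conjugate[OF X(10) Y(10) qc(2) X(6) qc(4) Y(6)]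
          X(11) Y(11) ..
      then have "(kron A0 B0, kron M0 N0, kron Ai Bi, kron Mi Ni) \<in> cOb (cat_S q)"
        using U.GL_kron[OF X(7) Y(7)] P.GL_kron[OF X(8) Y(8)] U.GL_kron[OF X(9) Y(9)] I.GL_kron[OF X(10) Y(10)]
        by (auto simp: cat_S_def)
      then show ?thesis by (simp add: X(1) Y(1) cat_S_def)
    qed
    show "tBraid (cat_S q) X Y \<in> cHom (cat_S q) (tOb (cat_S q) X Y) (tOb (cat_S q) Y X)"
    proof -
      have "(flip_mat n p, flip_mat n p, flip_mat n p) \<in>
          cHom (cat_S q) (kron A0 B0, kron M0 N0, kron Ai Bi, kron Mi Ni) (kron B0 A0, kron N0 M0, kron Bi Ai, kron Ni Mi)"
        unfolding S_hom_iff[OF kron_carrier[OF X(4) Y(4)] kron_carrier[OF Y(4) X(4)]] const_mat_kron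
        using P.intertwiners_flip[OF X(5) Y(5)] I.intertwiners_flip[OF X(6) Y(6)]
          flip_mat_natural[OF X(2) Y(2)] flip_mat_natural[OF X(3) Y(3)] by simp
      then show ?thesis using X Y by (simp add: cat_S_def Let_def)
    qed
    fix f assume f: "f \<in> cHom (cat_S q) X Y"
    obtain F S0 Si where fe: "f = (F, S0, Si)" by (cases f)
    have f: "F \<in> carrier_mat p n" "S0 \<in> intertwiners q mero_plane (const_mat A0) (const_mat B0)"
      "Si \<in> intertwiners q mero_inf (const_mat Ai) (const_mat Bi)" "F * M0 = N0 * S0" "F * Mi = Ni * Si"
      using f unfolding fe X(1) Y(1) S_hom_iff[OF X(4) Y(4)] by auto
    note c = f(1) ic[OF f(2) X(5) Y(5)] ic[OF f(3) X(6) Y(6)]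
    show "cScale (cat_S q) s f \<in> cHom (cat_S q) X Y" for s
    proof -
      have "(const_mero s \<cdot>\<^sub>m F, const_mero s \<cdot>\<^sub>m S0, const_mero s \<cdot>\<^sub>m Si) \<in> cHom (cat_S q) X Y"
        unfolding X(1) Y(1) S_hom_iff[OF X(4) Y(4)]
        using P.intertwiners_scale[OF X(5) Y(5) f(2)] I.intertwiners_scale[OF X(6) Y(6) f(3)]
          intertwine_smult[OF X(2) Y(2) c(1,2) f(4)] intertwine_smult[OF X(3) Y(3) c(1,3) f(5)] c(1) by simp
      then show ?thesis by (simp add: fe cat_S_def)
    qed
    fix g assume g: "g \<in> cHom (cat_S q) X Y"
    obtain G T0 Ti where ge: "g = (G, T0, Ti)" by (cases g)
    have g: "G \<in> carrier_mat p n" "T0 \<in> intertwiners q mero_plane (const_mat A0) (const_mat B0)"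
      "Ti \<in> intertwiners q mero_inf (const_mat Ai) (const_mat Bi)" "G * M0 = N0 * T0" "G * Mi = Ni * Ti"
      using g unfolding ge X(1) Y(1) S_hom_iff[OF X(4) Y(4)] by auto
    note d = g(1) ic[OF g(2) X(5) Y(5)] ic[OF g(3) X(6) Y(6)]
    show "cAdd (cat_S q) f g \<in> cHom (cat_S q) X Y"
    proof -
      have "(F + G, S0 + T0, Si + Ti) \<in> cHom (cat_S q) X Y"
        unfolding X(1) Y(1) S_hom_iff[OF X(4) Y(4)]
        using P.intertwiners_add[OF X(5) Y(5) f(2) g(2)] I.intertwiners_add[OF X(6) Y(6) f(3) g(3)]
          intertwine_add[OF X(2) Y(2) c(1,2) d(1,2) f(4) g(4)] intertwine_add[OF X(3) Y(3) c(1,3) d(1,3) f(5) g(5)] c(1) d(1)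
        by simp
      then show ?thesis by (simp add: fe ge cat_S_def)
    qed
  next
    fix X X' Y Y' f g
    assume XY: "X \<in> cOb (cat_S q)" "X' \<in> cOb (cat_S q)" "Y \<in> cOb (cat_S q)" "Y' \<in> cOb (cat_S q)"
      and fg: "f \<in> cHom (cat_S q) X X'" "g \<in> cHom (cat_S q) Y Y'"
    obtain n A0 M0 Ai Mi where X: "X = (A0, M0, Ai, Mi)" "M0 \<in> carrier_mat n n" "Mi \<in> carrier_mat n n"
      "A0 \<in> carrier_mat n n" "const_mat A0 \<in> carrier_mat n n" "const_mat Ai \<in> carrier_mat n n"
      using XY(1) by (rule S_obE) auto
    obtain n' A0' M0' Ai' Mi' where X': "X' = (A0', M0', Ai', Mi')" "M0' \<in> carrier_mat n' n'" "Mi' \<in> carrier_mat n' n'"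
      "A0' \<in> carrier_mat n' n'" "const_mat A0' \<in> carrier_mat n' n'" "const_mat Ai' \<in> carrier_mat n' n'"
      using XY(2) by (rule S_obE) auto
    obtain p B0 N0 Bi Ni where Y: "Y = (B0, N0, Bi, Ni)" "N0 \<in> carrier_mat p p" "Ni \<in> carrier_mat p p"
      "B0 \<in> carrier_mat p p" "const_mat B0 \<in> carrier_mat p p" "const_mat Bi \<in> carrier_mat p p"
      using XY(3) by (rule S_obE) auto
    obtain p' B0' N0' Bi' Ni' where Y': "Y' = (B0', N0', Bi', Ni')" "N0' \<in> carrier_mat p' p'" "Ni' \<in> carrier_mat p' p'"
      "B0' \<in> carrier_mat p' p'" "const_mat B0' \<in> carrier_mat p' p'" "const_mat Bi' \<in> carrier_mat p' p'"
      using XY(4) by (rule S_obE) auto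
    obtain F S0 Si G T0 Ti where fe: "f = (F, S0, Si)" "g = (G, T0, Ti)" by (cases f, cases g)
    have f: "F \<in> carrier_mat n' n" "S0 \<in> intertwiners q mero_plane (const_mat A0) (const_mat A0')"
      "Si \<in> intertwiners q mero_inf (const_mat Ai) (const_mat Ai')" "F * M0 = M0' * S0" "F * Mi = Mi' * Si"
      using fg(1) unfolding fe X(1) X'(1) S_hom_iff[OF X(4) X'(4)] by auto
    have g: "G \<in> carrier_mat p' p" "T0 \<in> intertwiners q mero_plane (const_mat B0) (const_mat B0')"
      "Ti \<in> intertwiners q mero_inf (const_mat Bi) (const_mat Bi')" "G * N0 = N0' * T0" "G * Ni = Ni' * Ti"
      using fg(2) unfolding fe Y(1) Y'(1) S_hom_iff[OF Y(4) Y'(4)] by auto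
    have "(kron F G, kron S0 T0, kron Si Ti) \<in> cHom (cat_S q)
        (kron A0 B0, kron M0 N0, kron Ai Bi, kron Mi Ni) (kron A0' B0', kron M0' N0', kron Ai' Bi', kron Mi' Ni')"
      unfolding S_hom_iff[OF kron_carrier[OF X(4) Y(4)] kron_carrier[OF X'(4) Y'(4)]] const_mat_kron
      using P.intertwiners_kron[OF X(5) X'(5) Y(5) Y'(5) f(2) g(2)] I.intertwiners_kron[OF X(6) X'(6) Y(6) Y'(6) f(3) g(3)]
        intertwine_kron[OF X(2) X'(2) f(1) ic[OF f(2) X(5) X'(5)] Y(2) Y'(2) g(1) ic[OF g(2) Y(5) Y'(5)] f(4) g(4)]
        intertwine_kron[OF X(3) X'(3) f(1) ic[OF f(3) X(6) X'(6)] Y(3) Y'(3) g(1) ic[OF g(3) Y(6) Y'(6)] f(5) g(5)]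
        kron_carrier[OF f(1) g(1)]
      by blast
    then show "tMor (cat_S q) f g \<in> cHom (cat_S q) (tOb (cat_S q) X Y) (tOb (cat_S q) X' Y')"
      by (simp add: fe X(1) X'(1) Y(1) Y'(1) cat_S_def)
  next
    show "tUnit (cat_S q) \<in> cOb (cat_S q)"
      using U.GL_one[of 1] P.GL_one[of 1] I.GL_one[of 1] q0 GL_inv_mat[OF P.GL_one[of 1]]
      by (auto simp: cat_S_def map_mat_one intro!: exI[of _ 1])
  qed (auto simp: cat_S_def S_ent_def S_rk_def kron_assoc Let_def split: prod.splits)
qed

section \<open>From solutions to equations\<close>

text \<open>
  The two formulas for \<open>A\<close> show that its entries are meromorphic on the plane and at infinity, hence rational.
\<close>

lemma SE_ob_facts:
  assumes q0: "q \<noteq> 0" and S: "A0 \<in> GL n UNIV" "M0 \<in> GL n mero_plane" "Ai \<in> GL n UNIV" "Mi \<in> GL n mero_inf"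
      "qshift_mat q Mi * const_mat Ai * inv_mat Mi = qshift_mat q M0 * const_mat A0 * inv_mat M0"
  defines "A \<equiv> SE_ob q (A0, M0, Ai, Mi)"
  shows "A \<in> GL n rat_mero" "qshift_mat q M0 * const_mat A0 = A * M0" "qshift_mat q Mi * const_mat Ai = A * Mi"
proof -
  interpret P: subfield_set mero_plane by (rule subfield_plane)
  interpret I: subfield_set mero_inf by (rule subfield_inf)
  have A: "A = qshift_mat q M0 * const_mat A0 * inv_mat M0" "A = qshift_mat q Mi * const_mat Ai * inv_mat Mi"
    unfolding S(5) by (simp_all add: A_def SE_ob_def)
  have c: "qshift_mat q M0 * const_mat A0 \<in> carrier_mat n n" "qshift_mat q Mi * const_mat Ai \<in> carrier_mat n n"
    using S(1-4)[THEN GL_carrier] by (intro mult_carrier_mat[of _ n n]; simp)+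
  show "qshift_mat q M0 * const_mat A0 = A * M0"
    unfolding A(1) by (rule GL_cancel_right(2)[OF S(2) c(1), symmetric])
  show "qshift_mat q Mi * const_mat Ai = A * Mi"
    unfolding A(2) by (rule GL_cancel_right(2)[OF S(4) c(2), symmetric])
  have "A \<in> GL n mero_plane"
    unfolding A(1)
    by (intro P.GL_mult qshift_mat_GL(1)[OF q0 S(2)] qshift_plane[OF q0] const_mat_GL(1)[OF S(1)]
        const_plane GL_inv_mat(1)[OF S(2)])
  moreover have "A \<in> GL n mero_inf"
    unfolding A(2)
    by (intro I.GL_mult qshift_mat_GL(1)[OF q0 S(4)] qshift_inf[OF q0] const_mat_GL(1)[OF S(3)]
        const_inf GL_inv_mat(1)[OF S(4)])
  ultimately have "A \<in> Mat n n rat_mero" "Determinant.det A \<noteq> 0"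
    using GL_det_nz[of A n] by (auto dest!: GL_Mat simp: Mat_iff rat_mero_iff)
  then show "A \<in> GL n rat_mero"
    by (rule subfield_set.GL_det(1)[OF subfield_rat])
qed

lemma gauge_to_const:
  assumes q0: "q \<noteq> 0" and A0: "A0 \<in> GL n UNIV" and M: "M \<in> GL n K" and A: "A \<in> carrier_mat n n"
    and eq: "qshift_mat q M * const_mat A0 = A * M"
  shows "inv_mat (qshift_mat q M) * A * M = const_mat A0"
proof -
  have qM: "qshift_mat q M \<in> GL n UNIV" by (rule qshift_mat_GL(1)[OF q0 M]) simp
  have "inv_mat (qshift_mat q M) * A * M = inv_mat (qshift_mat q M) * (A * M)"
    by (rule assoc_mult_mat[OF GL_inv_carrier[OF qM] A GL_carrier[OF M]])
  also have "\<dots> = const_mat A0"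
    unfolding eq[symmetric] by (rule GL_cancel_left(1)[OF qM, of _ n]) (use GL_carrier[OF A0] in simp)
  finally show ?thesis .
qed

lemma gauge_compose:
  assumes q0: "q \<noteq> 0" and F: "F \<in> GL n K" and X: "X \<in> GL n K" and A: "A \<in> carrier_mat n n"
    and A0: "A0 \<in> carrier_mat n n"
    and eq: "qshift_mat q X * A0 = inv_mat (qshift_mat q F) * A * F * X"
  shows "qshift_mat q (F * X) * A0 = A * (F * X)"
proof -
  have qF: "qshift_mat q F \<in> GL n UNIV" by (rule qshift_mat_GL(1)[OF q0 F]) simp
  note c = GL_carrier[OF F] GL_carrier[OF X] A A0 GL_carrier[OF qF] GL_inv_carrier[OF qF]
  have qX: "qshift_mat q X \<in> carrier_mat n n" using c(2) by simp
  have FX: "F * X \<in> carrier_mat n n" using c(1,2) by simp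
  have "qshift_mat q (F * X) * A0 = qshift_mat q F * (qshift_mat q X * A0)"
    unfolding qshift_mat_mult[OF q0 c(1,2)] by (rule assoc_mult_mat[OF c(5) qX A0])
  also have "qshift_mat q X * A0 = inv_mat (qshift_mat q F) * A * (F * X)"
    unfolding eq by (rule assoc_mult_mat[OF mult_carrier_mat[OF c(6,3)] c(1,2)])
  also have "\<dots> = inv_mat (qshift_mat q F) * (A * (F * X))"
    by (rule assoc_mult_mat[OF c(6,3) FX])
  also have "qshift_mat q F * \<dots> = A * (F * X)"
    by (rule GL_cancel_left(2)[OF qF mult_carrier_mat[OF A FX]])
  finally show ?thesis .
qed

lemma E_ob_if_S_ob:
  assumes q0: "q \<noteq> 0" and X: "X \<in> cOb (cat_S q)"
  shows "SE_ob q X \<in> cOb (cat_E q)"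
proof -
  obtain n A0 M0 Ai Mi where X: "X = (A0, M0, Ai, Mi)" and S: "A0 \<in> GL n UNIV" "M0 \<in> GL n mero_plane"
    "Ai \<in> GL n UNIV" "Mi \<in> GL n mero_inf"
    "qshift_mat q Mi * const_mat Ai * inv_mat Mi = qshift_mat q M0 * const_mat A0 * inv_mat M0"
    using X by (rule S_obE) blast
  define A where "A = SE_ob q (A0, M0, Ai, Mi)"
  note A = SE_ob_facts[OF q0 S, folded A_def]
  have "strictly_fuchsian_0 n (inv_mat (qshift_mat q M0) * A * M0)"
    unfolding gauge_to_const[OF q0 S(1,2) GL_carrier[OF A(1)] A(2)] strictly_fuchsian_0_def
    using const_mat_GL(1)[OF S(1), of rat_mero] const_rat S(1) GL_carrier[OF S(1)]
    by (auto intro!: bexI[of _ A0] value_const)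
  moreover have "strictly_fuchsian_inf n (inv_mat (qshift_mat q Mi) * A * Mi)"
    unfolding gauge_to_const[OF q0 S(3,4) GL_carrier[OF A(1)] A(3)] strictly_fuchsian_inf_def
    using const_mat_GL(1)[OF S(3), of rat_mero] const_rat S(3) GL_carrier[OF S(3)]
    by (auto intro!: bexI[of _ Ai] value_at_inf_const)
  ultimately have "fuchsian_0 q n A" "fuchsian_inf q n A"
    using A(1) S(2,4) unfolding fuchsian_0_def fuchsian_inf_def by blast+
  then show ?thesis
    unfolding X A_def cat_E_def by auto
qed

text \<open>
  A fuchsian system becomes constant after a further gauge transformation, at the origin and at
  infinity; the two resulting transformations are the solutions.
\<close>

lemma S_ob_if_E_ob:
  assumes q: "norm q > 1" and A: "A \<in> cOb (cat_E q)"
  shows "\<exists>X \<in> cOb (cat_S q). SE_ob q X = A"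
proof -
  have q0: "q \<noteq> 0" using q by auto
  interpret P: subfield_set mero_plane by (rule subfield_plane)
  interpret I: subfield_set mero_inf by (rule subfield_inf)
  obtain n where fuchs: "fuchsian_0 q n A" "fuchsian_inf q n A"
    using A by (auto simp: cat_E_def)
  have Ac: "A \<in> carrier_mat n n" using fuchs(1) by (auto simp: fuchsian_0_def dest: GL_carrier)
  obtain F B0 where F: "F \<in> GL n mero_plane" and B: "inv_mat (qshift_mat q F) * A * F \<in> GL n rat_mero"
    and B0: "B0 \<in> GL n UNIV" "\<forall>i<n. \<forall>j<n. value_at_0 ((inv_mat (qshift_mat q F) * A * F) $$ (i, j)) (B0 $$ (i, j))"
    using fuchs(1) unfolding fuchsian_0_def strictly_fuchsian_0_def by blast
  have "value_mat n (inv_mat (qshift_mat q F) * A * F) B0"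
    unfolding value_mat_def using GL_carrier[OF B] GL_carrier[OF B0(1)] B0(2) by blast
  then obtain A0 X where X: "A0 \<in> GL n UNIV" "X \<in> GL n mero_plane"
    "qshift_mat q X * const_mat A0 = inv_mat (qshift_mat q F) * A * F * X"
    using fundamental_solution_0[OF q _ GL_det_nz[OF B0(1)]] unfolding gauge_equiv_def by blast
  obtain F' B0' where F': "F' \<in> GL n mero_inf" and B': "inv_mat (qshift_mat q F') * A * F' \<in> GL n rat_mero"
    and B0': "B0' \<in> GL n UNIV" "\<forall>i<n. \<forall>j<n. value_at_inf ((inv_mat (qshift_mat q F') * A * F') $$ (i, j)) (B0' $$ (i, j))"
    using fuchs(2) unfolding fuchsian_inf_def strictly_fuchsian_inf_def by blast
  obtain Ai Y where Y: "Ai \<in> GL n UNIV" "Y \<in> GL n mero_inf"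
    "qshift_mat q Y * const_mat Ai = inv_mat (qshift_mat q F') * A * F' * Y"
    using fundamental_solution_inf[OF q GL_carrier[OF B'] B0'(1)] B0'(2) by blast
  have c: "const_mat A0 \<in> carrier_mat n n" "const_mat Ai \<in> carrier_mat n n"
    using GL_carrier[OF X(1)] GL_carrier[OF Y(1)] by auto
  define M0 where "M0 = F * X"
  define Mi where "Mi = F' * Y"
  have M: "M0 \<in> GL n mero_plane" "Mi \<in> GL n mero_inf"
    unfolding M0_def Mi_def by (rule P.GL_mult[OF F X(2)], rule I.GL_mult[OF F' Y(2)])
  have "qshift_mat q M0 * const_mat A0 = A * M0"
    unfolding M0_def by (rule gauge_compose[OF q0 F X(2) Ac c(1) X(3)])
  then have 1: "qshift_mat q M0 * const_mat A0 * inv_mat M0 = A"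
    using GL_cancel_right(1)[OF M(1) Ac] by simp
  have "qshift_mat q Mi * const_mat Ai = A * Mi"
    unfolding Mi_def by (rule gauge_compose[OF q0 F' Y(2) Ac c(2) Y(3)])
  then have 2: "qshift_mat q Mi * const_mat Ai * inv_mat Mi = A"
    using GL_cancel_right(1)[OF M(2) Ac] by simp
  have "(A0, M0, Ai, Mi) \<in> cOb (cat_S q)"
    unfolding cat_S_def using X(1) Y(1) M 1 2 by auto
  moreover have "SE_ob q (A0, M0, Ai, Mi) = A" using 1 by (simp add: SE_ob_def)
  ultimately show ?thesis by blast
qed

lemma cat_E_hom: "cHom (cat_E q) A B = intertwiners q rat_mero A B"
  by (simp add: cat_E_def intertwiners_def)

text \<open>
  Given \<open>F\<close>, the equations force \<open>S0 = N0\<inverse> F M0\<close> and \<open>Si = Ni\<inverse> F Mi\<close>.  Conversely \<open>F = N0 S0 M0\<inverse> = Ni Si Mi\<inverse>\<close>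
  is meromorphic on the sphere, hence rational.
\<close>

lemma SE_hom:
  assumes q0: "q \<noteq> 0" and X: "X \<in> cOb (cat_S q)" and Y: "Y \<in> cOb (cat_S q)"
  shows "cHom (cat_E q) (SE_ob q X) (SE_ob q Y) = SE_mor X Y ` cHom (cat_S q) X Y"
    "inj_on (SE_mor X Y) (cHom (cat_S q) X Y)"
proof -
  interpret P: subfield_set mero_plane by (rule subfield_plane)
  interpret I: subfield_set mero_inf by (rule subfield_inf)
  obtain n A0 M0 Ai Mi where X: "X = (A0, M0, Ai, Mi)" and S: "A0 \<in> GL n UNIV" "M0 \<in> GL n mero_plane"
    "Ai \<in> GL n UNIV" "Mi \<in> GL n mero_inf"
    "qshift_mat q Mi * const_mat Ai * inv_mat Mi = qshift_mat q M0 * const_mat A0 * inv_mat M0"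
    using X by (rule S_obE) blast
  obtain p B0 N0 Bi Ni where Y: "Y = (B0, N0, Bi, Ni)" and T: "B0 \<in> GL p UNIV" "N0 \<in> GL p mero_plane"
    "Bi \<in> GL p UNIV" "Ni \<in> GL p mero_inf"
    "qshift_mat q Ni * const_mat Bi * inv_mat Ni = qshift_mat q N0 * const_mat B0 * inv_mat N0"
    using Y by (rule S_obE) blast
  define A where "A = SE_ob q X"
  define B where "B = SE_ob q Y"
  note A = SE_ob_facts[OF q0 S, folded X, folded A_def] and B = SE_ob_facts[OF q0 T, folded Y, folded B_def]
  note Sc = S(1-4)[THEN GL_carrier] and Tc = T(1-4)[THEN GL_carrier]
  have cc: "const_mat A0 \<in> carrier_mat n n" "const_mat Ai \<in> carrier_mat n n"
    "const_mat B0 \<in> carrier_mat p p" "const_mat Bi \<in> carrier_mat p p"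
    using Sc Tc by auto
  note Ac = GL_carrier[OF A(1)] and Bc = GL_carrier[OF B(1)]
  note t0 = intertwine_transport[OF q0 S(2) T(2) Ac cc(1) Bc cc(3) A(2) B(2)]
  note ti = intertwine_transport[OF q0 S(4) T(4) Ac cc(2) Bc cc(4) A(3) B(3)]
  note hom = S_hom_iff[OF Sc(1) Tc(1), of _ _ _ q M0 Ai Mi N0 Bi Ni, folded X Y]
  show "cHom (cat_E q) (SE_ob q X) (SE_ob q Y) = SE_mor X Y ` cHom (cat_S q) X Y"
    unfolding A_def[symmetric] B_def[symmetric] cat_E_hom
  proof (intro equalityI subsetI)
    fix F assume "F \<in> intertwiners q rat_mero A B"
    then have F: "F \<in> Mat p n rat_mero" "qshift_mat q F * A = B * F"
      using Ac Bc by (auto simp: intertwiners_def)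
    note Fc = MatD(1)[OF F(1)]
    have FM: "F \<in> Mat p n mero_plane" "F \<in> Mat p n mero_inf"
      using F(1) by (auto simp: Mat_iff rat_mero_iff)
    define S0 where "S0 = inv_mat N0 * (F * M0)"
    define Si where "Si = inv_mat Ni * (F * Mi)"
    have S0: "S0 \<in> Mat p n mero_plane" and Si: "Si \<in> Mat p n mero_inf"
      unfolding S0_def Si_def
      by (rule P.Mat_mult[OF GL_Mat[OF GL_inv_mat(1)[OF T(2)]] P.Mat_mult[OF FM(1) GL_Mat[OF S(2)]]],
          rule I.Mat_mult[OF GL_Mat[OF GL_inv_mat(1)[OF T(4)]] I.Mat_mult[OF FM(2) GL_Mat[OF S(4)]]])
    have e: "F * M0 = N0 * S0" "F * Mi = Ni * Si"
      unfolding S0_def Si_def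
      by (rule GL_cancel_left(2)[OF T(2) mult_carrier_mat[OF Fc Sc(2)], symmetric],
          rule GL_cancel_left(2)[OF T(4) mult_carrier_mat[OF Fc Sc(4)], symmetric])
    have "(F, S0, Si) \<in> cHom (cat_S q) X Y"
      unfolding hom
      using t0[OF Fc MatD(1)[OF S0] e(1)] ti[OF Fc MatD(1)[OF Si] e(2)] F(2) Fc e S0 Si Sc Tc
      by (simp add: intertwiners_def)
    then show "F \<in> SE_mor X Y ` cHom (cat_S q) X Y"
      by (rule rev_image_eqI) (simp add: SE_mor_def)
  next
    fix F assume "F \<in> SE_mor X Y ` cHom (cat_S q) X Y"
    then obtain S0 Si where "(F, S0, Si) \<in> cHom (cat_S q) X Y"
      by (auto simp: SE_mor_def)
    then have F: "F \<in> carrier_mat p n" "S0 \<in> intertwiners q mero_plane (const_mat A0) (const_mat B0)"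
      "Si \<in> intertwiners q mero_inf (const_mat Ai) (const_mat Bi)" "F * M0 = N0 * S0" "F * Mi = Ni * Si"
      unfolding hom by blast+
    have S0: "S0 \<in> Mat p n mero_plane" "qshift_mat q S0 * const_mat A0 = const_mat B0 * S0"
      and Si: "Si \<in> Mat p n mero_inf"
      using F(2,3) cc by (auto simp: intertwiners_def)
    have "F \<in> Mat p n mero_plane"
    proof -
      have "F = N0 * S0 * inv_mat M0" using GL_cancel_right(1)[OF S(2) F(1)] F(4) by simp
      also have "\<dots> \<in> Mat p n mero_plane"
        by (intro P.Mat_mult[OF P.Mat_mult[OF GL_Mat[OF T(2)] S0(1)] GL_Mat[OF GL_inv_mat(1)[OF S(2)]]])
      finally show ?thesis .
    qed
    moreover have "F \<in> Mat p n mero_inf"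
    proof -
      have "F = Ni * Si * inv_mat Mi" using GL_cancel_right(1)[OF S(4) F(1)] F(5) by simp
      also have "\<dots> \<in> Mat p n mero_inf"
        by (intro I.Mat_mult[OF I.Mat_mult[OF GL_Mat[OF T(4)] Si] GL_Mat[OF GL_inv_mat(1)[OF S(4)]]])
      finally show ?thesis .
    qed
    ultimately have "F \<in> Mat p n rat_mero" by (auto simp: Mat_iff rat_mero_iff)
    then show "F \<in> intertwiners q rat_mero A B"
      using t0[OF F(1) MatD(1)[OF S0(1)] F(4)] S0(2) Ac Bc by (simp add: intertwiners_def)
  qed
  show "inj_on (SE_mor X Y) (cHom (cat_S q) X Y)"
  proof (rule inj_onI)
    fix f g assume f: "f \<in> cHom (cat_S q) X Y" and g: "g \<in> cHom (cat_S q) X Y" and eq: "SE_mor X Y f = SE_mor X Y g"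
    obtain F S0 Si T0 Ti where fg: "f = (F, S0, Si)" "g = (F, T0, Ti)"
      using eq by (cases f, cases g) (auto simp: SE_mor_def)
    have "S0 \<in> carrier_mat p n" "T0 \<in> carrier_mat p n" "Si \<in> carrier_mat p n" "Ti \<in> carrier_mat p n"
      "N0 * S0 = N0 * T0" "Ni * Si = Ni * Ti"
      using f g cc unfolding fg hom by (auto intro: intertwiners_carrier)
    then show "f = g"
      unfolding fg using GL_left_inject[OF T(2)] GL_left_inject[OF T(4)] by blast
  qed
qed

section \<open>From solutions to connection data\<close>

text \<open>
  \<open>M0\<close> and \<open>M\<close> are the two forms of one morphism, from \<open>A0\<close> to \<open>A\<close> and to the gauge transform \<open>Ai\<close> of \<open>A\<close>.
\<close>

lemma connection_transport:
  assumes q0: "q \<noteq> 0" and c: "A0 \<in> carrier_mat n n" "Ai \<in> carrier_mat n n" "A \<in> carrier_mat n n"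
    and M: "Mi \<in> GL n K" "M0 \<in> carrier_mat n n" "M \<in> carrier_mat n n" "Mi * M = M0"
    and eq: "qshift_mat q Mi * Ai = A * Mi"
  shows "qshift_mat q M0 * A0 = A * M0 \<longleftrightarrow> qshift_mat q M * A0 = Ai * M"
proof (rule intertwine_transport[OF q0 subfield_set.GL_one[OF subfield_set_UNIV] M(1) c(1,1,3,2) _ eq M(2,3)])
  show "qshift_mat q (1\<^sub>m n) * A0 = A0 * 1\<^sub>m n" using c(1) q0 by (simp add: map_mat_one)
  show "M0 * 1\<^sub>m n = Mi * M" using M by simp
qed

lemma connection_square:
  assumes "Ni \<in> GL p K" "Mi \<in> carrier_mat n n" "M \<in> carrier_mat n n" "N \<in> carrier_mat p p"
    and "F \<in> carrier_mat p n" "S0 \<in> carrier_mat p n" "Si \<in> carrier_mat p n"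
    and "Mi * M = M0" "Ni * N = N0" "F * Mi = Ni * Si"
  shows "F * M0 = N0 * S0 \<longleftrightarrow> Si * M = N * S0"
proof -
  note Nc = GL_carrier[OF assms(1)]
  have "F * M0 = Ni * Si * M"
    unfolding assms(8)[symmetric] assms(10)[symmetric] by (rule assoc_mult_mat[OF assms(5,2,3), symmetric])
  also have "\<dots> = Ni * (Si * M)" by (rule assoc_mult_mat[OF Nc assms(7,3)])
  finally have 1: "F * M0 = Ni * (Si * M)" .
  have 2: "N0 * S0 = Ni * (N * S0)"
    unfolding assms(9)[symmetric] by (rule assoc_mult_mat[OF Nc assms(4,6)])
  show ?thesis
    unfolding 1 2 by (rule GL_left_inject[OF assms(1) mult_carrier_mat[OF assms(7,3)] mult_carrier_mat[OF assms(4,6)]])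
qed

lemma cat_C_hom:
  "(S0, Si) \<in> cHom (cat_C q) (A0, M, Ai) (B0, N, Bi) \<longleftrightarrow>
    S0 \<in> intertwiners q mero_plane (const_mat A0) (const_mat B0) \<and>
    Si \<in> intertwiners q mero_inf (const_mat Ai) (const_mat Bi) \<and> Si * M = N * S0"
  by (simp add: cat_C_def hom_0_intertwiners hom_inf_intertwiners)

lemma C_ob_if_S_ob:
  assumes q0: "q \<noteq> 0" and X: "X \<in> cOb (cat_S q)"
  shows "SC_ob X \<in> cOb (cat_C q)"
proof -
  interpret U: subfield_set "UNIV :: mero set" by (rule subfield_set_UNIV)
  obtain n A0 M0 Ai Mi where X: "X = (A0, M0, Ai, Mi)" and S: "A0 \<in> GL n UNIV" "M0 \<in> GL n mero_plane"
    "Ai \<in> GL n UNIV" "Mi \<in> GL n mero_inf"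
    "qshift_mat q Mi * const_mat Ai * inv_mat Mi = qshift_mat q M0 * const_mat A0 * inv_mat M0"
    using X by (rule S_obE) blast
  note A = SE_ob_facts[OF q0 S]
  note Sc = S(1-4)[THEN GL_carrier]
  have M: "inv_mat Mi * M0 \<in> GL n UNIV"
    by (intro U.GL_mult GL_UNIV[OF GL_inv_mat(1)[OF S(4)]] GL_UNIV[OF S(2)])
  have "qshift_mat q (inv_mat Mi * M0) * const_mat A0 = const_mat Ai * (inv_mat Mi * M0)"
    using connection_transport[OF q0 _ _ GL_carrier[OF A(1)] S(4) Sc(2) GL_carrier[OF M]
        GL_cancel_left(2)[OF S(4) Sc(2)] A(3)] A(2) Sc by simp
  then show ?thesis
    unfolding X SC_ob_def cat_C_def using S M by auto
qed

text \<open>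
  The factor \<open>Mi\<close> and \<open>Ai\<close> determine a system \<open>A\<close>; that \<open>M\<close> connects \<open>A0\<close> with \<open>Ai\<close> means that \<open>M0\<close> brings the
  same system to \<open>A0\<close>.
\<close>

lemma S_ob_if_C_ob:
  assumes q0: "q \<noteq> 0" and Y: "Y \<in> cOb (cat_C q)"
  shows "\<exists>X \<in> cOb (cat_S q). SC_ob X = Y"
proof -
  obtain A0 M Ai where Y: "Y = (A0, M, Ai)" and Y': "(A0, M, Ai) \<in> cOb (cat_C q)"
    using Y by (cases Y) auto
  obtain n where C: "A0 \<in> GL n UNIV" "Ai \<in> GL n UNIV" "M \<in> GL n UNIV"
    "qshift_mat q M * const_mat A0 = const_mat Ai * M"
    using Y' unfolding cat_C_def by auto
  obtain M0 Mi where M: "M0 \<in> GL n mero_plane" "Mi \<in> GL n mero_inf" "Mi * M = M0"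
    using birkhoff_factorization[OF C(3)] by blast
  note Cc = C(1-3)[THEN GL_carrier] and Mc = M(1,2)[THEN GL_carrier]
  have cc: "const_mat A0 \<in> carrier_mat n n" "const_mat Ai \<in> carrier_mat n n"
    using Cc by auto
  define A where "A = qshift_mat q Mi * const_mat Ai * inv_mat Mi"
  have c: "qshift_mat q Mi * const_mat Ai \<in> carrier_mat n n"
    using Cc Mc by (intro mult_carrier_mat[of _ n n]) simp_all
  have Ac: "A \<in> carrier_mat n n"
    unfolding A_def by (rule mult_carrier_mat[OF c GL_inv_carrier[OF M(2)]])
  have "qshift_mat q Mi * const_mat Ai = A * Mi"
    unfolding A_def by (rule GL_cancel_right(2)[OF M(2) c, symmetric])
  then have "qshift_mat q M0 * const_mat A0 = A * M0"
    using connection_transport[OF q0 cc Ac M(2) Mc(1) Cc(3) M(3)] C(4) by blast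
  then have "qshift_mat q M0 * const_mat A0 * inv_mat M0 = A"
    using GL_cancel_right(1)[OF M(1) Ac] by simp
  then have "(A0, M0, Ai, Mi) \<in> cOb (cat_S q)"
    unfolding cat_S_def A_def using C M by auto
  moreover have "SC_ob (A0, M0, Ai, Mi) = Y"
    using GL_cancel_left(1)[OF M(2) Cc(3)] M(3) by (simp add: SC_ob_def Y)
  ultimately show ?thesis by blast
qed

text \<open>
  The matrix \<open>F = Ni Si Mi\<inverse>\<close> is forced by \<open>Si\<close>; it equals \<open>N0 S0 M0\<inverse>\<close> because \<open>Si M = N S0\<close>.
\<close>

lemma SC_hom:
  assumes q0: "q \<noteq> 0" and X: "X \<in> cOb (cat_S q)" and Y: "Y \<in> cOb (cat_S q)"
  shows "cHom (cat_C q) (SC_ob X) (SC_ob Y) = SC_mor X Y ` cHom (cat_S q) X Y"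
    "inj_on (SC_mor X Y) (cHom (cat_S q) X Y)"
proof -
  obtain n A0 M0 Ai Mi where X: "X = (A0, M0, Ai, Mi)" and S: "A0 \<in> GL n UNIV" "M0 \<in> GL n mero_plane"
    "Ai \<in> GL n UNIV" "Mi \<in> GL n mero_inf"
    using X by (rule S_obE) blast
  obtain p B0 N0 Bi Ni where Y: "Y = (B0, N0, Bi, Ni)" and T: "B0 \<in> GL p UNIV" "N0 \<in> GL p mero_plane"
    "Bi \<in> GL p UNIV" "Ni \<in> GL p mero_inf"
    using Y by (rule S_obE) blast
  note Sc = S(1-4)[THEN GL_carrier] and Tc = T(1-4)[THEN GL_carrier]
  have cc: "const_mat A0 \<in> carrier_mat n n" "const_mat Ai \<in> carrier_mat n n"
    "const_mat B0 \<in> carrier_mat p p" "const_mat Bi \<in> carrier_mat p p"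
    using Sc Tc by auto
  define M where "M = inv_mat Mi * M0"
  define N where "N = inv_mat Ni * N0"
  have MN: "M \<in> carrier_mat n n" "N \<in> carrier_mat p p" "Mi * M = M0" "Ni * N = N0"
    unfolding M_def N_def
    by (rule mult_carrier_mat[OF GL_inv_carrier[OF S(4)] Sc(2)], rule mult_carrier_mat[OF GL_inv_carrier[OF T(4)] Tc(2)],
        rule GL_cancel_left(2)[OF S(4) Sc(2)], rule GL_cancel_left(2)[OF T(4) Tc(2)])
  note square = connection_square[OF T(4) Sc(4) MN(1,2) _ _ _ MN(3,4)]
  note hom = S_hom_iff[OF Sc(1) Tc(1), of _ _ _ q M0 Ai Mi N0 Bi Ni, folded X Y]
  have SC: "SC_ob X = (A0, M, Ai)" "SC_ob Y = (B0, N, Bi)"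
    by (simp_all add: X Y SC_ob_def M_def N_def)
  note ic0 = intertwiners_carrier[OF _ cc(1,3)] and ici = intertwiners_carrier[OF _ cc(2,4)]
  show "cHom (cat_C q) (SC_ob X) (SC_ob Y) = SC_mor X Y ` cHom (cat_S q) X Y"
    unfolding SC
  proof (intro equalityI subsetI)
    fix s assume s: "s \<in> cHom (cat_C q) (A0, M, Ai) (B0, N, Bi)"
    obtain S0 Si where s0: "s = (S0, Si)" by (cases s)
    have *: "S0 \<in> intertwiners q mero_plane (const_mat A0) (const_mat B0)"
      "Si \<in> intertwiners q mero_inf (const_mat Ai) (const_mat Bi)" "Si * M = N * S0"
      using s unfolding s0 cat_C_hom by blast+
    have NS: "Ni * Si \<in> carrier_mat p n" by (rule mult_carrier_mat[OF Tc(4) ici[OF *(2)]])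
    define F where "F = Ni * Si * inv_mat Mi"
    have Fc: "F \<in> carrier_mat p n" unfolding F_def by (rule mult_carrier_mat[OF NS GL_inv_carrier[OF S(4)]])
    have F: "F * Mi = Ni * Si" unfolding F_def by (rule GL_cancel_right(2)[OF S(4) NS])
    have "(F, S0, Si) \<in> cHom (cat_S q) X Y"
      unfolding hom using square[OF Fc ic0[OF *(1)] ici[OF *(2)] F] F Fc * by blast
    then show "s \<in> SC_mor X Y ` cHom (cat_S q) X Y"
      by (rule rev_image_eqI) (simp add: SC_mor_def s0)
  next
    fix s assume "s \<in> SC_mor X Y ` cHom (cat_S q) X Y"
    then obtain F S0 Si where s0: "s = (S0, Si)" and "(F, S0, Si) \<in> cHom (cat_S q) X Y"
      by (auto simp: SC_mor_def)
    then have F: "F \<in> carrier_mat p n" "S0 \<in> intertwiners q mero_plane (const_mat A0) (const_mat B0)"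
      "Si \<in> intertwiners q mero_inf (const_mat Ai) (const_mat Bi)" "F * M0 = N0 * S0" "F * Mi = Ni * Si"
      unfolding hom by blast+
    then show "s \<in> cHom (cat_C q) (A0, M, Ai) (B0, N, Bi)"
      unfolding s0 cat_C_hom using square[OF F(1) ic0[OF F(2)] ici[OF F(3)] F(5)] by blast
  qed
  show "inj_on (SC_mor X Y) (cHom (cat_S q) X Y)"
  proof (rule inj_onI)
    fix f g assume f: "f \<in> cHom (cat_S q) X Y" and g: "g \<in> cHom (cat_S q) X Y" and eq: "SC_mor X Y f = SC_mor X Y g"
    obtain F S0 Si G where fg: "f = (F, S0, Si)" "g = (G, S0, Si)"
      using eq by (cases f, cases g) (auto simp: SC_mor_def)
    have "F \<in> carrier_mat p n" "G \<in> carrier_mat p n" "F * M0 = G * M0"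
      using f g unfolding fg hom by auto
    then show "f = g"
      unfolding fg using GL_right_inject[OF S(2)] by blast
  qed
qed

section \<open>The two equivalences\<close>

lemma matrix_operations_E: "matrix_operations (cat_E q) dim_row (\<lambda>i F. F)"
  by unfold_locales (auto simp: cat_E_def kron_assoc)

definition C_ent :: "nat \<Rightarrow> conn_mor \<Rightarrow> mero mat" where
  "C_ent i = (\<lambda>(S0, Si). if i = 0 then S0 else Si)"

definition C_rk :: "conn_ob \<Rightarrow> nat" where
  "C_rk = (\<lambda>(A0, M, Ai). dim_row A0)"

lemma matrix_operations_C: "matrix_operations (cat_C q) C_rk C_ent"
proof unfold_locales
  fix f g :: conn_mor assume a: "\<And>i. C_ent i f = C_ent i g"
  show "f = g" using a[of 0] a[of 1] by (auto simp: C_ent_def split: prod.splits)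
qed (auto simp: cat_C_def C_ent_def C_rk_def kron_assoc Let_def split: prod.splits)

theorem solutions_equivalent_to_equations:
  assumes q: "norm q > 1"
  shows "linear_tensor_equivalence (cat_S q) (cat_E q) (SE_ob q) SE_mor
    (\<lambda>X Y. cId (cat_E q) (tOb (cat_E q) (SE_ob q X) (SE_ob q Y))) (cId (cat_E q) (tUnit (cat_E q)))"
proof -
  have q0: "q \<noteq> 0" using q by auto
  have dim: "dim_row (SE_ob q X) = S_rk X" if X: "X \<in> cOb (cat_S q)" for X
  proof -
    obtain n A0 M0 Ai Mi where "X = (A0, M0, Ai, Mi)" "A0 \<in> carrier_mat n n" "M0 \<in> carrier_mat n n"
      using X by (rule S_obE) blast
    then show ?thesis by (simp add: SE_ob_def S_rk_def)
  qed
  show ?thesis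
  proof (rule linear_tensor_equivalenceI[OF matrix_category_S[OF q0] matrix_operations_E])
    show "cOb (cat_E q) = SE_ob q ` cOb (cat_S q)"
      using E_ob_if_S_ob[OF q0] S_ob_if_E_ob[OF q] by blast
    show "SE_ob q (tUnit (cat_S q)) = tUnit (cat_E q)"
      using q0 GL_inv_mat(3)[OF subfield_set.GL_one[OF subfield_plane, of 1]]
        GL_inv_carrier[OF subfield_set.GL_one[OF subfield_plane, of 1]]
      by (simp add: cat_S_def cat_E_def SE_ob_def map_mat_one)
  next
    fix X Y g assume "X \<in> cOb (cat_E q)" "Y \<in> cOb (cat_E q)" "g \<in> cHom (cat_E q) X Y"
    then show "g \<in> carrier_mat (dim_row Y) (dim_row X)"
      by (auto simp: cat_E_def dest: MatD(1))
  next
    fix X Y assume X: "X \<in> cOb (cat_S q)" and Y: "Y \<in> cOb (cat_S q)"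
    obtain n A0 M0 Ai Mi where X': "X = (A0, M0, Ai, Mi)" "A0 \<in> GL n UNIV" "M0 \<in> GL n mero_plane"
      using X by (rule S_obE) blast
    obtain p B0 N0 Bi Ni where Y': "Y = (B0, N0, Bi, Ni)" "B0 \<in> GL p UNIV" "N0 \<in> GL p mero_plane"
      using Y by (rule S_obE) blast
    have c: "qshift_mat q M0 \<in> carrier_mat n n" "const_mat A0 \<in> carrier_mat n n"
      "qshift_mat q N0 \<in> carrier_mat p p" "const_mat B0 \<in> carrier_mat p p"
      using X' Y' by (auto dest: GL_carrier)
    show "SE_ob q (tOb (cat_S q) X Y) = tOb (cat_E q) (SE_ob q X) (SE_ob q Y)"
      using kron_conjugate[OF X'(3) Y'(3) c]
      by (simp add: cat_S_def cat_E_def SE_ob_def X'(1) Y'(1) const_mat_kron map_mat_kron[OF qshift_mult[OF q0]]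
          del: assoc_mult_mat)
    show "SE_mor X Y (cZero (cat_S q) X Y) = cZero (cat_E q) (SE_ob q X) (SE_ob q Y)"
      using dim[OF X] dim[OF Y] by (simp add: cat_E_def cat_S_def SE_mor_def S_rk_def Let_def split: prod.splits)
    show "SE_mor (tOb (cat_S q) X Y) (tOb (cat_S q) Y X) (tBraid (cat_S q) X Y) =
        tBraid (cat_E q) (SE_ob q X) (SE_ob q Y)"
      using dim[OF X] dim[OF Y] by (simp add: cat_E_def cat_S_def SE_mor_def S_rk_def Let_def split: prod.splits)
    show "SE_mor X X (cId (cat_S q) X) = cId (cat_E q) (SE_ob q X)"
      using dim[OF X] by (simp add: cat_E_def cat_S_def SE_mor_def S_rk_def Let_def split: prod.splits)
  qed (simp_all add: SE_hom[OF q0], auto simp: SE_mor_def cat_E_def cat_S_def split: prod.splits)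
qed

theorem solutions_equivalent_to_connections:
  assumes q0: "q \<noteq> 0"
  shows "linear_tensor_equivalence (cat_S q) (cat_C q) SC_ob SC_mor
    (\<lambda>X Y. cId (cat_C q) (tOb (cat_C q) (SC_ob X) (SC_ob Y))) (cId (cat_C q) (tUnit (cat_C q)))"
proof (rule linear_tensor_equivalenceI[OF matrix_category_S[OF q0] matrix_operations_C])
  show "cOb (cat_C q) = SC_ob ` cOb (cat_S q)"
    using C_ob_if_S_ob[OF q0] S_ob_if_C_ob[OF q0] by blast
  show "SC_ob (tUnit (cat_S q)) = tUnit (cat_C q)"
    using GL_inv_mat(3)[OF subfield_set.GL_one[OF subfield_plane, of 1]]
    by (simp add: cat_S_def cat_C_def SC_ob_def)
next
  fix X Y g i assume X: "X \<in> cOb (cat_C q)" and Y: "Y \<in> cOb (cat_C q)" and g: "g \<in> cHom (cat_C q) X Y"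
  obtain A0 M Ai where X': "X = (A0, M, Ai)" by (cases X)
  obtain B0 N Bi where Y': "Y = (B0, N, Bi)" by (cases Y)
  obtain S0 Si where g': "g = (S0, Si)" by (cases g)
  have "dim_row Ai = dim_row A0" "dim_row Bi = dim_row B0"
    using X Y unfolding X' Y' cat_C_def by (auto dest!: GL_carrier)
  then show "C_ent i g \<in> carrier_mat (C_rk Y) (C_rk X)"
    using g unfolding X' Y' g' cat_C_hom by (auto simp: intertwiners_def C_ent_def C_rk_def dest!: MatD(1))
next
  fix X Y assume X: "X \<in> cOb (cat_S q)" and Y: "Y \<in> cOb (cat_S q)"
  obtain n A0 M0 Ai Mi where X': "X = (A0, M0, Ai, Mi)" "M0 \<in> GL n mero_plane" "Mi \<in> GL n mero_inf"
    using X by (rule S_obE) blast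
  obtain p B0 N0 Bi Ni where Y': "Y = (B0, N0, Bi, Ni)" "N0 \<in> GL p mero_plane" "Ni \<in> GL p mero_inf"
    using Y by (rule S_obE) blast
  have "inv_mat (kron Mi Ni) * kron M0 N0 = kron (inv_mat Mi * M0) (inv_mat Ni * N0)"
    unfolding kron_inverse(3)[OF X'(3) Y'(3)]
    by (rule kron_mult[symmetric, OF GL_inv_carrier[OF X'(3)] GL_carrier[OF X'(2)]
          GL_inv_carrier[OF Y'(3)] GL_carrier[OF Y'(2)]])
  then show "SC_ob (tOb (cat_S q) X Y) = tOb (cat_C q) (SC_ob X) (SC_ob Y)"
    by (simp add: cat_S_def cat_C_def SC_ob_def X'(1) Y'(1))
qed (simp_all add: SC_hom[OF q0], auto simp: SC_ob_def SC_mor_def cat_C_def cat_S_def Let_def split: prod.splits)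

theorem mainTheorem4:
  fixes q :: complex
  assumes "norm q > 1"
  shows "linear_tensor_equivalence (cat_S q) (cat_E q) (SE_ob q) SE_mor
           (\<lambda>X Y. cId (cat_E q) (tOb (cat_E q) (SE_ob q X) (SE_ob q Y)))
           (cId (cat_E q) (tUnit (cat_E q)))
       \<and> linear_tensor_equivalence (cat_S q) (cat_C q) SC_ob SC_mor
           (\<lambda>X Y. cId (cat_C q) (tOb (cat_C q) (SC_ob X) (SC_ob Y)))
           (cId (cat_C q) (tUnit (cat_C q)))"
proof -
  have "q \<noteq> 0" using assms by auto
  then show ?thesis
    using solutions_equivalent_to_equations[OF assms] solutions_equivalent_to_connections by blast
qed

end
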